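(* Let $\alpha\in[0,1]$. (1) If $\alpha$ is rational, then there is a unique $T\in\Delta$ such that $\{T\}$ enforces Sturmian lattices only with slope $\alpha$ (that is, $\emptyset\neq\mathscr{T}_{\{T\}}\cap\mathscr{T}_{\mathrm C}\subseteq\{\mathscr{T}_{\mathrm C}(\alpha)\}$), and this $T$ is a rational point. (2) If $\alpha$ is a quadratic irrational number, then there exist two rational points $T_1,T_2\in\Delta$ such that, for $\mathcal A=\{T_1,T_2\}$, one has $\mathscr{T}_{\mathrm C}(\alpha)\in\mathscr{T}_{\mathcal A}$ and $\mathscr{T}_{\mathcal A}\cap\mathscr{T}_{\mathrm C}\subseteq\{\mathscr{T}_{\mathrm C}(\alpha),\mathscr{T}_{\mathrm C}(\alpha')\}$, where $\alpha'$ is the Galois conjugate of $\alpha$ (the second point being relevant only if $\alpha'\in[0,1]$). In particular, there exists an aperiodic prototile set, consisting of finitely many patch-tiles (finite unions of cabinet cells carrying Sturmian Ammann bar segments) subject to the matching rule, in every tiling by which the Ammann bars form a Sturmian lattice of slope $\alpha$ or $\alpha'$; thus for every real quadratic field one obtains such aperiodic tile sets whose underlying self-similarity (expansion) constant is a quadratic unit of that field. (3) Otherwise (i.e. $\alpha$ irrational and not quadratic), no finite set $\mathcal A$ of rational points of $\Delta$ enforces a Sturmian lattice of slope $\alpha$: every finite set $\mathcal A$ of rational points of $\Delta$ with $\mathscr{T}_{\mathrm C}(\alpha)\in\mathscr{T}_{\mathcal A}$ satisfies $\mathscr{T}_{\mathrm C}(q)\in\mathscr{T}_{\mathcal A}$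 for some rational $q\in[0,1]$.
   Context: Let $\mathbb{R}P^2$ be the real projective plane and $\Delta=\{[x:2y:z]\in\mathbb{R}P^2: x,y,z\ge0\}$, identified with the simplex of nonnegative triples normalized by $x+2y+z=1$; a point is rational if it has rational homogeneous coordinates. For a finite set $\mathcal A\subset\Delta$, $\mathscr{T}_{\mathcal A}$ denotes its convex hull in this simplex. For $\beta\in[0,1]$ put $\mathscr{T}_{\mathrm C}(\beta)=[(1-\beta)^2:2\beta(1-\beta):\beta^2]$ and $\mathscr{T}_{\mathrm C}=\{\mathscr{T}_{\mathrm C}(\beta):\beta\in[0,1]\}$ (a parabolic arc). A finite set $\mathcal A\subset\Delta$ is said to enforce Sturmian lattices only with slopes in $\Sigma\subseteq[0,1]$ if $\emptyset\ne\mathscr{T}_{\mathcal A}\cap\mathscr{T}_{\mathrm C}\subseteq\{\mathscr{T}_{\mathrm C}(\beta):\beta\in\Sigma\}$. Interpretation: a Sturmian lattice is a configuration of three families of parallel lines in the plane (directions at angles $0,2\pi/3,4\pi/3$) with positions $a(i),b(j),c(k)$ such that lines with index sum $i+j+k=0$ always form a triangle of height $1/2$; in the $2$-color case the gaps between consecutive parallel lines take two values $\kappa,\kappa+1$, and the slope is the density of the wider gaps. Two of the three families cut the plane into parallelogram cells of three types ($S$: both gaps narrow, $M$: mixed, $L$: both wide), each carrying a segment of the third family (the Sturmian Ammann bar, SAB); cells $S$, $L$ are split into two triangles and $M$ is counted with weight 2. A rational point $[x:2y:z]$ encodes a class of patch-tiles (finite unions of such cells) containing cells $S,M,L$ in ratio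 $x:y:z$. The matching rule: tilings are edge-to-edge and the SAB segments continue across tile boundaries to form straight lines. A tiling in which the SABs form a Sturmian lattice of slope $\beta$ has cell-type densities given by $\mathscr{T}_{\mathrm C}(\beta)$. A tile is a pair (compact set equal to closure of its interior, color/decoration); a tiling is a collection of isometric copies of prototiles with disjoint interiors covering $\mathbb R^2$; a tiling is non-periodic if no nonzero translation preserves it; a prototile set is aperiodic if it admits a tiling and all its tilings are non-periodic. *)

theory Defs
  imports "HOL-Analysis.Analysis" "HOL-Computational_Algebra.Squarefree" "HOL-Library.Sublist"
begin

section \<open>The simplex and the parabolic arc\<close>

text \<open>The point \<open>[x : 2y : z]\<close> of the projective plane is represented by the multiple of
  \<open>(x, 2y, z)\<close> whose coordinates add up to 1. The second coordinate of a triple is thus \<open>2y\<close>.\<close>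

type_synonym ppoint = "real \<times> real \<times> real"

definition ppt :: "real \<Rightarrow> real \<Rightarrow> real \<Rightarrow> ppoint" where
  "ppt x y z = (x / (x + 2 * y + z), 2 * y / (x + 2 * y + z), z / (x + 2 * y + z))"

definition Simplex :: "ppoint set" where
  "Simplex = {(x, w, z). 0 \<le> x \<and> 0 \<le> w \<and> 0 \<le> z \<and> x + w + z = 1}"

definition rational_point :: "ppoint \<Rightarrow> bool" where
  "rational_point T \<longleftrightarrow>
     (case T of (x, w, z) \<Rightarrow> \<exists>r. r \<noteq> 0 \<and> r * x \<in> \<rat> \<and> r * w \<in> \<rat> \<and> r * z \<in> \<rat>)"

definition TC :: "real \<Rightarrow> ppoint" where
  "TC \<beta> = ppt ((1 - \<beta>)\<^sup>2) (\<beta> * (1 - \<beta>)) (\<beta>\<^sup>2)"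

definition arc_C :: "ppoint set" where
  "arc_C = TC ` {0..1}"

definition enforces :: "ppoint set \<Rightarrow> real set \<Rightarrow> bool" where
  "enforces A \<Sigma> \<longleftrightarrow>
     finite A \<and> A \<subseteq> Simplex \<and> \<Sigma> \<subseteq> {0..1} \<and>
     (convex hull A) \<inter> arc_C \<noteq> {} \<and> (convex hull A) \<inter> arc_C \<subseteq> TC ` \<Sigma>"


section \<open>Quadratic numbers\<close>

definition quadratic_irrational :: "real \<Rightarrow> bool" where
  "quadratic_irrational \<alpha> \<longleftrightarrow>
     \<alpha> \<notin> \<rat> \<and> (\<exists>p q r :: int. p \<noteq> 0 \<and> of_int p * \<alpha>\<^sup>2 + of_int q * \<alpha> + of_int r = 0)"

text \<open>The other root of the minimal polynomial; only meaningful for quadratic irrationals.\<close>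

definition galois_conj :: "real \<Rightarrow> real" where
  "galois_conj \<alpha> = (THE \<alpha>'. \<alpha>' \<noteq> \<alpha> \<and>
     (\<exists>p q r :: int. p \<noteq> 0 \<and> of_int p * \<alpha>\<^sup>2 + of_int q * \<alpha> + of_int r = 0 \<and>
        of_int p * \<alpha>'\<^sup>2 + of_int q * \<alpha>' + of_int r = 0))"

definition real_quadratic_field :: "real set \<Rightarrow> bool" where
  "real_quadratic_field K \<longleftrightarrow>
     (\<exists>d :: nat. 1 < d \<and> squarefree d \<and> K = {of_rat u + of_rat v * sqrt (real d) | u v. True})"

definition quadratic_unit_of :: "real set \<Rightarrow> real \<Rightarrow> bool" where
  "quadratic_unit_of K \<epsilon> \<longleftrightarrow>
     \<epsilon> \<in> K \<and> \<epsilon> \<notin> \<rat> \<and>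
     (\<exists>t n :: int. \<bar>n\<bar> = 1 \<and> \<epsilon>\<^sup>2 + of_int t * \<epsilon> + of_int n = 0)"


section \<open>Sturmian lattices\<close>

text \<open>\<open>bar m t\<close> is the line in direction \<open>2\<pi>m/3\<close> at signed distance \<open>t\<close> from the origin.\<close>

definition height :: "nat \<Rightarrow> complex \<Rightarrow> real" where
  "height m p = p \<bullet> (\<i> * cis (2 * pi * real m / 3))"

definition bar :: "nat \<Rightarrow> real \<Rightarrow> complex set" where
  "bar m t = {p. height m p = t}"

definition triangle_of_height ::
    "real \<Rightarrow> complex set \<Rightarrow> complex set \<Rightarrow> complex set \<Rightarrow> bool" where
  "triangle_of_height h l1 l2 l3 \<longleftrightarrow>
     (\<exists>p q r. l1 \<inter> l2 = {p} \<and> l2 \<inter> l3 = {q} \<and> l3 \<inter> l1 = {r} \<and>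
        infdist p l3 = h \<and> infdist q l1 = h \<and> infdist r l2 = h)"

definition sturmian_lattice ::
    "(int \<Rightarrow> real) \<Rightarrow> (int \<Rightarrow> real) \<Rightarrow> (int \<Rightarrow> real) \<Rightarrow> bool" where
  "sturmian_lattice a b c \<longleftrightarrow>
     (\<forall>i j k. i + j + k = 0 \<longrightarrow>
        triangle_of_height (1/2) (bar 0 (a i)) (bar 1 (b j)) (bar 2 (c k)))"

definition two_color_lattice ::
    "real \<Rightarrow> (int \<Rightarrow> real) \<Rightarrow> (int \<Rightarrow> real) \<Rightarrow> (int \<Rightarrow> real) \<Rightarrow> bool" where
  "two_color_lattice \<kappa> a b c \<longleftrightarrow>
     0 < \<kappa> \<and> sturmian_lattice a b c \<and>
     (\<forall>f\<in>{a, b, c}. \<forall>i. f (i + 1) - f i \<in> {\<kappa>, \<kappa> + 1})"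

definition gap_word :: "real \<Rightarrow> (int \<Rightarrow> real) \<Rightarrow> int \<Rightarrow> bool" where
  "gap_word \<kappa> f i \<longleftrightarrow> f (i + 1) - f i = \<kappa> + 1"

definition has_slope ::
    "real \<Rightarrow> (int \<Rightarrow> real) \<Rightarrow> (int \<Rightarrow> real) \<Rightarrow> (int \<Rightarrow> real) \<Rightarrow> real \<Rightarrow> bool" where
  "has_slope \<kappa> a b c \<beta> \<longleftrightarrow>
     (\<forall>f\<in>{a, b, c}.
        (\<lambda>n. real (card {i \<in> {- int n..<int n}. gap_word \<kappa> f i}) / (2 * real n)) \<longlonglongrightarrow> \<beta>)"


section \<open>Cabinet cells, patch-tiles and tilings\<close>

text \<open>A cell is a pair of a parallelogram and the Ammann bar segments it carries. A tile is a pair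
  of a region and a decoration; the decoration is the set of cells the tile is composed of.\<close>

type_synonym cell = "complex set \<times> complex set"
type_synonym tile = "complex set \<times> cell set"

definition lattice_region ::
    "(int \<Rightarrow> real) \<Rightarrow> (int \<Rightarrow> real) \<Rightarrow> int \<times> int \<Rightarrow> complex set" where
  "lattice_region a b = (\<lambda>(i, j).
     {p. a i \<le> height 0 p \<and> height 0 p \<le> a (i + 1) \<and>
         b j \<le> height 1 p \<and> height 1 p \<le> b (j + 1)})"

definition lattice_cell ::
    "(int \<Rightarrow> real) \<Rightarrow> (int \<Rightarrow> real) \<Rightarrow> (int \<Rightarrow> real) \<Rightarrow> int \<times> int \<Rightarrow> cell" where
  "lattice_cell a b c ij =
     (lattice_region a b ij, lattice_region a b ij \<inter> (\<Union>k. bar 2 (c k)))"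

definition S_cells :: "real \<Rightarrow> (int \<Rightarrow> real) \<Rightarrow> (int \<Rightarrow> real) \<Rightarrow> (int \<times> int) set" where
  "S_cells \<kappa> a b = {(i, j). \<not> gap_word \<kappa> a i \<and> \<not> gap_word \<kappa> b j}"

definition M_cells :: "real \<Rightarrow> (int \<Rightarrow> real) \<Rightarrow> (int \<Rightarrow> real) \<Rightarrow> (int \<times> int) set" where
  "M_cells \<kappa> a b = {(i, j). gap_word \<kappa> a i \<noteq> gap_word \<kappa> b j}"

definition L_cells :: "real \<Rightarrow> (int \<Rightarrow> real) \<Rightarrow> (int \<Rightarrow> real) \<Rightarrow> (int \<times> int) set" where
  "L_cells \<kappa> a b = {(i, j). gap_word \<kappa> a i \<and> gap_word \<kappa> b j}"

text \<open>Patch-tiles of the class encoded by \<open>T = [x : 2y : z]\<close>. Here \<open>x\<close> and \<open>z\<close> count the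
  triangles into which the cells \<open>S\<close> and \<open>L\<close> are split (two per cell), \<open>y\<close> counts the cells
  \<open>M\<close>.\<close>

definition patch_tile :: "real \<Rightarrow> ppoint \<Rightarrow> tile \<Rightarrow> bool" where
  "patch_tile \<kappa> T P \<longleftrightarrow>
     (\<exists>a b c I. two_color_lattice \<kappa> a b c \<and> finite I \<and> I \<noteq> {} \<and>
        P = (\<Union>ij\<in>I. lattice_region a b ij, lattice_cell a b c ` I) \<and>
        T = ppt (2 * real (card (I \<inter> S_cells \<kappa> a b)))
                (real (card (I \<inter> M_cells \<kappa> a b)))
                (2 * real (card (I \<inter> L_cells \<kappa> a b))))"

definition is_tile :: "tile \<Rightarrow> bool" where
  "is_tile P \<longleftrightarrow> fst P \<noteq> {} \<and> compact (fst P) \<and> closure (interior (fst P)) = fst P"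

definition isometry :: "(complex \<Rightarrow> complex) \<Rightarrow> bool" where
  "isometry g \<longleftrightarrow> (\<forall>x y. dist (g x) (g y) = dist x y)"

definition move :: "(complex \<Rightarrow> complex) \<Rightarrow> tile \<Rightarrow> tile" where
  "move g P = (g ` fst P, (\<lambda>(R, B). (g ` R, g ` B)) ` snd P)"

definition tiling :: "tile set \<Rightarrow> tile set \<Rightarrow> bool" where
  "tiling \<P> \<T> \<longleftrightarrow>
     (\<forall>T\<in>\<T>. \<exists>P\<in>\<P>. \<exists>g. isometry g \<and> T = move g P) \<and>
     (\<Union>T\<in>\<T>. fst T) = UNIV \<and>
     (\<forall>T\<in>\<T>. \<forall>U\<in>\<T>. T \<noteq> U \<longrightarrow> interior (fst T) \<inter> interior (fst U) = {})"

definition cells :: "tile set \<Rightarrow> cell set" where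
  "cells \<T> = (\<Union>T\<in>\<T>. snd T)"

definition edge_to_edge :: "tile set \<Rightarrow> bool" where
  "edge_to_edge \<T> \<longleftrightarrow>
     (\<forall>C\<in>cells \<T>. \<forall>D\<in>cells \<T>.
        (fst C \<inter> fst D) face_of fst C \<and> (fst C \<inter> fst D) face_of fst D)"

definition bars_continue :: "tile set \<Rightarrow> bool" where
  "bars_continue \<T> \<longleftrightarrow>
     (\<exists>\<L>. (\<forall>l\<in>\<L>. affine l \<and> aff_dim l = 1) \<and> (\<Union>C\<in>cells \<T>. snd C) = \<Union>\<L>)"

definition matching_tiling :: "tile set \<Rightarrow> tile set \<Rightarrow> bool" where
  "matching_tiling \<P> \<T> \<longleftrightarrow> tiling \<P> \<T> \<and> edge_to_edge \<T> \<and> bars_continue \<T>"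

definition non_periodic :: "tile set \<Rightarrow> bool" where
  "non_periodic \<T> \<longleftrightarrow> (\<forall>v. v \<noteq> 0 \<longrightarrow> move (\<lambda>x. x + v) ` \<T> \<noteq> \<T>)"

definition aperiodic :: "tile set \<Rightarrow> bool" where
  "aperiodic \<P> \<longleftrightarrow>
     (\<exists>\<T>. matching_tiling \<P> \<T>) \<and> (\<forall>\<T>. matching_tiling \<P> \<T> \<longrightarrow> non_periodic \<T>)"

text \<open>In a tiling, the lines of the two families that cut out the cells appear as cell edges, those
  of the third family as the bar segments carried by the cells.\<close>

definition bars_form_lattice ::
    "real \<Rightarrow> tile set \<Rightarrow> (int \<Rightarrow> real) \<Rightarrow> (int \<Rightarrow> real) \<Rightarrow> (int \<Rightarrow> real) \<Rightarrow> bool" where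
  "bars_form_lattice \<kappa> \<T> a b c \<longleftrightarrow>
     two_color_lattice \<kappa> a b c \<and>
     (\<exists>g. isometry g \<and>
        (\<Union>C\<in>cells \<T>. frontier (fst C)) = g ` ((\<Union>i. bar 0 (a i)) \<union> (\<Union>j. bar 1 (b j))) \<and>
        (\<Union>C\<in>cells \<T>. snd C) = g ` (\<Union>k. bar 2 (c k)))"

definition aperiodic_patch_tiles ::
    "real \<Rightarrow> ppoint set \<Rightarrow> real set \<Rightarrow> tile set \<Rightarrow> bool" where
  "aperiodic_patch_tiles \<kappa> A \<Sigma> \<P> \<longleftrightarrow>
     finite \<P> \<and> (\<forall>P\<in>\<P>. is_tile P \<and> (\<exists>T\<in>A. patch_tile \<kappa> T P)) \<and>
     aperiodic \<P> \<and>
     (\<forall>\<T>. matching_tiling \<P> \<T> \<longrightarrow>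
        (\<exists>\<beta>\<in>\<Sigma>. \<exists>a b c. bars_form_lattice \<kappa> \<T> a b c \<and> has_slope \<kappa> a b c \<beta>))"

definition enforcing_pair :: "real \<Rightarrow> ppoint \<Rightarrow> ppoint \<Rightarrow> bool" where
  "enforcing_pair \<alpha> T1 T2 \<longleftrightarrow>
     T1 \<in> Simplex \<and> T2 \<in> Simplex \<and> T1 \<noteq> T2 \<and> rational_point T1 \<and> rational_point T2 \<and>
     TC \<alpha> \<in> convex hull {T1, T2} \<and>
     (convex hull {T1, T2}) \<inter> arc_C \<subseteq> {TC \<alpha>, TC (galois_conj \<alpha>)}"


section \<open>Self-similarity\<close>

text \<open>Substitutions on the two gap lengths (\<open>True\<close> is the wider gap). The expansion constant is the
  factor \<open>\<lambda>\<close> such that, for suitable positive lengths of the two letters, a letter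
  inflated by \<open>\<lambda>\<close> is subdivided exactly into the letters of its image.\<close>

definition letter_map :: "(bool \<Rightarrow> bool list) \<Rightarrow> bool list \<Rightarrow> bool list" where
  "letter_map \<sigma> w = concat (map \<sigma> w)"

definition primitive_subst :: "(bool \<Rightarrow> bool list) \<Rightarrow> bool" where
  "primitive_subst \<sigma> \<longleftrightarrow> (\<exists>n. \<forall>x y. x \<in> set ((letter_map \<sigma> ^^ n) [y]))"

definition inflation_factor :: "(bool \<Rightarrow> bool list) \<Rightarrow> real \<Rightarrow> bool" where
  "inflation_factor \<sigma> \<epsilon> \<longleftrightarrow>
     (\<exists>len. (\<forall>x. 0 < len x) \<and> (\<forall>x. sum_list (map len (\<sigma> x)) = \<epsilon> * len x))"

definition subshift :: "(bool \<Rightarrow> bool list) \<Rightarrow> (int \<Rightarrow> bool) set" where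
  "subshift \<sigma> =
     {w. \<forall>i n. \<exists>k y. sublist (map (\<lambda>m. w (i + int m)) [0..<n]) ((letter_map \<sigma> ^^ k) [y])}"

definition expansion_constant :: "real \<Rightarrow> tile set \<Rightarrow> real \<Rightarrow> bool" where
  "expansion_constant \<kappa> \<P> \<epsilon> \<longleftrightarrow>
     1 < \<epsilon> \<and>
     (\<exists>\<sigma>. primitive_subst \<sigma> \<and> inflation_factor \<sigma> \<epsilon> \<and>
        (\<forall>\<T> a b c. matching_tiling \<P> \<T> \<and> bars_form_lattice \<kappa> \<T> a b c \<longrightarrow>
           (\<forall>f\<in>{a, b, c}. gap_word \<kappa> f \<in> subshift \<sigma>)))"

end

theory Submission
  imports Defs "HOL-Analysis.Kronecker_Approximation_Theorem"
begin

text \<open>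
  A pair of rational points spans the zero set of a linear form with integer coefficients \<open>wt\<close>. On
  the arc the form is a quadratic polynomial in the slope, whose roots can be prescribed to be a
  quadratic irrational and its conjugate; the line then meets the simplex in a segment with rational ends. If
  \<open>\<alpha>\<close> is neither rational nor quadratic, no rational line passes through \<open>TC \<alpha>\<close>, which is therefore
  interior to the hull, so that the hull also contains \<open>TC q\<close> for rational \<open>q\<close> near \<open>\<alpha>\<close>.

  In a matching tiling a line of bars that crosses a cell off the direction of the bars of that cell
  would have to run along cell edges, where it overlaps a further cell; so all bars are parallel, all
  cells share the same edge directions, and edge-to-edge they form a grid which, with the bars, is the
  image of a Sturmian lattice. Every patch-tile has total weight zero, hence the cell densities lie
  on the line \<open>wt = 0\<close> and the slope of the lattice is a root of the quadratic polynomial; it is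
  irrational, so no translation preserves the tiling.

  For existence take the lattice coded by the rotation by \<open>\<alpha>\<close>, for which the sum of the weights over
  a square grows at most like its side. Large square blocks of cells then become weightless by
  exchanging few cells between neighbours, and each block is divided into one tile
  per point of the pair. Up to translation only finitely many tiles occur.

  For the field of \<open>sqrt d\<close>, a solution of Pell's equation gives a unit \<open>\<epsilon>\<close> with norm \<open>1\<close> and slope
  \<open>1 / \<epsilon>\<close>; balanced words of this slope can be desubstituted forever, by a substitution with
  inflation factor \<open>\<epsilon>\<close>.\<close>

section \<open>The parabolic arc and quadratic numbers\<close>

text \<open>On the arc the linear form has to restrict to the integer polynomial of the slope, so
  its weights are Bernstein coefficients of that polynomial. Their mean vanishes at an irrational
  slope, so both signs occur, and after a change of sign exactly one cell type X has negative
  weight. The zero line then meets the two sides of the triangle that share the corner X, and its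
  ends belong to tiles with only two types of cells.

  Existence is obstructed by drift: a row of blocks in which wide gaps are over-represented gains
  weight linearly in its length, so no bounded exchange along the row can balance it. The surplus of
  a row is a difference of fractional parts of consecutive rows, hence telescopes, and a bounded
  vertical flow removes it.

  Forcing is obstructed by tiles being isometric copies of patches of unrelated lattices. Cells are
  therefore described without reference to a lattice, and their weight is read off from their
  diameter.

  A unit of norm 1 and trace \<open>n + 2\<close> has the conjugate \<gamma> = 1 / (n + 2 -
  \<gamma>), so desubstitution returns words of the same slope.\<close>

lemma TC_eq: "TC \<beta> = ((1 - \<beta>)\<^sup>2, 2 * (\<beta> * (1 - \<beta>)), \<beta>\<^sup>2)"
proof -
  have "(1 - \<beta>)\<^sup>2 + 2 * (\<beta> * (1 - \<beta>)) + \<beta>\<^sup>2 = 1"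
    by (simp add: power2_eq_square algebra_simps)
  then show ?thesis unfolding TC_def ppt_def by simp
qed

lemma TC_inj:
  assumes "TC a = TC b" "0 \<le> a" "0 \<le> b"
  shows "a = b"
  using assms by (auto simp: TC_eq)

lemma TC_in_Simplex: "\<beta> \<in> {0..1} \<Longrightarrow> TC \<beta> \<in> Simplex"
proof -
  assume "\<beta> \<in> {0..1}"
  moreover have "(1 - \<beta>)\<^sup>2 + 2 * (\<beta> * (1 - \<beta>)) + \<beta>\<^sup>2 = 1"
    by (simp add: power2_eq_square algebra_simps)
  ultimately show ?thesis unfolding TC_eq Simplex_def by auto
qed

lemma enforces_singleton:
  assumes "\<alpha> \<in> {0..1}"
  shows "T \<in> Simplex \<and> enforces {T} {\<alpha>} \<longleftrightarrow> T = TC \<alpha>"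
  using assms TC_in_Simplex[OF assms] by (auto simp: enforces_def arc_C_def)

lemma rational_point_TC: "\<alpha> \<in> \<rat> \<Longrightarrow> rational_point (TC \<alpha>)"
  unfolding rational_point_def TC_eq by (auto intro!: exI[of _ 1])

text \<open>Eliminating the square leaves an integer linear equation for an irrational number, so
  both of its coefficients vanish. This makes the conjugate independent of the polynomial that
  defines it.\<close>

lemma quadratic_proportional:
  fixes p q r p' q' r' :: int
  assumes "\<alpha> \<notin> \<rat>" "of_int p * \<alpha>\<^sup>2 + of_int q * \<alpha> + of_int r = (0::real)"
    "of_int p' * \<alpha>\<^sup>2 + of_int q' * \<alpha> + of_int r' = (0::real)"
  shows "p' * q = p * q'" "p' * r = p * r'"
proof -
  have "of_int p' * (of_int p * \<alpha>\<^sup>2 + of_int q * \<alpha> + of_int r) - of_int p * (of_int p' * \<alpha>\<^sup>2 + of_int q' * \<alpha> + of_int r') = 0"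
    using assms by simp
  then have eq: "of_int (p' * q - p * q') * \<alpha> = of_int (p * r' - p' * r)"
    by (simp add: algebra_simps)
  show "p' * q = p * q'"
  proof (rule ccontr)
    assume "p' * q \<noteq> p * q'"
    then have "of_int (p' * q - p * q') \<noteq> (0::real)" by (metis of_int_eq_0_iff right_minus_eq)
    then have "\<alpha> = of_int (p * r' - p' * r) / of_int (p' * q - p * q')" using eq
      by (metis nonzero_mult_div_cancel_left)
    then show False using assms(1) by (metis Rats_divide Rats_of_int)
  qed
  with eq show "p' * r = p * r'" by (metis diff_self eq_iff_diff_eq_0 mult_zero_left of_int_0 of_int_eq_iff)
qed

text \<open>By Vieta the two roots add up to \<open>- q / p\<close>; they are distinct because a
  double root would be rational.\<close>

lemma galois_conj_eq:
  fixes p q r :: int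
  assumes "\<alpha> \<notin> \<rat>" "p \<noteq> 0" "of_int p * \<alpha>\<^sup>2 + of_int q * \<alpha> + of_int r = (0::real)"
  shows "galois_conj \<alpha> = - of_int q / of_int p - \<alpha>"
  unfolding galois_conj_def
proof (rule the_equality)
  let ?b = "- of_int q / of_int p - \<alpha>"
  have "?b \<noteq> \<alpha>"
  proof
    assume "?b = \<alpha>"
    then have "\<alpha> = - of_int q / of_int (2 * p)" using assms(2) by (simp add: field_simps)
    then show False using assms(1) by (metis Rats_divide Rats_minus_iff Rats_of_int)
  qed
  moreover have "of_int p * ?b\<^sup>2 + of_int q * ?b + of_int r = of_int p * \<alpha>\<^sup>2 + of_int q * \<alpha> + of_int r"
    using assms(2) by (simp add: field_simps power2_eq_square)
  ultimately show "?b \<noteq> \<alpha> \<and> (\<exists>p q r :: int. p \<noteq> 0 \<and> of_int p * \<alpha>\<^sup>2 + of_int q * \<alpha> + of_int r = 0 \<and>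
        of_int p * ?b\<^sup>2 + of_int q * ?b + of_int r = 0)"
    using assms by metis
next
  fix b assume "b \<noteq> \<alpha> \<and> (\<exists>p q r :: int. p \<noteq> 0 \<and> of_int p * \<alpha>\<^sup>2 + of_int q * \<alpha> + of_int r = 0 \<and>
        of_int p * b\<^sup>2 + of_int q * b + of_int r = 0)"
  then obtain p' q' r' :: int where *: "b \<noteq> \<alpha>" "p' \<noteq> 0" "of_int p' * \<alpha>\<^sup>2 + of_int q' * \<alpha> + of_int r' = 0"
    "of_int p' * b\<^sup>2 + of_int q' * b + of_int r' = 0" by auto
  have "(b - \<alpha>) * (of_int p' * (b + \<alpha>) + of_int q') = 0"
    using *(3,4) by (simp add: algebra_simps power2_eq_square)
  then have "of_int p' * (b + \<alpha>) = - of_int q'" using *(1) by simp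
  then have "b + \<alpha> = - of_int q' / of_int p'" using *(2) by (simp add: field_simps)
  moreover have "real_of_int p' * of_int q = of_int p * of_int q'"
    using quadratic_proportional(1)[OF assms(1,3) *(3)] by (metis of_int_mult)
  then have "of_int q' / of_int p' = (of_int q / of_int p :: real)" using *(2) assms(2)
    by (simp add: field_simps)
  ultimately show "b = - of_int q / of_int p - \<alpha>" by simp
qed

lemma quadratic_root_cases:
  fixes p q r :: int
  assumes "\<alpha> \<notin> \<rat>" "p \<noteq> 0" "of_int p * \<alpha>\<^sup>2 + of_int q * \<alpha> + of_int r = (0::real)"
    and "of_int p * \<beta>\<^sup>2 + of_int q * \<beta> + of_int r = 0"
  shows "\<beta> = \<alpha> \<or> \<beta> = galois_conj \<alpha>"
proof -
  have "(\<beta> - \<alpha>) * (of_int p * (\<beta> + \<alpha>) + of_int q) = 0"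
    using assms(3,4) by (simp add: algebra_simps power2_eq_square)
  then consider "\<beta> = \<alpha>" | "of_int p * (\<beta> + \<alpha>) = - of_int q" by force
  then show ?thesis
  proof cases
    case 2
    then have "\<beta> = - of_int q / of_int p - \<alpha>" using assms(2) by (simp add: field_simps)
    then show ?thesis using galois_conj_eq[OF assms(1-3)] by simp
  qed simp
qed

section \<open>Rational lines meeting the arc\<close>

lemma Rats_clear_denominators:
  assumes "(a::real) \<in> \<rat>" "b \<in> \<rat>" "c \<in> \<rat>"
  obtains N p q r :: int where "N \<noteq> 0" "of_int p = of_int N * a" "of_int q = of_int N * b" "of_int r = of_int N * c"
proof -
  obtain a1 a2 b1 b2 c1 c2 :: int where "a2 > 0" "a = of_int a1 / of_int a2" "b2 > 0" "b = of_int b1 / of_int b2"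
    "c2 > 0" "c = of_int c1 / of_int c2" using assms by (metis Rats_cases')
  then show ?thesis
    by (intro that[of "a2 * b2 * c2" "a1 * b2 * c2" "a2 * b1 * c2" "a2 * b2 * c1"]) (auto simp: field_simps)
qed

lemma quadratic_over_Rats:
  assumes "a \<in> \<rat>" "b \<in> \<rat>" "c \<in> \<rat>" "(a, b) \<noteq> (0, 0)" "a * \<alpha>\<^sup>2 + b * \<alpha> + c = (0::real)"
  shows "\<alpha> \<in> \<rat> \<or> quadratic_irrational \<alpha>"
proof (cases "a = 0")
  case True
  then have "b \<noteq> 0" "\<alpha> = - c / b" using assms by (auto simp: field_simps)
  then show ?thesis using assms by auto
next
  case False
  obtain N p q r :: int where *: "N \<noteq> 0" "of_int p = of_int N * a" "of_int q = of_int N * b" "of_int r = of_int N * c"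
    using Rats_clear_denominators assms(1-3) by metis
  have "of_int p * \<alpha>\<^sup>2 + of_int q * \<alpha> + of_int r = of_int N * (a * \<alpha>\<^sup>2 + b * \<alpha> + c)"
    unfolding * by (simp add: algebra_simps)
  then have "of_int p * \<alpha>\<^sup>2 + of_int q * \<alpha> + of_int r = 0" using assms(5) by simp
  moreover have "p \<noteq> 0" using * False by (metis mult_eq_0_iff of_int_eq_0_iff)
  ultimately show ?thesis unfolding quadratic_irrational_def by blast
qed

text \<open>Expanded in \<alpha>, the equation of a line has the leading coefficients
  \<open>a + b\<close> and \<open>- 2 * a\<close>. They vanish together only for
  \<open>a = b = 0\<close>, so a genuine line never degenerates to a trivial equation.\<close>

lemma arc_on_rational_line:
  assumes "a \<in> \<rat>" "b \<in> \<rat>" "c \<in> \<rat>" "(a, b) \<noteq> (0, 0)" "a * (1 - \<alpha>)\<^sup>2 + b * \<alpha>\<^sup>2 + c = (0::real)"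
  shows "\<alpha> \<in> \<rat> \<or> quadratic_irrational \<alpha>"
proof (rule quadratic_over_Rats)
  show "(a + b) * \<alpha>\<^sup>2 + (- 2 * a) * \<alpha> + (a + c) = 0"
    using assms(5) by (simp add: power2_eq_square algebra_simps)
qed (use assms in auto)

text \<open>The coordinates add up to 1, so the common factor \<open>r\<close> is itself a sum of
  three rationals and can be divided out.\<close>

lemma rational_point_Simplex:
  assumes "rational_point (x, w, z)" "(x, w, z) \<in> Simplex"
  shows "x \<in> \<rat>" "z \<in> \<rat>"
proof -
  obtain r where r: "r \<noteq> 0" "r * x \<in> \<rat>" "r * w \<in> \<rat>" "r * z \<in> \<rat>"
    using assms(1) by (auto simp: rational_point_def)
  have "r * x + r * w + r * z = r * (x + w + z)" by (simp add: algebra_simps)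
  then have "r \<in> \<rat>" using assms(2) r by (auto simp: Simplex_def) (metis Rats_add mult.right_neutral)
  then have "r * x / r \<in> \<rat>" "r * z / r \<in> \<rat>" using r by (metis Rats_divide)+
  then show "x \<in> \<rat>" "z \<in> \<rat>" using r(1) by (simp_all del: Rats_divide)
qed

text \<open>The simplex is a graph over its first and third coordinates, so the hull can be studied in
  the plane of these two. A point of the hull off its interior lies on a supporting line, hence on
  a line through one or two rational points of the finite set.\<close>

lemma hull_not_interior_rational_line:
  fixes A :: "(real \<times> real) set"
  assumes "finite A" and rat: "\<And>x z. (x, z) \<in> A \<Longrightarrow> x \<in> \<rat> \<and> z \<in> \<rat>"
    and "(u, v) \<in> convex hull A" "(u, v) \<notin> interior (convex hull A)"
  shows "\<exists>a\<in>\<rat>. \<exists>b\<in>\<rat>. \<exists>c\<in>\<rat>. (a, b) \<noteq> (0, 0) \<and> a * u + b * v + c = 0"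
proof -
  let ?H = "convex hull A"
  \<comment> \<open>A supporting functional at \<open>(u, v)\<close>: on a flat hull take one that
    is constant there, otherwise separate the point from the interior and pass to the
    closure.\<close>
  have "\<exists>n. n \<noteq> 0 \<and> (\<forall>y\<in>?H. n \<bullet> y \<le> n \<bullet> (u, v))"
  proof (cases "interior ?H = {}")
    case True
    then obtain n d where "n \<noteq> 0" "?H \<subseteq> {x. n \<bullet> x = d}"
      using empty_interior_subset_hyperplane[OF convex_convex_hull] by metis
    then have "n \<bullet> y = d" if "y \<in> ?H" for y using that by blast
    then show ?thesis using assms(3) \<open>n \<noteq> 0\<close> by (metis order_refl)
  next
    case False
    obtain n d where n: "n \<noteq> 0" "\<forall>x\<in>interior ?H. n \<bullet> x \<le> d" "\<forall>x\<in>{(u, v)}. n \<bullet> x \<ge> d"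
      using separating_hyperplane_sets[of "interior ?H" "{(u, v)}"] False assms(4)
      by (auto simp: convex_interior)
    have "?H \<subseteq> closure (interior ?H)"
      using False convex_closure_interior[of ?H] closure_subset by auto
    also have "\<dots> \<subseteq> {x. n \<bullet> x \<le> d}"
      using n(2) by (intro closure_minimal) (auto simp: closed_halfspace_le)
    finally show ?thesis using n by (intro exI[of _ n]) force
  qed
  then obtain n where n: "n \<noteq> 0" "\<And>y. y \<in> ?H \<Longrightarrow> n \<bullet> y \<le> n \<bullet> (u, v)" by blast
  obtain l where l: "\<And>T. T \<in> A \<Longrightarrow> 0 \<le> l T" "sum l A = 1" "(\<Sum>T\<in>A. l T *\<^sub>R T) = (u, v)"
    using assms(3) unfolding convex_hull_finite[OF assms(1)] by auto
  \<comment> \<open>The defects \<open>n \<bullet> (u, v) - n \<bullet> T\<close> are nonnegative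
    and average to zero, so every point with a positive coefficient lies on the supporting
    line.\<close>
  have "(\<Sum>T\<in>A. l T * (n \<bullet> (u, v) - n \<bullet> T)) = sum l A * (n \<bullet> (u, v)) - n \<bullet> (\<Sum>T\<in>A. l T *\<^sub>R T)"
    by (simp add: algebra_simps sum_subtractf inner_sum_right sum_distrib_left sum_distrib_right)
  also have "\<dots> = 0" using l by simp
  finally have "(\<Sum>T\<in>A. l T * (n \<bullet> (u, v) - n \<bullet> T)) = 0" .
  then have zero: "l T * (n \<bullet> (u, v) - n \<bullet> T) = 0" if "T \<in> A" for T
    using that assms(1) l(1) n(2)[OF hull_inc] by (subst (asm) sum_nonneg_eq_0_iff) auto
  have on_line: "n \<bullet> T = n \<bullet> (u, v)" if "T \<in> A" "l T \<noteq> 0" for T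
    using zero[OF that(1)] that(2) by simp
  obtain T1 where T1: "T1 \<in> A" "l T1 \<noteq> 0" using l(2) by (metis sum.neutral zero_neq_one)
  obtain x1 z1 where T1eq: "T1 = (x1, z1)" by (cases T1)
  have r1: "x1 \<in> \<rat>" "z1 \<in> \<rat>" using rat T1 T1eq by auto
  show ?thesis
  proof (cases "\<exists>T2\<in>A. l T2 \<noteq> 0 \<and> T2 \<noteq> T1")
    case True
    then obtain x2 z2 where T2: "(x2, z2) \<in> A" "l (x2, z2) \<noteq> 0" "(x2, z2) \<noteq> (x1, z1)"
      using T1eq by (metis surj_pair)
    have r2: "x2 \<in> \<rat>" "z2 \<in> \<rat>" using rat T2 by auto
    obtain n1 n2 where nn: "n = (n1, n2)" by (cases n)
    have e1: "n1 * x1 + n2 * z1 = n1 * u + n2 * v" "n1 * x2 + n2 * z2 = n1 * u + n2 * v"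
      using on_line[OF T1] on_line[OF T2(1,2)] T1eq nn by auto
    \<comment> \<open>The vectors from \<open>T1\<close> to \<open>T2\<close> and to
      \<open>(u, v)\<close> are both orthogonal to the nonzero \<open>n\<close>, so their
      determinant vanishes. This trades the possibly irrational normal for one with rational
      coordinates.\<close>
    have "n1 * ((z2 - z1) * (u - x1) - (x2 - x1) * (v - z1)) = 0"
      "n2 * ((z2 - z1) * (u - x1) - (x2 - x1) * (v - z1)) = 0"
      using e1 by algebra+
    then have "(z2 - z1) * (u - x1) - (x2 - x1) * (v - z1) = 0" using n(1) nn by (auto simp: zero_prod_def)
    then have "(z2 - z1) * u + (x1 - x2) * v + ((x2 - x1) * z1 - (z2 - z1) * x1) = 0"
      by (simp add: algebra_simps)
    moreover have "(z2 - z1, x1 - x2) \<noteq> (0, 0)" using T2(3) by auto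
    ultimately show ?thesis using r1 r2 by (metis Rats_diff Rats_mult)
  next
    case False
    then have "(\<Sum>T\<in>A. l T *\<^sub>R T) = (\<Sum>T\<in>{T1}. l T *\<^sub>R T)" "sum l A = sum l {T1}"
      using T1 assms(1) by (intro sum.mono_neutral_right; auto)+
    then have "u = x1" using l T1eq by auto
    then show ?thesis using r1 by (intro bexI[of _ 1] bexI[of _ 0] bexI[of _ "-x1"]) auto
  qed
qed

text \<open>In the plane of the first and third coordinates the point of slope \<alpha> is interior
  to the hull; by continuity so are the points of nearby slopes, among them rational ones. The
  projection is needed because the simplex has empty interior in space.\<close>

lemma hull_contains_rational_slope:
  assumes "\<alpha> \<in> {0..1}" "\<alpha> \<notin> \<rat>" "\<not> quadratic_irrational \<alpha>"
    and "finite A" "A \<subseteq> Simplex" "\<forall>T\<in>A. rational_point T" "TC \<alpha> \<in> convex hull A"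
  shows "\<exists>q \<in> \<rat> \<inter> {0..1}. TC q \<in> convex hull A"
proof -
  define f :: "ppoint \<Rightarrow> real \<times> real" where "f = (\<lambda>(x, w, z). (x, z))"
  have "linear f" unfolding f_def by (rule linearI) auto
  then have hull: "f ` (convex hull A) = convex hull (f ` A)" by (simp add: convex_hull_linear_image)
  have inj: "T = U" if "T \<in> Simplex" "U \<in> Simplex" "f T = f U" for T U
    using that by (auto simp: f_def Simplex_def split: prod.splits)
  have "convex Simplex"
  proof (rule convexI)
    fix T U :: ppoint and s t :: real assume *: "T \<in> Simplex" "U \<in> Simplex" "0 \<le> s" "0 \<le> t" "s + t = 1"
    obtain x w z x' w' z' where TU: "T = (x, w, z)" "U = (x', w', z')" by (metis surj_pair)
    have "s * x + t * x' + (s * w + t * w') + (s * z + t * z') = s * (x + w + z) + t * (x' + w' + z')"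
      by (simp add: algebra_simps)
    also have "\<dots> = 1" using * TU by (simp add: Simplex_def)
    finally show "s *\<^sub>R T + t *\<^sub>R U \<in> Simplex" using * TU by (simp add: Simplex_def)
  qed
  then have hS: "convex hull A \<subseteq> Simplex" using assms(5) by (simp add: subset_hull)
  let ?g = "\<lambda>t. ((1 - t)\<^sup>2, t\<^sup>2) :: real \<times> real"
  have fTC: "f (TC t) = ?g t" for t by (simp add: f_def TC_eq)
  have "?g \<alpha> \<in> interior (convex hull (f ` A))"
  proof (rule ccontr)
    assume "?g \<alpha> \<notin> interior (convex hull (f ` A))"
    moreover have "?g \<alpha> \<in> convex hull (f ` A)" using assms(7) hull fTC by (metis image_eqI)
    moreover have "x \<in> \<rat> \<and> z \<in> \<rat>" if xz: "(x, z) \<in> f ` A" for x z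
    proof -
      obtain T where "T \<in> A" "(x, z) = f T" using xz by blast
      then obtain w where "(x, w, z) \<in> A" by (cases T) (auto simp: f_def)
      then show ?thesis using assms(5,6) rational_point_Simplex[of x w z] by auto
    qed
    ultimately have "\<exists>a\<in>\<rat>. \<exists>b\<in>\<rat>. \<exists>c\<in>\<rat>. (a, b) \<noteq> (0, 0) \<and> a * (1 - \<alpha>)\<^sup>2 + b * \<alpha>\<^sup>2 + c = 0"
      using assms(4) by (intro hull_not_interior_rational_line[of "f ` A"]) auto
    then obtain a b c where "a \<in> \<rat>" "b \<in> \<rat>" "c \<in> \<rat>" "(a, b) \<noteq> (0, 0)" "a * (1 - \<alpha>)\<^sup>2 + b * \<alpha>\<^sup>2 + c = 0"
      by (elim bexE conjE)
    then have "\<alpha> \<in> \<rat> \<or> quadratic_irrational \<alpha>" by (rule arc_on_rational_line)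
    then show False using assms(2,3) by simp
  qed
  moreover have "open (?g -` interior (convex hull (f ` A)))"
    by (intro open_vimage continuous_intros) auto
  ultimately obtain e where e: "e > 0" "\<And>t. dist t \<alpha> < e \<Longrightarrow> ?g t \<in> interior (convex hull (f ` A))"
    unfolding open_dist by auto
  have "\<alpha> \<noteq> 1" "\<alpha> \<noteq> 0" using assms(2) by auto
  then have "\<alpha> < min 1 (\<alpha> + e)" using assms(1) e by auto
  then obtain q where q: "q \<in> \<rat>" "\<alpha> < q" "q < min 1 (\<alpha> + e)" using Rats_dense_in_real by blast
  then have "?g q \<in> convex hull (f ` A)" using e(2)[of q] interior_subset by (auto simp: dist_real_def)
  then obtain T where T: "T \<in> convex hull A" "f T = f (TC q)" using hull fTC by (metis imageE)
  have q01: "q \<in> {0..1}" using q assms(1) by auto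
  then have "T = TC q" using T inj hS TC_in_Simplex by blast
  then show ?thesis using T q q01 by auto
qed

lemma no_finite_enforcing_set:
  assumes "\<alpha> \<in> {0..1}" "\<alpha> \<notin> \<rat>" "\<not> quadratic_irrational \<alpha>"
    and "finite A" "A \<subseteq> Simplex" "\<forall>T\<in>A. rational_point T"
  shows "\<not> enforces A {\<alpha>}"
proof
  assume "enforces A {\<alpha>}"
  then have *: "TC \<alpha> \<in> convex hull A" "convex hull A \<inter> arc_C \<subseteq> {TC \<alpha>}"
    by (auto simp: enforces_def)
  obtain q where "q \<in> \<rat> \<inter> {0..1}" "TC q \<in> convex hull A"
    using hull_contains_rational_slope[OF assms *(1)] by blast
  then have "TC q = TC \<alpha>" using *(2) by (auto simp: arc_C_def)
  then show False using TC_inj assms \<open>q \<in> \<rat> \<inter> {0..1}\<close> by auto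
qed

section \<open>Balanced two-letter words\<close>

lemma archimedean_mult:
  assumes "0 < (x::real)"
  obtains n where "c < real n * x"
  using reals_Archimedean3[OF assms] by blast

definition cnt :: "(int \<Rightarrow> bool) \<Rightarrow> int \<Rightarrow> nat \<Rightarrow> int" where
  "cnt w i n = (\<Sum>j<n. of_bool (w (i + int j)))"

lemma cnt_0 [simp]: "cnt w i 0 = 0" by (simp add: cnt_def)

lemma cnt_Suc: "cnt w i (Suc n) = cnt w i n + of_bool (w (i + int n))" by (simp add: cnt_def)

lemma cnt_nonneg: "0 \<le> cnt w i n" by (simp add: cnt_def sum_nonneg)

lemma cnt_le: "cnt w i n \<le> int n" by (induction n) (auto simp: cnt_Suc)

lemma cnt_add: "cnt w i (m + n) = cnt w i m + cnt w (i + int m) n"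
  by (induction n) (auto simp: cnt_Suc algebra_simps)

lemma cnt_card: "int (card {j \<in> {i..<i + int n}. w j}) = cnt w i n"
proof (induction n)
  case (Suc n)
  have "{i..<i + int (Suc n)} = insert (i + int n) {i..<i + int n}" by auto
  then have "{j \<in> {i..<i + int (Suc n)}. w j} =
      (if w (i + int n) then insert (i + int n) {j \<in> {i..<i + int n}. w j} else {j \<in> {i..<i + int n}. w j})"
    by (simp only:) (auto split: if_splits)
  moreover have "finite {j \<in> {i..<i + int n}. w j}" by (rule finite_subset[of _ "{i..<i + int n}"]) auto
  moreover have "i + int n \<notin> {j \<in> {i..<i + int n}. w j}" by auto
  ultimately show ?case using Suc by (simp only: cnt_Suc card_insert_disjoint split: if_split) simp
qed simp

lemma cnt_all_eq_0: "cnt w i n = 0 \<longleftrightarrow> (\<forall>j\<in>{i..<i + int n}. \<not> w j)"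
proof -
  have "cnt w i n = 0 \<longleftrightarrow> {j \<in> {i..<i + int n}. w j} = {}"
    using cnt_card[of i n w] by (metis card_eq_0_iff finite_atLeastLessThan_int finite_Collect_conjI of_nat_eq_0_iff finite_subset Collect_mem_eq mem_Collect_eq subsetI)
  then show ?thesis by auto
qed

lemma cnt_mult_le:
  assumes "\<And>l. cnt w l n \<le> B"
  shows "cnt w i (m * n) \<le> int m * B"
proof (induction m)
  case (Suc m)
  have "cnt w i (Suc m * n) = cnt w i (m * n) + cnt w (i + int (m * n)) n"
    using cnt_add[of w i "m * n" n] by (simp add: add.commute)
  then show ?case using Suc assms[of "i + int (m * n)"] by (simp add: algebra_simps)
qed simp

lemma cnt_mult_ge:
  assumes "\<And>l. B \<le> cnt w l n"
  shows "int m * B \<le> cnt w i (m * n)"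
proof (induction m)
  case (Suc m)
  have "cnt w i (Suc m * n) = cnt w i (m * n) + cnt w (i + int (m * n)) n"
    using cnt_add[of w i "m * n" n] by (simp add: add.commute)
  then show ?case using Suc assms[of "i + int (m * n)"] by (simp add: algebra_simps)
qed simp

text \<open>Uniform discrepancy over all windows, which is stronger than having a density. The bound
  is not strict because it arises as a limit; for irrational slopes equality is impossible.\<close>

definition near_slope :: "real \<Rightarrow> (int \<Rightarrow> bool) \<Rightarrow> bool" where
  "near_slope \<beta> w \<longleftrightarrow> (\<forall>i n. \<bar>real_of_int (cnt w i n) - real n * \<beta>\<bar> \<le> 1)"

text \<open>A window of \<open>v\<close> of length \<open>n\<close> is compared with
  \<open>m\<close> consecutive windows of \<open>u\<close> of that length. Each comparison costs at
  most 1, so \<open>m\<close> times the discrepancy is at most \<open>m + 1\<close>, and letting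
  \<open>m\<close> grow removes the extra 1.\<close>

lemma near_slope_transfer:
  assumes u: "near_slope \<beta> u" and close: "\<And>i j n. \<bar>cnt u i n - cnt v j n\<bar> \<le> 1"
  shows "near_slope \<beta> v"
  unfolding near_slope_def
proof (intro allI)
  fix j n
  let ?c = "cnt v j n"
  have bound: "\<bar>real m * (real_of_int ?c - real n * \<beta>)\<bar> \<le> real m + 1" for m
  proof -
    have "int m * (?c - 1) \<le> cnt u 0 (m * n)" "cnt u 0 (m * n) \<le> int m * (?c + 1)"
      using close[of _ n j] by (intro cnt_mult_ge cnt_mult_le; smt (verit))+
    then have "real_of_int (int m * (?c - 1)) \<le> cnt u 0 (m * n)" "cnt u 0 (m * n) \<le> real_of_int (int m * (?c + 1))"
      by (simp_all only: of_int_le_iff)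
    moreover have "\<bar>cnt u 0 (m * n) - real (m * n) * \<beta>\<bar> \<le> 1"
      using u[unfolded near_slope_def, rule_format, of 0 "m * n"] .
    ultimately show ?thesis by (simp add: algebra_simps abs_le_iff)
  qed
  show "\<bar>?c - real n * \<beta>\<bar> \<le> 1"
  proof (rule ccontr)
    assume "\<not> ?thesis"
    then have "0 < \<bar>?c - real n * \<beta>\<bar> - 1" by simp
    then obtain m where m: "1 < real m * (\<bar>?c - real n * \<beta>\<bar> - 1)" by (rule archimedean_mult)
    have "real m * \<bar>?c - real n * \<beta>\<bar> \<le> real m + 1" using bound[of m] by (simp only: abs_mult abs_of_nat)
    then show False using m by (simp only: right_diff_distrib)
  qed
qed

text \<open>The slope is the supremum of the lower estimates \<open>(cnt - 1) / n\<close>. They stay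
  below all upper estimates \<open>(cnt + 1) / m\<close>, since \<open>m\<close> windows of length
  \<open>n\<close> and \<open>n\<close> windows of length \<open>m\<close> of \<open>u\<close> are
  both comparable with one window of \<open>v\<close> of length \<open>m * n\<close>.\<close>

lemma slope_exists:
  assumes close: "\<And>i j n. \<bar>cnt u i n - cnt v j n\<bar> \<le> 1"
  obtains \<beta> where "\<beta> \<in> {0..1}" "near_slope \<beta> u" "near_slope \<beta> v"
proof -
  have cross: "int m * (cnt u i n - 1) \<le> int n * (cnt u j m + 1)" for i j m n
  proof -
    have "int m * (cnt u i n - 1) \<le> cnt v 0 (m * n)"
      using close[of i n] by (intro cnt_mult_ge) (smt (verit))
    also have "\<dots> = cnt v 0 (n * m)" by (simp add: mult.commute)
    also have "\<dots> \<le> int n * (cnt u j m + 1)"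
      using close[of j m] by (intro cnt_mult_le) (smt (verit))
    finally show ?thesis .
  qed
  let ?S = "{(real_of_int (cnt u i n) - 1) / real n | i n. n > 0}"
  have le: "(real_of_int (cnt u i n) - 1) / real n \<le> (real_of_int (cnt u j m) + 1) / real m"
    if "n > 0" "m > 0" for i j n m
  proof -
    have "real_of_int (int m * (cnt u i n - 1)) \<le> real_of_int (int n * (cnt u j m + 1))"
      using cross by (simp only: of_int_le_iff)
    then show ?thesis using that by (simp add: field_simps)
  qed
  then have bdd: "bdd_above ?S"
    by (intro bdd_aboveI[of _ "(real_of_int (cnt u 0 1) + 1) / real 1"]) (smt (verit) mem_Collect_eq zero_less_one)
  define \<beta> where "\<beta> = Sup ?S"
  have up: "(real_of_int (cnt u i n) - 1) / real n \<le> \<beta>" if "n > 0" for i n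
    unfolding \<beta>_def by (rule cSup_upper[OF _ bdd]) (use that in auto)
  have low: "\<beta> \<le> (real_of_int (cnt u i n) + 1) / real n" if "n > 0" for i n
    unfolding \<beta>_def by (rule cSup_least) (use le that in \<open>auto intro: exI[of _ 1]\<close>)
  have u: "near_slope \<beta> u"
    unfolding near_slope_def
  proof (intro allI)
    fix i n show "\<bar>real_of_int (cnt u i n) - real n * \<beta>\<bar> \<le> 1"
      using up[of n i] low[of n i] by (cases "n = 0") (auto simp: field_simps abs_le_iff)
  qed
  have "0 \<le> \<beta>"
  proof (rule ccontr)
    assume "\<not> 0 \<le> \<beta>"
    then have "0 < - \<beta>" by simp
    then obtain n where "1 < real n * (- \<beta>)" by (rule archimedean_mult)
    moreover have "real_of_int (cnt u 0 n) \<ge> 0" using cnt_nonneg by simp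
    moreover have "\<bar>real_of_int (cnt u 0 n) - real n * \<beta>\<bar> \<le> 1"
      using u[unfolded near_slope_def, rule_format, of 0 n] .
    ultimately show False by simp
  qed
  moreover have "\<beta> \<le> 1"
  proof (rule ccontr)
    assume "\<not> \<beta> \<le> 1"
    then have "0 < \<beta> - 1" by simp
    then obtain n where "1 < real n * (\<beta> - 1)" by (rule archimedean_mult)
    moreover have "real_of_int (cnt u 0 n) \<le> real n" using cnt_le[of u 0 n] by linarith
    moreover have "\<bar>real_of_int (cnt u 0 n) - real n * \<beta>\<bar> \<le> 1"
      using u[unfolded near_slope_def, rule_format, of 0 n] .
    ultimately show False by (simp add: right_diff_distrib)
  qed
  ultimately show ?thesis using that u near_slope_transfer[OF u close] by auto
qed

lemma near_slope_unique:
  assumes "near_slope \<beta> w" "near_slope \<beta>' w"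
  shows "\<beta> = \<beta>'"
proof (rule ccontr)
  assume "\<beta> \<noteq> \<beta>'"
  then have "0 < \<bar>\<beta> - \<beta>'\<bar>" by simp
  then obtain n where n: "2 < real n * \<bar>\<beta> - \<beta>'\<bar>" by (rule archimedean_mult)
  have "\<bar>real_of_int (cnt w 0 n) - real n * \<beta>\<bar> \<le> 1" "\<bar>real_of_int (cnt w 0 n) - real n * \<beta>'\<bar> \<le> 1"
    using assms by (auto simp: near_slope_def)
  then have "\<bar>real n * \<beta> - real n * \<beta>'\<bar> \<le> 2" by linarith
  moreover have "\<bar>real n * \<beta> - real n * \<beta>'\<bar> = real n * \<bar>\<beta> - \<beta>'\<bar>"
    by (simp add: right_diff_distrib[symmetric] abs_mult)
  ultimately show False using n by simp
qed

lemma near_slope_density: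
  assumes "near_slope \<beta> w"
  shows "(\<lambda>n. real (card {i \<in> {- int n..<int n}. w i}) / (2 * real n)) \<longlonglongrightarrow> \<beta>"
proof (rule Lim_transform_eventually)
  have "(\<lambda>n. (real_of_int (cnt w (- int n) (2 * n)) - real (2 * n) * \<beta>) / real n) \<longlonglongrightarrow> 0"
  proof (rule Lim_null_comparison[OF _ lim_1_over_n])
    show "\<forall>\<^sub>F n in sequentially. norm ((real_of_int (cnt w (- int n) (2 * n)) - real (2 * n) * \<beta>) / real n) \<le> 1 / real n"
    proof (intro always_eventually allI)
      fix n
      have "\<bar>real_of_int (cnt w (- int n) (2 * n)) - real (2 * n) * \<beta>\<bar> \<le> 1"
        using assms unfolding near_slope_def by blast
      then show "norm ((real_of_int (cnt w (- int n) (2 * n)) - real (2 * n) * \<beta>) / real n) \<le> 1 / real n"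
        by (simp add: divide_right_mono)
    qed
  qed
  then have "(\<lambda>n. \<beta> + (real_of_int (cnt w (- int n) (2 * n)) - real (2 * n) * \<beta>) / real n / 2) \<longlonglongrightarrow> \<beta> + 0 / 2"
    by (intro tendsto_intros) auto
  then show "(\<lambda>n. \<beta> + (real_of_int (cnt w (- int n) (2 * n)) - real (2 * n) * \<beta>) / real n / 2) \<longlonglongrightarrow> \<beta>" by simp
  show "\<forall>\<^sub>F n in sequentially. \<beta> + (real_of_int (cnt w (- int n) (2 * n)) - real (2 * n) * \<beta>) / real n / 2
     = real (card {i \<in> {- int n..<int n}. w i}) / (2 * real n)"
    using eventually_gt_at_top[of 0]
  proof eventually_elim
    case (elim n)
    have "real_of_int (int (card {i \<in> {- int n..<- int n + int (2 * n)}. w i})) = real_of_int (cnt w (- int n) (2 * n))"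
      using cnt_card by metis
    then have "real (card {i \<in> {- int n..<int n}. w i}) = real_of_int (cnt w (- int n) (2 * n))" by simp
    then show ?case using elim by (simp add: field_simps)
  qed
qed

lemma near_slope_irrational:
  assumes "near_slope \<beta> w" "\<beta> \<notin> \<rat>"
  shows "\<bar>real_of_int (cnt w i n) - real n * \<beta>\<bar> < 1"
proof (rule ccontr)
  assume "\<not> ?thesis"
  then have "\<bar>real_of_int (cnt w i n) - real n * \<beta>\<bar> = 1" using assms(1) unfolding near_slope_def by (metis linorder_not_less nle_le)
  then have "real n * \<beta> \<in> \<rat>"
    by (smt (verit) Rats_1 Rats_add Rats_diff Rats_of_int)
  moreover have "n \<noteq> 0" using \<open>\<bar>real_of_int (cnt w i n) - real n * \<beta>\<bar> = 1\<close> by (cases "n = 0") auto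
  ultimately have "real n * \<beta> / real n \<in> \<rat>" by (intro Rats_divide) auto
  then show False using assms(2) \<open>n \<noteq> 0\<close> by simp
qed

text \<open>The discrepancy of one period is nonzero at an irrational slope and is multiplied by
  \<open>m\<close> over \<open>m\<close> periods, so it would be unbounded.\<close>

lemma not_periodic_if_irrational:
  assumes "near_slope \<beta> w" "\<beta> \<notin> \<rat>" "p > 0" "\<And>i. w (i + int p) = w i"
  shows False
proof -
  have "w (l + int p + int j) = w (l + int j)" for l j
    using assms(4)[of "l + int j"] by (simp add: algebra_simps)
  then have shift: "cnt w (l + int p) n = cnt w l n" for l n
    unfolding cnt_def by simp
  have "cnt w (int (m * p)) p = cnt w 0 p" for m
  proof (induction m)
    case (Suc m)
    have "int (Suc m * p) = int (m * p) + int p" by simp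
    then show ?case using shift Suc by metis
  qed simp
  then have c: "cnt w 0 (m * p) = int m * cnt w 0 p" for m
  proof (induction m)
    case (Suc m)
    then show ?case using cnt_add[of w 0 "m * p" p] by (simp add: algebra_simps)
  qed simp
  let ?d = "real_of_int (cnt w 0 p) - real p * \<beta>"
  have "?d \<noteq> 0"
  proof
    assume "?d = 0"
    then have "\<beta> = real_of_int (cnt w 0 p) / real p" using assms(3) by (simp add: field_simps)
    then show False using assms(2) by simp
  qed
  then have "0 < \<bar>?d\<bar>" by simp
  then obtain m where "1 < real m * \<bar>?d\<bar>" by (rule archimedean_mult)
  moreover have "real_of_int (cnt w 0 (m * p)) - real (m * p) * \<beta> = real m * ?d"
    unfolding c by (simp add: algebra_simps)
  moreover have "\<bar>real_of_int (cnt w 0 (m * p)) - real (m * p) * \<beta>\<bar> \<le> 1"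
    using assms(1)[unfolded near_slope_def, rule_format, of 0 "m * p"] .
  ultimately show False by (simp only: abs_mult abs_of_nat)
qed

section \<open>Sturmian substitutions\<close>

definition fac :: "(int \<Rightarrow> bool) \<Rightarrow> int \<Rightarrow> nat \<Rightarrow> bool list" where
  "fac w i n = map (\<lambda>m. w (i + int m)) [0..<n]"

lemma length_fac [simp]: "length (fac w i n) = n" by (simp add: fac_def)

lemma fac_0 [simp]: "fac w i 0 = []" by (simp add: fac_def)

lemma fac_append: "fac w i (m + n) = fac w i m @ fac w (i + int m) n"
  by (rule nth_equalityI) (auto simp: fac_def nth_append)

lemma fac_one: "fac w i (Suc 0) = [w i]" by (simp add: fac_def)

lemma fac_Suc: "fac w i (Suc n) = w i # fac w (i + 1) n"
  using fac_append[of w i 1 n] by (simp add: fac_one)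

lemma sublist_fac:
  assumes "s \<le> i" "i + int n \<le> s + int L"
  shows "sublist (fac w i n) (fac w s L)"
proof -
  define a where "a = nat (i - s)"
  define b where "b = L - a - n"
  have "L = a + (n + b)" "i = s + int a" using assms by (auto simp: a_def b_def)
  then have "fac w s L = fac w s a @ fac w i n @ fac w (i + int n) b"
    by (simp only: fac_append append_assoc)
  then show ?thesis by (metis sublist_appendI)
qed

lemma letter_map_append: "letter_map \<sigma> (u @ v) = letter_map \<sigma> u @ letter_map \<sigma> v"
  by (simp add: letter_map_def)

lemma letter_map_pow_append: "(letter_map \<sigma> ^^ k) (u @ v) = (letter_map \<sigma> ^^ k) u @ (letter_map \<sigma> ^^ k) v"
  by (induction k) (simp_all add: letter_map_append)

lemma letter_map_pow_sublist: "sublist u v \<Longrightarrow> sublist ((letter_map \<sigma> ^^ k) u) ((letter_map \<sigma> ^^ k) v)"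
  unfolding sublist_def by (metis letter_map_pow_append)

lemma int_switch:
  fixes a b :: int
  assumes "P a" "\<not> P b" "a < b"
  obtains i where "a \<le> i" "i < b" "P i" "\<not> P (i + 1)"
proof -
  have "\<exists>i\<ge>a. i < b \<and> P i \<and> \<not> P (i + 1)"
  proof (rule ccontr)
    assume no: "\<not> ?thesis"
    have "a \<le> i \<Longrightarrow> i \<le> b \<Longrightarrow> P i" for i
      by (induction i rule: int_ge_induct) (use assms(1) no in auto)
    then show False using assms by auto
  qed
  then show ?thesis using that by blast
qed

lemma bracket_int_seq:
  fixes s :: "int \<Rightarrow> int"
  assumes "\<And>j. s j + 1 \<le> s (j + 1)"
  obtains j where "s j \<le> i" "i < s (j + 1)"
proof -
  have up: "s 0 + int n \<le> s (int n)" for n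
  proof (induction n)
    case (Suc n)
    then show ?case using assms[of "int n"] by (simp add: algebra_simps)
  qed simp
  have dn: "s (- int n) \<le> s 0 - int n" for n
  proof (induction n)
    case (Suc n)
    have e: "- int (Suc n) = - int n - 1" by simp
    show ?case using Suc assms[of "- int n - 1"] unfolding e by simp
  qed simp
  define n where "n = nat (\<bar>i\<bar> + \<bar>s 0\<bar> + 1)"
  have "s (- int n) \<le> i" "\<not> s (int n) \<le> i" "- int n < int n"
  proof -
    have "int n = \<bar>i\<bar> + \<bar>s 0\<bar> + 1" by (simp add: n_def)
    then show "s (- int n) \<le> i" "\<not> s (int n) \<le> i" "- int n < int n"
      using up[of n] dn[of n] by linarith+
  qed
  then obtain j where "s j \<le> i" "\<not> s (j + 1) \<le> i" by (rule int_switch[of "\<lambda>j. s j \<le> i"])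
  then show ?thesis using that by simp
qed

lemma int_seq_mono:
  fixes s :: "int \<Rightarrow> int"
  assumes "\<And>j. s j \<le> s (j + 1)"
  shows "s j \<le> s (j + int m)"
proof (induction m)
  case (Suc m)
  have e: "j + int (Suc m) = j + int m + 1" by simp
  show ?case unfolding e using Suc assms[of "j + int m"] by (rule order_trans)
qed simp

text \<open>Both images contain one \<open>True\<close>; they encode the two possible distances
  between neighbouring \<open>True\<close> letters. The incidence matrix has trace
  \<open>n + 2\<close> and determinant 1, whence the polynomial of \<gamma> below.\<close>

definition sturm_subst :: "nat \<Rightarrow> bool \<Rightarrow> bool list" where
  "sturm_subst n x = replicate n False @ (if x then [True] else [True, False])"

text \<open>The equation says \<gamma> = 1 / (n + 2 - \<gamma>): the mean distance of neighbouring
  \<open>True\<close> letters, \<open>1 / \<gamma>\<close>, is \<open>n + 2\<close> minus the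
  density of the short distances, so this density is again \<gamma>.\<close>

locale noble_slope =
  fixes n :: nat and \<gamma> :: real
  assumes n: "2 \<le> n" and \<gamma>: "0 < \<gamma>" "\<gamma> < 1" "\<gamma>\<^sup>2 - (real n + 2) * \<gamma> + 1 = 0"
begin

definition bal :: "(int \<Rightarrow> bool) \<Rightarrow> bool" where
  "bal w \<longleftrightarrow> (\<forall>i m. \<bar>real_of_int (cnt w i m) - real m * \<gamma>\<bar> < 1)"

lemma balD: "bal w \<Longrightarrow> \<bar>real_of_int (cnt w i m) - real m * \<gamma>\<bar> < 1"
  by (simp add: bal_def)

lemma \<gamma>_bounds: "1 < (real n + 2) * \<gamma>" "(real n + 1) * \<gamma> < 1"
proof -
  have "(real n + 2) * \<gamma> = 1 + \<gamma>\<^sup>2" using \<gamma>(3) by simp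
  then show "1 < (real n + 2) * \<gamma>" using \<gamma>(1) by simp
  have "\<gamma>\<^sup>2 < \<gamma>" using \<gamma> by (simp add: power2_eq_square)
  then show "(real n + 1) * \<gamma> < 1" using \<gamma>(3) by (simp add: algebra_simps)
qed

lemma True_in_window:
  assumes "bal w"
  obtains j where "i \<le> j" "j < i + int (n + 2)" "w j"
proof -
  have "cnt w i (n + 2) \<noteq> 0"
    using balD[OF assms, of i "n + 2"] \<gamma>_bounds(1) by (auto simp: algebra_simps)
  then show ?thesis using that unfolding cnt_all_eq_0 by auto
qed

text \<open>Each \<open>True\<close> is preceded by at least \<open>n\<close> and at most \<open>n + 1\<close> letters \<open>False\<close>; cutting before
  the last \<open>n\<close> of them splits the word into images of letters. Comparing the windows from one
  \<open>True\<close> to another, with both ends included and with both ends excluded, shows that the word of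
  preimages is again balanced.\<close>

lemma desubstitute:
  assumes w: "bal w"
  obtains w' s where "bal w'" "\<And>k. s (k + 1) = s k + int (length (sturm_subst n (w' k)))"
    "\<And>k. fac w (s k) (length (sturm_subst n (w' k))) = sturm_subst n (w' k)"
proof -
  define nxt where "nxt i = (LEAST m. w (i + 1 + int m))" for i
  have ex: "\<exists>m. w (i + 1 + int m)" for i
  proof -
    obtain j where "i + 1 \<le> j" "w j" using True_in_window[OF w] by metis
    then show ?thesis by (intro exI[of _ "nat (j - i - 1)"]) auto
  qed
  define up where "up i = i + 1 + int (nxt i)" for i
  have up: "w (up i)" "i < up i" "\<And>j. i < j \<Longrightarrow> j < up i \<Longrightarrow> \<not> w j" for i
  proof -
    show "w (up i)" unfolding up_def nxt_def by (rule LeastI_ex[OF ex])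
    show "i < up i" by (simp add: up_def)
    fix j assume "i < j" "j < up i"
    then have "nat (j - i - 1) < nxt i" by (auto simp: up_def)
    then have "\<not> w (i + 1 + int (nat (j - i - 1)))" unfolding nxt_def by (rule not_less_Least)
    then show "\<not> w j" using \<open>i < j\<close> by simp
  qed
  have ex': "\<exists>m. w (i - 1 - int m)" for i
  proof -
    obtain j where "i - int (n + 2) \<le> j" "j < i" "w j" using True_in_window[OF w, of "i - int (n + 2)"] by auto
    then show ?thesis by (intro exI[of _ "nat (i - 1 - j)"]) auto
  qed
  define dn where "dn i = i - 1 - int (LEAST m. w (i - 1 - int m))" for i
  have dn: "w (dn i)" "dn i < i" "\<And>j. dn i < j \<Longrightarrow> j < i \<Longrightarrow> \<not> w j" for i
  proof -
    show "w (dn i)" unfolding dn_def by (rule LeastI_ex[OF ex'])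
    show "dn i < i" by (simp add: dn_def)
    fix j assume "dn i < j" "j < i"
    then have "nat (i - 1 - j) < (LEAST m. w (i - 1 - int m))" by (auto simp: dn_def)
    then have "\<not> w (i - 1 - int (nat (i - 1 - j)))" by (rule not_less_Least)
    then show "\<not> w j" using \<open>j < i\<close> by simp
  qed
  have updn: "up (dn i) = i" if "w i" for i
    using up[of "dn i"] dn[of i] that by (meson linorder_cases)
  obtain p0 where p0: "w p0" using True_in_window[OF w] by metis
  \<comment> \<open>Two-sided enumeration of the positions of \<open>True\<close>, starting from an
    arbitrary one.\<close>
  define p where "p k = (if k \<ge> 0 then (up ^^ nat k) p0 else (dn ^^ nat (- k)) p0)" for k :: int
  have wp: "w (p k)" for k
  proof -
    have "w ((up ^^ m) p0)" "w ((dn ^^ m) p0)" for m by (cases m; simp add: p0 up dn)+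
    then show ?thesis by (simp add: p_def)
  qed
  have p_step: "p (k + 1) = up (p k)" for k
  proof (cases "k \<ge> 0")
    case True
    then have "nat (k + 1) = Suc (nat k)" by simp
    then show ?thesis using True by (simp add: p_def)
  next
    case False
    then have k: "nat (- k) = Suc (nat (- (k + 1)))" by simp
    have "p k = dn (p (k + 1))" using False k by (auto simp: p_def)
    then show ?thesis using updn wp by simp
  qed
  define g where "g k = nat (p (k + 1) - p k)" for k
  have pg: "p (k + 1) = p k + int (g k)" "g k > 0" for k
    using up(2)[of "p k"] p_step[of k] by (auto simp: g_def)
  have between: "\<not> w j" if "p k < j" "j < p (k + 1)" for j k
    using up(3) that by (simp add: p_step)
  have c0: "cnt w (p k + 1) (g k - 1) = 0" for k
    unfolding cnt_all_eq_0 using between[of k] pg[of k] by auto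
  have c1: "cnt w (p k) (g k) = 1" for k
  proof -
    have "cnt w (p k) (1 + (g k - 1)) = cnt w (p k) 1 + cnt w (p k + int 1) (g k - 1)" by (rule cnt_add)
    then show ?thesis using c0[of k] wp[of k] pg(2)[of k] by (simp add: cnt_def)
  qed
  \<comment> \<open>A window ending in \<open>True\<close> on both sides contains two of them, so it
    is longer than \<open>1 / \<gamma> > n + 1\<close>; the window strictly between contains none,
    so it is shorter than \<open>1 / \<gamma> < n + 2\<close>.\<close>
  have gval: "g k = n + 1 \<or> g k = n + 2" for k
  proof -
    have "cnt w (p k) (g k + 1) = 2"
      using cnt_add[of w "p k" "g k" 1] c1[of k] wp[of "k + 1"] pg(1)[of k] by (simp add: cnt_def)
    then have "1 < real (g k + 1) * \<gamma>" using balD[OF w, of "p k" "g k + 1"] by simp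
    then have "(real n + 1) * \<gamma> < real (g k + 1) * \<gamma>" using \<gamma>_bounds by linarith
    then have "real n + 1 < real (g k + 1)" using \<gamma> by simp
    moreover have "real (g k - 1) * \<gamma> < 1" using balD[OF w, of "p k + 1" "g k - 1"] c0[of k] by simp
    then have "real (g k - 1) * \<gamma> < (real n + 2) * \<gamma>" using \<gamma>_bounds by linarith
    then have "real (g k - 1) < real n + 2" using \<gamma> by simp
    ultimately show ?thesis by linarith
  qed
  define w' where "w' k \<longleftrightarrow> g k = n + 1" for k
  have len: "length (sturm_subst n (w' k)) = g k" for k
    using gval[of k] by (auto simp: sturm_subst_def w'_def)
  have gcnt: "int (g k) = int (n + 2) - of_bool (w' k)" for k using gval[of k] by (auto simp: w'_def)
  have L: "p (k + int m) = p k + int (n + 2) * int m - cnt w' k m" for k m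
  proof (induction m)
    case (Suc m)
    then show ?case using pg(1)[of "k + int m"] gcnt[of "k + int m"] by (simp add: cnt_Suc algebra_simps)
  qed simp
  have ple: "p k \<le> p (k + int m)" for k m using int_seq_mono[of p] pg by (metis le_add_same_cancel1 of_nat_0_le_iff)
  have cm: "cnt w (p k) (nat (p (k + int m) - p k)) = int m" for k m
  proof (induction m)
    case (Suc m)
    have "nat (p (k + int (Suc m)) - p k) = nat (p (k + int m) - p k) + g (k + int m)"
      using pg(1)[of "k + int m"] ple[of k m] by (simp add: algebra_simps)
    then show ?case using Suc c1[of "k + int m"] ple[of k m] by (simp add: cnt_add)
  qed simp
  have "bal w'"
    unfolding bal_def
  proof (intro allI)
    fix k m
    let ?b = "real_of_int (cnt w' k m)"
    define l where "l = nat (p (k + int m) - p k)"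
    have lr: "real l = (real n + 2) * real m - ?b"
    proof -
      have "int l = int (n + 2) * int m - cnt w' k m" using ple[of k m] L[of k m] by (simp add: l_def)
      then have "real_of_int (int l) = real_of_int (int (n + 2) * int m - cnt w' k m)" by simp
      then show ?thesis by simp
    qed
    \<comment> \<open>Renormalization: by the equation of \<gamma> the discrepancy of a window of
      \<open>w\<close> is \<gamma> times that of the word of preimages. The bounds obtained from the
      two windows are \<open>\<gamma>\<close> and \<open>- \<gamma>\<close>, so the factor cancels
      exactly and the bound 1 is reproduced.\<close>
    have e: "real m - real l * \<gamma> = \<gamma> * (?b - real m * \<gamma>)"
    proof -
      have "real m - real l * \<gamma> - \<gamma> * (?b - real m * \<gamma>) = real m * (\<gamma>\<^sup>2 - (real n + 2) * \<gamma> + 1)"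
        unfolding lr by (simp add: algebra_simps power2_eq_square)
      then show ?thesis using \<gamma>(3) by simp
    qed
    have pl: "p k + int l = p (k + int m)" using ple[of k m] by (simp add: l_def)
    have "cnt w (p k) (l + 1) = int m + 1"
      using cnt_add[of w "p k" l 1] cm[of k m] wp[of "k + int m"] pl by (simp add: cnt_def l_def)
    then have "real m - real l * \<gamma> < \<gamma>" using balD[OF w, of "p k" "l + 1"] by (simp add: algebra_simps abs_less_iff)
    then have up: "?b - real m * \<gamma> < 1" unfolding e using \<gamma> by simp
    have low: "-1 < ?b - real m * \<gamma>"
    proof (cases "m = 0")
      case False
      then have "l > 0" using cm[of k m] by (cases "l = 0") (auto simp: l_def)
      then have "cnt w (p k) (1 + (l - 1)) = int m" using cm[of k m] by (simp add: l_def)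
      then have "cnt w (p k + 1) (l - 1) = int m - 1"
        using cnt_add[of w "p k" 1 "l - 1"] wp[of k] by (simp add: cnt_def)
      then have "real m - real l * \<gamma> > - \<gamma>"
        using balD[OF w, of "p k + 1" "l - 1"] \<open>l > 0\<close> by (simp add: algebra_simps abs_less_iff of_nat_diff)
      then have "\<gamma> * (- 1) < \<gamma> * (?b - real m * \<gamma>)" unfolding e by simp
      then show ?thesis using \<gamma> by (simp only: mult_less_cancel_left_pos)
    qed simp
    show "\<bar>?b - real m * \<gamma>\<bar> < 1" using up low by simp
  qed
  moreover define s where "s k = p k - int n" for k
  have "s (k + 1) = s k + int (length (sturm_subst n (w' k)))" for k
    using pg(1)[of k] by (simp add: s_def len)
  moreover have "fac w (s k) (length (sturm_subst n (w' k))) = sturm_subst n (w' k)" for k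
  proof -
    have F: "fac w (s k) n = replicate n False"
    proof (rule nth_equalityI)
      fix i assume "i < length (fac w (s k) n)"
      then have i: "i < n" by simp
      have "p (k - 1 + 1) = p (k - 1) + int (g (k - 1))" by (rule pg)
      then have "p (k - 1) < s k + int i" using gval[of "k - 1"] i by (auto simp: s_def)
      moreover have "s k + int i < p (k - 1 + 1)" using i by (simp add: s_def)
      ultimately show "fac w (s k) n ! i = replicate n False ! i" using i between[of "k - 1"] by (simp add: fac_def)
    qed simp
    have pk: "s k + int n = p k" by (simp add: s_def)
    show ?thesis
    proof (cases "w' k")
      case True
      then have "length (sturm_subst n (w' k)) = n + 1" by (simp add: sturm_subst_def)
      then show ?thesis using True F wp[of k] pk fac_append[of w "s k" n 1] by (simp add: sturm_subst_def fac_one)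
    next
      case False
      then have "g k = n + 2" using gval[of k] by (auto simp: w'_def)
      then have "\<not> w (p k + 1)" using between[of k "p k + 1"] pg(1)[of k] n by simp
      moreover have "length (sturm_subst n (w' k)) = n + 2" using False by (simp add: sturm_subst_def)
      ultimately show ?thesis using False F wp[of k] pk fac_append[of w "s k" n 2]
        by (simp add: sturm_subst_def fac_Suc numeral_2_eq_2)
    qed
  qed
  ultimately show ?thesis by (rule that)
qed

lemma length_sturm_subst: "2 \<le> length (sturm_subst n x)"
  using n by (auto simp: sturm_subst_def)

lemma length_letter_map_pow: "2 ^ k * length u \<le> length ((letter_map (sturm_subst n) ^^ k) u)"
proof (induction k)
  case (Suc k)
  have "2 * length v \<le> length (letter_map (sturm_subst n) v)" for v
  proof (induction v)
    case (Cons x v)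
    then show ?case using length_sturm_subst[of x] by (simp add: letter_map_def)
  qed (simp add: letter_map_def)
  from this[of "(letter_map (sturm_subst n) ^^ k) u"] Suc show ?case by simp
qed simp

text \<open>The cuts of successive levels compose; \<open>block\<close> extends the parsing of level
  \<open>k\<close> from single letters to whole factors, which the next level needs.\<close>

lemma desubstitute_pow:
  assumes "bal w"
  shows "\<exists>w' s. bal w' \<and> (\<forall>j. s (j + 1) = s j + int (length ((letter_map (sturm_subst n) ^^ k) [w' j]))) \<and>
    (\<forall>j. fac w (s j) (length ((letter_map (sturm_subst n) ^^ k) [w' j])) = (letter_map (sturm_subst n) ^^ k) [w' j])"
  using assms
proof (induction k arbitrary: w)
  case 0
  then show ?case by (intro exI[of _ w] exI[of _ "\<lambda>j. j"]) (simp add: fac_one)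
next
  case (Suc k)
  let ?\<phi> = "letter_map (sturm_subst n)"
  obtain v t where v: "bal v" "\<And>j. t (j + 1) = t j + int (length ((?\<phi> ^^ k) [v j]))"
    "\<And>j. fac w (t j) (length ((?\<phi> ^^ k) [v j])) = (?\<phi> ^^ k) [v j]"
    using Suc.IH[OF Suc.prems] by blast
  obtain w' s where w': "bal w'" "\<And>j. s (j + 1) = s j + int (length (sturm_subst n (w' j)))"
    "\<And>j. fac v (s j) (length (sturm_subst n (w' j))) = sturm_subst n (w' j)"
    using desubstitute[OF v(1)] by metis
  have block: "t (j + int m) = t j + int (length ((?\<phi> ^^ k) (fac v j m))) \<and>
      fac w (t j) (length ((?\<phi> ^^ k) (fac v j m))) = (?\<phi> ^^ k) (fac v j m)" for j m
  proof (induction m)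
    case 0
    have "(?\<phi> ^^ k) [] = []" by (induction k) (simp_all add: letter_map_def)
    then show ?case by simp
  next
    case (Suc m)
    have eq: "(?\<phi> ^^ k) (fac v j (Suc m)) = (?\<phi> ^^ k) (fac v j m) @ (?\<phi> ^^ k) [v (j + int m)]"
      using fac_append[of v j m 1] by (simp add: letter_map_pow_append fac_one)
    show ?case unfolding eq using Suc v(2)[of "j + int m"] v(3)[of "j + int m"]
      by (simp add: fac_append algebra_simps)
  qed
  have one: "(?\<phi> ^^ Suc k) [x] = (?\<phi> ^^ k) (sturm_subst n x)" for x
    by (simp add: funpow_swap1 letter_map_def)
  show ?case
  proof (intro exI conjI allI)
    show "bal w'" by (rule w')
    fix j
    show "(t \<circ> s) (j + 1) = (t \<circ> s) j + int (length ((?\<phi> ^^ Suc k) [w' j]))"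
      unfolding one o_def w'(2) using block[of "s j" "length (sturm_subst n (w' j))"] w'(3)[of j] by simp
    show "fac w ((t \<circ> s) j) (length ((?\<phi> ^^ Suc k) [w' j])) = (?\<phi> ^^ Suc k) [w' j]"
      unfolding one o_def using block[of "s j" "length (sturm_subst n (w' j))"] w'(3)[of j] by simp
  qed
qed

text \<open>As \<open>(n + 1) * \<gamma> < 1\<close> and \<open>n\<close> is at least 2, two
  \<open>True\<close> letters are at least three apart. So the only factors of length 2 are those
  found right around any \<open>True\<close>; a window of length \<open>n + 2\<close> contains one,
  and the extra four letters leave room on both sides.\<close>

lemma pair_in_long_window:
  assumes "bal w" "bal v"
  shows "sublist (fac w i 2) (fac v j (n + 6))"
proof -
  obtain t where t: "j + 1 \<le> t" "t < j + 1 + int (n + 2)" "v t" using True_in_window[OF assms(2), of "j + 1"] by blast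
  have not2: "\<not> (bal u \<and> u k \<and> u l \<and> l = k + int m \<and> 0 < m \<and> m \<le> n)" for u k l m
  proof
    assume h: "bal u \<and> u k \<and> u l \<and> l = k + int m \<and> 0 < m \<and> m \<le> n"
    then have "cnt u k (m + 1) = cnt u k m + 1" by (auto simp: cnt_Suc)
    moreover have "cnt u k (1 + (m - 1)) = cnt u k 1 + cnt u (k + int 1) (m - 1)" by (rule cnt_add)
    then have "cnt u k m \<ge> 1" using h cnt_nonneg[of u "k + 1" "m - 1"] by (simp add: cnt_def)
    ultimately have "real_of_int (cnt u k (m + 1)) \<ge> 2" by linarith
    moreover have "\<bar>real_of_int (cnt u k (m + 1)) - real (m + 1) * \<gamma>\<bar> < 1" using h balD by blast
    ultimately have "1 < real (m + 1) * \<gamma>" by linarith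
    also have "\<dots> \<le> (real n + 1) * \<gamma>" using h \<gamma> by (intro mult_right_mono) auto
    finally show False using \<gamma>_bounds by simp
  qed
  have v: "\<not> v (t + 1)" "\<not> v (t + 2)" "\<not> v (t - 1)"
    using not2[of v t "t + 1" 1] not2[of v t "t + 2" 2] not2[of v "t - 1" t 1] t(3) assms(2) n by auto
  have two: "fac u k 2 = [u k, u (k + 1)]" for u k by (simp add: fac_Suc numeral_2_eq_2)
  have "\<exists>k. j \<le> k \<and> k + 2 \<le> j + int (n + 6) \<and> fac v k 2 = fac w i 2"
  proof (cases "w i"; cases "w (i + 1)")
    assume "w i" "w (i + 1)" then show ?thesis using not2[of w i "i + 1" 1] assms(1) n by auto
  next
    assume "w i" "\<not> w (i + 1)" then show ?thesis using v t by (intro exI[of _ t]) (auto simp: two)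
  next
    assume "\<not> w i" "w (i + 1)" then show ?thesis using v t by (intro exI[of _ "t - 1"]) (auto simp: two)
  next
    assume "\<not> w i" "\<not> w (i + 1)" then show ?thesis using v t by (intro exI[of _ "t + 1"]) (auto simp: two add.commute)
  qed
  then show ?thesis using sublist_fac[of j _ 2 "n + 6" v] by (metis of_nat_numeral)
qed

text \<open>A factor shorter than all images of letters at level \<open>k\<close> meets at most two
  consecutive ones, so it lies in the image of a factor of length 2 of the desubstituted word. That
  pair occurs in a single letter image of level \<open>m\<close>, giving level
  \<open>k + m\<close>.\<close>

lemma balanced_in_subshift:
  assumes "bal w"
  shows "w \<in> subshift (sturm_subst n)"
proof -
  let ?\<phi> = "letter_map (sturm_subst n)"
  have "\<exists>k y. sublist (fac w i l) ((?\<phi> ^^ k) [y])" for i l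
  proof -
    obtain k :: nat where k: "l < 2 ^ k" by (metis less_exp)
    obtain w' s where w': "bal w'" "\<And>j. s (j + 1) = s j + int (length ((?\<phi> ^^ k) [w' j]))"
      "\<And>j. fac w (s j) (length ((?\<phi> ^^ k) [w' j])) = (?\<phi> ^^ k) [w' j]"
      using desubstitute_pow[OF assms, of k] by blast
    have len: "l < length ((?\<phi> ^^ k) [x])" for x
      using length_letter_map_pow[of k "[x]"] k by simp
    have "s j + 1 \<le> s (j + 1)" for j using w'(2)[of j] len[of "w' j"] by simp
    then obtain j where j: "s j \<le> i" "i < s (j + 1)" by (rule bracket_int_seq)
    let ?A = "(?\<phi> ^^ k) [w' j]" and ?B = "(?\<phi> ^^ k) [w' (j + 1)]"
    have "fac w (s j) (length ?A + length ?B) = ?A @ ?B"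
      using w'(3)[of j] w'(3)[of "j + 1"] w'(2)[of j] by (simp add: fac_append)
    also have "\<dots> = (?\<phi> ^^ k) (fac w' j 2)"
      by (simp add: letter_map_pow_append[symmetric] fac_Suc numeral_2_eq_2)
    finally have "sublist (fac w i l) ((?\<phi> ^^ k) (fac w' j 2))"
      using sublist_fac[of "s j" i l "length ?A + length ?B" w] j len[of "w' (j + 1)"] w'(2)[of j] by simp
    moreover obtain m :: nat where m: "n + 6 < 2 ^ m" by (metis less_exp)
    obtain v r where v: "bal v" "\<And>j. fac w' (r j) (length ((?\<phi> ^^ m) [v j])) = (?\<phi> ^^ m) [v j]"
      using desubstitute_pow[OF w'(1), of m] by blast
    have "n + 6 \<le> length ((?\<phi> ^^ m) [v 0])" using length_letter_map_pow[of m "[v 0]"] m by simp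
    then have "sublist (fac w' (r 0) (n + 6)) (fac w' (r 0) (length ((?\<phi> ^^ m) [v 0])))" by (intro sublist_fac) auto
    then have "sublist (fac w' j 2) ((?\<phi> ^^ m) [v 0])"
      using pair_in_long_window[OF w'(1) w'(1), of j "r 0"] v(2)[of 0] by (metis sublist_order.order.trans)
    then have "sublist ((?\<phi> ^^ k) (fac w' j 2)) ((?\<phi> ^^ (k + m)) [v 0])"
      by (simp add: funpow_add letter_map_pow_sublist)
    ultimately show ?thesis by (metis sublist_order.order.trans)
  qed
  then show ?thesis by (auto simp: subshift_def fac_def)
qed

lemma primitive_sturm_subst: "primitive_subst (sturm_subst n)"
  unfolding primitive_subst_def
  by (rule exI[of _ 1]) (use n in \<open>auto simp: letter_map_def sturm_subst_def\<close>)

lemma inflation_factor_sturm_subst: "inflation_factor (sturm_subst n) (real n + 2 - \<gamma>)"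
  unfolding inflation_factor_def
\<comment> \<open>The lengths form a left eigenvector of the incidence matrix for the eigenvalue
  \<open>n + 2 - \<gamma>\<close>.\<close>
proof (intro exI[of _ "\<lambda>x. if x then 1 - \<gamma> else 1"] conjI allI)
  fix x
  show "0 < (if x then 1 - \<gamma> else 1)" using \<gamma> by simp
  show "sum_list (map (\<lambda>x. if x then 1 - \<gamma> else 1) (sturm_subst n x)) = (real n + 2 - \<gamma>) * (if x then 1 - \<gamma> else 1)"
    using \<gamma>(3) by (auto simp: sturm_subst_def sum_list_replicate algebra_simps power2_eq_square)
qed

end

section \<open>Units of real quadratic fields\<close>

lemma sqrt_irrational:
  assumes "1 < d" "squarefree (d::nat)"
  shows "sqrt (real d) \<notin> \<rat>"
proof
  assume "sqrt (real d) \<in> \<rat>"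
  then obtain m n :: int where mn: "n > 0" "coprime m n" "sqrt (real d) = of_int m / of_int n"
    by (metis Rats_cases')
  then have "of_int m = sqrt (real d) * of_int n" by (simp add: field_simps)
  then have "(of_int m :: real)\<^sup>2 = real d * (of_int n)\<^sup>2" by (simp add: power_mult_distrib)
  then have "real_of_int (m\<^sup>2) = real_of_int (int d * n\<^sup>2)" by simp
  then have eq: "m\<^sup>2 = int d * n\<^sup>2" by (simp only: of_int_eq_iff)
  then have "n\<^sup>2 dvd m\<^sup>2" by simp
  then have "n dvd m" by (simp add: power2_eq_square[symmetric])
  then have "is_unit n" using mn(2) by (metis coprime_common_divisor dvd_refl)
  then have "n = 1" using mn(1) by simp
  then have "int d = m\<^sup>2" using eq by simp
  then have "d = (nat \<bar>m\<bar>)\<^sup>2" by (metis nat_int nat_power_eq abs_ge_zero power2_abs)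
  then have "is_unit (nat \<bar>m\<bar>)" using assms(2) unfolding squarefree_def by (metis dvd_refl)
  then show False using \<open>d = (nat \<bar>m\<bar>)\<^sup>2\<close> assms(1) by simp
qed

text \<open>Dirichlet approximation gives infinitely many \<open>a + b * sqrt d\<close> of bounded norm; two of them
  with the same norm and congruent coordinates modulo that norm have a quotient that is a unit.\<close>

lemma pell_solution:
  assumes "1 < d" "squarefree (d::nat)"
  obtains x y :: int where "2 \<le> x" "x\<^sup>2 - int d * y\<^sup>2 = 1"
proof -
  define s where "s = sqrt (real d)"
  have s: "s \<notin> \<rat>" "s > 1" "s\<^sup>2 = real d"
    using sqrt_irrational[OF assms] assms by (auto simp: s_def)
  define C where "C = 2 * s + 1"
  \<comment> \<open>Pairs approximating \<open>s\<close> as well as Dirichlet's theorem promises;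
    their norms \<open>h\<^sup>2 - d * k\<^sup>2\<close> are bounded by the constant
    \<open>C\<close>.\<close>
  define S where "S = {(h, k). 0 < k \<and> \<bar>of_int k * s - of_int h\<bar> * of_int k < (1::real)}"
  have nz: "of_int k * s - of_int h \<noteq> 0" if "k \<noteq> 0" for h k :: int
  proof
    assume "of_int k * s - of_int h = 0"
    then have "s = of_int h / of_int k" using that by (simp add: field_simps)
    then show False using s(1) by simp
  qed
  have "infinite S"
  proof
    assume fin: "finite S"
    \<comment> \<open>If there were finitely many pairs, the errors \<open>k * s - h\<close> would
      stay away from 0, against a Dirichlet approximation of quality
      \<open>1 / N < e\<close>.\<close>
    define e where "e = Min (insert 1 ((\<lambda>(h, k). \<bar>of_int k * s - of_int h\<bar>) ` S))"
    have "e > 0" unfolding e_def using fin nz by (subst Min_gr_iff) (auto simp: S_def)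
    have le: "e \<le> \<bar>of_int k * s - of_int h\<bar>" if "(h, k) \<in> S" for h k
      unfolding e_def using fin that by (intro Min_le) force+
    obtain N :: nat where N: "N > 0" "1 / real N < e"
      using \<open>e > 0\<close> by (metis nat_approx_posE of_nat_Suc zero_less_Suc)
    obtain h k where hk: "0 < k" "k \<le> int N" "\<bar>of_int k * s - of_int h\<bar> < 1 / real N"
      using Dirichlet_approx[OF N(1)] by metis
    have "\<bar>of_int k * s - of_int h\<bar> * of_int k \<le> \<bar>of_int k * s - of_int h\<bar> * real N"
      using hk by (intro mult_left_mono) auto
    also have "\<dots> < 1" using hk(3) N by (simp add: field_simps)
    finally have "(h, k) \<in> S" using hk by (simp add: S_def)
    then show False using le hk(3) N(2) by fastforce
  qed
  have bound: "\<bar>h\<^sup>2 - int d * k\<^sup>2\<bar> \<le> \<lceil>C\<rceil>" if "(h, k) \<in> S" for h k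
  proof -
    let ?u = "of_int k * s - of_int h :: real"
    have k: "1 \<le> k" "\<bar>?u\<bar> * of_int k < 1" using that by (auto simp: S_def)
    have "\<bar>?u\<bar> \<le> \<bar>?u\<bar> * of_int k" using k(1) by (simp add: mult_le_cancel_left1)
    then have u: "\<bar>?u\<bar> < 1" using k by linarith
    have "real_of_int (h\<^sup>2 - int d * k\<^sup>2) = - ?u * (2 * s * of_int k - ?u)"
      using s(3) by (simp add: power2_eq_square algebra_simps)
    then have "\<bar>real_of_int (h\<^sup>2 - int d * k\<^sup>2)\<bar> = \<bar>?u\<bar> * \<bar>2 * s * of_int k - ?u\<bar>"
      by (simp only: abs_mult abs_minus_cancel)
    also have "\<dots> \<le> \<bar>?u\<bar> * (2 * s * of_int k + \<bar>?u\<bar>)"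
    proof (intro mult_left_mono)
      have "0 \<le> 2 * s * of_int k" using k s(2) by simp
      then show "\<bar>2 * s * of_int k - ?u\<bar> \<le> 2 * s * of_int k + \<bar>?u\<bar>" by linarith
    qed simp
    also have "\<dots> = 2 * s * (\<bar>?u\<bar> * of_int k) + \<bar>?u\<bar> * \<bar>?u\<bar>" by (simp add: algebra_simps)
    also have "\<dots> \<le> 2 * s * 1 + 1 * 1"
      using k u s(2) by (intro add_mono mult_left_mono mult_mono) auto
    finally show ?thesis unfolding C_def by linarith
  qed
  define f where "f = (\<lambda>(h, k). h\<^sup>2 - int d * k\<^sup>2)"
  have "finite (f ` S)"
    by (rule finite_subset[of _ "{-\<lceil>C\<rceil>..\<lceil>C\<rceil>}"]) (use bound in \<open>force simp: f_def abs_le_iff\<close>)+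
  then obtain p where p: "infinite {q\<in>S. f q = f p}"
    using pigeonhole_infinite[OF \<open>infinite S\<close>] by blast
  define n where "n = f p"
  define S1 where "S1 = {q\<in>S. f q = n}"
  have inf1: "infinite S1" using p unfolding S1_def n_def .
  have n0: "n \<noteq> 0"
  proof
    assume "n = 0"
    obtain h k where hk: "(h, k) \<in> S1" using infinite_imp_nonempty[OF inf1] by auto
    then have "h\<^sup>2 = int d * k\<^sup>2" "0 < k" using \<open>n = 0\<close> by (auto simp: S1_def S_def f_def)
    then have "real_of_int (h\<^sup>2) = real_of_int (int d * k\<^sup>2)" by simp
    then have "(of_int h)\<^sup>2 = (s * of_int k)\<^sup>2" using s(3) by (simp add: power_mult_distrib)
    then have "of_int h = s * of_int k \<or> of_int h = - (s * of_int k)" by (simp only: power2_eq_iff)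
    then have "of_int k * s - of_int h = 0 \<or> of_int k * s - of_int (-h) = 0" by (auto simp: algebra_simps)
    then show False using nz[of k h] nz[of k "- h"] \<open>0 < k\<close> by simp
  qed
  define m where "m = (\<lambda>(h, k). (h mod n, k mod n))"
  have "finite (m ` S1)"
  proof (rule finite_subset)
    have "- \<bar>n\<bar> \<le> a mod n \<and> a mod n \<le> \<bar>n\<bar>" for a
      using abs_mod_less[OF n0, of a] by linarith
    then show "m ` S1 \<subseteq> {-\<bar>n\<bar>..\<bar>n\<bar>} \<times> {-\<bar>n\<bar>..\<bar>n\<bar>}" by (auto simp: m_def)
  qed simp
  then obtain q where q: "infinite {r\<in>S1. m r = m q}"
    using pigeonhole_infinite[OF inf1] by blast
  obtain h1 k1 where 1: "(h1, k1) \<in> {r\<in>S1. m r = m q}" using infinite_imp_nonempty[OF q] by auto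
  have "infinite ({r\<in>S1. m r = m q} - {(h1, k1)})" using q by simp
  then obtain h2 k2 where 2: "(h2, k2) \<in> {r\<in>S1. m r = m q}" "(h2, k2) \<noteq> (h1, k1)"
    by (metis (no_types, lifting) infinite_imp_nonempty equals0I surj_pair Diff_iff singletonI)
  have pos: "h > 0 \<and> k > 0" if "(h, k) \<in> S" for h k
  proof -
    have k: "1 \<le> k" "\<bar>of_int k * s - of_int h\<bar> * of_int k < 1" using that by (auto simp: S_def)
    have "\<bar>of_int k * s - of_int h\<bar> \<le> \<bar>of_int k * s - of_int h\<bar> * of_int k" using k(1) by (simp add: mult_le_cancel_left1)
    moreover have "1 * 1 < real_of_int k * s" using k(1) s(2) by (intro mult_le_less_imp_less) auto
    ultimately have "real_of_int h > 0" using k(2) by linarith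
    then show ?thesis using k by simp
  qed
  have "m (h1, k1) = m (h2, k2)" using 1 2(1) by (simp only: mem_Collect_eq)
  then have mm: "h1 mod n = h2 mod n" "k1 mod n = k2 mod n" by (simp_all add: m_def)
  have hk: "h1 > 0" "k1 > 0" "h2 > 0" "k2 > 0" "h1\<^sup>2 - int d * k1\<^sup>2 = n" "h2\<^sup>2 - int d * k2\<^sup>2 = n"
    "h1 mod n = h2 mod n" "k1 mod n = k2 mod n"
    using 1 2 pos mm unfolding S1_def f_def by auto
  obtain t where t: "h2 = h1 + n * t" using hk(7) by (metis mod_eq_dvd_iff dvd_def diff_add_cancel add.commute)
  obtain u where u: "k2 = k1 + n * u" using hk(8) by (metis mod_eq_dvd_iff dvd_def diff_add_cancel add.commute)
  \<comment> \<open>Up to the sign of \<open>y\<close>, these are the coordinates of the product of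
    \<open>h1 + k1 * sqrt d\<close> with the conjugate of \<open>h2 + k2 * sqrt d\<close>, divided
    by \<open>n\<close>. The congruences make the division exact.\<close>
  define x where "x = 1 + h1 * t - int d * (k1 * u)"
  define y where "y = h1 * u - t * k1"
  have X: "h1 * h2 - int d * (k1 * k2) = n * x"
    unfolding x_def t u using hk(5) by (simp add: power2_eq_square algebra_simps)
  have Y: "h1 * k2 - h2 * k1 = n * y" unfolding y_def t u by (simp add: algebra_simps)
  have "n * n = (h1\<^sup>2 - int d * k1\<^sup>2) * (h2\<^sup>2 - int d * k2\<^sup>2)" using hk by simp
  also have "\<dots> = (h1 * h2 - int d * (k1 * k2))\<^sup>2 - int d * (h1 * k2 - h2 * k1)\<^sup>2"
    by (simp add: power2_eq_square algebra_simps)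
  finally have "(n * x)\<^sup>2 - int d * (n * y)\<^sup>2 = n * n" unfolding X Y by simp
  then have "n * n * (x\<^sup>2 - int d * y\<^sup>2 - 1) = 0" by (simp add: power2_eq_square algebra_simps)
  then have pell: "x\<^sup>2 - int d * y\<^sup>2 = 1" using n0 by simp
  \<comment> \<open>For \<open>y = 0\<close> the two pairs are proportional; having the same nonzero
    norm and positive entries they would coincide.\<close>
  have "y \<noteq> 0"
  proof
    assume "y = 0"
    then have e: "h1 * k2 = h2 * k1" using Y by simp
    have "h1\<^sup>2 * n = h1\<^sup>2 * (h2\<^sup>2 - int d * k2\<^sup>2)" using hk by simp
    also have "\<dots> = h2\<^sup>2 * h1\<^sup>2 - int d * (h1 * k2)\<^sup>2" by (simp add: algebra_simps power2_eq_square)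
    also have "\<dots> = h2\<^sup>2 * (h1\<^sup>2 - int d * k1\<^sup>2)" unfolding e by (simp add: algebra_simps power2_eq_square)
    finally have "h1\<^sup>2 = h2\<^sup>2" using hk n0 by simp
    then have "h1 = h2" using hk by (simp add: power2_eq_iff)
    then show False using e hk 2(2) by auto
  qed
  then have "y\<^sup>2 \<ge> 1" by (simp add: int_one_le_iff_zero_less)
  then have "int d * 1 \<le> int d * y\<^sup>2" by (intro mult_left_mono) auto
  then have "x\<^sup>2 > 1" using pell assms(1) by linarith
  then have "\<bar>x\<bar> > 1" by (metis abs_square_le_1 not_le)
  then show ?thesis using pell by (intro that[of "\<bar>x\<bar>" y]) auto
qed

section \<open>Tilings of the index lattice by balanced blocks\<close>

lemma obtain_split_five:
  assumes "finite S" "a + b + c + d \<le> card S"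
  obtains g where "\<And>s. g s \<in> {(0, 0), (1, 0), (- 1, 0), (0, 1), (0, - 1 :: int) :: int \<times> int}"
    "card {s \<in> S. g s = (1, 0)} = a" "card {s \<in> S. g s = (- 1, 0)} = b"
    "card {s \<in> S. g s = (0, 1)} = c" "card {s \<in> S. g s = (0, - 1)} = d"
    "card {s \<in> S. g s = (0, 0)} = card S - (a + b + c + d)"
proof -
  obtain A where A: "A \<subseteq> S" "card A = a" by (rule obtain_subset_with_card_n[of a S]) (use assms in auto)
  have fA: "finite A" using A assms finite_subset by blast
  then have cA: "card (S - A) = card S - a" using A by (simp add: card_Diff_subset)
  obtain B where B: "B \<subseteq> S - A" "card B = b" by (rule obtain_subset_with_card_n[of b "S - A"]) (use assms cA in auto)
  have fB: "finite B" using B assms finite_subset by (metis finite_Diff)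
  then have cB: "card (S - A - B) = card S - a - b" using B cA by (simp add: card_Diff_subset)
  obtain C where C: "C \<subseteq> S - A - B" "card C = c" by (rule obtain_subset_with_card_n[of c "S - A - B"]) (use assms cB in auto)
  have fC: "finite C" using C assms finite_subset by (metis finite_Diff)
  then have cC: "card (S - A - B - C) = card S - a - b - c" using C cB by (simp add: card_Diff_subset)
  obtain D where D: "D \<subseteq> S - A - B - C" "card D = d" by (rule obtain_subset_with_card_n[of d "S - A - B - C"]) (use assms cC in auto)
  have fD: "finite D" using D assms finite_subset by (metis finite_Diff)
  then have cD: "card (S - A - B - C - D) = card S - a - b - c - d" using D cC by (simp add: card_Diff_subset)
  define g where "g s = (if s \<in> A then (1, 0) else if s \<in> B then (- 1, 0) else if s \<in> C then (0, 1)
     else if s \<in> D then (0, - 1) else (0, 0 :: int) :: int \<times> int)" for s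
  have "{s \<in> S. g s = (1, 0)} = A" "{s \<in> S. g s = (- 1, 0)} = B" "{s \<in> S. g s = (0, 1)} = C"
    "{s \<in> S. g s = (0, - 1)} = D" "{s \<in> S. g s = (0, 0)} = S - A - B - C - D"
    using A B C D by (auto simp: g_def)
  then show ?thesis using A B C D cD by (intro that[of g]) (auto simp: g_def)
qed

text \<open>\<open>R B\<close> and \<open>U B\<close> are signed numbers of elements passed from the block \<open>B\<close> to its right and upper
  neighbour.\<close>

lemma realize_flow:
  fixes S :: "int \<times> int \<Rightarrow> 'a set" and R U :: "int \<Rightarrow> int \<Rightarrow> int"
  assumes fin: "\<And>B. finite (S B)" and disj: "\<And>B B'. B \<noteq> B' \<Longrightarrow> S B \<inter> S B' = {}"
    and bound: "\<And>I J. \<bar>R I J\<bar> \<le> K" "\<And>I J. \<bar>U I J\<bar> \<le> K" "\<And>B. 4 * K \<le> int (card (S B))"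
  obtains dest where
    "\<And>I J s. s \<in> S (I, J) \<Longrightarrow> dest s \<in> {I - 1..I + 1} \<times> {J - 1..J + 1}"
    "\<And>I J. finite {s. (\<exists>B. s \<in> S B) \<and> dest s = (I, J)}"
    "\<And>I J. int (card {s. (\<exists>B. s \<in> S B) \<and> dest s = (I, J)}) =
      int (card (S (I, J))) - R I J + R (I - 1) J - U I J + U I (J - 1)"
proof -
  \<comment> \<open>Blocks only ever give: a positive flow is sent by the block itself, a negative
    one is sent back by its neighbour. Each block thus parts with four disjoint portions of at most
    \<open>K\<close> elements, which is why it must hold \<open>4 * K\<close>.\<close>
  define Q where "Q I J g \<longleftrightarrow> (\<forall>s. g s \<in> {(0, 0), (1, 0), (- 1, 0), (0, 1), (0, - 1 :: int) :: int \<times> int}) \<and>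
      int (card {s \<in> S (I, J). g s = (1, 0)}) = max 0 (R I J) \<and>
      int (card {s \<in> S (I, J). g s = (- 1, 0)}) = max 0 (- R (I - 1) J) \<and>
      int (card {s \<in> S (I, J). g s = (0, 1)}) = max 0 (U I J) \<and>
      int (card {s \<in> S (I, J). g s = (0, - 1)}) = max 0 (- U I (J - 1)) \<and>
      int (card {s \<in> S (I, J). g s = (0, 0)}) = int (card (S (I, J))) - max 0 (R I J) - max 0 (- R (I - 1) J)
        - max 0 (U I J) - max 0 (- U I (J - 1))" for I J g
  have "\<exists>g. Q I J g" for I J
  proof -
    define a where "a = nat (max 0 (R I J))"
    define b where "b = nat (max 0 (- R (I - 1) J))"
    define c where "c = nat (max 0 (U I J))"
    define d where "d = nat (max 0 (- U I (J - 1)))"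
    have "int a \<le> K" "int b \<le> K" "int c \<le> K" "int d \<le> K"
      using bound(1)[of I J] bound(1)[of "I - 1" J] bound(2)[of I J] bound(2)[of I "J - 1"]
      by (auto simp: a_def b_def c_def d_def)
    then have le: "a + b + c + d \<le> card (S (I, J))" using bound(3)[of "(I, J)"] by linarith
    obtain g where g: "\<And>s. g s \<in> {(0, 0), (1, 0), (- 1, 0), (0, 1), (0, - 1 :: int) :: int \<times> int}"
      "card {s \<in> S (I, J). g s = (1, 0)} = a" "card {s \<in> S (I, J). g s = (- 1, 0)} = b"
      "card {s \<in> S (I, J). g s = (0, 1)} = c" "card {s \<in> S (I, J). g s = (0, - 1)} = d"
      "card {s \<in> S (I, J). g s = (0, 0)} = card (S (I, J)) - (a + b + c + d)"
      by (rule obtain_split_five[OF fin le]) blast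
    then show ?thesis using le unfolding Q_def by (intro exI[of _ g]) (simp add: a_def b_def c_def d_def of_nat_diff)
  qed
  then obtain g where Q: "\<And>I J. Q I J (g I J)" by metis
  have g: "\<And>I J s. g I J s \<in> {(0, 0), (1, 0), (- 1, 0), (0, 1), (0, - 1 :: int) :: int \<times> int}"
    "\<And>I J. int (card {s \<in> S (I, J). g I J s = (1, 0)}) = max 0 (R I J)"
    "\<And>I J. int (card {s \<in> S (I, J). g I J s = (- 1, 0)}) = max 0 (- R (I - 1) J)"
    "\<And>I J. int (card {s \<in> S (I, J). g I J s = (0, 1)}) = max 0 (U I J)"
    "\<And>I J. int (card {s \<in> S (I, J). g I J s = (0, - 1)}) = max 0 (- U I (J - 1))"
    "\<And>I J. int (card {s \<in> S (I, J). g I J s = (0, 0)}) = int (card (S (I, J))) - max 0 (R I J) - max 0 (- R (I - 1) J)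
        - max 0 (U I J) - max 0 (- U I (J - 1))"
    using Q unfolding Q_def by blast+
  define block where "block s = (THE B. s \<in> S B)" for s
  have block: "block s = B" if "s \<in> S B" for s B
    unfolding block_def using that disj by (intro the_equality) blast+
  define dest where "dest s = (case block s of (I, J) \<Rightarrow> (I, J) + g I J s)" for s
  have dest: "dest s = (I, J) + g I J s" if "s \<in> S (I, J)" for s I J
    using block[OF that] by (simp add: dest_def)
  define P where "P I J x = {s \<in> S (I, J). g I J s = x}" for I J x
  have P: "finite (P I J x)" for I J x using fin by (simp add: P_def)
  have Pd: "P I J x \<inter> P I' J' x' = {}" if "(I, J) \<noteq> (I', J')" for I J I' J' x x'
    using disj[OF that] by (auto simp: P_def)
  have eq: "{s. (\<exists>B. s \<in> S B) \<and> dest s = (I, J)} =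
      P I J (0, 0) \<union> (P (I - 1) J (1, 0) \<union> (P (I + 1) J (- 1, 0) \<union> (P I (J - 1) (0, 1) \<union> P I (J + 1) (0, - 1))))" for I J
  proof (intro set_eqI iffI)
    fix s assume "s \<in> {s. (\<exists>B. s \<in> S B) \<and> dest s = (I, J)}"
    then obtain I' J' where s: "s \<in> S (I', J')" "(I', J') + g I' J' s = (I, J)" using dest by force
    then show "s \<in> P I J (0, 0) \<union> (P (I - 1) J (1, 0) \<union> (P (I + 1) J (- 1, 0) \<union> (P I (J - 1) (0, 1) \<union> P I (J + 1) (0, - 1))))"
      using g(1)[of I' J' s] by (auto simp: P_def)
  qed (auto simp: P_def dest)
  show ?thesis
  proof (rule that)
    show "dest s \<in> {I - 1..I + 1} \<times> {J - 1..J + 1}" if "s \<in> S (I, J)" for s I J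
      using g(1)[of I J s] dest[OF that] by auto
    fix I J
    show "finite {s. (\<exists>B. s \<in> S B) \<and> dest s = (I, J)}" unfolding eq by (simp add: P)
    have "card {s. (\<exists>B. s \<in> S B) \<and> dest s = (I, J)} =
       card (P I J (0, 0)) + (card (P (I - 1) J (1, 0)) + (card (P (I + 1) J (- 1, 0)) + (card (P I (J - 1) (0, 1)) + card (P I (J + 1) (0, - 1)))))"
      unfolding eq by (subst card_Un_disjoint; simp add: P Int_Un_distrib Pd)+
    then have "int (card {s. (\<exists>B. s \<in> S B) \<and> dest s = (I, J)}) =
       int (card (P I J (0, 0))) + int (card (P (I - 1) J (1, 0))) + int (card (P (I + 1) J (- 1, 0))) + int (card (P I (J - 1) (0, 1))) + int (card (P I (J + 1) (0, - 1)))"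
      by simp
    also have "\<dots> = int (card (S (I, J))) - R I J + R (I - 1) J - U I J + U I (J - 1)"
      unfolding P_def g by (simp add: max_def)
    finally show "int (card {s. (\<exists>B. s \<in> S B) \<and> dest s = (I, J)}) =
      int (card (S (I, J))) - R I J + R (I - 1) J - U I J + U I (J - 1)" .
  qed
qed

text \<open>The number of cells of type \<open>t\<close> in a product of \<open>A1\<close> wide and
  \<open>A0\<close> narrow strips with \<open>B1\<close> wide and \<open>B0\<close> narrow ones. It
  is polymorphic so that integer counts can be compared with their real approximations, and bilinear
  so that it makes sense for negative arguments.\<close>

definition Nt :: "nat \<Rightarrow> 'a::comm_ring_1 \<Rightarrow> 'a \<Rightarrow> 'a \<Rightarrow> 'a \<Rightarrow> 'a" where
  "Nt t A1 A0 B1 B0 = (if t = 0 then A0 * B0 else if t = 1 then A1 * B0 + A0 * B1 else A1 * B1)"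

lemma Nt_diff: "Nt t (A1 - C1) (A0 - C0) B1 B0 = Nt t A1 A0 B1 B0 - Nt t C1 C0 B1 B0"
  by (simp add: Nt_def algebra_simps)

lemma of_int_Nt: "of_int (Nt t A1 A0 B1 B0) = Nt t (of_int A1) (of_int A0) (of_int B1) (of_int B0)"
  by (simp add: Nt_def)

text \<open>The mechanical word of slope \<alpha> and intercept 0, coding the rotation by
  \<alpha>.\<close>

definition rotw :: "real \<Rightarrow> int \<Rightarrow> bool" where
  "rotw \<alpha> i \<longleftrightarrow> \<lfloor>real_of_int (i + 1) * \<alpha>\<rfloor> \<noteq> \<lfloor>real_of_int i * \<alpha>\<rfloor>"

lemma rotw_floor:
  assumes "0 < \<alpha>" "\<alpha> < 1"
  shows "\<lfloor>real_of_int (i + 1) * \<alpha>\<rfloor> = \<lfloor>real_of_int i * \<alpha>\<rfloor> + of_bool (rotw \<alpha> i)"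
proof -
  have "real_of_int (i + 1) * \<alpha> = real_of_int i * \<alpha> + \<alpha>" by (simp add: algebra_simps)
  then have "\<lfloor>real_of_int i * \<alpha>\<rfloor> \<le> \<lfloor>real_of_int (i + 1) * \<alpha>\<rfloor>" "\<lfloor>real_of_int (i + 1) * \<alpha>\<rfloor> \<le> \<lfloor>real_of_int i * \<alpha>\<rfloor> + 1"
    using assms by linarith+
  then show ?thesis by (auto simp: rotw_def)
qed

lemma cnt_rotw:
  assumes "0 < \<alpha>" "\<alpha> < 1"
  shows "cnt (rotw \<alpha>) i n = \<lfloor>real_of_int (i + int n) * \<alpha>\<rfloor> - \<lfloor>real_of_int i * \<alpha>\<rfloor>"
proof (induction n)
  case (Suc n)
  have "i + int (Suc n) = i + int n + 1" by simp
  then show ?case using Suc rotw_floor[OF assms, of "i + int n"] by (simp only: cnt_Suc)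
qed simp

text \<open>The type is the number of wide sides: 0, 1, 2 stand for the cells S, M, L.\<close>

definition ctype :: "(int \<Rightarrow> bool) \<Rightarrow> (int \<Rightarrow> bool) \<Rightarrow> int \<times> int \<Rightarrow> nat" where
  "ctype u v = (\<lambda>(i, j). of_bool (u i) + of_bool (v j))"

lemma ctype_le: "ctype u v c \<in> {0, 1, 2}"
  by (auto simp: ctype_def split: prod.splits)

lemma ctype_eq:
  "ctype u v (i, j) = 0 \<longleftrightarrow> \<not> u i \<and> \<not> v j"
  "ctype u v (i, j) = 1 \<longleftrightarrow> u i \<noteq> v j"
  "ctype u v (i, j) = 2 \<longleftrightarrow> u i \<and> v j"
  by (simp_all add: ctype_def)

section \<open>Weights of rectangular blocks\<close>

lemma div_eq_interval:
  fixes h :: int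
  assumes "0 < h"
  shows "{i. i div h = I} = {I * h..<I * h + h}"
proof -
  have "i div h = I \<longleftrightarrow> I * h \<le> i \<and> i < I * h + h" for i
  proof
    assume "i div h = I"
    then show "I * h \<le> i \<and> i < I * h + h"
      using assms div_mult_mod_eq[of i h] pos_mod_bound[OF assms, of i] pos_mod_sign[OF assms, of i] by auto
  next
    assume *: "I * h \<le> i \<and> i < I * h + h"
    have "i = I * h + (i - I * h)" by simp
    then show "i div h = I" using * by (intro int_div_pos_eq[of i h I "i - I * h"]) (auto simp: mult.commute)
  qed
  then show ?thesis by (intro set_eqI) simp
qed

lemma card_block:
  assumes h: "0 < h" and t: "t \<in> {0, 1, 2}"
  defines "ones \<equiv> \<lambda>u I. cnt u (I * h) (nat h)"
  shows "finite {(i, j). i div h = I \<and> j div h = J \<and> ctype u v (i, j) = t}"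
    and "int (card {(i, j). i div h = I \<and> j div h = J \<and> ctype u v (i, j) = t}) =
      Nt t (ones u I) (h - ones u I) (ones v J) (h - ones v J)"
proof -
  define A where "A u I b = {i. i div h = I \<and> u i = b}" for u :: "int \<Rightarrow> bool" and I b
  have fA: "finite (A u I b)" for u I b
  proof (rule finite_subset)
    show "finite {i. i div h = I}" by (simp add: div_eq_interval[OF h])
  qed (auto simp: A_def)
  have "A u I True = {i \<in> {I * h..<I * h + h}. u i}" for u I
    unfolding A_def using div_eq_interval[OF h, of I] by blast
  then have c1: "int (card (A u I True)) = ones u I" for u I
    using cnt_card[of "I * h" "nat h" u] h by (simp add: ones_def)
  have "A u I True \<union> A u I False = {i. i div h = I}" "A u I True \<inter> A u I False = {}" for u I
    by (auto simp: A_def)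
  then have "card (A u I True) + card (A u I False) = nat h" for u I
    using card_Un_disjoint[OF fA fA, of u I True u I False] by (simp add: div_eq_interval[OF h])
  then have c0: "int (card (A u I False)) = h - ones u I" for u I
    using c1[of u I] h by (metis add_diff_cancel_left' int_nat_eq less_imp_le of_nat_add)
  consider "t = 0" | "t = 1" | "t = 2" using t by blast
  then have sp: "{(i, j). i div h = I \<and> j div h = J \<and> ctype u v (i, j) = t} =
     (if t = 0 then A u I False \<times> A v J False else if t = 1 then (A u I True \<times> A v J False) \<union> (A u I False \<times> A v J True)
      else A u I True \<times> A v J True)"
  proof cases
    case 1
    then show ?thesis unfolding A_def by (simp only: ctype_eq) fastforce
  next
    case 2
    have "{(i, j). i div h = I \<and> j div h = J \<and> u i \<noteq> v j} = (A u I True \<times> A v J False) \<union> (A u I False \<times> A v J True)"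
      unfolding A_def by fastforce
    then show ?thesis using 2 by (simp only: ctype_eq) simp
  next
    case 3
    then show ?thesis unfolding A_def by (simp only: ctype_eq) fastforce
  qed
  then show "finite {(i, j). i div h = I \<and> j div h = J \<and> ctype u v (i, j) = t}" using fA by simp
  have d: "(A u I True \<times> A v J False) \<inter> (A u I False \<times> A v J True) = {}" by (auto simp: A_def)
  show "int (card {(i, j). i div h = I \<and> j div h = J \<and> ctype u v (i, j) = t}) =
      Nt t (ones u I) (h - ones u I) (ones v J) (h - ones v J)"
    unfolding sp using fA card_Un_disjoint[OF _ _ d] by (simp add: Nt_def card_cartesian_product c1 c0)
qed

text \<open>The main term is \<open>n * h * h\<close> times the mean weight and vanishes. Of the
  rest only \<open>n * h * \<delta> * \<beta>\<close> grows with \<open>n\<close>; it is the drift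
  caused by the discrepancy \<delta> of the row. The constant \<beta> is half the derivative of the
  mean weight at \<alpha>.\<close>

lemma weighted_block_sum:
  fixes a0 a1 a2 \<alpha> h n \<rho> \<delta> :: real
  assumes "a0 * (1 - \<alpha>)\<^sup>2 + 2 * a1 * \<alpha> * (1 - \<alpha>) + a2 * \<alpha>\<^sup>2 = 0"
  defines "A1 \<equiv> n * h * \<alpha> - \<rho>" and "A0 \<equiv> n * h - (n * h * \<alpha> - \<rho>)"
    and "B1 \<equiv> h * \<alpha> + \<delta>" and "B0 \<equiv> h - (h * \<alpha> + \<delta>)"
    and "\<beta> \<equiv> - a0 * (1 - \<alpha>) + a1 * (1 - 2 * \<alpha>) + a2 * \<alpha>"
  shows "a0 * Nt 0 A1 A0 B1 B0 + a1 * Nt 1 A1 A0 B1 B0 + a2 * Nt 2 A1 A0 B1 B0 =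
    n * h * \<delta> * \<beta> - \<rho> * h * \<beta> - \<rho> * \<delta> * (a0 - 2 * a1 + a2)"
proof -
  have "a0 * Nt 0 A1 A0 B1 B0 + a1 * Nt 1 A1 A0 B1 B0 + a2 * Nt 2 A1 A0 B1 B0 -
    (n * h * \<delta> * \<beta> - \<rho> * h * \<beta> - \<rho> * \<delta> * (a0 - 2 * a1 + a2)) =
    n * h * h * (a0 * (1 - \<alpha>)\<^sup>2 + 2 * a1 * \<alpha> * (1 - \<alpha>) + a2 * \<alpha>\<^sup>2)"
    unfolding A1_def A0_def B1_def B0_def \<beta>_def Nt_def by (simp add: power2_eq_square) (simp add: algebra_simps)
  then show ?thesis using assms(1) by simp
qed

lemma sum_three_types:
  fixes f :: "nat \<Rightarrow> 'a::comm_monoid_add"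
  assumes "{X, Y, Z} = {0, 1, 2}" "X \<noteq> Y" "Y \<noteq> Z" "X \<noteq> Z"
  shows "f X + f Y + f Z = f 0 + f 1 + f 2"
proof -
  have "sum f {X, Y, Z} = f X + (f Y + f Z)" using assms(2-4) by simp
  moreover have "sum f {0, 1, 2} = f 0 + (f 1 + f 2)" by simp
  ultimately show ?thesis using assms(1) by (simp add: add.assoc)
qed

text \<open>Cells are dealt out to blocks of size \<open>h\<close>. In each block the
  \<open>Y\<close> cells join \<open>X\<close> cells in the ratio \<open>w : y\<close>, the
  \<open>Z\<close> cells in the ratio \<open>w : z\<close>, so both parts have weight zero. The
  remainders modulo \<open>w\<close> of the \<open>Y\<close> and \<open>Z\<close> cells are handed
  on along the row, while the surplus of \<open>X\<close> cells travels in both directions.\<close>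

theorem balanced_partition:
  fixes wt :: "nat \<Rightarrow> int" and w y z :: int and \<alpha> :: real
  assumes \<alpha>: "0 < \<alpha>" "\<alpha> < 1"
    and XYZ: "{X, Y, Z} = {0, 1, 2}" "X \<noteq> Y" "Y \<noteq> Z" "X \<noteq> Z"
    and wt: "wt X = - w" "wt Y = y" "wt Z = z" "0 < w" "0 \<le> y" "0 \<le> z"
    and mean: "real_of_int (wt 0) * (1 - \<alpha>)\<^sup>2 + 2 * real_of_int (wt 1) * \<alpha> * (1 - \<alpha>) + real_of_int (wt 2) * \<alpha>\<^sup>2 = 0"
  defines "ty \<equiv> ctype (rotw \<alpha>) (rotw \<alpha>)"
  obtains h :: int and owner :: "int \<times> int \<Rightarrow> (int \<times> int) \<times> bool" where "0 < h"
    "\<And>i j I J b. owner (i, j) = ((I, J), b) \<Longrightarrow> \<bar>i div h - I\<bar> \<le> 1 \<and> \<bar>j div h - J\<bar> \<le> 1"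
    "\<And>B. \<exists>m. int (card {c. owner c = (B, True) \<and> ty c = X}) = y * m \<and>
      int (card {c. owner c = (B, True) \<and> ty c = Y}) = w * m \<and> {c. owner c = (B, True) \<and> ty c = Z} = {}"
    "\<And>B. \<exists>m. int (card {c. owner c = (B, False) \<and> ty c = X}) = z * m \<and>
      int (card {c. owner c = (B, False) \<and> ty c = Z}) = w * m \<and> {c. owner c = (B, False) \<and> ty c = Y} = {}"
proof -
  define S where "S = \<bar>wt 0\<bar> + \<bar>wt 1\<bar> + \<bar>wt 2\<bar>"
  define C where "C = 3 * S + y + z + 1 + w"
  have S0: "0 \<le> S" and C1: "C \<ge> 2" using wt by (auto simp: C_def S_def)
  define \<mu> where "\<mu> = min \<alpha> (1 - \<alpha>)"
  have \<mu>: "0 < \<mu>" "\<mu> \<le> \<alpha>" "\<mu> \<le> 1 - \<alpha>" using \<alpha> by (auto simp: \<mu>_def)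
  \<comment> \<open>Flows are at most \<open>C * h\<close>, whereas a block holds at least
    \<open>(h * \<mu> / 2)\<^sup>2\<close> cells of each type. The second summand makes this at
    least \<open>4 * C * h\<close>; the first ensures that rounding costs no more than half of
    \<open>h * \<mu>\<close>.\<close>
  define h where "h = \<lceil>2 / \<mu>\<rceil> + \<lceil>16 * real_of_int C / \<mu>\<^sup>2\<rceil>"
  have "2 / \<mu> \<le> \<lceil>2 / \<mu>\<rceil>" "16 * real_of_int C / \<mu>\<^sup>2 \<le> \<lceil>16 * real_of_int C / \<mu>\<^sup>2\<rceil>" by linarith+
  moreover have "0 < 2 / \<mu>" "0 < 16 * real_of_int C / \<mu>\<^sup>2" using \<mu> C1 by auto
  ultimately have hr: "2 / \<mu> \<le> real_of_int h" "16 * real_of_int C / \<mu>\<^sup>2 \<le> real_of_int h" "0 < real_of_int h"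
  proof -
    assume *: "2 / \<mu> \<le> \<lceil>2 / \<mu>\<rceil>" "16 * real_of_int C / \<mu>\<^sup>2 \<le> \<lceil>16 * real_of_int C / \<mu>\<^sup>2\<rceil>"
      "0 < 2 / \<mu>" "0 < 16 * real_of_int C / \<mu>\<^sup>2"
    have "real_of_int h = \<lceil>2 / \<mu>\<rceil> + \<lceil>16 * real_of_int C / \<mu>\<^sup>2\<rceil>" by (simp add: h_def)
    then show "2 / \<mu> \<le> real_of_int h" "16 * real_of_int C / \<mu>\<^sup>2 \<le> real_of_int h" "0 < real_of_int h"
      using * by linarith+
  qed
  then have h: "0 < h" by simp
  have h\<mu>: "2 \<le> h * \<mu>" "16 * C \<le> h * \<mu>\<^sup>2" using hr \<mu> by (simp_all add: field_simps)
  define P where "P n = \<lfloor>real_of_int n * (h * \<alpha>)\<rfloor>" for n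
  define p where "p I = P (I + 1) - P I" for I
  \<comment> \<open>The fractional part of \<open>n * h * \<alpha>\<close>. The discrepancies of the
    rows and columns of blocks are differences of consecutive values, hence telescope.\<close>
  define s where "s n = real_of_int n * (h * \<alpha>) - P n" for n
  have s: "0 \<le> s n" "s n < 1" for n unfolding s_def P_def by linarith+
  have pI: "real_of_int (p I) = h * \<alpha> + (s I - s (I + 1))" for I by (simp add: p_def s_def algebra_simps)
  have ones: "cnt (rotw \<alpha>) (I * h) (nat h) = p I" for I
    using h cnt_rotw[OF \<alpha>, of "I * h" "nat h"] by (simp add: p_def P_def algebra_simps)
  define Sb where "Sb t B = {(i, j). i div h = fst B \<and> j div h = snd B \<and> ty (i, j) = t}" for t and B :: "int \<times> int"
  have Sb: "finite (Sb t (I, J))" "int (card (Sb t (I, J))) = Nt t (p I) (h - p I) (p J) (h - p J)"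
    if "t \<in> {0, 1, 2}" for t I J
    using card_block[OF h that, of I J "rotw \<alpha>" "rotw \<alpha>"] by (simp_all add: Sb_def ty_def ones)
  \<comment> \<open>The number of cells of type \<open>t\<close> in the blocks 0 to
    \<open>n - 1\<close> of row \<open>J\<close>, with a sign for negative \<open>n\<close>.\<close>
  define cum where "cum t n J = Nt t (P n) (n * h - P n) (p J) (h - p J)" for t n J
  have card_cum: "int (card (Sb t (I, J))) = cum t (I + 1) J - cum t I J" if "t \<in> {0, 1, 2}" for t I J
    unfolding Sb(2)[OF that] cum_def Nt_diff[symmetric] by (simp add: p_def algebra_simps)
  have XYZ': "X \<in> {0, 1, 2}" "Y \<in> {0, 1, 2}" "Z \<in> {0, 1, 2}" unfolding XYZ(1)[symmetric] by simp_all
  define \<beta> where "\<beta> = - real_of_int (wt 0) * (1 - \<alpha>) + wt 1 * (1 - 2 * \<alpha>) + wt 2 * \<alpha>"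
  have mid: "\<bar>1 - 2 * \<alpha>\<bar> \<le> 1" using \<alpha> by linarith
  have b\<beta>: "\<bar>\<beta>\<bar> \<le> S"
  proof -
    have "\<bar>\<beta>\<bar> \<le> \<bar>real_of_int (wt 0)\<bar> * (1 - \<alpha>) + \<bar>real_of_int (wt 1)\<bar> * \<bar>1 - 2 * \<alpha>\<bar> + \<bar>real_of_int (wt 2)\<bar> * \<alpha>"
    proof -
      have "\<bar>- real_of_int (wt 0) * (1 - \<alpha>)\<bar> = \<bar>real_of_int (wt 0)\<bar> * (1 - \<alpha>)"
        "\<bar>real_of_int (wt 1) * (1 - 2 * \<alpha>)\<bar> = \<bar>real_of_int (wt 1)\<bar> * \<bar>1 - 2 * \<alpha>\<bar>"
        "\<bar>real_of_int (wt 2) * \<alpha>\<bar> = \<bar>real_of_int (wt 2)\<bar> * \<alpha>"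
        using \<alpha> by (simp_all add: abs_mult)
      then show ?thesis unfolding \<beta>_def by linarith
    qed
    also have "\<dots> \<le> \<bar>real_of_int (wt 0)\<bar> * 1 + \<bar>real_of_int (wt 1)\<bar> * 1 + \<bar>real_of_int (wt 2)\<bar> * 1"
      using \<alpha> mid by (intro add_mono mult_left_mono) auto
    finally show ?thesis by (simp add: S_def)
  qed
  \<comment> \<open>Mean number of \<open>X\<close> cells that each block of row \<open>J\<close>
    passes upwards. \<open>U\<close> rounds it so that partial sums along a row stay within rounding
    error of the exact total.\<close>
  define \<theta> where "\<theta> J = h * \<beta> * s (J + 1) / w" for J
  define U where "U I J = \<lfloor>real_of_int (I + 1) * \<theta> J\<rfloor> - \<lfloor>real_of_int I * \<theta> J\<rfloor>" for I J
  \<comment> \<open>The \<open>X\<close> cells among the first \<open>n\<close> blocks of row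
    \<open>J\<close> beyond what their \<open>Y\<close> and \<open>Z\<close> cells need, less the
    net vertical outflow: precisely what must cross to the right.\<close>
  define H where "H n J = cum X n J - y * (cum Y n J div w) - z * (cum Z n J div w)
    - (\<lfloor>real_of_int n * \<theta> J\<rfloor> - \<lfloor>real_of_int n * \<theta> (J - 1)\<rfloor>)" for n J
  define K where "K = C * h"
  have h1: "1 \<le> h" using h by simp
  have boundU: "\<bar>U I J\<bar> \<le> K" for I J
  proof -
    have "\<bar>\<theta> J\<bar> = h * \<bar>\<beta>\<bar> * s (J + 1) / w" using h wt s by (simp add: \<theta>_def abs_mult)
    also have "\<dots> \<le> h * \<bar>\<beta>\<bar> * s (J + 1) / 1" using h wt s by (intro divide_left_mono) auto
    also have "\<dots> = real_of_int h * \<bar>\<beta>\<bar> * s (J + 1)" by simp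
    also have "\<dots> \<le> real_of_int h * real_of_int S * 1"
      using h b\<beta> s[of "J + 1"] S0 by (intro mult_mono mult_nonneg_nonneg) auto
    finally have t: "\<bar>\<theta> J\<bar> \<le> real_of_int (h * S)" by simp
    have "real_of_int (I + 1) * \<theta> J = real_of_int I * \<theta> J + \<theta> J" by (simp add: algebra_simps)
    then have "\<bar>real_of_int (U I J)\<bar> \<le> \<bar>\<theta> J\<bar> + 1" unfolding U_def by linarith
    then have "\<bar>U I J\<bar> \<le> h * S + 1" using t by linarith
    also have "\<dots> \<le> S * h + 1 * h" using h1 by (simp add: mult.commute)
    also have "\<dots> = (S + 1) * h" by (simp add: algebra_simps)
    also have "\<dots> \<le> C * h" using h S0 wt by (intro mult_right_mono) (auto simp: C_def)
    finally show ?thesis by (simp add: K_def)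
  qed
  have boundH: "\<bar>H n J\<bar> \<le> K" for n J
  proof -
    let ?D = "real_of_int (wt 0) - 2 * real_of_int (wt 1) + real_of_int (wt 2)" and ?d = "s J - s (J + 1)"
    have Pn: "real_of_int (P n) = real_of_int n * h * \<alpha> - s n" by (simp add: s_def algebra_simps)
    let ?c = "\<lambda>t. real_of_int (cum t n J)"
    have c: "?c t = Nt t (real_of_int n * h * \<alpha> - s n) (real_of_int n * h - (real_of_int n * h * \<alpha> - s n))
        (h * \<alpha> + ?d) (h - (h * \<alpha> + ?d))" for t
      unfolding cum_def of_int_Nt by (simp add: Pn pI)
    have "wt X * ?c X + wt Y * ?c Y + wt Z * ?c Z = wt 0 * ?c 0 + wt 1 * ?c 1 + wt 2 * ?c 2"
      using sum_three_types[OF XYZ, of "\<lambda>t. wt t * ?c t"] .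
    also have "\<dots> = real_of_int n * h * ?d * \<beta> - s n * h * \<beta> - s n * ?d * ?D"
      unfolding c using weighted_block_sum[OF mean, of "real_of_int n" h "s n" ?d] by (simp add: \<beta>_def)
    finally have F: "- real_of_int w * ?c X + y * ?c Y + z * ?c Z = real_of_int n * h * ?d * \<beta> - s n * h * \<beta> - s n * ?d * ?D"
      by (simp add: wt)
    have wq: "real_of_int w * real_of_int (cum t n J div w) = ?c t - real_of_int (cum t n J mod w)" for t
    proof -
      have "real_of_int (w * (cum t n J div w) + cum t n J mod w) = ?c t" by (simp only: mult_div_mod_eq)
      then show ?thesis by (simp only: of_int_add of_int_mult)
    qed
    define f1 where "f1 = real_of_int n * \<theta> J - \<lfloor>real_of_int n * \<theta> J\<rfloor>"
    define f2 where "f2 = real_of_int n * \<theta> (J - 1) - \<lfloor>real_of_int n * \<theta> (J - 1)\<rfloor>"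
    have f: "0 \<le> f1" "f1 < 1" "0 \<le> f2" "f2 < 1" unfolding f1_def f2_def by linarith+
    \<comment> \<open>The difference of the vertical rates of two neighbouring rows is exactly the
      drift of row \<open>J\<close>, so all terms growing with \<open>n\<close> cancel in
      \<open>H n J\<close>.\<close>
    have st: "w * (\<theta> J - \<theta> (J - 1)) = h * \<beta> * (s (J + 1) - s J)"
      using wt by (simp add: \<theta>_def field_simps)
    have "w * (real_of_int n * \<theta> J - real_of_int n * \<theta> (J - 1)) = real_of_int n * (w * (\<theta> J - \<theta> (J - 1)))"
      by (simp add: algebra_simps)
    also have "\<dots> = - (real_of_int n * h * ?d * \<beta>)" unfolding st by (simp add: algebra_simps)
    finally have th: "w * (real_of_int n * \<theta> J - real_of_int n * \<theta> (J - 1)) = - (real_of_int n * h * ?d * \<beta>)" .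
    have "w * real_of_int (H n J) = w * ?c X - y * (w * real_of_int (cum Y n J div w)) - z * (w * real_of_int (cum Z n J div w))
      - w * (real_of_int n * \<theta> J - f1 - (real_of_int n * \<theta> (J - 1) - f2))"
      unfolding H_def f1_def f2_def by (simp add: algebra_simps)
    also have "\<dots> = - (- real_of_int w * ?c X + y * ?c Y + z * ?c Z) + y * (cum Y n J mod w) + z * (cum Z n J mod w)
      + real_of_int n * h * ?d * \<beta> + w * (f1 - f2)"
    proof -
      have "w * (real_of_int n * \<theta> J - f1 - (real_of_int n * \<theta> (J - 1) - f2)) =
          w * (real_of_int n * \<theta> J - real_of_int n * \<theta> (J - 1)) - w * (f1 - f2)"
        by (simp add: algebra_simps)
      then show ?thesis unfolding wq th by (simp add: algebra_simps)
    qed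
    also have "\<dots> = s n * h * \<beta> + s n * ?d * ?D + y * (cum Y n J mod w) + z * (cum Z n J mod w) + w * (f1 - f2)"
      unfolding F by simp
    finally have eq: "w * real_of_int (H n J) = s n * h * \<beta> + s n * ?d * ?D + y * (cum Y n J mod w) + z * (cum Z n J mod w) + w * (f1 - f2)" .
    have "\<bar>s n * h * \<beta>\<bar> \<le> 1 * real_of_int h * real_of_int S" unfolding abs_mult using s h b\<beta> S0 by (intro mult_mono) (auto simp: less_imp_le)
    moreover have "\<bar>s n * ?d * ?D\<bar> \<le> 1 * 1 * real_of_int (2 * S)"
    proof -
      have "\<bar>?d\<bar> \<le> 1" using s[of J] s[of "J + 1"] by (auto simp: abs_le_iff)
      moreover have "\<bar>?D\<bar> \<le> 2 * S" by (auto simp: S_def abs_if)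
      ultimately show ?thesis unfolding abs_mult using s[of n] by (intro mult_mono mult_nonneg_nonneg) auto
    qed
    moreover have "\<bar>v * real_of_int (cum t n J mod w)\<bar> \<le> real_of_int v * real_of_int w" if "0 \<le> v" for t and v :: int
      unfolding abs_mult using that wt(4) pos_mod_bound[OF wt(4), of "cum t n J"] pos_mod_sign[OF wt(4), of "cum t n J"]
      by (simp add: mult_left_mono)
    note this[OF wt(5), of Y] this[OF wt(6), of Z]
    moreover have "\<bar>w * (f1 - f2)\<bar> \<le> real_of_int w * 1" unfolding abs_mult using f wt(4) by (intro mult_mono) (auto simp: abs_le_iff)
    ultimately have "\<bar>w * real_of_int (H n J)\<bar> \<le> 1 * real_of_int h * real_of_int S + 1 * 1 * real_of_int (2 * S) + real_of_int y * real_of_int w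
        + real_of_int z * real_of_int w + real_of_int w * 1"
      unfolding eq of_int_mult by linarith
    also have "\<dots> \<le> w * real_of_int ((3 * S + y + z + 1) * h)"
    proof -
      have "1 * h * S + 1 * 1 * (2 * S) + y * w + z * w + w * 1 \<le> h * S + 2 * (S * h) + (y * w) * h + (z * w) * h + w * h"
      proof -
        have le: "a \<le> a * h" if "0 \<le> a" for a using mult_left_mono[OF h1 that] by simp
        have "0 \<le> y * w" "0 \<le> z * w" using wt by auto
        then show ?thesis using le[OF S0] le[of "y * w"] le[of "z * w"] le[of w] wt(4)
          unfolding mult_1 mult_1_right by linarith
      qed
      also have "\<dots> = 3 * (h * S) * 1 + w * ((y + z + 1) * h)" by (simp add: algebra_simps)
      also have "\<dots> \<le> 3 * (h * S) * w + w * ((y + z + 1) * h)"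
        using h S0 wt by (intro add_mono mult_left_mono) auto
      also have "\<dots> = w * ((3 * S + y + z + 1) * h)" by (simp add: algebra_simps)
      finally have "real_of_int (1 * h * S + 1 * 1 * (2 * S) + y * w + z * w + w * 1) \<le> real_of_int (w * ((3 * S + y + z + 1) * h))"
        by (simp only: of_int_le_iff)
      then show ?thesis by simp
    qed
    finally have "w * \<bar>H n J\<bar> \<le> w * ((3 * S + y + z + 1) * h)" using wt(4)
      by (simp add: abs_mult flip: of_int_abs of_int_mult)
    then have "\<bar>H n J\<bar> \<le> (3 * S + y + z + 1) * h" using wt(4) by (simp add: mult_le_cancel_left)
    also have "\<dots> \<le> C * h" using h wt by (intro mult_right_mono) (auto simp: C_def)
    finally show ?thesis by (simp add: K_def)
  qed
  have boundm: "\<bar>cum t (I + 1) J mod w\<bar> \<le> K" for t I J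
  proof -
    have "\<bar>cum t (I + 1) J mod w\<bar> \<le> w * 1" using wt(4) pos_mod_bound[OF wt(4)] pos_mod_sign[OF wt(4)] by (simp add: less_imp_le)
    also have "\<dots> \<le> C * h" using h1 wt S0 by (intro mult_mono) (auto simp: C_def)
    finally show ?thesis by (simp add: K_def)
  qed
  have big: "4 * K \<le> int (card (Sb t B))" if "t \<in> {0, 1, 2}" for t B
  proof -
    obtain I J where B: "B = (I, J)" by (cases B)
    have lo: "h * \<mu> / 2 \<le> real_of_int (p I)" "h * \<mu> / 2 \<le> real_of_int (h - p I)" for I
    proof -
      have "h * \<mu> \<le> h * \<alpha>" "h * \<mu> \<le> h * (1 - \<alpha>)" using h \<mu> by (auto intro: mult_left_mono)
      then show "h * \<mu> / 2 \<le> real_of_int (p I)" "h * \<mu> / 2 \<le> real_of_int (h - p I)"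
        using h\<mu>(1) s[of I] s[of "I + 1"] by (auto simp: pI algebra_simps)
    qed
    have pos: "0 \<le> h * \<mu> / 2" using h \<mu> by simp
    have prod: "(h * \<mu> / 2) * (h * \<mu> / 2) \<le> x * y" if "h * \<mu> / 2 \<le> x" "h * \<mu> / 2 \<le> y" for x y
      using that pos by (intro mult_mono) auto
    have "4 * real_of_int K = h * (16 * C) / 4" by (simp add: K_def)
    also have "\<dots> \<le> h * (h * \<mu>\<^sup>2) / 4" using h h\<mu>(2) by simp
    also have "\<dots> = (h * \<mu> / 2) * (h * \<mu> / 2)" by (simp add: power2_eq_square)
    also have "\<dots> \<le> real_of_int (Nt t (p I) (h - p I) (p J) (h - p J))"
    proof -
      have "0 \<le> real_of_int (h - p I) * real_of_int (p J)" using lo[of I] lo[of J] pos by (intro mult_nonneg_nonneg) linarith+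
      then show ?thesis
        using prod[OF lo(2)[of I] lo(2)[of J]] prod[OF lo(1)[of I] lo(2)[of J]] prod[OF lo(1)[of I] lo(1)[of J]]
        unfolding Nt_def by simp
    qed
    finally show ?thesis unfolding B Sb(2)[OF that] by linarith
  qed
  have Sfin: "finite (Sb t B)" if "t \<in> {0, 1, 2}" for t B using Sb(1)[OF that, of "fst B" "snd B"] by simp
  have Sdisj: "Sb t B \<inter> Sb t B' = {}" if "B \<noteq> B'" for t B B' using that by (auto simp: Sb_def prod_eq_iff)
  have all: "(\<exists>B. c \<in> Sb t B) \<longleftrightarrow> ty c = t" for c t by (cases c) (auto simp: Sb_def)
  have dests: "\<exists>dest. (\<forall>i j. ty (i, j) = t \<longrightarrow> dest (i, j) \<in> {i div h - 1..i div h + 1} \<times> {j div h - 1..j div h + 1}) \<and>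
     (\<forall>I J. finite {c. ty c = t \<and> dest c = (I, J)}) \<and>
     (\<forall>I J. int (card {c. ty c = t \<and> dest c = (I, J)}) =
      int (card (Sb t (I, J))) - R I J + R (I - 1) J - V I J + V I (J - 1))"
    if t: "t \<in> {0, 1, 2}" and R: "\<And>I J. \<bar>R I J\<bar> \<le> K" and V: "\<And>I J. \<bar>V I J\<bar> \<le> K" for t R V
  proof -
    obtain dest where d: "\<And>I J s. s \<in> Sb t (I, J) \<Longrightarrow> dest s \<in> {I - 1..I + 1} \<times> {J - 1..J + 1}"
      "\<And>I J. finite {s. (\<exists>B. s \<in> Sb t B) \<and> dest s = (I, J)}"
      "\<And>I J. int (card {s. (\<exists>B. s \<in> Sb t B) \<and> dest s = (I, J)}) =
      int (card (Sb t (I, J))) - R I J + R (I - 1) J - V I J + V I (J - 1)"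
      using realize_flow[of "Sb t" R K V, OF Sfin[OF t] Sdisj R V big[OF t]] by blast
    have "(i, j) \<in> Sb t (i div h, j div h)" if "ty (i, j) = t" for i j using that by (simp add: Sb_def)
    then show ?thesis using d(1) d(2,3)[unfolded all] by (intro exI[of _ dest]) blast
  qed
  obtain dX where dX: "\<And>i j. ty (i, j) = X \<Longrightarrow> dX (i, j) \<in> {i div h - 1..i div h + 1} \<times> {j div h - 1..j div h + 1}"
     "\<And>I J. finite {c. ty c = X \<and> dX c = (I, J)}"
     "\<And>I J. int (card {c. ty c = X \<and> dX c = (I, J)}) = int (card (Sb X (I, J))) - H (I + 1) J + H (I - 1 + 1) J - U I J + U I (J - 1)"
    using dests[OF XYZ'(1), of "\<lambda>I J. H (I + 1) J" U] boundH boundU by blast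
  obtain dY where dY: "\<And>i j. ty (i, j) = Y \<Longrightarrow> dY (i, j) \<in> {i div h - 1..i div h + 1} \<times> {j div h - 1..j div h + 1}"
     "\<And>I J. finite {c. ty c = Y \<and> dY c = (I, J)}"
     "\<And>I J. int (card {c. ty c = Y \<and> dY c = (I, J)}) = int (card (Sb Y (I, J))) - cum Y (I + 1) J mod w + cum Y (I - 1 + 1) J mod w - 0 + 0"
    using dests[OF XYZ'(2), of "\<lambda>I J. cum Y (I + 1) J mod w" "\<lambda>_ _. 0"] boundm C1 h by (auto simp: K_def)
  obtain dZ where dZ: "\<And>i j. ty (i, j) = Z \<Longrightarrow> dZ (i, j) \<in> {i div h - 1..i div h + 1} \<times> {j div h - 1..j div h + 1}"
     "\<And>I J. finite {c. ty c = Z \<and> dZ c = (I, J)}"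
     "\<And>I J. int (card {c. ty c = Z \<and> dZ c = (I, J)}) = int (card (Sb Z (I, J))) - cum Z (I + 1) J mod w + cum Z (I - 1 + 1) J mod w - 0 + 0"
    using dests[OF XYZ'(3), of "\<lambda>I J. cum Z (I + 1) J mod w" "\<lambda>_ _. 0"] boundm C1 h by (auto simp: K_def)
  \<comment> \<open>The number of groups of \<open>w\<close> cells of type \<open>t\<close> left in
    the block after the remainders have been passed on.\<close>
  define m where "m t B = cum t (fst B + 1) (snd B) div w - cum t (fst B) (snd B) div w" for t and B :: "int \<times> int"
  have dm: "cum t n J - cum t n J mod w = w * (cum t n J div w)" for t n J
    by (simp add: minus_mod_eq_mult_div)
  have cY: "int (card {c. ty c = Y \<and> dY c = B}) = w * m Y B" for B
    using dY(3)[of "fst B" "snd B"] card_cum[OF XYZ'(2), of "fst B" "snd B"]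
    unfolding m_def right_diff_distrib dm[symmetric] prod.collapse diff_add_cancel by linarith
  have cZ: "int (card {c. ty c = Z \<and> dZ c = B}) = w * m Z B" for B
    using dZ(3)[of "fst B" "snd B"] card_cum[OF XYZ'(3), of "fst B" "snd B"]
    unfolding m_def right_diff_distrib dm[symmetric] prod.collapse diff_add_cancel by linarith
  have cX: "int (card {c. ty c = X \<and> dX c = B}) = y * m Y B + z * m Z B" for B
    using dX(3)[of "fst B" "snd B"] card_cum[OF XYZ'(1), of "fst B" "snd B"]
    unfolding m_def H_def U_def right_diff_distrib prod.collapse diff_add_cancel by linarith
  have "0 \<le> w * m Y B" "0 \<le> w * m Z B" for B using cY[of B] cZ[of B] by (metis of_nat_0_le_iff)+
  then have m0: "0 \<le> m Y B" "0 \<le> m Z B" for B using wt(4) by (auto simp: zero_le_mult_iff)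
  \<comment> \<open>The \<open>X\<close> cells of a block are exactly as many as the two tiles need
    together; any subset of the right size serves the first tile.\<close>
  have "\<exists>A. A \<subseteq> {c. ty c = X \<and> dX c = B} \<and> int (card A) = y * m Y B" for B
  proof -
    have "nat (y * m Y B) \<le> card {c. ty c = X \<and> dX c = B}" using cX[of B] m0[of B] wt by (simp add: nat_le_iff)
    then obtain A where "A \<subseteq> {c. ty c = X \<and> dX c = B}" "card A = nat (y * m Y B)" by (rule obtain_subset_with_card_n)
    then show ?thesis using m0[of B] wt by (intro exI[of _ A]) simp
  qed
  then obtain A where A: "\<And>B. A B \<subseteq> {c. ty c = X \<and> dX c = B}" "\<And>B. int (card (A B)) = y * m Y B" by metis
  define owner where "owner c = (if ty c = Y then (dY c, True) else if ty c = Z then (dZ c, False) else (dX c, c \<in> A (dX c)))" for c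
  have tyX: "ty c = X \<or> ty c = Y \<or> ty c = Z" for c using ctype_le[of "rotw \<alpha>" "rotw \<alpha>" c] XYZ(1) unfolding ty_def by blast
  have oXT: "{c. owner c = (B, True) \<and> ty c = X} = A B" for B using A(1)[of B] XYZ by (auto simp: owner_def)
  have oXF: "{c. owner c = (B, False) \<and> ty c = X} = {c. ty c = X \<and> dX c = B} - A B" for B using A(1)[of B] XYZ by (auto simp: owner_def)
  have fX: "finite {c. ty c = X \<and> dX c = B}" for B using dX(2)[of "fst B" "snd B"] by simp
  show ?thesis
  proof (rule that[OF h])
    show "\<bar>i div h - I\<bar> \<le> 1 \<and> \<bar>j div h - J\<bar> \<le> 1" if "owner (i, j) = ((I, J), b)" for i j I J b
      using that tyX[of "(i, j)"] dX(1)[of i j] dY(1)[of i j] dZ(1)[of i j]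
      by (auto simp: owner_def abs_le_iff split: if_splits)
    fix B
    have "{c. owner c = (B, True) \<and> ty c = Y} = {c. ty c = Y \<and> dY c = B}" by (auto simp: owner_def)
    moreover have "{c. owner c = (B, True) \<and> ty c = Z} = {}" using XYZ by (auto simp: owner_def)
    ultimately show "\<exists>m. int (card {c. owner c = (B, True) \<and> ty c = X}) = y * m \<and>
      int (card {c. owner c = (B, True) \<and> ty c = Y}) = w * m \<and> {c. owner c = (B, True) \<and> ty c = Z} = {}"
      using A(2) cY oXT by (intro exI[of _ "m Y B"]) simp
    have "card ({c. ty c = X \<and> dX c = B} - A B) + card (A B) = card {c. ty c = X \<and> dX c = B}"
      using card_Diff_subset[OF finite_subset[OF A(1) fX] A(1)] card_mono[OF fX A(1)] by simp
    then have "int (card ({c. ty c = X \<and> dX c = B} - A B)) = z * m Z B" using A(2)[of B] cX[of B] by linarith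
    moreover have "{c. owner c = (B, False) \<and> ty c = Z} = {c. ty c = Z \<and> dZ c = B}" using XYZ by (auto simp: owner_def)
    moreover have "{c. owner c = (B, False) \<and> ty c = Y} = {}" by (auto simp: owner_def)
    ultimately show "\<exists>m. int (card {c. owner c = (B, False) \<and> ty c = X}) = z * m \<and>
      int (card {c. owner c = (B, False) \<and> ty c = Z}) = w * m \<and> {c. owner c = (B, False) \<and> ty c = Y} = {}"
      using cZ oXF by (intro exI[of _ "m Z B"]) simp
  qed
qed

section \<open>Geometry of cells and lattices\<close>

text \<open>Unit normals of the two edge directions of a cell, at 120 degrees in either orientation,
  so that reflected copies are covered. The bars of the cell have the normal
  \<open>n + m\<close>.\<close>

definition frame :: "complex \<Rightarrow> complex \<Rightarrow> bool" where
  "frame n m \<longleftrightarrow> n \<bullet> n = 1 \<and> m \<bullet> m = 1 \<and> n \<bullet> m = - 1 / 2"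

lemma frame_sym: "frame n m \<Longrightarrow> frame m n" by (simp add: frame_def inner_commute)

lemma frame_uminus: "frame n m \<Longrightarrow> frame (- n) (- m)" by (simp add: frame_def)

lemma frame_rotate: "frame n m \<Longrightarrow> frame m (- n - m)"
  by (simp add: frame_def inner_diff_left inner_diff_right inner_commute)

text \<open>The point with heights \<open>X\<close> and \<open>Y\<close> over the two normals; the
  coefficients are those of the inverse of the Gram matrix of the frame.\<close>

definition pt :: "complex \<Rightarrow> complex \<Rightarrow> real \<Rightarrow> real \<Rightarrow> complex" where
  "pt n m X Y = (4 / 3 * (X + Y / 2)) *\<^sub>R n + (4 / 3 * (Y + X / 2)) *\<^sub>R m"

lemma inner_pt:
  assumes "frame n m"
  shows "n \<bullet> pt n m X Y = X" "m \<bullet> pt n m X Y = Y"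
proof -
  have h: "n \<bullet> n = 1" "m \<bullet> m = 1" "n \<bullet> m = - 1 / 2" "m \<bullet> n = - 1 / 2"
    using assms by (simp_all add: frame_def inner_commute)
  show "n \<bullet> pt n m X Y = X" "m \<bullet> pt n m X Y = Y"
    by (simp_all only: pt_def inner_add_right inner_scaleR_right h) (simp_all add: field_simps)
qed

lemma frame_eqI:
  assumes "frame n m" "n \<bullet> p = n \<bullet> q" "m \<bullet> p = m \<bullet> q"
  shows "p = q"
proof -
  let ?d = "Re n * Im m - Im n * Re m"
  have "?d\<^sup>2 = (n \<bullet> n) * (m \<bullet> m) - (n \<bullet> m)\<^sup>2"
    by (simp add: inner_complex_def power2_eq_square algebra_simps)
  also have "\<dots> = 3 / 4" using assms(1) by (simp add: frame_def power2_eq_square)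
  finally have d: "?d \<noteq> 0" by auto
  have e: "n \<bullet> (p - q) = 0" "m \<bullet> (p - q) = 0" using assms(2,3) by (simp_all add: inner_diff_right)
  have "?d * Re (p - q) = Im m * (n \<bullet> (p - q)) - Im n * (m \<bullet> (p - q))"
    "?d * Im (p - q) = Re n * (m \<bullet> (p - q)) - Re m * (n \<bullet> (p - q))"
    by (simp_all add: inner_complex_def algebra_simps)
  then have "?d * Re (p - q) = 0" "?d * Im (p - q) = 0" by (simp_all only: e)
  then show ?thesis using d by (simp add: complex_eq_iff)
qed

lemma pt_inner: "frame n m \<Longrightarrow> pt n m (n \<bullet> p) (m \<bullet> p) = p"
  by (rule frame_eqI) (auto simp: inner_pt)

lemma frame_norm:
  assumes "frame n m"
  shows "p \<bullet> p = 4 / 3 * ((n \<bullet> p)\<^sup>2 + (n \<bullet> p) * (m \<bullet> p) + (m \<bullet> p)\<^sup>2)"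
proof -
  let ?X = "n \<bullet> p" and ?Y = "m \<bullet> p"
  have "p \<bullet> p = pt n m ?X ?Y \<bullet> pt n m ?X ?Y" using pt_inner[OF assms] by simp
  also have "\<dots> = 4 / 3 * (?X\<^sup>2 + ?X * ?Y + ?Y\<^sup>2)"
  proof -
    have h: "n \<bullet> n = 1" "m \<bullet> m = 1" "n \<bullet> m = - 1 / 2" "m \<bullet> n = - 1 / 2"
      using assms by (simp_all add: frame_def inner_commute)
    have "pt n m X Y \<bullet> pt n m X Y = 4 / 3 * (X\<^sup>2 + X * Y + Y\<^sup>2)" for X Y
      by (simp only: pt_def inner_add_left inner_add_right inner_scaleR_left inner_scaleR_right h)
        (simp add: power2_eq_square field_simps)
    then show ?thesis .
  qed
  finally show ?thesis .
qed

text \<open>The bar normal splits into two unit vectors at 120 degrees in only one way up to order: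
  the height of \<open>n'\<close> over \<open>n\<close> solves a quadratic equation with roots 1 and
  - 1 / 2. Hence the bar direction determines the edge directions.\<close>

lemma frame_unique:
  assumes "frame n m" "frame n' m'" "n + m = n' + m'"
  shows "n' = n \<and> m' = m \<or> n' = m \<and> m' = n"
proof -
  let ?X = "n \<bullet> n'" and ?Y = "m \<bullet> n'"
  have "?X + ?Y = n' \<bullet> n' + m' \<bullet> n'" using assms(3) by (metis inner_add_left)
  then have s: "?X + ?Y = 1 / 2" using assms(2) by (simp add: frame_def inner_commute)
  have "1 = 4 / 3 * (?X\<^sup>2 + ?X * ?Y + ?Y\<^sup>2)" using frame_norm[OF assms(1), of n'] assms(2) by (simp add: frame_def)
  moreover have "?Y = 1 / 2 - ?X" using s by simp
  ultimately have "(?X - 1) * (?X + 1 / 2) = 0" by (simp add: power2_eq_square field_simps)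
  then consider "?X = 1" | "?X = - 1 / 2" by auto
  then show ?thesis
  proof cases
    case 1
    then have "n' = n" using assms(1) s by (intro frame_eqI[OF assms(1)]) (auto simp: frame_def inner_commute)
    then show ?thesis using assms(3) by simp
  next
    case 2
    then have "n' = m" using assms(1) s by (intro frame_eqI[OF assms(1)]) (auto simp: frame_def inner_commute)
    then show ?thesis using assms(3) by simp
  qed
qed

text \<open>Parametrized by a corner and two widths, because isometries change the corner and keep
  the widths.\<close>

definition reg :: "complex \<Rightarrow> complex \<Rightarrow> real \<Rightarrow> real \<Rightarrow> real \<Rightarrow> real \<Rightarrow> complex set" where
  "reg n m x e y e' = {p. x \<le> n \<bullet> p \<and> n \<bullet> p \<le> x + e \<and> y \<le> m \<bullet> p \<and> m \<bullet> p \<le> y + e'}"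

lemma reg_halfspaces:
  "reg n m x e y e' = {p. n \<bullet> p \<ge> x} \<inter> {p. n \<bullet> p \<le> x + e} \<inter> ({p. m \<bullet> p \<ge> y} \<inter> {p. m \<bullet> p \<le> y + e'})"
  by (auto simp: reg_def)

lemma closed_reg: "closed (reg n m x e y e')"
  unfolding reg_halfspaces by (intro closed_Int closed_halfspace_le closed_halfspace_ge)

lemma convex_reg: "convex (reg n m x e y e')"
  unfolding reg_halfspaces by (intro convex_Int convex_halfspace_le convex_halfspace_ge)

lemma frame_nonzero: "frame n m \<Longrightarrow> n \<noteq> 0 \<and> m \<noteq> 0" by (auto simp: frame_def)

lemma interior_reg:
  assumes "frame n m"
  shows "interior (reg n m x e y e') = {p. x < n \<bullet> p \<and> n \<bullet> p < x + e \<and> y < m \<bullet> p \<and> m \<bullet> p < y + e'}"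
  unfolding reg_halfspaces using frame_nonzero[OF assms] by auto

lemma frontier_reg:
  assumes "frame n m"
  shows "frontier (reg n m x e y e') = {p \<in> reg n m x e y e'. n \<bullet> p \<in> {x, x + e} \<or> m \<bullet> p \<in> {y, y + e'}}"
  unfolding frontier_def interior_reg[OF assms] closure_closed[OF closed_reg] by (auto simp: reg_def)

lemma bounded_reg:
  assumes "frame n m"
  shows "bounded (reg n m x e y e')"
proof (rule boundedI)
  fix p assume p: "p \<in> reg n m x e y e'"
  define A where "A = \<bar>x\<bar> + \<bar>e\<bar>"
  define B where "B = \<bar>y\<bar> + \<bar>e'\<bar>"
  have h: "- A \<le> n \<bullet> p" "n \<bullet> p \<le> A" "- B \<le> m \<bullet> p" "m \<bullet> p \<le> B" "0 \<le> A" "0 \<le> B"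
    using p by (auto simp: reg_def A_def B_def)
  then have "\<bar>4 / 3 * (n \<bullet> p + m \<bullet> p / 2)\<bar> \<le> 2 * A + 2 * B \<and> \<bar>4 / 3 * (m \<bullet> p + n \<bullet> p / 2)\<bar> \<le> 2 * A + 2 * B"
    unfolding abs_le_iff distrib_left by (intro conjI) (use h in \<open>simp add: field_simps\<close>)+
  moreover have "norm p \<le> norm ((4 / 3 * (n \<bullet> p + m \<bullet> p / 2)) *\<^sub>R n) + norm ((4 / 3 * (m \<bullet> p + n \<bullet> p / 2)) *\<^sub>R m)"
    using pt_inner[OF assms, of p] norm_triangle_ineq unfolding pt_def by metis
  moreover have "norm n = 1" "norm m = 1" using assms by (simp_all add: frame_def norm_eq_sqrt_inner)
  ultimately show "norm p \<le> 4 * (\<bar>x\<bar> + \<bar>e\<bar>) + 4 * (\<bar>y\<bar> + \<bar>e'\<bar>)"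
    unfolding norm_scaleR A_def B_def by simp
qed

lemma compact_reg: "frame n m \<Longrightarrow> compact (reg n m x e y e')"
  by (simp add: compact_eq_bounded_closed bounded_reg closed_reg)

lemma closure_interior_reg:
  assumes "frame n m" "0 < e" "0 < e'"
  shows "closure (interior (reg n m x e y e')) = reg n m x e y e'"
proof -
  have "pt n m (x + e / 2) (y + e' / 2) \<in> interior (reg n m x e y e')"
    using assms by (simp add: interior_reg inner_pt)
  then have "closure (interior (reg n m x e y e')) = closure (reg n m x e y e')"
    by (intro convex_closure_interior convex_reg) auto
  then show ?thesis by (simp add: closure_closed closed_reg)
qed

text \<open>The quadratic form of \<open>frame_norm\<close> has a positive mixed term, so the
  diagonal along which both heights grow is the longest; it is the diameter.\<close>

lemma reg_dist_max:
  assumes "frame n m" "0 \<le> e" "0 \<le> e'"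
  shows "\<exists>p\<in>reg n m x e y e'. \<exists>q\<in>reg n m x e y e'. (dist p q)\<^sup>2 = 4 / 3 * (e\<^sup>2 + e * e' + e'\<^sup>2)"
    and "\<And>p q. p \<in> reg n m x e y e' \<Longrightarrow> q \<in> reg n m x e y e' \<Longrightarrow> (dist p q)\<^sup>2 \<le> 4 / 3 * (e\<^sup>2 + e * e' + e'\<^sup>2)"
proof -
  have d: "(dist p q)\<^sup>2 = 4 / 3 * ((n \<bullet> p - n \<bullet> q)\<^sup>2 + (n \<bullet> p - n \<bullet> q) * (m \<bullet> p - m \<bullet> q) + (m \<bullet> p - m \<bullet> q)\<^sup>2)" for p q
    using frame_norm[OF assms(1), of "p - q"] by (simp add: dist_norm power2_norm_eq_inner inner_diff_right)
  show "\<exists>p\<in>reg n m x e y e'. \<exists>q\<in>reg n m x e y e'. (dist p q)\<^sup>2 = 4 / 3 * (e\<^sup>2 + e * e' + e'\<^sup>2)"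
  proof (intro bexI)
    show "(dist (pt n m (x + e) (y + e')) (pt n m x y))\<^sup>2 = 4 / 3 * (e\<^sup>2 + e * e' + e'\<^sup>2)"
      unfolding d inner_pt[OF assms(1)] by simp
  qed (use assms in \<open>auto simp: reg_def inner_pt\<close>)
  fix p q assume pq: "p \<in> reg n m x e y e'" "q \<in> reg n m x e y e'"
  define a where "a = \<bar>n \<bullet> p - n \<bullet> q\<bar>"
  define b where "b = \<bar>m \<bullet> p - m \<bullet> q\<bar>"
  have ab: "0 \<le> a" "a \<le> e" "0 \<le> b" "b \<le> e'" using pq by (auto simp: reg_def a_def b_def)
  have "(n \<bullet> p - n \<bullet> q) * (m \<bullet> p - m \<bullet> q) \<le> a * b"
    unfolding a_def b_def by (metis abs_ge_self abs_mult)
  then have "(dist p q)\<^sup>2 \<le> 4 / 3 * (a\<^sup>2 + a * b + b\<^sup>2)" unfolding d a_def b_def by simp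
  also have "\<dots> \<le> 4 / 3 * (e\<^sup>2 + e * e' + e'\<^sup>2)"
    using ab by (intro mult_left_mono add_mono power_mono mult_mono) auto
  finally show "(dist p q)\<^sup>2 \<le> 4 / 3 * (e\<^sup>2 + e * e' + e'\<^sup>2)" .
qed

section \<open>Isometries of the plane\<close>

lemma isometry_decompose:
  assumes "isometry g"
  obtains f where "linear f" "\<And>x y. f x \<bullet> f y = x \<bullet> y" "surj f" "\<And>p. g p = f p + g 0"
proof -
  define f where "f p = g p - g 0" for p
  have f0: "f 0 = 0" and fd: "\<forall>x y. dist (f x) (f y) = dist x y"
    using assms by (auto simp: f_def isometry_def dist_norm)
  have ot: "orthogonal_transformation f"
    unfolding orthogonal_transformation_isometry using f0 fd by blast
  show ?thesis
  proof (rule that)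
    show "linear f" using ot by (rule orthogonal_transformation_linear)
    show "f x \<bullet> f y = x \<bullet> y" for x y using ot by (simp add: orthogonal_transformation_def)
    show "surj f" using ot by (rule orthogonal_transformation_surj)
  qed (simp add: f_def)
qed

lemma isometry_id: "isometry (\<lambda>x. x)" by (simp add: isometry_def)

lemma isometry_bij:
  assumes "isometry g"
  shows "bij g"
proof -
  obtain f where f: "linear f" "\<And>x y. f x \<bullet> f y = x \<bullet> y" "surj f" "\<And>p. g p = f p + g 0"
    using isometry_decompose[OF assms] by metis
  have "inj g" using assms by (intro injI) (metis isometry_def dist_eq_0_iff)
  moreover have "g (inv f (y - g 0)) = y" for y
    using f(3) f(4)[of "inv f (y - g 0)"] by (simp add: surj_f_inv_f)
  then have "surj g" by (rule surjI)
  ultimately show ?thesis by (simp add: bij_def)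
qed

lemma isometry_inv:
  assumes "isometry g"
  shows "isometry (inv g)"
  using isometry_bij[OF assms] assms unfolding isometry_def by (metis bij_is_surj surj_f_inv_f)

lemma infdist_hyperplane:
  fixes n :: complex
  assumes "n \<bullet> n = 1"
  shows "infdist p {q. n \<bullet> q = u} = \<bar>n \<bullet> p - u\<bar>"
proof -
  let ?H = "{q. n \<bullet> q = u}"
  let ?q = "p - (n \<bullet> p - u) *\<^sub>R n"
  have q: "?q \<in> ?H" using assms by (simp add: inner_diff_right)
  have "norm n = 1" using assms by (simp add: norm_eq_sqrt_inner)
  then have dq: "dist p ?q = \<bar>n \<bullet> p - u\<bar>" by (simp add: dist_norm)
  have "\<bar>n \<bullet> p - u\<bar> \<le> (INF r\<in>?H. dist p r)"
  proof (rule cINF_greatest)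
    show "?H \<noteq> {}" using q by blast
    fix r assume "r \<in> ?H"
    have "\<bar>n \<bullet> (p - r)\<bar> \<le> norm n * norm (p - r)" by (rule Cauchy_Schwarz_ineq2)
    then show "\<bar>n \<bullet> p - u\<bar> \<le> dist p r"
      using \<open>norm n = 1\<close> \<open>r \<in> ?H\<close> by (simp add: dist_norm inner_diff_right)
  qed
  also have "\<dots> = infdist p ?H" using q by (auto simp: infdist_def)
  finally have "\<bar>n \<bullet> p - u\<bar> \<le> infdist p ?H" .
  moreover have "infdist p ?H \<le> \<bar>n \<bullet> p - u\<bar>" using infdist_le[OF q, of p] unfolding dq .
  ultimately show ?thesis by simp
qed

section \<open>The three bar directions\<close>

definition nrm :: "nat \<Rightarrow> complex" where
  "nrm m = \<i> * cis (2 * pi * real m / 3)"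

lemma nrm_values: "nrm 0 = Complex 0 1" "nrm 1 = Complex (- sqrt 3 / 2) (- 1 / 2)" "nrm 2 = Complex (sqrt 3 / 2) (- 1 / 2)"
proof -
  have c: "cos (2 * pi / 3) = - 1 / 2" "sin (2 * pi / 3) = sqrt 3 / 2" by (simp_all add: cos_120 sin_120)
  have "4 * pi / 3 = pi / 3 + pi" by simp
  then have d: "cos (4 * pi / 3) = - 1 / 2" "sin (4 * pi / 3) = - sqrt 3 / 2"
    by (simp_all only: cos_periodic_pi sin_periodic_pi) (simp_all add: cos_60 sin_60)
  show "nrm 0 = Complex 0 1" "nrm 1 = Complex (- sqrt 3 / 2) (- 1 / 2)" "nrm 2 = Complex (sqrt 3 / 2) (- 1 / 2)"
    using c d by (simp_all add: nrm_def complex_eq_iff)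
qed

lemma frame_nrm: "frame (nrm 0) (nrm 1)" "nrm 2 = - nrm 0 - nrm 1"
  by (simp_all del: One_nat_def add: nrm_values frame_def inner_complex_def complex_eq_iff power2_eq_square[symmetric] power_divide)

lemma height_nrm: "height m p = nrm m \<bullet> p"
  by (simp add: height_def nrm_def inner_commute)

lemma bar_nrm: "bar m t = {p. nrm m \<bullet> p = t}"
  by (simp add: bar_def height_nrm)

lemma frame_lines_Int:
  assumes "frame n m"
  shows "{p. n \<bullet> p = s} \<inter> {p. m \<bullet> p = t} = {pt n m s t}"
  using assms by (auto simp: inner_pt intro: frame_eqI)

text \<open>The three unit normals add up to zero, so the intersection of two of the lines has
  height minus the sum of theirs over the third normal, and its distance to the third line is
  \<bar>s + t + u\<bar> for every choice.\<close>

lemma triangle_of_height_iff: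
  "triangle_of_height (1 / 2) (bar 0 s) (bar 1 t) (bar 2 u) \<longleftrightarrow> \<bar>s + t + u\<bar> = 1 / 2"
proof -
  let ?n = "nrm 0" and ?m = "nrm 1" and ?k = "nrm 2"
  have f: "frame ?n ?m" "frame ?m ?k" "frame ?k ?n"
    using frame_nrm frame_rotate[of ?n ?m] frame_rotate[of ?m "- ?n - ?m"] by auto
  have sum: "?n \<bullet> p + ?m \<bullet> p + ?k \<bullet> p = 0" for p by (simp add: frame_nrm(2) inner_diff_left)
  have unit: "?n \<bullet> ?n = 1" "?m \<bullet> ?m = 1" "?k \<bullet> ?k = 1" using f by (auto simp: frame_def)
  note pp = inner_pt[OF f(1), of s t] inner_pt[OF f(2), of t u] inner_pt[OF f(3), of u s]
  have "?k \<bullet> pt ?n ?m s t = - s - t" "?n \<bullet> pt ?m ?k t u = - t - u" "?m \<bullet> pt ?k ?n u s = - u - s"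
    using sum[of "pt ?n ?m s t"] sum[of "pt ?m ?k t u"] sum[of "pt ?k ?n u s"] pp by linarith+
  then have "infdist (pt ?n ?m s t) (bar 2 u) = \<bar>s + t + u\<bar>" "infdist (pt ?m ?k t u) (bar 0 s) = \<bar>s + t + u\<bar>"
    "infdist (pt ?k ?n u s) (bar 1 t) = \<bar>s + t + u\<bar>"
    by (auto simp del: One_nat_def simp add: bar_nrm infdist_hyperplane unit)
  moreover have "bar 0 s \<inter> bar 1 t = {pt ?n ?m s t}" "bar 1 t \<inter> bar 2 u = {pt ?m ?k t u}" "bar 2 u \<inter> bar 0 s = {pt ?k ?n u s}"
    unfolding bar_nrm using f by (simp_all add: frame_lines_Int)
  ultimately show ?thesis unfolding triangle_of_height_def by auto
qed

text \<open>The narrow gap is fixed to 2 from here on: gaps of 2 or 3 dominate the offsets 1 / 2,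
  which separates the bars of a cell from each other and from its corners.\<close>

lemma two_color_lattice_2_iff:
  "two_color_lattice 2 a b c \<longleftrightarrow> (\<forall>i j k. i + j + k = 0 \<longrightarrow> \<bar>a i + b j + c k\<bar> = 1 / 2) \<and>
     (\<forall>f\<in>{a, b, c}. \<forall>i. f (i + 1) - f i \<in> {2, 3})"
  unfolding two_color_lattice_def sturmian_lattice_def triangle_of_height_iff by simp

section \<open>Cells in coordinates\<close>

abbreviation move_cell :: "(complex \<Rightarrow> complex) \<Rightarrow> cell \<Rightarrow> cell" where
  "move_cell g \<equiv> \<lambda>(R, B). (g ` R, g ` B)"

text \<open>A description of a cell that forgets the lattice it was cut from. The levels
  \<open>k0\<close>, \<open>k1\<close>, \<open>k2\<close> of the bars over \<open>n + m\<close> lie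
  within 1 / 2 of the lowest corner, of both middle corners and of the highest corner. The outer two
  may miss the cell, but are kept so that the pattern is uniform.\<close>

definition cell_rep :: "complex \<Rightarrow> complex \<Rightarrow> real \<Rightarrow> real \<Rightarrow> real \<Rightarrow> real \<Rightarrow> real \<Rightarrow> real \<Rightarrow> real \<Rightarrow> cell \<Rightarrow> bool" where
  "cell_rep n m x e y e' k0 k1 k2 C \<longleftrightarrow> frame n m \<and> e \<in> {2, 3} \<and> e' \<in> {2, 3} \<and>
     \<bar>k0 - (x + y)\<bar> = 1 / 2 \<and> \<bar>k1 - (x + e + y)\<bar> = 1 / 2 \<and> \<bar>k1 - (x + y + e')\<bar> = 1 / 2 \<and>
     \<bar>k2 - (x + e + y + e')\<bar> = 1 / 2 \<and> k1 - k0 \<in> {2, 3} \<and> k2 - k1 \<in> {2, 3} \<and>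
     C = (reg n m x e y e', {p \<in> reg n m x e y e'. (n + m) \<bullet> p \<in> {k0, k1, k2}})"

text \<open>Regions and bars are both defined through heights, so moving them amounts to turning the
  normals and shifting the heights.\<close>

lemma isometry_image_Collect:
  assumes "linear f" "\<And>x y. f x \<bullet> f y = x \<bullet> y" "surj f" "\<And>p. g p = f p + g 0"
  shows "g ` {p. P (n \<bullet> p) (m \<bullet> p)} = {q. P (f n \<bullet> q - f n \<bullet> g 0) (f m \<bullet> q - f m \<bullet> g 0)}"
proof -
  have e: "f l \<bullet> g p - f l \<bullet> g 0 = l \<bullet> p" for l p
    using assms(4)[of p] assms(2)[of l p] by (simp add: inner_add_right)
  have "\<exists>p. q = g p" for q
  proof -
    obtain p where "f p = q - g 0" using assms(3) by (metis surjD)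
    then have "q = g p" using assms(4)[of p] by simp
    then show ?thesis by blast
  qed
  then show ?thesis using e by (auto; metis image_eqI mem_Collect_eq)
qed

lemma lattice_gaps:
  assumes "\<And>i. f (i + 1) - f i \<in> {2, 3::real}"
  shows "i \<le> j \<Longrightarrow> f i + 2 * (real_of_int (j - i)) \<le> f j"
proof (induction j rule: int_ge_induct)
  case (step j)
  then show ?case using assms[of j] by auto
qed simp

text \<open>Only three bars can touch a cell: the outer two listed are within 1 / 2 of its extreme
  corners and any further bar is at least 2 beyond. Signs are reversed because the third normal is
  minus the sum of the first two.\<close>

lemma lattice_cell_rep:
  assumes lat: "two_color_lattice 2 a b c"
  shows "cell_rep (nrm 0) (nrm 1) (a i) (a (i + 1) - a i) (b j) (b (j + 1) - b j)
     (- c (- i - j)) (- c (- i - j - 1)) (- c (- i - j - 2)) (lattice_cell a b c (i, j))"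
proof -
  have h: "\<bar>a i + b j + c k\<bar> = 1 / 2" if "i + j + k = 0" for i j k
    using lat that unfolding two_color_lattice_2_iff by blast
  have ga: "a (i + 1) - a i \<in> {2, 3}" and gb: "b (j + 1) - b j \<in> {2, 3}" and gc: "c (k + 1) - c k \<in> {2, 3}" for i j k
    using lat unfolding two_color_lattice_2_iff by auto
  let ?R = "reg (nrm 0) (nrm 1) (a i) (a (i + 1) - a i) (b j) (b (j + 1) - b j)"
  have R: "lattice_region a b (i, j) = ?R"
    by (simp add: lattice_region_def reg_def height_nrm)
  have "h2p": "nrm 2 \<bullet> p = - ((nrm 0 + nrm 1) \<bullet> p)" for p by (simp add: frame_nrm(2) inner_diff_left inner_add_left)
  have B: "?R \<inter> (\<Union>k. bar 2 (c k)) = {p \<in> ?R. (nrm 0 + nrm 1) \<bullet> p \<in> {- c (- i - j), - c (- i - j - 1), - c (- i - j - 2)}}"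
    (is "?L = ?S")
  proof
    show "?S \<subseteq> ?L" by (auto simp: bar_nrm h2p)
    show "?L \<subseteq> ?S"
    proof
      fix p assume "p \<in> ?L"
      then obtain k where k: "p \<in> ?R" "nrm 2 \<bullet> p = c k" by (auto simp: bar_nrm)
      then have p: "p \<in> ?R" "(nrm 0 + nrm 1) \<bullet> p = - c k" using h2p[of p] by simp_all
      then have s: "a i + b j \<le> - c k" "- c k \<le> a (i + 1) + b (j + 1)"
        by (auto simp: reg_def inner_add_left)
      have "k \<le> - i - j"
      proof (rule ccontr)
        assume "\<not> k \<le> - i - j"
        then have "c (- i - j) + 2 * real_of_int (k - (- i - j)) \<le> c k" using lattice_gaps[of c "- i - j" k, OF gc] by simp
        moreover have "real_of_int (k - (- i - j)) \<ge> 1" using \<open>\<not> k \<le> - i - j\<close> by linarith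
        ultimately show False using h[of i j "- i - j"] s by (simp add: abs_if split: if_splits)
      qed
      moreover have "- i - j - 2 \<le> k"
      proof (rule ccontr)
        assume "\<not> - i - j - 2 \<le> k"
        then have "c k + 2 * real_of_int ((- i - j - 2) - k) \<le> c (- i - j - 2)" using lattice_gaps[of c k "- i - j - 2", OF gc] by simp
        moreover have "real_of_int ((- i - j - 2) - k) \<ge> 1" using \<open>\<not> - i - j - 2 \<le> k\<close> by linarith
        ultimately show False using h[of "i + 1" "j + 1" "- i - j - 2"] s by (simp add: abs_if split: if_splits)
      qed
      ultimately have "k \<in> {- i - j, - i - j - 1, - i - j - 2}" by auto
      then show "p \<in> ?S" using p by auto
    qed
  qed
  show ?thesis
    unfolding cell_rep_def lattice_cell_def R B
    using frame_nrm(1) ga[of i] gb[of j] h[of i j "- i - j"] h[of "i + 1" j "- i - j - 1"] h[of i "j + 1" "- i - j - 1"]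
      h[of "i + 1" "j + 1" "- i - j - 2"] gc[of "- i - j - 1"] gc[of "- i - j - 2"]
    by (simp add: abs_minus_commute abs_if split: if_splits)
qed

lemma cell_rep_move:
  assumes rep: "cell_rep n m x e y e' k0 k1 k2 C" and g: "isometry g"
  obtains n' m' x' y' d where "cell_rep n' m' x' e y' e' (k0 + d) (k1 + d) (k2 + d) (move_cell g C)"
proof -
  obtain f where f: "linear f" "\<And>x y. f x \<bullet> f y = x \<bullet> y" "surj f" "\<And>p. g p = f p + g 0"
    using isometry_decompose[OF g] by metis
  let ?x = "f n \<bullet> g 0" and ?y = "f m \<bullet> g 0"
  have 1: "g ` reg n m x e y e' = reg (f n) (f m) (x + ?x) e (y + ?y) e'"
    unfolding reg_def isometry_image_Collect[OF f, of "\<lambda>X Y. x \<le> X \<and> X \<le> x + e \<and> y \<le> Y \<and> Y \<le> y + e'"]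
    by (auto simp: algebra_simps)
  have 2: "g ` {p \<in> reg n m x e y e'. (n + m) \<bullet> p \<in> {k0, k1, k2}} =
     {p \<in> reg (f n) (f m) (x + ?x) e (y + ?y) e'. (f n + f m) \<bullet> p \<in> {k0 + (?x + ?y), k1 + (?x + ?y), k2 + (?x + ?y)}}"
    unfolding reg_def mem_Collect_eq inner_add_left
      isometry_image_Collect[OF f, of "\<lambda>X Y. (x \<le> X \<and> X \<le> x + e \<and> y \<le> Y \<and> Y \<le> y + e') \<and> X + Y \<in> {k0, k1, k2}"]
    by (auto simp: algebra_simps)
  have "C = (reg n m x e y e', {p \<in> reg n m x e y e'. (n + m) \<bullet> p \<in> {k0, k1, k2}})"
    using rep by (simp only: cell_rep_def)
  then have eq: "move_cell g C = (reg (f n) (f m) (x + ?x) e (y + ?y) e',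
    {p \<in> reg (f n) (f m) (x + ?x) e (y + ?y) e'. (f n + f m) \<bullet> p \<in> {k0 + (?x + ?y), k1 + (?x + ?y), k2 + (?x + ?y)}})"
    by (simp only: case_prod_conv 1 2)
  have "cell_rep (f n) (f m) (x + ?x) e (y + ?y) e' (k0 + (?x + ?y)) (k1 + (?x + ?y)) (k2 + (?x + ?y)) (move_cell g C)"
    unfolding cell_rep_def eq using rep[unfolded cell_rep_def] by (simp add: frame_def f(2) algebra_simps)
  then show ?thesis by (rule that)
qed

lemma cell_rep_swap:
  assumes "cell_rep n m x e y e' k0 k1 k2 C"
  shows "cell_rep m n y e' x e k0 k1 k2 C"
  using assms unfolding cell_rep_def reg_def by (auto simp: frame_sym algebra_simps)

lemma cell_rep_uminus:
  assumes "cell_rep n m x e y e' k0 k1 k2 C"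
  shows "cell_rep (- n) (- m) (- x - e) e (- y - e') e' (- k2) (- k1) (- k0) C"
proof -
  have 1: "reg (- n) (- m) (- x - e) e (- y - e') e' = reg n m x e y e'"
    unfolding reg_def by auto
  have 2: "(- n + - m) \<bullet> p \<in> {- k2, - k1, - k0} \<longleftrightarrow> (n + m) \<bullet> p \<in> {k0, k1, k2}" for p
    by (auto simp: inner_add_left inner_diff_left)
  show ?thesis
    using assms unfolding cell_rep_def 1 2 by (auto simp: frame_uminus abs_if split: if_splits)
qed

section \<open>Recovering the lattice from a matching tiling\<close>

lemma perp_parallel:
  fixes N d v :: complex
  assumes "N \<noteq> 0" "d \<noteq> 0" "N \<bullet> d = 0" "N \<bullet> v = 0"
  obtains t where "v = t *\<^sub>R d"
proof -
  have c: "Re N * (Re v * Im d - Im v * Re d) = 0" "Im N * (Re v * Im d - Im v * Re d) = 0"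
    using assms(3,4) unfolding inner_complex_def by algebra+
  then have c: "Re v * Im d = Im v * Re d" using assms(1) by (auto simp: complex_eq_iff)
  show ?thesis
  proof (cases "Re d = 0")
    case True
    then have "Im d \<noteq> 0" using assms(2) by (simp add: complex_eq_iff)
    then show ?thesis using c True by (intro that[of "Im v / Im d"]) (auto simp: complex_eq_iff)
  next
    case False
    then show ?thesis using c by (intro that[of "Re v / Re d"]) (simp add: complex_eq_iff field_simps)
  qed
qed

lemma unit_det_zero:
  fixes N M :: complex
  assumes "N \<bullet> N = 1" "M \<bullet> M = 1" "M \<noteq> N" "M \<noteq> - N"
  shows "Re N * Im M - Im N * Re M \<noteq> 0"
proof
  assume "Re N * Im M - Im N * Re M = 0"
  moreover have "(Re N * Im M - Im N * Re M)\<^sup>2 = (N \<bullet> N) * (M \<bullet> M) - (N \<bullet> M)\<^sup>2"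
    by (simp add: inner_complex_def power2_eq_square algebra_simps)
  ultimately have "(N \<bullet> M)\<^sup>2 = 1" using assms by simp
  then consider "N \<bullet> M = 1" | "N \<bullet> M = - 1" by (auto simp: power2_eq_1_iff)
  then show False
  proof cases
    case 1
    then have "(N - M) \<bullet> (N - M) = 0" using assms by (simp add: inner_diff_left inner_diff_right inner_commute)
    then show False using assms(3) by simp
  next
    case 2
    then have "(N + M) \<bullet> (N + M) = 0" using assms by (simp add: inner_add_left inner_add_right inner_commute)
    then show False using assms(4) by (simp add: add_eq_0_iff)
  qed
qed

lemma two_lines_meet:
  fixes N M :: complex
  assumes "N \<bullet> N = 1" "M \<bullet> M = 1" "M \<noteq> N" "M \<noteq> - N"
  obtains x where "N \<bullet> x = s" "M \<bullet> x = t"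
proof -
  define D where "D = Re N * Im M - Im N * Re M"
  have D: "D \<noteq> 0" unfolding D_def by (rule unit_det_zero[OF assms])
  let ?x = "Complex ((s * Im M - t * Im N) / D) ((t * Re N - s * Re M) / D)"
  have "N \<bullet> ?x = (Re N * (s * Im M - t * Im N) + Im N * (t * Re N - s * Re M)) / D"
    by (simp add: inner_complex_def add_divide_distrib)
  also have "Re N * (s * Im M - t * Im N) + Im N * (t * Re N - s * Re M) = s * D"
    by (simp add: D_def algebra_simps)
  finally have 1: "N \<bullet> ?x = s" using D by simp
  have "M \<bullet> ?x = (Re M * (s * Im M - t * Im N) + Im M * (t * Re N - s * Re M)) / D"
    by (simp add: inner_complex_def add_divide_distrib)
  also have "Re M * (s * Im M - t * Im N) + Im M * (t * Re N - s * Re M) = t * D"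
    by (simp add: D_def algebra_simps)
  finally have 2: "M \<bullet> ?x = t" using D by simp
  show ?thesis by (rule that[OF 1 2])
qed

lemma separated_finite:
  fixes Z :: "complex set"
  assumes "bounded Z" "\<And>z w. z \<in> Z \<Longrightarrow> w \<in> Z \<Longrightarrow> z \<noteq> w \<Longrightarrow> 1 \<le> dist z w"
  shows "finite Z"
proof (rule ccontr)
  assume inf: "infinite Z"
  have "compact (closure Z)" using assms(1) by (simp add: compact_closure)
  then obtain x where "x islimpt Z" using inf closure_subset unfolding compact_eq_Bolzano_Weierstrass by metis
  then have i: "infinite (Z \<inter> ball x (1 / 2))" unfolding islimpt_eq_infinite_ball by simp
  obtain z where z: "z \<in> Z \<inter> ball x (1 / 2)" using infinite_imp_nonempty[OF i] by blast
  have "infinite (Z \<inter> ball x (1 / 2) - {z})" using i by simp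
  then obtain w where w: "w \<in> Z \<inter> ball x (1 / 2)" "w \<noteq> z" using infinite_imp_nonempty by blast
  have "dist z w < 1" using z w dist_triangle_half_r[of x z 1 w] by (simp add: dist_commute)
  then show False using assms(2) z w by force
qed

lemma shift_interior:
  fixes X c lo hi :: real
  assumes "lo < X" "X < hi"
  shows "\<exists>\<delta>>0. \<forall>t. \<bar>t\<bar> < \<delta> \<longrightarrow> lo < X + t * c \<and> X + t * c < hi"
proof -
  define \<delta> where "\<delta> = min (X - lo) (hi - X) / (\<bar>c\<bar> + 1)"
  have "\<delta> > 0" using assms by (simp add: \<delta>_def)
  moreover have "lo < X + t * c \<and> X + t * c < hi" if "\<bar>t\<bar> < \<delta>" for t
  proof -
    have "\<bar>t * c\<bar> \<le> \<bar>t\<bar> * (\<bar>c\<bar> + 1)" by (simp add: abs_mult mult_left_mono)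
    also have "\<dots> < \<delta> * (\<bar>c\<bar> + 1)" using that by (intro mult_strict_right_mono) auto
    also have "\<dots> = min (X - lo) (hi - X)" by (simp add: \<delta>_def)
    finally show ?thesis by (auto simp: abs_less_iff)
  qed
  ultimately show ?thesis by blast
qed

lemma shift_into_interior:
  fixes X c lo hi :: real
  assumes "lo \<le> X" "X \<le> hi" "lo < hi" "c \<noteq> 0"
  shows "\<exists>s\<in>{1, - 1}. \<exists>\<delta>>0. \<forall>t. 0 < t \<and> t < \<delta> \<longrightarrow> lo < X + t * (s * c) \<and> X + t * (s * c) < hi"
proof -
  define s where "s = (if X = lo then sgn c else if X = hi then - sgn c else 1)"
  have s: "s \<in> {1, - 1}" using assms(4) by (auto simp: s_def sgn_if)
  obtain \<delta>1 where d1: "\<delta>1 > 0" "\<forall>t. \<bar>t\<bar> < \<delta>1 \<longrightarrow> lo - 1 < X + t * (s * c) \<and> X + t * (s * c) < hi" if "X \<noteq> hi"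
    using shift_interior[of "lo - 1" X hi "s * c"] assms by fastforce
  obtain \<delta>2 where d2: "\<delta>2 > 0" "\<forall>t. \<bar>t\<bar> < \<delta>2 \<longrightarrow> lo < X + t * (s * c) \<and> X + t * (s * c) < hi + 1" if "X \<noteq> lo"
    using shift_interior[of lo X "hi + 1" "s * c"] assms by fastforce
  consider "X = lo" | "X = hi" "X \<noteq> lo" | "X \<noteq> lo" "X \<noteq> hi" by blast
  then have "\<exists>\<delta>>0. \<forall>t. 0 < t \<and> t < \<delta> \<longrightarrow> lo < X + t * (s * c) \<and> X + t * (s * c) < hi"
  proof cases
    case 1
    then have "s * c = \<bar>c\<bar>" by (simp add: s_def abs_sgn mult.commute)
    then show ?thesis using 1 d1 assms by (intro exI[of _ \<delta>1]) auto
  next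
    case 2
    then have "s * c = - \<bar>c\<bar>" by (simp add: s_def abs_sgn mult.commute)
    then show ?thesis using 2 d2 assms by (intro exI[of _ \<delta>2]) auto
  next
    case 3
    then show ?thesis using d1 d2 by (intro exI[of _ "min \<delta>1 \<delta>2"]) auto
  qed
  then show ?thesis using s by blast
qed

section \<open>Lines through points of a bar\<close>

lemma cell_rep_sizes:
  assumes "cell_rep n m x e y e' k0 k1 k2 C"
  shows "frame n m" "2 \<le> e" "2 \<le> e'" "e \<le> 3" "e' \<le> 3" "fst C = reg n m x e y e'"
    "snd C = {p \<in> reg n m x e y e'. (n + m) \<bullet> p \<in> {k0, k1, k2}}"
  using assms unfolding cell_rep_def by auto

text \<open>Each level is off by exactly 1 / 2 from its own corners, and the levels of the other
  corners are at least 2 away from these.\<close>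

lemma bar_avoids_vertices:
  assumes rep: "cell_rep n m x e y e' k0 k1 k2 C" and p: "p \<in> snd C"
  shows "\<not> (n \<bullet> p \<in> {x, x + e} \<and> m \<bullet> p \<in> {y, y + e'})"
proof -
  have k: "n \<bullet> p + m \<bullet> p = k0 \<or> n \<bullet> p + m \<bullet> p = k1 \<or> n \<bullet> p + m \<bullet> p = k2"
    using p cell_rep_sizes(7)[OF rep] by (auto simp: inner_add_left)
  have a: "2 \<le> e" "2 \<le> e'" "\<bar>k0 - (x + y)\<bar> = 1 / 2" "\<bar>k1 - (x + e + y)\<bar> = 1 / 2" "\<bar>k1 - (x + y + e')\<bar> = 1 / 2"
    "\<bar>k2 - (x + e + y + e')\<bar> = 1 / 2"
    using rep unfolding cell_rep_def by auto
  show ?thesis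
  proof
    assume "n \<bullet> p \<in> {x, x + e} \<and> m \<bullet> p \<in> {y, y + e'}"
    then consider "n \<bullet> p = x" "m \<bullet> p = y" | "n \<bullet> p = x + e" "m \<bullet> p = y" | "n \<bullet> p = x" "m \<bullet> p = y + e'"
      | "n \<bullet> p = x + e" "m \<bullet> p = y + e'" by blast
    then show False
      by cases (use k a in \<open>(elim disjE; linarith)+\<close>)
  qed
qed

lemma frame_sum_unit:
  assumes "frame n m"
  shows "(n + m) \<bullet> (n + m) = 1"
proof -
  have "n \<bullet> n = 1" "m \<bullet> m = 1" "n \<bullet> m = - 1 / 2" "m \<bullet> n = - 1 / 2"
    using assms by (simp_all add: frame_def inner_commute)
  then show ?thesis by (simp add: inner_add_left inner_add_right)
qed

text \<open>Since \<open>p\<close> is not a vertex, at most one side of the cell contains it. A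
  direction transversal to that side points inwards for one of its signs; otherwise the line runs
  along the side.\<close>

lemma line_enters_cell:
  assumes rep: "cell_rep n m x e y e' k0 k1 k2 C" and p: "p \<in> snd C"
  shows "(\<exists>s\<in>{1, - 1}. \<exists>\<delta>>0. \<forall>t. 0 < t \<and> t < \<delta> \<longrightarrow> p + t *\<^sub>R (s *\<^sub>R d) \<in> interior (fst C)) \<or>
     (n \<bullet> d = 0 \<or> m \<bullet> d = 0) \<and> (\<exists>\<delta>>0. \<forall>t. \<bar>t\<bar> < \<delta> \<longrightarrow> p + t *\<^sub>R d \<in> fst C)"
proof -
  note sz = cell_rep_sizes[OF rep]
  let ?X = "n \<bullet> p" and ?Y = "m \<bullet> p" and ?dx = "n \<bullet> d" and ?dy = "m \<bullet> d"
  have in_C: "x \<le> ?X" "?X \<le> x + e" "y \<le> ?Y" "?Y \<le> y + e'"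
    using p sz(7) by (auto simp: reg_def)
  have mem: "p + t *\<^sub>R (s *\<^sub>R d) \<in> interior (fst C) \<longleftrightarrow>
     (x < ?X + t * (s * ?dx) \<and> ?X + t * (s * ?dx) < x + e) \<and> (y < ?Y + t * (s * ?dy) \<and> ?Y + t * (s * ?dy) < y + e')" for t s
    unfolding sz(6) interior_reg[OF sz(1)] by (simp add: inner_add_right mult.assoc)
  have memc: "p + t *\<^sub>R d \<in> fst C \<longleftrightarrow>
     (x \<le> ?X + t * ?dx \<and> ?X + t * ?dx \<le> x + e) \<and> (y \<le> ?Y + t * ?dy \<and> ?Y + t * ?dy \<le> y + e')" for t
    unfolding sz(6) reg_def by (simp add: inner_add_right)
  consider "x < ?X" "?X < x + e" "y < ?Y" "?Y < y + e'" | "?X \<in> {x, x + e}" "y < ?Y" "?Y < y + e'"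
    | "x < ?X" "?X < x + e" "?Y \<in> {y, y + e'}"
  proof -
    have "?X \<in> {x, x + e} \<or> x < ?X \<and> ?X < x + e" "?Y \<in> {y, y + e'} \<or> y < ?Y \<and> ?Y < y + e'" using in_C by auto
    then show ?thesis using that bar_avoids_vertices[OF rep p] by blast
  qed
  then show ?thesis
  proof cases
    case 1
    obtain d1 d2 where "d1 > 0" "d2 > 0" "\<forall>t. \<bar>t\<bar> < d1 \<longrightarrow> x < ?X + t * ?dx \<and> ?X + t * ?dx < x + e"
      "\<forall>t. \<bar>t\<bar> < d2 \<longrightarrow> y < ?Y + t * ?dy \<and> ?Y + t * ?dy < y + e'"
      using shift_interior[of x ?X "x + e" ?dx] shift_interior[of y ?Y "y + e'" ?dy] 1 by blast
    then have "\<exists>\<delta>>0. \<forall>t. 0 < t \<and> t < \<delta> \<longrightarrow> p + t *\<^sub>R (1 *\<^sub>R d) \<in> interior (fst C)"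
      unfolding mem by (intro exI[of _ "min d1 d2"]) simp
    then show ?thesis by blast
  next
    case 2
    obtain d2 where d2: "d2 > 0" "\<forall>t. \<bar>t\<bar> < d2 \<longrightarrow> y < ?Y + t * ?dy \<and> ?Y + t * ?dy < y + e'"
      using shift_interior[of y ?Y "y + e'" ?dy] 2 by blast
    show ?thesis
    proof (cases "?dx = 0")
      case True
      then have "\<forall>t. \<bar>t\<bar> < d2 \<longrightarrow> p + t *\<^sub>R d \<in> fst C" unfolding memc using d2 in_C by (auto simp: less_imp_le)
      then show ?thesis using True d2 by blast
    next
      case False
      then obtain s d1 where s: "s \<in> {1, - 1}" "d1 > 0" "\<forall>t. 0 < t \<and> t < d1 \<longrightarrow> x < ?X + t * (s * ?dx) \<and> ?X + t * (s * ?dx) < x + e"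
        using shift_into_interior[of x ?X "x + e" ?dx] in_C sz by force
      have "y < ?Y + t * (s * ?dy) \<and> ?Y + t * (s * ?dy) < y + e'" if "0 < t" "t < d2" for t
        using d2(2)[rule_format, of "t * s"] that s(1) by (auto simp: abs_mult mult.assoc)
      then have "\<exists>\<delta>>0. \<forall>t. 0 < t \<and> t < \<delta> \<longrightarrow> p + t *\<^sub>R (s *\<^sub>R d) \<in> interior (fst C)"
        unfolding mem using s d2 by (intro exI[of _ "min d1 d2"]) simp
      then show ?thesis using s by blast
    qed
  next
    case 3
    obtain d2 where d2: "d2 > 0" "\<forall>t. \<bar>t\<bar> < d2 \<longrightarrow> x < ?X + t * ?dx \<and> ?X + t * ?dx < x + e"
      using shift_interior[of x ?X "x + e" ?dx] 3 by blast
    show ?thesis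
    proof (cases "?dy = 0")
      case True
      then have "\<forall>t. \<bar>t\<bar> < d2 \<longrightarrow> p + t *\<^sub>R d \<in> fst C" unfolding memc using d2 in_C by (auto simp: less_imp_le)
      then show ?thesis using True d2 by blast
    next
      case False
      then obtain s d1 where s: "s \<in> {1, - 1}" "d1 > 0" "\<forall>t. 0 < t \<and> t < d1 \<longrightarrow> y < ?Y + t * (s * ?dy) \<and> ?Y + t * (s * ?dy) < y + e'"
        using shift_into_interior[of y ?Y "y + e'" ?dy] in_C sz by force
      have "x < ?X + t * (s * ?dx) \<and> ?X + t * (s * ?dx) < x + e" if "0 < t" "t < d2" for t
        using d2(2)[rule_format, of "t * s"] that s(1) by (auto simp: abs_mult mult.assoc)
      then have "\<exists>\<delta>>0. \<forall>t. 0 < t \<and> t < \<delta> \<longrightarrow> p + t *\<^sub>R (s *\<^sub>R d) \<in> interior (fst C)"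
        unfolding mem using s d2 by (intro exI[of _ "min d1 d2"]) simp
      then show ?thesis using s by blast
    qed
  qed
qed

text \<open>The cells of a matching tiling with their grouping into tiles forgotten. Nothing relates
  the orientations of different cells yet.\<close>

locale bar_tiling =
  fixes \<C> :: "cell set"
  assumes rep: "C \<in> \<C> \<Longrightarrow> \<exists>n m x e y e' k0 k1 k2. cell_rep n m x e y e' k0 k1 k2 C"
    and cover: "(\<Union>C\<in>\<C>. fst C) = UNIV"
    and disjoint: "C \<in> \<C> \<Longrightarrow> D \<in> \<C> \<Longrightarrow> C \<noteq> D \<Longrightarrow> interior (fst C) \<inter> interior (fst D) = {}"
    and faces: "C \<in> \<C> \<Longrightarrow> D \<in> \<C> \<Longrightarrow> (fst C \<inter> fst D) face_of fst C \<and> (fst C \<inter> fst D) face_of fst D"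
    and lines: "\<exists>\<L>. (\<forall>l\<in>\<L>. affine l \<and> aff_dim l = 1) \<and> (\<Union>C\<in>\<C>. snd C) = \<Union>\<L>"
begin

lemma regular:
  assumes "C \<in> \<C>"
  shows "closure (interior (fst C)) = fst C" "convex (fst C)" "closed (fst C)" "snd C \<subseteq> fst C"
proof -
  obtain n m x e y e' k0 k1 k2 where r: "cell_rep n m x e y e' k0 k1 k2 C" using rep[OF assms] by blast
  note sz = cell_rep_sizes[OF r]
  show "closure (interior (fst C)) = fst C"
    unfolding sz(6) by (rule closure_interior_reg) (use sz in auto)
  show "convex (fst C)" "closed (fst C)" "snd C \<subseteq> fst C"
    unfolding sz(6,7) by (auto intro: convex_reg closed_reg)
qed

lemma interior_meets_imp_eq:
  assumes "C \<in> \<C>" "D \<in> \<C>" "p \<in> interior (fst C)" "p \<in> fst D"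
  shows "C = D"
proof (rule ccontr)
  assume "C \<noteq> D"
  then have "interior (fst C) \<inter> interior (fst D) = {}" using assms disjoint by blast
  then have "interior (fst C) \<inter> closure (interior (fst D)) = {}" by (simp add: open_Int_closure_eq_empty)
  then show False using regular(1)[OF assms(2)] assms by auto
qed

text \<open>A cell contains the unit disc around its centre and stays within distance 6 of it,
  because the squared diameter is at most 4 / 3 * 27 = 36. So the centres of the cells near
  \<open>x\<close> are separated and bounded.\<close>

lemma locally_finite: "finite {C \<in> \<C>. fst C \<inter> cball x r \<noteq> {}}"
proof -
  have "\<exists>z. ball z 1 \<subseteq> interior (fst C) \<and> (\<forall>p\<in>fst C. dist p z \<le> 6)" if C: "C \<in> \<C>" for C
  proof -
    obtain n m x e y e' k0 k1 k2 where r: "cell_rep n m x e y e' k0 k1 k2 C" using rep[OF C] by blast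
    note sz = cell_rep_sizes[OF r]
    let ?z = "pt n m (x + e / 2) (y + e' / 2)"
    have unit: "norm n = 1" "norm m = 1" using sz(1) by (simp_all add: frame_def norm_eq_sqrt_inner)
    have "ball ?z 1 \<subseteq> interior (fst C)"
    proof
      fix p assume "p \<in> ball ?z 1"
      then have d: "norm (p - ?z) < 1" by (simp add: dist_norm norm_minus_commute)
      have "\<bar>n \<bullet> (p - ?z)\<bar> < 1" "\<bar>m \<bullet> (p - ?z)\<bar> < 1"
        using Cauchy_Schwarz_ineq2[of n "p - ?z"] Cauchy_Schwarz_ineq2[of m "p - ?z"] d unit by simp_all
      then show "p \<in> interior (fst C)"
        unfolding sz(6) interior_reg[OF sz(1)] using sz by (auto simp: inner_diff_right inner_pt abs_less_iff)
    qed
    moreover have "dist p ?z \<le> 6" if "p \<in> fst C" for p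
    proof -
      have "?z \<in> fst C" using sz by (simp add: reg_def inner_pt)
      then have "(dist p ?z)\<^sup>2 \<le> 4 / 3 * (e\<^sup>2 + e * e' + e'\<^sup>2)"
        using reg_dist_max(2)[OF sz(1)] that sz by simp
      also have "\<dots> \<le> 4 / 3 * (3\<^sup>2 + 3 * 3 + 3\<^sup>2)"
        using sz by (intro mult_left_mono add_mono power_mono mult_mono) auto
      finally have "(dist p ?z)\<^sup>2 \<le> 6\<^sup>2" by simp
      then show ?thesis by (rule power2_le_imp_le) simp
    qed
    ultimately show ?thesis by blast
  qed
  then obtain z where z: "\<And>C. C \<in> \<C> \<Longrightarrow> ball (z C) 1 \<subseteq> interior (fst C)" "\<And>C p. C \<in> \<C> \<Longrightarrow> p \<in> fst C \<Longrightarrow> dist p (z C) \<le> 6"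
    by metis
  let ?S = "{C \<in> \<C>. fst C \<inter> cball x r \<noteq> {}}"
  have zin: "z C \<in> interior (fst C)" if "C \<in> \<C>" for C using z(1)[OF that] by auto
  have sep: "1 \<le> dist (z C) (z D)" if "C \<in> \<C>" "D \<in> \<C>" "C \<noteq> D" for C D
  proof (rule ccontr)
    assume "\<not> 1 \<le> dist (z C) (z D)"
    then have "z D \<in> interior (fst C)" using z(1)[OF that(1)] by auto
    then show False using zin that disjoint by blast
  qed
  have inj: "inj_on z ?S" by (rule inj_onI) (use sep in fastforce)
  have "bounded (z ` ?S)"
  proof (rule boundedI)
    fix w assume "w \<in> z ` ?S"
    then obtain C where "C \<in> ?S" "w = z C" by blast
    moreover from this obtain p where "p \<in> fst C" "p \<in> cball x r" by blast
    ultimately have "C \<in> \<C>" "w = z C" "p \<in> fst C" "dist x p \<le> r" by simp_all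
    then have "dist p w \<le> 6" using z(2) by blast
    have "norm w \<le> norm x + dist x p + dist p w"
      using norm_triangle_sub[of w p] norm_triangle_sub[of p x] by (simp add: dist_norm norm_minus_commute)
    then show "norm w \<le> norm x + r + 6" using \<open>dist p w \<le> 6\<close> \<open>dist x p \<le> r\<close> by simp
  qed
  then have "finite (z ` ?S)" by (rule separated_finite) (use sep in force)
  then show ?thesis using inj by (rule finite_imageD)
qed

text \<open>The points tend to \<open>x\<close>, so by local finiteness only finitely many cells are
  involved and one of them recurs.\<close>

lemma ray_pigeonhole:
  assumes "\<And>k::nat. \<exists>C\<in>\<C>. x + (1 / real (Suc k)) *\<^sub>R d \<in> S C" "\<And>C. C \<in> \<C> \<Longrightarrow> S C \<subseteq> fst C"
  obtains C where "C \<in> \<C>" "infinite {k::nat. x + (1 / real (Suc k)) *\<^sub>R d \<in> S C}"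
proof -
  obtain f where f: "\<And>k. f k \<in> \<C>" "\<And>k::nat. x + (1 / real (Suc k)) *\<^sub>R d \<in> S (f k)" using assms(1) by metis
  have "f k \<in> {C \<in> \<C>. fst C \<inter> cball x (norm d) \<noteq> {}}" for k
  proof -
    have "1 / real (Suc k) * norm d \<le> 1 * norm d" by (intro mult_right_mono) auto
    then have "x + (1 / real (Suc k)) *\<^sub>R d \<in> cball x (norm d)" by (simp add: dist_norm)
    then show ?thesis using f assms(2) by blast
  qed
  then have "finite (range f)" by (intro finite_subset[OF _ locally_finite[of x "norm d"]]) auto
  then obtain k0 where "infinite {k \<in> UNIV. f k = f k0}"
    using pigeonhole_infinite[of "UNIV :: nat set" f] by auto
  then have "infinite {k. x + (1 / real (Suc k)) *\<^sub>R d \<in> S (f k0)}"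
  proof (rule infinite_super[rotated], intro subsetI)
    fix k assume "k \<in> {k \<in> UNIV. f k = f k0}"
    then show "k \<in> {k. x + (1 / real (Suc k)) *\<^sub>R d \<in> S (f k0)}" using f(2)[of k] by simp
  qed
  then show ?thesis using f(1) that by blast
qed

text \<open>Closedness of the cell yields the limit point \<open>x\<close>, convexity the segment
  from there to any of the points.\<close>

lemma ray_segment:
  assumes C: "C \<in> \<C>" and inf: "infinite {k::nat. x + (1 / real (Suc k)) *\<^sub>R d \<in> fst C}"
  shows "x \<in> fst C" "\<exists>t0>0. \<forall>t. 0 \<le> t \<and> t \<le> t0 \<longrightarrow> x + t *\<^sub>R d \<in> fst C"
proof -
  let ?K = "{k::nat. x + (1 / real (Suc k)) *\<^sub>R d \<in> fst C}"
  have "(\<lambda>j. x + (1 / real (Suc (enumerate ?K j))) *\<^sub>R d) \<longlonglongrightarrow> x + 0 *\<^sub>R d"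
  proof (intro tendsto_intros)
    have "(\<lambda>k. 1 / real (Suc k)) \<longlonglongrightarrow> 0" using LIMSEQ_inverse_real_of_nat by (simp add: inverse_eq_divide)
    then show "(\<lambda>j. 1 / real (Suc (enumerate ?K j))) \<longlonglongrightarrow> 0"
      by (rule filterlim_compose) (rule filterlim_subseq[OF strict_mono_enumerate[OF inf]])
  qed
  then have lim: "(\<lambda>j. x + (1 / real (Suc (enumerate ?K j))) *\<^sub>R d) \<longlonglongrightarrow> x" by simp
  have "x + (1 / real (Suc (enumerate ?K j))) *\<^sub>R d \<in> fst C" for j
    using enumerate_in_set[OF inf, of j] by blast
  then show x: "x \<in> fst C" using closed_sequentially[OF regular(3)[OF C] _ lim] by blast
  obtain k where k: "x + (1 / real (Suc k)) *\<^sub>R d \<in> fst C" using infinite_imp_nonempty[OF inf] by blast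
  let ?r = "1 / real (Suc k)"
  have "x + t *\<^sub>R d \<in> fst C" if "0 \<le> t" "t \<le> ?r" for t
  proof -
    define u where "u = t / ?r"
    have u: "0 \<le> u" "u \<le> 1" "t = u * ?r" using that by (auto simp: u_def divide_le_eq field_simps)
    have "(1 - u) *\<^sub>R x + u *\<^sub>R (x + ?r *\<^sub>R d) \<in> fst C"
      using convexD[OF regular(2)[OF C] x k, of "1 - u" u] u by simp
    moreover have "(1 - u) *\<^sub>R x + u *\<^sub>R (x + ?r *\<^sub>R d) = x + t *\<^sub>R d"
      unfolding u(3) by (simp add: algebra_simps)
    ultimately show ?thesis by simp
  qed
  then show "\<exists>t0>0. \<forall>t. 0 \<le> t \<and> t \<le> t0 \<longrightarrow> x + t *\<^sub>R d \<in> fst C"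
    by (intro exI[of _ ?r]) simp
qed

lemma ray_in_cell:
  obtains C t0 where "C \<in> \<C>" "t0 > 0" "\<And>t. 0 \<le> t \<Longrightarrow> t \<le> t0 \<Longrightarrow> x + t *\<^sub>R d \<in> fst C"
proof -
  have "\<exists>C\<in>\<C>. p \<in> fst C" for p using cover by (metis UNIV_I UN_iff)
  then obtain C where "C \<in> \<C>" "infinite {k::nat. x + (1 / real (Suc k)) *\<^sub>R d \<in> fst C}"
    using ray_pigeonhole[of x d fst] by blast
  then show ?thesis using ray_segment(2) that by metis
qed

lemma ray_in_bar:
  assumes "\<And>t. x + t *\<^sub>R d \<in> (\<Union>C\<in>\<C>. snd C)"
  obtains C t0 where "C \<in> \<C>" "t0 > 0" "\<And>t. 0 \<le> t \<Longrightarrow> t \<le> t0 \<Longrightarrow> x + t *\<^sub>R d \<in> snd C"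
    "\<And>n m x e y e' k0 k1 k2. cell_rep n m x e y e' k0 k1 k2 C \<Longrightarrow> (n + m) \<bullet> d = 0"
proof -
  have "\<And>k::nat. \<exists>C\<in>\<C>. x + (1 / real (Suc k)) *\<^sub>R d \<in> snd C" using assms by blast
  then obtain C where C: "C \<in> \<C>" "infinite {k::nat. x + (1 / real (Suc k)) *\<^sub>R d \<in> snd C}"
    using ray_pigeonhole[of x d snd] regular(4) by blast
  then have "infinite {k::nat. x + (1 / real (Suc k)) *\<^sub>R d \<in> fst C}"
    by (elim infinite_super[rotated]) (use regular(4) C in blast)
  then obtain t0 where t0: "t0 > 0" "\<And>t. 0 \<le> t \<Longrightarrow> t \<le> t0 \<Longrightarrow> x + t *\<^sub>R d \<in> fst C"
    using ray_segment(2) C(1) by blast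
  let ?K = "{k::nat. x + (1 / real (Suc k)) *\<^sub>R d \<in> snd C}"
  have main: "(n + m) \<bullet> d = 0 \<and> (\<forall>t. 0 \<le> t \<and> t \<le> t0 \<longrightarrow> x + t *\<^sub>R d \<in> snd C)"
    if r: "cell_rep n m x' e y e' k0 k1 k2 C" for n m x' e y e' k0 k1 k2
  proof -
    note sz = cell_rep_sizes[OF r]
    \<comment> \<open>Infinitely many points of the ray lie on three levels, so two of them share
      one; the level is then constant along the whole ray.\<close>
    let ?h = "\<lambda>k::nat. (n + m) \<bullet> (x + (1 / real (Suc k)) *\<^sub>R d)"
    have "?h ` ?K \<subseteq> {k0, k1, k2}" using sz(7) by blast
    then have "finite (?h ` ?K)" by (rule finite_subset) simp
    then obtain i where "infinite {k \<in> ?K. ?h k = ?h i}" using pigeonhole_infinite[OF C(2)] by blast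
    then have "infinite ({k \<in> ?K. ?h k = ?h i} - {i})" by simp
    then obtain j where "j \<noteq> i" "?h j = ?h i" "j \<in> ?K" using infinite_imp_nonempty by blast
    then have j: "(1 / real (Suc j) - 1 / real (Suc i)) * ((n + m) \<bullet> d) = 0"
      by (simp add: inner_add_right algebra_simps)
    moreover have "1 / real (Suc j) \<noteq> 1 / real (Suc i)" using \<open>j \<noteq> i\<close> by simp
    ultimately have z: "(n + m) \<bullet> d = 0" by simp
    have "(n + m) \<bullet> x \<in> {k0, k1, k2}" using \<open>j \<in> ?K\<close> sz(7) z by (auto simp: inner_add_right)
    then have "x + t *\<^sub>R d \<in> snd C" if "0 \<le> t" "t \<le> t0" for t
      using t0(2)[OF that] z unfolding sz(6,7) by (simp add: inner_add_right)
    then show ?thesis using z by blast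
  qed
  show ?thesis using that[OF C(1) t0(1)] main rep[OF C(1)] by blast
qed

text \<open>No bar passes through a vertex, so at a point of a bar the cell carrying it fills at least a
  half-disc. A line made of bars therefore runs inside that cell on one side of the point, or
  along an edge of it; in the latter case some other cell whose bars are parallel to the line would
  have to overlap it.\<close>

lemma line_parallel_to_bar:
  assumes line: "\<And>t. x + t *\<^sub>R d \<in> (\<Union>C\<in>\<C>. snd C)" and "d \<noteq> 0"
    and C: "C \<in> \<C>" "x \<in> snd C" and r: "cell_rep n m x' e y e' k0 k1 k2 C"
  shows "(n + m) \<bullet> d = 0"
proof -
  have sub: "(n + m) \<bullet> d = 0" if s: "s \<in> {1, - 1}" "\<delta> > 0" "\<forall>t. 0 < t \<and> t < \<delta> \<longrightarrow> x + t *\<^sub>R (s *\<^sub>R d) \<in> interior (fst C)" for s \<delta>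
  proof -
    have "x + t *\<^sub>R (s *\<^sub>R d) \<in> (\<Union>C\<in>\<C>. snd C)" for t using line[of "t * s"] by simp
    then obtain D t0 where D: "D \<in> \<C>" "t0 > 0" "\<And>t. 0 \<le> t \<Longrightarrow> t \<le> t0 \<Longrightarrow> x + t *\<^sub>R (s *\<^sub>R d) \<in> snd D"
      "\<And>n m x e y e' k0 k1 k2. cell_rep n m x e y e' k0 k1 k2 D \<Longrightarrow> (n + m) \<bullet> (s *\<^sub>R d) = 0"
      by (rule ray_in_bar) blast
    define t where "t = min t0 (\<delta> / 2)"
    have t: "0 < t" "t < \<delta>" "t \<le> t0" using s D by (auto simp: t_def)
    have "C = D" using interior_meets_imp_eq[OF C(1) D(1)] s(3) t D(3)[of t] regular(4)[OF D(1)] by (meson less_imp_le subsetD)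
    then show ?thesis using D(4) r s(1) by auto
  qed
  consider "\<exists>s\<in>{1, - 1}. \<exists>\<delta>>0. \<forall>t. 0 < t \<and> t < \<delta> \<longrightarrow> x + t *\<^sub>R (s *\<^sub>R d) \<in> interior (fst C)"
    | "\<exists>\<delta>>0. \<forall>t. \<bar>t\<bar> < \<delta> \<longrightarrow> x + t *\<^sub>R d \<in> fst C"
    using line_enters_cell[OF r C(2)] by blast
  then show ?thesis
  proof cases
    case 1
    then show ?thesis using sub by blast
  next
    case 2
    then obtain \<delta> where \<delta>: "\<delta> > 0" "\<forall>t. \<bar>t\<bar> < \<delta> \<longrightarrow> x + t *\<^sub>R d \<in> fst C" by blast
    obtain D t0 where D: "D \<in> \<C>" "t0 > 0" "\<And>t. 0 \<le> t \<Longrightarrow> t \<le> t0 \<Longrightarrow> x + t *\<^sub>R d \<in> snd D"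
      "\<And>n m x e y e' k0 k1 k2. cell_rep n m x e y e' k0 k1 k2 D \<Longrightarrow> (n + m) \<bullet> d = 0"
      using ray_in_bar[OF line] by blast
    obtain n' m' x'' e1 y' e1' l0 l1 l2 where r': "cell_rep n' m' x'' e1 y' e1' l0 l1 l2 D" using rep[OF D(1)] by blast
    have z: "(n' + m') \<bullet> d = 0" using D(4) r' by blast
    define t where "t = min t0 (\<delta> / 2)"
    have t: "0 < t" "t < \<delta>" "t \<le> t0" using \<delta> D by (auto simp: t_def)
    define p where "p = x + t *\<^sub>R d"
    have p: "p \<in> snd D" unfolding p_def using D(3) t by simp
    \<comment> \<open>An edge of \<open>D\<close> parallel to its own bars would make both normals
      vanish on \<open>d\<close>. So the line is transversal to every edge of \<open>D\<close> and
      has to enter its interior near \<open>p\<close>.\<close>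
    have "\<not> (n' \<bullet> d = 0 \<or> m' \<bullet> d = 0)"
    proof
      assume "n' \<bullet> d = 0 \<or> m' \<bullet> d = 0"
      then have "n' \<bullet> d = 0" "m' \<bullet> d = 0" using z by (auto simp: inner_add_left)
      then have "d = 0" using frame_eqI[OF cell_rep_sizes(1)[OF r'], of d 0] by simp
      then show False using \<open>d \<noteq> 0\<close> by simp
    qed
    then obtain s \<delta>' where s: "s \<in> {1, - 1}" "\<delta>' > 0" "\<forall>u. 0 < u \<and> u < \<delta>' \<longrightarrow> p + u *\<^sub>R (s *\<^sub>R d) \<in> interior (fst D)"
      using line_enters_cell[OF r' p, of d] by blast
    \<comment> \<open>Small enough to stay in the interior of \<open>D\<close>, and also on the
      stretch of the line lying in \<open>C\<close>, whichever sign \<open>s\<close> has.\<close>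
    define u where "u = min (\<delta>' / 2) ((\<delta> - t) / 2)"
    have u: "0 < u" "u < \<delta>'" "u < \<delta> - t" using s t by (auto simp: u_def min_less_iff_disj)
    have "p + u *\<^sub>R (s *\<^sub>R d) = x + (t + u * s) *\<^sub>R d" by (simp add: p_def algebra_simps)
    moreover have "\<bar>t + u * s\<bar> < \<delta>" using s(1) u t by auto
    ultimately have "p + u *\<^sub>R (s *\<^sub>R d) \<in> fst C" using \<delta> by simp
    then have "D = C" using interior_meets_imp_eq[OF D(1) C(1)] s u by blast
    then show ?thesis using D(4) r by blast
  qed
qed

text \<open>The bar condition supplies some full line through \<open>p\<close>. It is parallel to
  the bars of \<open>C\<close>, hence equal to the whole level line of \<open>p\<close>.\<close>

lemma bar_point_line:
  assumes C: "C \<in> \<C>" "p \<in> snd C" and r: "cell_rep n m x e y e' k0 k1 k2 C" and q: "(n + m) \<bullet> q = (n + m) \<bullet> p"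
  shows "q \<in> (\<Union>C\<in>\<C>. snd C)"
proof -
  obtain \<L> where L: "\<And>l. l \<in> \<L> \<Longrightarrow> affine l \<and> aff_dim l = 1" "(\<Union>C\<in>\<C>. snd C) = \<Union>\<L>" using lines by blast
  obtain l where l: "l \<in> \<L>" "p \<in> l" using C L(2) by blast
  have "l \<noteq> {p}" using L(1)[OF l(1)] by auto
  then obtain p' where p': "p' \<in> l" "p' \<noteq> p" using l by blast
  let ?d = "p' - p"
  have inl: "p + t *\<^sub>R ?d \<in> l" for t
  proof -
    have "(1 - t) *\<^sub>R p + t *\<^sub>R p' \<in> l" using L(1)[OF l(1)] l p' unfolding affine_def by simp
    moreover have "(1 - t) *\<^sub>R p + t *\<^sub>R p' = p + t *\<^sub>R ?d" by (simp add: algebra_simps)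
    ultimately show ?thesis by simp
  qed
  then have line: "p + t *\<^sub>R ?d \<in> (\<Union>C\<in>\<C>. snd C)" for t using L(2) l(1) by blast
  have "(n + m) \<bullet> ?d = 0" using line_parallel_to_bar[OF line _ C r] p' by simp
  moreover have "(n + m) \<bullet> (q - p) = 0" using q by (simp add: inner_diff_right)
  moreover have "n + m \<noteq> 0"
  proof
    assume "n + m = 0"
    then have "m = - n" by (simp add: add_eq_0_iff2)
    moreover have "n \<bullet> n = 1" "n \<bullet> m = - 1 / 2" using cell_rep_sizes(1)[OF r] by (simp_all only: frame_def)
    ultimately show False by simp
  qed
  ultimately obtain t where "q - p = t *\<^sub>R ?d" using perp_parallel[of "n + m" ?d "q - p"] p' by (metis right_minus_eq)
  then have "q = p + t *\<^sub>R ?d" by (simp add: algebra_simps)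
  then show ?thesis using line by simp
qed

text \<open>The diagonal from the lowest to the highest corner runs through the interior and takes
  every intermediate level.\<close>

lemma bar_exists:
  assumes r: "cell_rep n m x e y e' k0 k1 k2 C" and k: "k \<in> {k0, k1, k2}" "x + y < k" "k < x + e + (y + e')"
  obtains p where "p \<in> snd C" "p \<in> interior (fst C)" "(n + m) \<bullet> p = k"
proof -
  note sz = cell_rep_sizes[OF r]
  define u where "u = (k - (x + y)) / (e + e')"
  have u: "0 < u" "u < 1" "u * (e + e') = k - (x + y)" using k sz by (auto simp: u_def field_simps)
  let ?p = "pt n m (x + u * e) (y + u * e')"
  have ips: "n \<bullet> ?p = x + u * e" "m \<bullet> ?p = y + u * e'" using inner_pt[OF sz(1)] by auto
  have "(n + m) \<bullet> ?p = k" unfolding inner_add_left ips using u(3) by (simp add: algebra_simps)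
  moreover have "?p \<in> interior (fst C)" unfolding sz(6) interior_reg[OF sz(1)] using u sz by (simp add: ips)
  moreover from this have "?p \<in> snd C" unfolding sz(7) using interior_subset[of "fst C"] sz(6) k(1) \<open>(n + m) \<bullet> ?p = k\<close> by auto
  ultimately show ?thesis using that by blast
qed

lemma middle_bar:
  assumes "cell_rep n m x e y e' k0 k1 k2 C"
  shows "x + y < k1" "k1 < x + e + (y + e')"
  using assms unfolding cell_rep_def by (auto simp: abs_if split: if_splits)

text \<open>Bars are full lines, so bars of two directions would cross at some point
  \<open>z\<close>, and the bars of a cell carrying \<open>z\<close> would be parallel to
  both.\<close>

lemma bars_parallel:
  assumes "C \<in> \<C>" "D \<in> \<C>" and r: "cell_rep n m x e y e' k0 k1 k2 C" "cell_rep n' m' x' e1 y' e1' l0 l1 l2 D"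
  shows "n' + m' = n + m \<or> n' + m' = - (n + m)"
proof (rule ccontr)
  assume no: "\<not> ?thesis"
  have u: "(n + m) \<bullet> (n + m) = 1" "(n' + m') \<bullet> (n' + m') = 1"
    using cell_rep_sizes(1)[OF r(1)] cell_rep_sizes(1)[OF r(2)] by (auto intro: frame_sum_unit)
  obtain p where p: "p \<in> snd C" "(n + m) \<bullet> p = k1" using bar_exists[OF r(1) _ middle_bar[OF r(1)]] by blast
  obtain q where q: "q \<in> snd D" "(n' + m') \<bullet> q = l1" using bar_exists[OF r(2) _ middle_bar[OF r(2)]] by blast
  obtain z where z: "(n + m) \<bullet> z = k1" "(n' + m') \<bullet> z = l1" using two_lines_meet[OF u] no by metis
  have "z \<in> (\<Union>C\<in>\<C>. snd C)" using bar_point_line[OF assms(1) p(1) r(1)] p z by simp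
  then obtain E where E: "E \<in> \<C>" "z \<in> snd E" by blast
  obtain n'' m'' x'' e2 y'' e2' j0 j1 j2 where r3: "cell_rep n'' m'' x'' e2 y'' e2' j0 j1 j2 E" using rep[OF E(1)] by blast
  define d where "d = Complex (- Im (n + m)) (Re (n + m))"
  define d' where "d' = Complex (- Im (n' + m')) (Re (n' + m'))"
  have dd: "(n + m) \<bullet> d = 0" "(n' + m') \<bullet> d' = 0" by (simp_all add: d_def d'_def inner_complex_def algebra_simps)
  have nz: "n + m \<noteq> 0" "n' + m' \<noteq> 0" using u by (auto simp del: inner_eq_zero_iff)
  then have d0: "d \<noteq> 0" "d' \<noteq> 0" by (auto simp: d_def d'_def complex_eq_iff)
  have "z + t *\<^sub>R d \<in> (\<Union>C\<in>\<C>. snd C)" for t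
    using bar_point_line[OF assms(1) p(1) r(1), of "z + t *\<^sub>R d"] p z dd by (simp add: inner_add_right)
  then have a: "(n'' + m'') \<bullet> d = 0" using line_parallel_to_bar[OF _ d0(1) E r3] by blast
  have "z + t *\<^sub>R d' \<in> (\<Union>C\<in>\<C>. snd C)" for t
    using bar_point_line[OF assms(2) q(1) r(2), of "z + t *\<^sub>R d'"] q z dd by (simp add: inner_add_right)
  then have b: "(n'' + m'') \<bullet> d' = 0" using line_parallel_to_bar[OF _ d0(2) E r3] by blast
  have "(n'' + m'') \<bullet> (n'' + m'') = 1"
    using cell_rep_sizes(1)[OF r3] by (rule frame_sum_unit)
  then have "n'' + m'' \<noteq> 0" by (auto simp del: inner_eq_zero_iff)
  then obtain t where t: "d' = t *\<^sub>R d" using perp_parallel[OF _ d0(1) a b] by blast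
  have e: "Re (n' + m') = t * Re (n + m)" "Im (n' + m') = t * Im (n + m)"
    using arg_cong[OF t, of Im] arg_cong[OF t, of Re] by (simp_all add: d_def d'_def algebra_simps)
  have "Re (n + m) * Im (n' + m') - Im (n + m) * Re (n' + m') = 0" unfolding e by simp
  moreover have "Re (n + m) * Im (n' + m') - Im (n + m) * Re (n' + m') \<noteq> 0"
    by (rule unit_det_zero[OF u]) (use no in blast)+
  ultimately show False by simp
qed

text \<open>Parallel bars fix \<open>n + m\<close> up to sign, and the sum fixes the frame up to
  order. A point reflection of the coordinates repairs the sign, a swap repairs the order.\<close>

lemma common_frame:
  obtains n m where "frame n m" "\<And>C. C \<in> \<C> \<Longrightarrow> \<exists>x e y e' k0 k1 k2. cell_rep n m x e y e' k0 k1 k2 C"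
proof -
  obtain C0 where C0: "C0 \<in> \<C>" using cover by blast
  obtain n m x0 e0 y0 e0' j0 j1 j2 where r0: "cell_rep n m x0 e0 y0 e0' j0 j1 j2 C0" using rep[OF C0] by blast
  have f: "frame n m" by (rule cell_rep_sizes(1)[OF r0])
  have "\<exists>x e y e' k0 k1 k2. cell_rep n m x e y e' k0 k1 k2 C" if C: "C \<in> \<C>" for C
  proof -
    obtain n' m' x e y e' k0 k1 k2 where r: "cell_rep n' m' x e y e' k0 k1 k2 C" using rep[OF C] by blast
    have "\<exists>n' m' x e y e' k0 k1 k2. cell_rep n' m' x e y e' k0 k1 k2 C \<and> n + m = n' + m'"
    proof (cases "n' + m' = n + m")
      case True
      then show ?thesis using r by metis
    next
      case False
      then have "n + m = - n' + - m'" using bars_parallel[OF C0 C r0 r] by (metis minus_add_distrib minus_minus)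
      then show ?thesis using cell_rep_uminus[OF r] by blast
    qed
    then obtain n' m' x e y e' k0 k1 k2 where r: "cell_rep n' m' x e y e' k0 k1 k2 C" "n + m = n' + m'" by blast
    have "n' = n \<and> m' = m \<or> n' = m \<and> m' = n"
      using frame_unique[OF f cell_rep_sizes(1)[OF r(1)] r(2)] .
    then show ?thesis using r(1) cell_rep_swap[OF r(1)] by blast
  qed
  then show ?thesis using that f by blast
qed

end

section \<open>From edge-to-edge cells to a grid\<close>

lemma pt_open_segment:
  assumes "frame n m" "Y1 < Y" "Y < Y2"
  shows "pt n m X Y \<in> open_segment (pt n m X Y1) (pt n m X Y2)"
proof -
  define u where "u = (Y - Y1) / (Y2 - Y1)"
  have u: "0 < u" "u < 1" "u * (Y2 - Y1) = Y - Y1" using assms by (auto simp: u_def)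
  have "pt n m X Y = (1 - u) *\<^sub>R pt n m X Y1 + u *\<^sub>R pt n m X Y2"
    using u(3) by (intro frame_eqI[OF assms(1)]) (simp_all add: inner_pt[OF assms(1)] inner_add_right algebra_simps)
  moreover have "pt n m X Y1 \<noteq> pt n m X Y2" using inner_pt(2)[OF assms(1)] assms by (metis less_irrefl less_trans)
  ultimately show ?thesis unfolding in_segment using u by blast
qed

text \<open>Two-sided dependent choice: the chain is extended to the right and to the left
  independently, and the two halves share the initial pair.\<close>

lemma dependent_int_choice:
  assumes "Q x0 x1" "\<And>x y. Q x y \<Longrightarrow> \<exists>z. Q y z" "\<And>x y. Q x y \<Longrightarrow> \<exists>w. Q w x"
  obtains a :: "int \<Rightarrow> 'a" where "\<And>i. Q (a i) (a (i + 1))" "a 0 = x0" "a 1 = x1"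
proof -
  define nx where "nx y = (SOME z. Q y z)" for y
  define pv where "pv x = (SOME w. Q w x)" for x
  have nx: "Q y (nx y)" if "Q x y" for x y unfolding nx_def by (rule someI_ex[OF assms(2)[OF that]])
  have pv: "Q (pv x) x" if "Q x y" for x y unfolding pv_def by (rule someI_ex[OF assms(3)[OF that]])
  define f where "f k = ((\<lambda>(x, y). (y, nx y)) ^^ k) (x0, x1)" for k :: nat
  define g where "g k = ((\<lambda>(x, y). (pv x, x)) ^^ k) (x0, x1)" for k :: nat
  have f: "f 0 = (x0, x1)" "Q (fst (f k)) (snd (f k)) \<and> fst (f (Suc k)) = snd (f k)" for k
  proof -
    show "f 0 = (x0, x1)" by (simp add: f_def)
    have "Q (fst (f k)) (snd (f k))"
      by (induction k) (auto simp: f_def assms(1) case_prod_beta intro: nx)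
    then show "Q (fst (f k)) (snd (f k)) \<and> fst (f (Suc k)) = snd (f k)" by (simp add: f_def case_prod_beta)
  qed
  have g: "g 0 = (x0, x1)" "Q (fst (g k)) (snd (g k)) \<and> snd (g (Suc k)) = fst (g k)" for k
  proof -
    show "g 0 = (x0, x1)" by (simp add: g_def)
    have "Q (fst (g k)) (snd (g k))"
      by (induction k) (auto simp: g_def assms(1) case_prod_beta intro: pv)
    then show "Q (fst (g k)) (snd (g k)) \<and> snd (g (Suc k)) = fst (g k)" by (simp add: g_def case_prod_beta)
  qed
  define a where "a i = (if i \<ge> 0 then fst (f (nat i)) else fst (g (nat (- i))))" for i :: int
  have "Q (a i) (a (i + 1))" for i
  proof (cases "i \<ge> 0")
    case True
    then have "nat (i + 1) = Suc (nat i)" by simp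
    then show ?thesis using True f(2)[of "nat i"] by (simp add: a_def)
  next
    case False
    define k where "k = nat (- i - 1)"
    have k: "nat (- i) = Suc k" using False by (simp add: k_def)
    have "a i = fst (g (Suc k))" using False k by (simp add: a_def)
    moreover have "a (i + 1) = fst (g k)"
    proof (cases "i = - 1")
      case True
      then show ?thesis using f(1) g(1) by (simp add: a_def k_def)
    next
      case False
      then have "nat (- (i + 1)) = k" "\<not> i + 1 \<ge> 0" using \<open>\<not> i \<ge> 0\<close> by (auto simp: k_def)
      then show ?thesis by (simp add: a_def)
    qed
    ultimately show ?thesis using g(2)[of "Suc k"] g(2)[of k] by simp
  qed
  moreover have "a 0 = x0" by (simp add: a_def f(1))
  moreover have "a 1 = x1" using f(1) f(2)[of 0] by (simp add: a_def)
  ultimately show ?thesis by (rule that)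
qed

lemma reg_eq_iff:
  assumes f: "frame n m" and "reg n m x e y f' = reg n m X E Y F" "0 \<le> e" "0 \<le> f'" "0 \<le> E" "0 \<le> F"
  shows "x = X \<and> e = E \<and> y = Y \<and> f' = F"
proof -
  have mem: "a \<in> {x..x + e} \<and> b \<in> {y..y + f'} \<longleftrightarrow> a \<in> {X..X + E} \<and> b \<in> {Y..Y + F}" for a b
    using assms(2) inner_pt[OF f, of a b] unfolding reg_def by (auto simp: set_eq_iff) (metis inner_pt[OF f])+
  show ?thesis
    using mem[of x y] mem[of "x + e" "y + f'"] mem[of X Y] mem[of "X + E" "Y + F"] assms by auto
qed

context bar_tiling
begin

text \<open>The neighbour is found just to the right of the midpoint of the right edge. As the
  intersection of the two cells is a face of both, containing an inner point of an edge it contains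
  the whole edge, first that of \<open>C\<close>, then that of \<open>D\<close>.\<close>

lemma right_neighbor:
  assumes fr: "\<And>C. C \<in> \<C> \<Longrightarrow> \<exists>x e y e' k0 k1 k2. cell_rep n m x e y e' k0 k1 k2 C"
    and C: "C \<in> \<C>" "fst C = reg n m x e y e'" and sz: "2 \<le> e" "2 \<le> e'"
  shows "\<exists>D\<in>\<C>. \<exists>e2\<in>{2, 3}. fst D = reg n m (x + e) e2 y e'"
proof -
  have f: "frame n m" using fr[OF C(1)] cell_rep_sizes(1) by blast
  define w where "w = pt n m (x + e) (y + e' / 2)"
  define d where "d = pt n m 1 0"
  note ip = inner_pt[OF f]
  obtain D t0 where D: "D \<in> \<C>" "t0 > 0" "\<And>t. 0 \<le> t \<Longrightarrow> t \<le> t0 \<Longrightarrow> w + t *\<^sub>R d \<in> fst D"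
    using ray_in_cell[of w d] by metis
  obtain X E Y E' k0 k1 k2 where rD: "cell_rep n m X E Y E' k0 k1 k2 D" using fr[OF D(1)] by blast
  note szD = cell_rep_sizes[OF rD]
  have wD: "w \<in> fst D" using D(3)[of 0] D(2) by simp
  have "w + t0 *\<^sub>R d \<in> fst D" using D by simp
  then have X: "X \<le> x + e" "x + e + t0 \<le> X + E" "Y \<le> y + e' / 2" "y + e' / 2 \<le> Y + E'"
    using wD unfolding szD(6) reg_def w_def d_def by (simp_all add: inner_add_right ip)
  have wC: "w \<in> fst C" unfolding C(2) reg_def w_def using sz by (simp add: ip)
  have "C \<noteq> D"
  proof
    assume "C = D"
    then have "w + t0 *\<^sub>R d \<in> reg n m x e y e'" using D C by simp
    then show False using D(2) by (simp add: reg_def w_def d_def inner_add_right ip)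
  qed
  \<comment> \<open>If \<open>D\<close> reached to the left of the common edge, its interior would
    overlap that of \<open>C\<close>.\<close>
  have Xe: "X = x + e"
  proof (rule ccontr)
    assume "X \<noteq> x + e"
    then have "max x X < x + e" "max y Y < min (y + e') (Y + E')" using X sz szD by auto
    then obtain a b where ab: "max x X < a" "a < x + e" "max y Y < b" "b < min (y + e') (Y + E')" using dense by meson
    have "pt n m a b \<in> interior (fst C)" unfolding C(2) interior_reg[OF f] using ab by (simp add: ip)
    moreover have "pt n m a b \<in> fst D" unfolding szD(6) reg_def using ab X D(2) by (simp add: ip)
    ultimately show False using interior_meets_imp_eq[OF C(1) D(1)] \<open>C \<noteq> D\<close> by blast
  qed
  let ?F = "fst C \<inter> fst D"
  have wF: "w \<in> ?F" using wC wD by simp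
  have cpt: "pt n m (x + e) Y' \<in> fst C \<longleftrightarrow> y \<le> Y' \<and> Y' \<le> y + e'" for Y'
    unfolding C(2) reg_def using sz by (simp add: ip)
  have dpt: "pt n m (x + e) Y' \<in> fst D \<longleftrightarrow> Y \<le> Y' \<and> Y' \<le> Y + E'" for Y'
    unfolding szD(6) reg_def using szD Xe by (simp add: ip)
  have fc: "a \<in> ?F" "b \<in> ?F" if "a \<in> fst C" "b \<in> fst C" "p \<in> ?F" "p \<in> open_segment a b" for a b p
    using faces[OF C(1) D(1)] that unfolding face_of_def by blast+
  have fd: "a \<in> ?F" "b \<in> ?F" if "a \<in> fst D" "b \<in> fst D" "p \<in> ?F" "p \<in> open_segment a b" for a b p
    using faces[OF C(1) D(1)] that unfolding face_of_def by blast+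
  have "w \<in> open_segment (pt n m (x + e) y) (pt n m (x + e) (y + e'))"
    unfolding w_def by (rule pt_open_segment[OF f]) (use sz in auto)
  moreover have "pt n m (x + e) y \<in> fst C" "pt n m (x + e) (y + e') \<in> fst C"
    using cpt[of y] cpt[of "y + e'"] sz by simp_all
  ultimately have ends: "pt n m (x + e) y \<in> ?F" "pt n m (x + e) (y + e') \<in> ?F"
    using fc[OF _ _ wF] by blast+
  then have le: "Y \<le> y" "y + e' \<le> Y + E'" using dpt[of y] dpt[of "y + e'"] by blast+
  \<comment> \<open>If the edge of \<open>D\<close> were longer, the corner of \<open>C\<close>
    would be an inner point of it, and the face property would drag the far end of that edge into
    \<open>C\<close>.\<close>
  have Yy: "Y = y"
  proof (rule ccontr)
    assume "Y \<noteq> y"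
    then have "Y < y" using le by simp
    then have "pt n m (x + e) y \<in> open_segment (pt n m (x + e) Y) (pt n m (x + e) (y + e'))"
      by (intro pt_open_segment[OF f]) (use sz in auto)
    moreover have "pt n m (x + e) Y \<in> fst D" using dpt[of Y] szD by simp
    ultimately have "pt n m (x + e) Y \<in> ?F" using fd(1)[OF _ IntD2[OF ends(2)] ends(1)] by blast
    then show False using cpt[of Y] \<open>Y < y\<close> by simp
  qed
  have YE: "Y + E' = y + e'"
  proof (rule ccontr)
    assume "Y + E' \<noteq> y + e'"
    then have "y + e' < Y + E'" using le by simp
    then have "pt n m (x + e) (y + e') \<in> open_segment (pt n m (x + e) y) (pt n m (x + e) (Y + E'))"
      by (intro pt_open_segment[OF f]) (use sz in auto)
    moreover have "pt n m (x + e) (Y + E') \<in> fst D" using dpt[of "Y + E'"] szD by simp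
    ultimately have "pt n m (x + e) (Y + E') \<in> ?F" using fd(2)[OF IntD2[OF ends(1)] _ ends(2)] by blast
    then show False using cpt[of "Y + E'"] \<open>y + e' < Y + E'\<close> by simp
  qed
  have "E \<in> {2, 3}" using rD unfolding cell_rep_def by blast
  moreover have "fst D = reg n m (x + e) E y e'" using szD(6) Xe Yy YE by simp
  ultimately show ?thesis using D(1) by blast
qed

text \<open>\<open>Rg x x' y y'\<close>: the parallelogram \<open>[x, x'] \<times> [y, y']\<close> (in the coordinates of the frame) is a
  cell.\<close>

definition Rg :: "complex \<Rightarrow> complex \<Rightarrow> real \<Rightarrow> real \<Rightarrow> real \<Rightarrow> real \<Rightarrow> bool" where
  "Rg n m x x' y y' \<longleftrightarrow> x' - x \<in> {2, 3} \<and> y' - y \<in> {2, 3} \<and> (\<exists>C\<in>\<C>. fst C = reg n m x (x' - x) y (y' - y))"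

lemma reg_swap: "reg m n y f x e = reg n m x e y f"
  by (auto simp: reg_def)

lemma reg_uminus: "reg (- n) (- m) (- x - e) e (- y - f) f = reg n m x e y f"
  by (auto simp: reg_def)

lemma Rg_swap: "Rg m n y y' x x' \<longleftrightarrow> Rg n m x x' y y'"
  using reg_swap[of m n y "y' - y" x "x' - x"] unfolding Rg_def by auto

lemma Rg_uminus: "Rg (- n) (- m) (- x') (- x) (- y') (- y) \<longleftrightarrow> Rg n m x x' y y'"
  using reg_uminus[of n m x "x' - x" y "y' - y"] unfolding Rg_def by simp

context
  fixes n m
  assumes f: "frame n m"
    and fr: "\<And>C. C \<in> \<C> \<Longrightarrow> \<exists>x e y e' k0 k1 k2. cell_rep n m x e y e' k0 k1 k2 C"
begin

text \<open>Stated for an arbitrary frame, so that the neighbours in the other three directions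
  follow by exchanging or negating the normals.\<close>

lemma Rg_right_gen:
  assumes "\<And>C. C \<in> \<C> \<Longrightarrow> \<exists>x e y e' k0 k1 k2. cell_rep n' m' x e y e' k0 k1 k2 C" "Rg n' m' x x' y y'"
  shows "\<exists>x''. Rg n' m' x' x'' y y'"
proof -
  obtain C where C: "C \<in> \<C>" "fst C = reg n' m' x (x' - x) y (y' - y)" "x' - x \<in> {2, 3}" "y' - y \<in> {2, 3}"
    using assms(2) by (auto simp: Rg_def)
  then have "2 \<le> x' - x" "2 \<le> y' - y" by auto
  then obtain D e2 where "D \<in> \<C>" "e2 \<in> {2, 3}" "fst D = reg n' m' (x + (x' - x)) e2 y (y' - y)"
    using right_neighbor[OF assms(1) C(1,2)] by blast
  then have "Rg n' m' x' (x' + e2) y y'" using C unfolding Rg_def by auto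
  then show ?thesis by blast
qed

lemma fr_swap: "C \<in> \<C> \<Longrightarrow> \<exists>x e y e' k0 k1 k2. cell_rep m n x e y e' k0 k1 k2 C"
proof -
  assume "C \<in> \<C>"
  then obtain x e y e' k0 k1 k2 where "cell_rep n m x e y e' k0 k1 k2 C" using fr by blast
  then have "cell_rep m n y e' x e k0 k1 k2 C" by (rule cell_rep_swap)
  then show ?thesis by blast
qed

lemma fr_uminus: "C \<in> \<C> \<Longrightarrow> \<exists>x e y e' k0 k1 k2. cell_rep (- n) (- m) x e y e' k0 k1 k2 C"
proof -
  assume "C \<in> \<C>"
  then obtain x e y e' k0 k1 k2 where "cell_rep n m x e y e' k0 k1 k2 C" using fr by blast
  from cell_rep_uminus[OF this] show ?thesis by blast
qed

lemma fr_uminus_swap: "C \<in> \<C> \<Longrightarrow> \<exists>x e y e' k0 k1 k2. cell_rep (- m) (- n) x e y e' k0 k1 k2 C"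
proof -
  assume "C \<in> \<C>"
  then obtain x e y e' k0 k1 k2 where "cell_rep (- n) (- m) x e y e' k0 k1 k2 C" using fr_uminus by blast
  from cell_rep_swap[OF this] show ?thesis by blast
qed

lemma Rg_right: "Rg n m x x' y y' \<Longrightarrow> \<exists>x''. Rg n m x' x'' y y'"
  by (rule Rg_right_gen[OF fr])

lemma Rg_up: "Rg n m x x' y y' \<Longrightarrow> \<exists>y''. Rg n m x x' y' y''"
  using Rg_right_gen[OF fr_swap] Rg_swap by blast

lemma Rg_left: assumes "Rg n m x x' y y'" shows "\<exists>x0. Rg n m x0 x y y'"
proof -
  have "Rg (- n) (- m) (- x') (- x) (- y') (- y)" using assms Rg_uminus by blast
  then obtain z where "Rg (- n) (- m) (- x) z (- y') (- y)" using Rg_right_gen[OF fr_uminus] by blast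
  then have "Rg (- n) (- m) (- x) (- (- z)) (- y') (- y)" by simp
  then show ?thesis using Rg_uminus by blast
qed

lemma Rg_down: assumes "Rg n m x x' y y'" shows "\<exists>y0. Rg n m x x' y0 y"
proof -
  have "Rg (- m) (- n) (- y') (- y) (- x') (- x)" using assms Rg_uminus Rg_swap by blast
  then obtain z where "Rg (- m) (- n) (- y) z (- x') (- x)" using Rg_right_gen[OF fr_uminus_swap] by blast
  then have "Rg (- m) (- n) (- y) (- (- z)) (- x') (- x)" by simp
  then show ?thesis using Rg_uminus Rg_swap by blast
qed

lemma Rg_overlap:
  assumes "Rg n m x x' y y'" "Rg n m X X' Y Y'" "x < a" "a < x'" "y < b" "b < y'" "X < a" "a < X'" "Y < b" "b < Y'"
  shows "x = X \<and> x' = X' \<and> y = Y \<and> y' = Y'"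
proof -
  obtain C D where C: "C \<in> \<C>" "fst C = reg n m x (x' - x) y (y' - y)" and D: "D \<in> \<C>" "fst D = reg n m X (X' - X) Y (Y' - Y)"
    using assms(1,2) by (auto simp: Rg_def)
  have "pt n m a b \<in> interior (fst C)" unfolding C(2) interior_reg[OF f] using assms by (simp add: inner_pt[OF f])
  moreover have "pt n m a b \<in> fst D" unfolding D(2) reg_def using assms by (simp add: inner_pt[OF f])
  ultimately have "C = D" using interior_meets_imp_eq C(1) D(1) by blast
  then show ?thesis using reg_eq_iff[OF f, of x "x' - x" y "y' - y" X "X' - X" Y "Y' - Y"] C D assms by auto
qed

lemma Rg_size: "Rg n m x x' y y' \<Longrightarrow> x + 2 \<le> x' \<and> y + 2 \<le> y'"
  by (auto simp: Rg_def)

text \<open>One row and one column of cells through a starting cell determine the coordinates. The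
  rest is filled in row by row, working outwards from the known column.\<close>

lemma grid_exists:
  obtains a b :: "int \<Rightarrow> real" where "\<And>i j. Rg n m (a i) (a (i + 1)) (b j) (b (j + 1))"
proof -
  obtain C0 where C0: "C0 \<in> \<C>" using cover by blast
  obtain x e y e' k0 k1 k2 where r0: "cell_rep n m x e y e' k0 k1 k2 C0" using fr[OF C0] by blast
  have R0: "Rg n m x (x + e) y (y + e')"
  proof -
    have "e \<in> {2, 3}" "e' \<in> {2, 3}" using r0 unfolding cell_rep_def by blast+
    then show ?thesis using C0 cell_rep_sizes(6)[OF r0] unfolding Rg_def by (intro conjI bexI[of _ C0]) simp_all
  qed
  obtain a :: "int \<Rightarrow> real" where a: "\<And>i. Rg n m (a i) (a (i + 1)) y (y + e')" "a 0 = x" "a 1 = x + e"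
    by (rule dependent_int_choice[of "\<lambda>u v. Rg n m u v y (y + e')" x "x + e"]) (use R0 Rg_right Rg_left in blast)+
  obtain b :: "int \<Rightarrow> real" where b: "\<And>j. Rg n m x (x + e) (b j) (b (j + 1))" "b 0 = y" "b 1 = y + e'"
    by (rule dependent_int_choice[of "\<lambda>u v. Rg n m x (x + e) u v" y "y + e'"]) (use R0 Rg_up Rg_down in blast)+
  \<comment> \<open>The upper neighbour of one cell and the right neighbour of the other overlap
    near the common corner, so they are the same cell, which inherits both of its extents. The three
    variants below treat the other corners.\<close>
  have ur: "Rg n m x2 x3 y2 y3" if h1: "Rg n m x2 x3 y1 y2" and h2: "Rg n m x1 x2 y2 y3" for x1 x2 x3 y1 y2 y3
  proof -
    obtain Y where Y: "Rg n m x2 x3 y2 Y" using Rg_up[OF h1] by blast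
    obtain X where X: "Rg n m x2 X y2 y3" using Rg_right[OF h2] by blast
    show ?thesis using Rg_overlap[OF Y X, of "x2 + 1" "y2 + 1"] Y Rg_size[OF X] Rg_size[OF Y] by auto
  qed
  have ul: "Rg n m x0 x1 y2 y3" if h1: "Rg n m x0 x1 y1 y2" and h2: "Rg n m x1 x2 y2 y3" for x0 x1 x2 y1 y2 y3
  proof -
    obtain Y where Y: "Rg n m x0 x1 y2 Y" using Rg_up[OF h1] by blast
    obtain X where X: "Rg n m X x1 y2 y3" using Rg_left[OF h2] by blast
    show ?thesis using Rg_overlap[OF Y X, of "x1 - 1" "y2 + 1"] Y Rg_size[OF X] Rg_size[OF Y] by auto
  qed
  have dr: "Rg n m x2 x3 y0 y1" if h1: "Rg n m x2 x3 y1 y2" and h2: "Rg n m x1 x2 y0 y1" for x1 x2 x3 y0 y1 y2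
  proof -
    obtain Y where Y: "Rg n m x2 x3 Y y1" using Rg_down[OF h1] by blast
    obtain X where X: "Rg n m x2 X y0 y1" using Rg_right[OF h2] by blast
    show ?thesis using Rg_overlap[OF Y X, of "x2 + 1" "y1 - 1"] Y Rg_size[OF X] Rg_size[OF Y] by auto
  qed
  have dl: "Rg n m x0 x1 y0 y1" if h1: "Rg n m x0 x1 y1 y2" and h2: "Rg n m x1 x2 y0 y1" for x0 x1 x2 y0 y1 y2
  proof -
    obtain Y where Y: "Rg n m x0 x1 Y y1" using Rg_down[OF h1] by blast
    obtain X where X: "Rg n m X x1 y0 y1" using Rg_left[OF h2] by blast
    show ?thesis using Rg_overlap[OF Y X, of "x1 - 1" "y1 - 1"] Y Rg_size[OF X] Rg_size[OF Y] by auto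
  qed
  have b0: "Rg n m (a 0) (a (0 + 1)) (b j) (b (j + 1))" for j using a b by simp
  have row_up: "\<forall>i. Rg n m (a i) (a (i + 1)) (b (j + 1)) (b (j + 1 + 1))" if row: "\<forall>i. Rg n m (a i) (a (i + 1)) (b j) (b (j + 1))" for j
  proof
    fix i show "Rg n m (a i) (a (i + 1)) (b (j + 1)) (b (j + 1 + 1))"
    proof (induction i rule: int_induct[of _ 0])
      case base then show ?case by (rule b0)
    next
      case (step1 i) show ?case by (rule ur[OF row[rule_format] step1(2)])
    next
      case (step2 i)
      have "Rg n m (a (i - 1)) (a i) (b j) (b (j + 1))" using row[rule_format, of "i - 1"] by simp
      from ul[OF this step2(2)] show ?case by simp
    qed
  qed
  have row_down: "\<forall>i. Rg n m (a i) (a (i + 1)) (b (j - 1)) (b j)" if row: "\<forall>i. Rg n m (a i) (a (i + 1)) (b j) (b (j + 1))" for j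
  proof
    fix i show "Rg n m (a i) (a (i + 1)) (b (j - 1)) (b j)"
    proof (induction i rule: int_induct[of _ 0])
      case base then show ?case using b0[of "j - 1"] by simp
    next
      case (step1 i) show ?case by (rule dr[OF row[rule_format] step1(2)])
    next
      case (step2 i)
      have "Rg n m (a (i - 1)) (a i) (b j) (b (j + 1))" using row[rule_format, of "i - 1"] by simp
      from dl[OF this step2(2)] show ?case by simp
    qed
  qed
  have "\<forall>i. Rg n m (a i) (a (i + 1)) (b j) (b (j + 1))" for j
  proof (induction j rule: int_induct[of _ 0])
    case base then show ?case using a(1) b by simp
  next
    case (step1 j) show ?case by (rule row_up[OF step1(2)])
  next
    case (step2 j) from row_down[OF step2(2)] show ?case by simp
  qed
  then have "Rg n m (a i) (a (i + 1)) (b j) (b (j + 1))" for i j by blast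
  then show ?thesis by (rule that)
qed

end

end

section \<open>Bar levels on the grid\<close>

lemma bracket_real_seq:
  fixes a :: "int \<Rightarrow> real"
  assumes "\<And>i. a i + 2 \<le> a (i + 1)"
  obtains i where "a i \<le> x" "x < a (i + 1)"
proof -
  have up: "a 0 + real N \<le> a (int N)" for N
  proof (induction N)
    case (Suc N)
    then show ?case using assms[of "int N"] by (simp add: add.commute)
  qed simp
  have dn: "a (- int N) \<le> a 0 - real N" for N
  proof (induction N)
    case (Suc N)
    have e: "- int (Suc N) = - int N - 1" by simp
    show ?case using Suc assms[of "- int N - 1"] unfolding e by simp
  qed simp
  obtain N :: nat where N: "\<bar>x - a 0\<bar> < real N" using reals_Archimedean2 by blast
  have "a (- int N) \<le> x" "\<not> a (int N) \<le> x" "- int N < int N"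
    using up[of N] dn[of N] N by (auto simp: abs_less_iff)
  then obtain j where "a j \<le> x" "\<not> a (j + 1) \<le> x" by (rule int_switch[of "\<lambda>j. a j \<le> x"])
  then show ?thesis using that by simp
qed

text \<open>Lengths depend on heights through the same quadratic form in every frame, so matching
  the heights over two frames gives an isometry, possibly a reflection.\<close>

lemma frame_isometry:
  assumes "frame n m"
  defines "g \<equiv> \<lambda>p. pt n m (nrm 0 \<bullet> p) (nrm 1 \<bullet> p)"
  shows "isometry g" "g ` {p. P (nrm 0 \<bullet> p) (nrm 1 \<bullet> p)} = {q. P (n \<bullet> q) (m \<bullet> q)}"
proof -
  have ip: "n \<bullet> g p = nrm 0 \<bullet> p" "m \<bullet> g p = nrm 1 \<bullet> p" for p
    unfolding g_def by (rule inner_pt[OF assms(1)])+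
  have "(dist (g p) (g q))\<^sup>2 = (dist p q)\<^sup>2" for p q
  proof -
    have d: "n \<bullet> (g p - g q) = nrm 0 \<bullet> (p - q)" "m \<bullet> (g p - g q) = nrm 1 \<bullet> (p - q)"
      by (simp_all only: inner_diff_right ip)
    have "(g p - g q) \<bullet> (g p - g q) = (p - q) \<bullet> (p - q)"
      unfolding frame_norm[OF assms(1), of "g p - g q"] frame_norm[OF frame_nrm(1), of "p - q"] d ..
    then show ?thesis by (simp add: dist_norm power2_norm_eq_inner)
  qed
  then show "isometry g" unfolding isometry_def by (simp add: power2_eq_iff_nonneg)
  show "g ` {p. P (nrm 0 \<bullet> p) (nrm 1 \<bullet> p)} = {q. P (n \<bullet> q) (m \<bullet> q)}"
  proof (intro set_eqI iffI)
    fix q assume q: "q \<in> {q. P (n \<bullet> q) (m \<bullet> q)}"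
    let ?p = "pt (nrm 0) (nrm 1) (n \<bullet> q) (m \<bullet> q)"
    have 1: "q = g ?p" unfolding g_def inner_pt[OF frame_nrm(1)] by (rule pt_inner[OF assms(1), symmetric])
    have 2: "?p \<in> {p. P (nrm 0 \<bullet> p) (nrm 1 \<bullet> p)}" using q unfolding mem_Collect_eq inner_pt[OF frame_nrm(1)] .
    show "q \<in> g ` {p. P (nrm 0 \<bullet> p) (nrm 1 \<bullet> p)}" by (rule image_eqI[where f = g and x = ?p, OF 1 2])
  qed (auto simp only: mem_Collect_eq ip)
qed

lemma frame_isometry_cell:
  assumes "frame n m"
  defines "g \<equiv> \<lambda>p. pt n m (nrm 0 \<bullet> p) (nrm 1 \<bullet> p)"
  shows "move_cell g (reg (nrm 0) (nrm 1) x e y e', {p \<in> reg (nrm 0) (nrm 1) x e y e'. (nrm 0 + nrm 1) \<bullet> p \<in> K}) =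
    (reg n m x e y e', {p \<in> reg n m x e y e'. (n + m) \<bullet> p \<in> K})"
  unfolding g_def reg_def mem_Collect_eq inner_add_left case_prod_conv
    frame_isometry(2)[OF assms(1), of "\<lambda>X Y. x \<le> X \<and> X \<le> x + e \<and> y \<le> Y \<and> Y \<le> y + e'"]
    frame_isometry(2)[OF assms(1), of "\<lambda>X Y. (x \<le> X \<and> X \<le> x + e \<and> y \<le> Y \<and> Y \<le> y + e') \<and> X + Y \<in> K"] ..

context bar_tiling
begin

text \<open>A bar is a full line and crosses every cell whose open range of levels contains its own;
  a point in the interior of a cell is covered by that cell only, so the cell must carry the bar
  itself.\<close>

lemma bar_height_propagates:
  assumes D: "D \<in> \<C>" "p \<in> snd D" and rD: "cell_rep n m x' e1 y' e1' l0 l1 l2 D"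
    and C: "C \<in> \<C>" and rC: "cell_rep n m x e y e' k0 k1 k2 C"
    and v: "x + y < (n + m) \<bullet> p" "(n + m) \<bullet> p < x + e + (y + e')"
  shows "(n + m) \<bullet> p \<in> {k0, k1, k2}"
proof -
  note sz = cell_rep_sizes[OF rC]
  let ?k = "(n + m) \<bullet> p"
  define u where "u = (?k - (x + y)) / (e + e')"
  have u: "0 < u" "u < 1" "u * (e + e') = ?k - (x + y)" using v sz by (auto simp: u_def field_simps)
  let ?q = "pt n m (x + u * e) (y + u * e')"
  have ips: "n \<bullet> ?q = x + u * e" "m \<bullet> ?q = y + u * e'" using inner_pt[OF sz(1)] by auto
  have k: "(n + m) \<bullet> ?q = ?k" unfolding inner_add_left[of n m ?q] ips using u(3) by (simp add: algebra_simps)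
  have q: "?q \<in> interior (fst C)" unfolding sz(6) interior_reg[OF sz(1)] using u sz by (simp add: ips)
  have "?q \<in> (\<Union>C\<in>\<C>. snd C)" by (rule bar_point_line[OF D rD k])
  then obtain E where E: "E \<in> \<C>" "?q \<in> snd E" by blast
  then have "C = E" using interior_meets_imp_eq[OF C E(1) q] regular(4) by blast
  then show ?thesis using E(2) sz(7) k by simp
qed

text \<open>The grid gives two line families; it remains to merge the levels of all cells into one
  sequence indexed by \<open>i + j\<close>. The middle level always lies inside its cell and can be
  followed, while the outer levels may fall outside and have to be identified with middle levels of
  neighbours.\<close>

theorem lattice_structure:
  "\<exists>g a b c. isometry g \<and> two_color_lattice 2 a b c \<and> \<C> = move_cell g ` range (lattice_cell a b c)"
proof -
  obtain n m where f: "frame n m" and fr: "\<And>C. C \<in> \<C> \<Longrightarrow> \<exists>x e y e' k0 k1 k2. cell_rep n m x e y e' k0 k1 k2 C"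
    by (rule common_frame) blast
  obtain a b :: "int \<Rightarrow> real" where ab: "\<And>i j. Rg n m (a i) (a (i + 1)) (b j) (b (j + 1))"
    using grid_exists[OF f fr] by blast
  have ga: "a (i + 1) - a i \<in> {2, 3}" and gb: "b (j + 1) - b j \<in> {2, 3}" for i j
    using ab[of i j] by (auto simp: Rg_def)
  have sa: "a i + 2 \<le> a (i + 1)" and sb: "b j + 2 \<le> b (j + 1)" for i j using ga[of i] gb[of j] by auto
  define Q where "Q i j t \<longleftrightarrow> (case t of (C, k0, k1, k2) \<Rightarrow> C \<in> \<C> \<and>
    cell_rep n m (a i) (a (i + 1) - a i) (b j) (b (j + 1) - b j) k0 k1 k2 C)" for i j t
  have "\<exists>t. Q i j t" for i j
  proof -
    obtain C where C: "C \<in> \<C>" "fst C = reg n m (a i) (a (i + 1) - a i) (b j) (b (j + 1) - b j)"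
      using ab[of i j] by (auto simp: Rg_def)
    obtain x e y e' k0 k1 k2 where r: "cell_rep n m x e y e' k0 k1 k2 C" using fr[OF C(1)] by blast
    have "x = a i \<and> e = a (i + 1) - a i \<and> y = b j \<and> e' = b (j + 1) - b j"
      using cell_rep_sizes[OF r] C(2) sa[of i] sb[of j] by (intro reg_eq_iff[OF f]) auto
    then have "Q i j (C, k0, k1, k2)" using r C(1) by (simp add: Q_def)
    then show ?thesis by blast
  qed
  then obtain t where Qt: "\<And>i j. Q i j (t i j)" by metis
  define Ce where "Ce i j = fst (t i j)" for i j
  define K0 where "K0 i j = fst (snd (t i j))" for i j
  define K1 where "K1 i j = fst (snd (snd (t i j)))" for i j
  define K2 where "K2 i j = snd (snd (snd (t i j)))" for i j
  have Ce: "Ce i j \<in> \<C>" and r: "cell_rep n m (a i) (a (i + 1) - a i) (b j) (b (j + 1) - b j) (K0 i j) (K1 i j) (K2 i j) (Ce i j)" for i j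
    using Qt[of i j] unfolding Q_def Ce_def K0_def K1_def K2_def by (auto simp: case_prod_beta)
  have k: "\<bar>K0 i j - (a i + b j)\<bar> = 1 / 2" "\<bar>K1 i j - (a (i + 1) + b j)\<bar> = 1 / 2" "\<bar>K1 i j - (a i + b (j + 1))\<bar> = 1 / 2"
    "\<bar>K2 i j - (a (i + 1) + b (j + 1))\<bar> = 1 / 2" "K1 i j - K0 i j \<in> {2, 3}" "K2 i j - K1 i j \<in> {2, 3}" for i j
    using r[of i j] unfolding cell_rep_def by (simp_all add: algebra_simps)
  have kg: "K0 i j + 2 \<le> K1 i j" "K1 i j + 2 \<le> K2 i j" for i j using k(5,6)[of i j] by auto
  have all: "\<exists>i j. C = Ce i j" if C: "C \<in> \<C>" for C
  proof -
    obtain x e y e' k0 k1 k2 where rC: "cell_rep n m x e y e' k0 k1 k2 C" using fr[OF C] by blast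
    note sz = cell_rep_sizes[OF rC]
    obtain i where i: "a i \<le> x + 1" "x + 1 < a (i + 1)" using bracket_real_seq[of a, OF sa] by blast
    obtain j where j: "b j \<le> y + 1" "y + 1 < b (j + 1)" using bracket_real_seq[of b, OF sb] by blast
    have "pt n m (x + 1) (y + 1) \<in> interior (fst C)" unfolding sz(6) interior_reg[OF f] using sz by (simp add: inner_pt[OF f])
    moreover have "pt n m (x + 1) (y + 1) \<in> fst (Ce i j)"
      unfolding cell_rep_sizes(6)[OF r] reg_def using i j by (simp add: inner_pt[OF f])
    ultimately show ?thesis using interior_meets_imp_eq[OF C Ce] by blast
  qed
  have propag: "v \<in> {K0 i j, K1 i j, K2 i j}"
    if v: "v \<in> {K0 i' j', K1 i' j', K2 i' j'}" "a i' + b j' < v" "v < a (i' + 1) + b (j' + 1)"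
      "a i + b j < v" "v < a (i + 1) + b (j + 1)" for v i j i' j'
  proof -
    obtain p where p: "p \<in> snd (Ce i' j')" "(n + m) \<bullet> p = v"
      using bar_exists[OF r, of v i' j'] v by auto
    then show ?thesis using bar_height_propagates[OF Ce p(1) r Ce r, of i j] v by simp
  qed
  have K1in: "a i + b j < K1 i j" "K1 i j < a (i + 1) + b (j + 1)" for i j
    using middle_bar[OF r, of i j] by simp_all
  have sa': "a (i - 1) + 2 \<le> a i" and k2': "\<bar>K1 (i - 1) j - (a i + b j)\<bar> = 1 / 2"
    and K1in': "K1 (i - 1) j < a i + b (j + 1)" for i j
    using sa[of "i - 1"] k(2)[of "i - 1" j] K1in[of "i - 1" j] by simp_all
  \<comment> \<open>Both levels are within 1 / 2 of the corner shared by the two cells. The level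
    propagates into the diagonal neighbour, whose levels are at least 2 apart, so it can only be the
    middle one there.\<close>
  have diag: "K1 i j = K1 (i - 1) (j + 1)" for i j
  proof -
    have "K1 i j \<in> {K0 (i - 1) (j + 1), K1 (i - 1) (j + 1), K2 (i - 1) (j + 1)}"
    proof (rule propag[of _ i j])
      show "a (i - 1) + b (j + 1) < K1 i j" using k(3)[of i j] sa'[of i] by linarith
      have "K1 i j < a i + b (j + 1 + 1)" using k(3)[of i j] sb[of "j + 1"] by linarith
      then show "K1 i j < a (i - 1 + 1) + b (j + 1 + 1)" by simp
    qed (use K1in[of i j] in auto)
    moreover have "\<bar>K1 i j - K1 (i - 1) (j + 1)\<bar> \<le> 1" using k(3)[of i j] k2'[of i "j + 1"] by linarith
    ultimately show ?thesis using kg[of "i - 1" "j + 1"] by auto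
  qed
  have K1sum: "K1 i j = K1 0 (i + j)" for i j
  proof (induction i arbitrary: j rule: int_induct[of _ 0])
    case (step1 i)
    then show ?case using diag[of "i + 1" j] step1(2)[of "j + 1"] by (simp add: algebra_simps)
  next
    case (step2 i)
    have "K1 i (j - 1) = K1 (i - 1) j" using diag[of i "j - 1"] by simp
    then show ?case using step2(2)[of "j - 1"] by (simp add: algebra_simps)
  qed simp
  \<comment> \<open>Both levels are \<open>a i + b j\<close> up to 1 / 2. If either is the larger
    value, it lies inside the range of both cells, propagates to the other one and is too close to
    any level but the right one. Otherwise both have the smaller value.\<close>
  have K0eq: "K0 i j = K1 (i - 1) j" for i j
  proof (cases "K1 (i - 1) j = a i + b j + 1 / 2")
    case True
    have "K1 (i - 1) j \<in> {K0 i j, K1 i j, K2 i j}"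
    proof (rule propag[of _ "i - 1" j])
      show "K1 (i - 1) j < a (i + 1) + b (j + 1)" "a i + b j < K1 (i - 1) j" using True sa[of i] sb[of j] by linarith+
    qed (use K1in[of "i - 1" j] in auto)
    moreover have "\<bar>K1 (i - 1) j - K0 i j\<bar> \<le> 1" using True k(1)[of i j] by linarith
    ultimately show ?thesis using kg[of i j] by auto
  next
    case False
    then have u: "K1 (i - 1) j = a i + b j - 1 / 2" using k2'[of i j] by linarith
    show ?thesis
    proof (rule ccontr)
      assume "K0 i j \<noteq> K1 (i - 1) j"
      then have k0: "K0 i j = a i + b j + 1 / 2" using u k(1)[of i j] by linarith
      have "K0 i j \<in> {K0 (i - 1) j, K1 (i - 1) j, K2 (i - 1) j}"
      proof (rule propag[of _ i j])
        show "a i + b j < K0 i j" "K0 i j < a (i + 1) + b (j + 1)" "a (i - 1) + b j < K0 i j"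
          using k0 sa[of i] sb[of j] sa'[of i] by linarith+
        have "K0 i j < a i + b (j + 1)" using k0 sb[of j] by linarith
        then show "K0 i j < a (i - 1 + 1) + b (j + 1)" by simp
      qed simp
      then show False using u k0 kg[of "i - 1" j] by auto
    qed
  qed
  have K2eq: "K2 i j = K1 i (j + 1)" for i j
  proof (cases "K1 i (j + 1) = a (i + 1) + b (j + 1) - 1 / 2")
    case True
    have "K1 i (j + 1) \<in> {K0 i j, K1 i j, K2 i j}"
    proof (rule propag[of _ i "j + 1"])
      show "a i + b j < K1 i (j + 1)" "K1 i (j + 1) < a (i + 1) + b (j + 1)" using True sa[of i] sb[of j] by linarith+
    qed (use K1in[of i "j + 1"] in auto)
    moreover have "\<bar>K1 i (j + 1) - K2 i j\<bar> \<le> 1" using True k(4)[of i j] by linarith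
    ultimately show ?thesis using kg[of i j] by auto
  next
    case False
    then have u: "K1 i (j + 1) = a (i + 1) + b (j + 1) + 1 / 2" using k(2)[of i "j + 1"] by linarith
    show ?thesis
    proof (rule ccontr)
      assume "K2 i j \<noteq> K1 i (j + 1)"
      then have k2: "K2 i j = a (i + 1) + b (j + 1) - 1 / 2" using u k(4)[of i j] by linarith
      have "K2 i j \<in> {K0 i (j + 1), K1 i (j + 1), K2 i (j + 1)}"
      proof (rule propag[of _ i j])
        show "a i + b j < K2 i j" "K2 i j < a (i + 1) + b (j + 1)" "a i + b (j + 1) < K2 i j"
          "K2 i j < a (i + 1) + b (j + 1 + 1)"
          using k2 sa[of i] sb[of j] sb[of "j + 1"] by linarith+
      qed simp
      then show False using u k2 kg[of i "j + 1"] by auto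
    qed
  qed
  \<comment> \<open>The sign comes from the third normal being \<open>- nrm 0 - nrm 1\<close>; the
    shift by 1 makes \<open>K1 i j\<close> the bar of index \<open>- i - j - 1\<close>.\<close>
  define c where "c l = - K1 0 (- l - 1)" for l :: int
  have c: "- c (- i - j) = K0 i j" "- c (- i - j - 1) = K1 i j" "- c (- i - j - 2) = K2 i j" for i j
    using K0eq[of i j] K1sum[of "i - 1" j] K1sum[of i j] K2eq[of i j] K1sum[of i "j + 1"]
    by (simp_all add: c_def algebra_simps)
  have lat: "two_color_lattice 2 a b c"
    unfolding two_color_lattice_2_iff
  proof (intro conjI allI impI ballI)
    fix i j l :: int assume "i + j + l = 0"
    then have "l = - i - j" by simp
    then have "c l = - K0 i j" using c(1)[of i j] by simp
    then show "\<bar>a i + b j + c l\<bar> = 1 / 2" using k(1)[of i j] by (simp add: abs_if split: if_splits)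
  next
    fix h i assume "h \<in> {a, b, c}"
    moreover have "c (i + 1) - c i = K1 (- i - 1) 0 - K0 (- i - 1) 0"
    proof -
      have "- (- i - 1) - 0 = i + 1" "- (- i - 1) - 0 - 1 = i" by simp_all
      then have "- c (i + 1) = K0 (- i - 1) 0" "- c i = K1 (- i - 1) 0" using c(1,2)[of "- i - 1" 0] by metis+
      then show ?thesis by linarith
    qed
    then have "c (i + 1) - c i \<in> {2, 3}" using k(5)[of "- i - 1" 0] by metis
    ultimately show "h (i + 1) - h i \<in> {2, 3}" using ga[of i] gb[of i] by auto
  qed
  let ?g = "\<lambda>p. pt n m (nrm 0 \<bullet> p) (nrm 1 \<bullet> p)"
  have mc: "move_cell ?g (lattice_cell a b c (i, j)) = Ce i j" for i j
  proof -
    have "lattice_cell a b c (i, j) = (reg (nrm 0) (nrm 1) (a i) (a (i + 1) - a i) (b j) (b (j + 1) - b j),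
       {p \<in> reg (nrm 0) (nrm 1) (a i) (a (i + 1) - a i) (b j) (b (j + 1) - b j). (nrm 0 + nrm 1) \<bullet> p \<in> {K0 i j, K1 i j, K2 i j}})"
      using lattice_cell_rep[OF lat, of i j] unfolding cell_rep_def c by blast
    moreover have "Ce i j = (reg n m (a i) (a (i + 1) - a i) (b j) (b (j + 1) - b j),
       {p \<in> reg n m (a i) (a (i + 1) - a i) (b j) (b (j + 1) - b j). (n + m) \<bullet> p \<in> {K0 i j, K1 i j, K2 i j}})"
      using r[of i j] unfolding cell_rep_def by blast
    ultimately show ?thesis by (simp only: frame_isometry_cell[OF f])
  qed
  have "\<C> = move_cell ?g ` range (lattice_cell a b c)"
  proof (intro set_eqI iffI)
    fix C assume "C \<in> \<C>"
    then obtain i j where "C = move_cell ?g (lattice_cell a b c (i, j))" using all mc by metis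
    then show "C \<in> move_cell ?g ` range (lattice_cell a b c)" by (simp only: image_eqI rangeI)
  next
    fix C assume "C \<in> move_cell ?g ` range (lattice_cell a b c)"
    then obtain ij where "C = move_cell ?g (lattice_cell a b c ij)" by blast
    then show "C \<in> \<C>" using mc Ce by (cases ij) simp
  qed
  then show ?thesis using frame_isometry(1)[OF f] lat by blast
qed

end

section \<open>Slopes of tilings by patch-tiles\<close>

lemma isometry_interior_image:
  assumes "isometry g"
  shows "interior (g ` S) = g ` interior S"
proof -
  have cont: "continuous_on UNIV h" if "isometry h" for h
    using that unfolding continuous_on_iff isometry_def by auto
  have op: "open (h ` S)" if h: "isometry h" "open S" for h S
  proof -
    have "h ` S = inv h -` S"
      using isometry_bij[OF h(1)] by (simp add: bij_vimage_eq_inv_image bij_imp_bij_inv inv_inv_eq)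
    then show ?thesis using cont[OF isometry_inv[OF h(1)]] h(2) by (simp add: open_vimage)
  qed
  have b: "bij g" by (rule isometry_bij[OF assms])
  show ?thesis
  proof
    show "g ` interior S \<subseteq> interior (g ` S)"
      by (intro interior_maximal image_mono interior_subset op[OF assms] open_interior)
    have "inv g ` interior (g ` S) \<subseteq> interior (inv g ` g ` S)"
      by (intro interior_maximal image_mono interior_subset op[OF isometry_inv[OF assms]] open_interior)
    also have "inv g ` g ` S = S" using b by (simp only: image_inv_f_f[OF bij_is_inj])
    finally have "g ` inv g ` interior (g ` S) \<subseteq> g ` interior S" by (rule image_mono)
    then show "interior (g ` S) \<subseteq> g ` interior S" using b by (simp only: image_f_inv_f[OF bij_is_surj])
  qed
qed

lemma lattice_mono:
  fixes f :: "int \<Rightarrow> real"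
  assumes "\<And>i. f (i + 1) - f i \<in> {2, 3::real}" "i < j"
  shows "f (i + 1) \<le> f j" "f i + 2 \<le> f j"
proof -
  have s: "f i + 2 \<le> f (i + 1)" for i using assms(1)[of i] by auto
  have "f (i + 1) + 2 * real_of_int (j - (i + 1)) \<le> f j" using lattice_gaps[of f "i + 1" j, OF assms(1)] assms(2) by simp
  moreover have "0 \<le> 2 * real_of_int (j - (i + 1))" using assms(2) by simp
  ultimately show "f (i + 1) \<le> f j" by linarith
  then show "f i + 2 \<le> f j" using s[of i] by linarith
qed

lemma lattice_regions_disjoint:
  assumes lat: "two_color_lattice 2 a b c" and "ij \<noteq> ij'"
  shows "interior (lattice_region a b ij) \<inter> interior (lattice_region a b ij') = {}"
proof -
  obtain i j i' j' where ij: "ij = (i, j)" "ij' = (i', j')" by (metis surj_pair)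
  have ga: "a (i + 1) - a i \<in> {2, 3}" and gb: "b (j + 1) - b j \<in> {2, 3}" for i j
    using lat unfolding two_color_lattice_2_iff by auto
  have R: "lattice_region a b (i, j) = reg (nrm 0) (nrm 1) (a i) (a (i + 1) - a i) (b j) (b (j + 1) - b j)" for i j
    using cell_rep_sizes(6)[OF lattice_cell_rep[OF lat, of i j]] by (simp add: lattice_cell_def)
  consider "i < i'" | "i' < i" | "j < j'" | "j' < j" using assms(2) ij by fastforce
  then show ?thesis
  proof cases
    case 1
    from lattice_mono(1)[of a, OF ga this] show ?thesis unfolding ij R interior_reg[OF frame_nrm(1)] by auto
  next
    case 2
    from lattice_mono(1)[of a, OF ga this] show ?thesis unfolding ij R interior_reg[OF frame_nrm(1)] by auto
  next
    case 3
    from lattice_mono(1)[of b, OF gb this] show ?thesis unfolding ij R interior_reg[OF frame_nrm(1)] by auto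
  next
    case 4
    from lattice_mono(1)[of b, OF gb this] show ?thesis unfolding ij R interior_reg[OF frame_nrm(1)] by auto
  qed
qed

lemma moved_cells_disjoint:
  assumes lat: "two_color_lattice 2 a b c" and g: "isometry g" and "ij \<noteq> ij'"
  shows "interior (fst (move_cell g (lattice_cell a b c ij))) \<inter> interior (fst (move_cell g (lattice_cell a b c ij'))) = {}"
    (is "interior (fst ?C) \<inter> interior (fst ?D) = {}")
proof -
  have "fst ?C = g ` lattice_region a b ij" "fst ?D = g ` lattice_region a b ij'"
    by (simp_all add: lattice_cell_def)
  then have "interior (fst ?C) \<inter> interior (fst ?D) = g ` (interior (lattice_region a b ij) \<inter> interior (lattice_region a b ij'))"
    using isometry_bij[OF g] by (simp add: isometry_interior_image[OF g] image_Int bij_is_inj)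
  then show ?thesis using lattice_regions_disjoint[OF lat assms(3)] by simp
qed

lemma moved_cell_rep:
  assumes lat: "two_color_lattice 2 a b c" and g: "isometry g"
  shows "\<exists>n m x y k0 k1 k2. cell_rep n m x (a (i + 1) - a i) y (b (j + 1) - b j) k0 k1 k2 (move_cell g (lattice_cell a b c (i, j)))"
  using cell_rep_move[OF lattice_cell_rep[OF lat] g] by metis

lemma moved_cell_nonempty:
  assumes lat: "two_color_lattice 2 a b c" and g: "isometry g"
  shows "interior (fst (move_cell g (lattice_cell a b c ij))) \<noteq> {}"
proof -
  obtain i j where ij: "ij = (i, j)" by (cases ij)
  obtain n m x y k0 k1 k2 where r: "cell_rep n m x (a (i + 1) - a i) y (b (j + 1) - b j) k0 k1 k2 (move_cell g (lattice_cell a b c ij))"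
    unfolding ij using moved_cell_rep[OF lat g] by blast
  note sz = cell_rep_sizes[OF r]
  have "pt n m (x + 1) (y + 1) \<in> interior (fst (move_cell g (lattice_cell a b c ij)))"
    unfolding sz(6) interior_reg[OF sz(1)] using sz by (simp add: inner_pt)
  then show ?thesis by blast
qed

lemma inj_moved_cell:
  assumes lat: "two_color_lattice 2 a b c" and g: "isometry g"
  shows "inj (\<lambda>ij. move_cell g (lattice_cell a b c ij))"
proof (rule injI)
  fix ij ij' assume eq: "move_cell g (lattice_cell a b c ij) = move_cell g (lattice_cell a b c ij')"
  show "ij = ij'"
  proof (rule ccontr)
    assume "ij \<noteq> ij'"
    from moved_cells_disjoint[OF lat g this] show False
      unfolding eq using moved_cell_nonempty[OF lat g, of ij'] by simp
  qed
qed

text \<open>The sum of the two widths is an invariant of a cell, since it can be read off its diameter.\<close>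

lemma cell_rep_size_unique:
  assumes r: "cell_rep n m x e y e' k0 k1 k2 C" and r': "cell_rep n' m' x' f y' f' l0 l1 l2 C"
  shows "e + e' = f + f'"
proof -
  note sz = cell_rep_sizes[OF r] and sz' = cell_rep_sizes[OF r']
  obtain p q where "p \<in> fst C" "q \<in> fst C" "(dist p q)\<^sup>2 = 4 / 3 * (e\<^sup>2 + e * e' + e'\<^sup>2)"
    using reg_dist_max(1)[OF sz(1), of e e' x y] sz by auto
  then have 1: "e\<^sup>2 + e * e' + e'\<^sup>2 \<le> f\<^sup>2 + f * f' + f'\<^sup>2"
    using reg_dist_max(2)[OF sz'(1), of f f' p x' y' q] sz' by auto
  obtain p q where "p \<in> fst C" "q \<in> fst C" "(dist p q)\<^sup>2 = 4 / 3 * (f\<^sup>2 + f * f' + f'\<^sup>2)"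
    using reg_dist_max(1)[OF sz'(1), of f f' x' y'] sz' by auto
  then have 2: "f\<^sup>2 + f * f' + f'\<^sup>2 \<le> e\<^sup>2 + e * e' + e'\<^sup>2"
    using reg_dist_max(2)[OF sz(1), of e e' p x y q] sz by auto
  have "e \<in> {2, 3}" "e' \<in> {2, 3}" "f \<in> {2, 3}" "f' \<in> {2, 3}" using r r' unfolding cell_rep_def by blast+
  then show ?thesis using 1 2 by auto
qed

text \<open>A tile of a tiling does not record the lattice it came from, so the size is chosen from
  any description; \<open>cell_rep_size_unique\<close> makes it well defined.\<close>

definition csize :: "cell \<Rightarrow> real" where
  "csize C = (SOME s. \<exists>n m x e y e' k0 k1 k2. cell_rep n m x e y e' k0 k1 k2 C \<and> s = e + e')"

lemma csize_eq:
  assumes "cell_rep n m x e y e' k0 k1 k2 C"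
  shows "csize C = e + e'"
  unfolding csize_def using assms cell_rep_size_unique[OF _ assms] by (intro some_equality) blast+

abbreviation ltype :: "(int \<Rightarrow> real) \<Rightarrow> (int \<Rightarrow> real) \<Rightarrow> int \<times> int \<Rightarrow> nat" where
  "ltype a b \<equiv> ctype (gap_word 2 a) (gap_word 2 b)"

lemma csize_moved_cell:
  assumes lat: "two_color_lattice 2 a b c" and g: "isometry g"
  shows "csize (move_cell g (lattice_cell a b c ij)) = 4 + real (ltype a b ij)"
proof -
  obtain i j where ij: "ij = (i, j)" by (cases ij)
  have ga: "a (i + 1) - a i \<in> {2, 3}" and gb: "b (j + 1) - b j \<in> {2, 3}" for i j
    using lat unfolding two_color_lattice_2_iff by auto
  have "csize (move_cell g (lattice_cell a b c ij)) = (a (i + 1) - a i) + (b (j + 1) - b j)"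
    unfolding ij using moved_cell_rep[OF lat g, of i j] csize_eq by blast
  also have "\<dots> = 4 + real (ltype a b ij)"
    using ga[of i] gb[of j] unfolding ij ctype_def gap_word_def by auto
  finally show ?thesis .
qed

definition linf :: "(nat \<Rightarrow> int) \<Rightarrow> ppoint \<Rightarrow> real" where
  "linf wt = (\<lambda>(s, m, l). wt 0 * s + wt 1 * m + wt 2 * l)"

text \<open>Sizes are 4, 5 or 6, so subtracting 4 recovers the type. Unlike the type, this weight is
  a function of the cell alone and is preserved by isometries.\<close>

definition cweight :: "(nat \<Rightarrow> int) \<Rightarrow> cell \<Rightarrow> real" where
  "cweight wt C = wt (nat \<lfloor>csize C - 4\<rfloor>)"

lemma cweight_moved_cell:
  assumes "two_color_lattice 2 a b c" "isometry g"
  shows "cweight wt (move_cell g (lattice_cell a b c ij)) = wt (ltype a b ij)"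
  unfolding cweight_def csize_moved_cell[OF assms] by simp

lemma sum_type_counts:
  assumes "finite I"
  shows "(\<Sum>ij\<in>I. real_of_int (wt (ctype u v ij))) = wt 0 * real (card {ij\<in>I. ctype u v ij = 0})
    + wt 1 * real (card {ij\<in>I. ctype u v ij = 1}) + wt 2 * real (card {ij\<in>I. ctype u v ij = 2})"
  using assms
proof (induction I)
  case (insert x I)
  have c: "real (card {ij \<in> insert x I. ctype u v ij = t}) = of_bool (ctype u v x = t) + real (card {ij\<in>I. ctype u v ij = t})" for t
  proof (cases "ctype u v x = t")
    case True
    then have "{ij \<in> insert x I. ctype u v ij = t} = insert x {ij\<in>I. ctype u v ij = t}" by auto
    moreover have "card (insert x {ij\<in>I. ctype u v ij = t}) = Suc (card {ij\<in>I. ctype u v ij = t})"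
      using insert by (intro card_insert_disjoint) auto
    ultimately show ?thesis using True by simp
  next
    case False
    then have "{ij \<in> insert x I. ctype u v ij = t} = {ij\<in>I. ctype u v ij = t}" by auto
    then show ?thesis using False by simp
  qed
  have "real_of_int (wt (ctype u v x)) = wt 0 * of_bool (ctype u v x = 0) + wt 1 * of_bool (ctype u v x = 1) + wt 2 * of_bool (ctype u v x = 2)"
    using ctype_le[of u v x] by auto
  then show ?case unfolding sum.insert[OF insert(1,2)] insert(3) c by (simp add: algebra_simps)
qed simp

lemma type_cells:
  "I \<inter> S_cells 2 a b = {ij\<in>I. ltype a b ij = 0}" "I \<inter> M_cells 2 a b = {ij\<in>I. ltype a b ij = 1}"
  "I \<inter> L_cells 2 a b = {ij\<in>I. ltype a b ij = 2}"
  by (auto simp del: One_nat_def simp add: S_cells_def M_cells_def L_cells_def ctype_eq)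

lemma card_types:
  assumes "finite I"
  shows "card I = card {ij\<in>I. ctype u v ij = 0} + card {ij\<in>I. ctype u v ij = 1} + card {ij\<in>I. ctype u v ij = 2}"
  using sum_type_counts[OF assms, of "\<lambda>_. 1" u v] by simp

text \<open>The doubled counts of S and L and the doubled middle coordinate compensate each other:
  the point consists of the frequencies of the three types, so the form is the mean weight per
  cell.\<close>

lemma linf_ppt:
  assumes "finite I" "I \<noteq> {}"
  shows "linf wt (ppt (2 * real (card (I \<inter> S_cells 2 a b))) (real (card (I \<inter> M_cells 2 a b))) (2 * real (card (I \<inter> L_cells 2 a b))))
    = (\<Sum>ij\<in>I. real_of_int (wt (ltype a b ij))) / real (card I)"
proof -
  let ?s = "real (card {ij\<in>I. ltype a b ij = 0})" and ?m = "real (card {ij\<in>I. ltype a b ij = 1})"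
    and ?l = "real (card {ij\<in>I. ltype a b ij = 2})"
  have "real (card I) = ?s + ?m + ?l" using card_types[OF assms(1), of "gap_word 2 a" "gap_word 2 b"] by simp
  moreover have "real (card I) > 0" using assms by (simp add: card_gt_0_iff)
  moreover have "linf wt (ppt (2 * S) M (2 * L)) = (wt 0 * S + wt 1 * M + wt 2 * L) / N"
    if "N = S + M + L" "N > 0" for N S M L :: real
  proof -
    have "2 * S + 2 * M + 2 * L = 2 * N" using that by simp
    then show ?thesis unfolding linf_def ppt_def by (simp add: add_divide_distrib)
  qed
  ultimately show ?thesis unfolding type_cells sum_type_counts[OF assms(1)] by blast
qed

section \<open>Patch-tiles as sets of moved cells\<close>

lemma patch_tile_cells:
  assumes "patch_tile 2 T P" "isometry g"
  obtains a b c I where "two_color_lattice 2 a b c" "finite I" "I \<noteq> {}"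
    "snd (move g P) = (\<lambda>ij. move_cell g (lattice_cell a b c ij)) ` I" "fst (move g P) = (\<Union>C\<in>snd (move g P). fst C)"
    "compact (fst P)" "linf wt T = (\<Sum>ij\<in>I. real_of_int (wt (ltype a b ij))) / real (card I)"
proof -
  obtain a b c I where h: "two_color_lattice 2 a b c" "finite I" "I \<noteq> {}"
    "P = (\<Union>ij\<in>I. lattice_region a b ij, lattice_cell a b c ` I)"
    "T = ppt (2 * real (card (I \<inter> S_cells 2 a b))) (real (card (I \<inter> M_cells 2 a b))) (2 * real (card (I \<inter> L_cells 2 a b)))"
    using assms(1) unfolding patch_tile_def by blast
  have 1: "snd (move g P) = (\<lambda>ij. move_cell g (lattice_cell a b c ij)) ` I"
    by (simp add: move_def h(4) image_image)
  have 2: "fst (move g P) = (\<Union>C\<in>snd (move g P). fst C)"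
    unfolding 1 by (simp add: move_def h(4) image_UN lattice_cell_def)
  have "compact (lattice_region a b ij)" for ij
  proof (cases ij)
    case (Pair i j)
    have "lattice_region a b (i, j) = reg (nrm 0) (nrm 1) (a i) (a (i + 1) - a i) (b j) (b (j + 1) - b j)"
      using cell_rep_sizes(6)[OF lattice_cell_rep[OF h(1), of i j]] by (simp add: lattice_cell_def)
    then show ?thesis using Pair compact_reg[OF frame_nrm(1)] by simp
  qed
  then have 3: "compact (fst P)" using h(2) by (simp add: h(4) compact_UN)
  show ?thesis by (rule that[OF h(1-3) 1 2 3]) (simp add: h(5) linf_ppt[OF h(2,3)])
qed

lemma matching_bar_tiling:
  assumes P: "\<And>P. P \<in> \<P> \<Longrightarrow> \<exists>T. patch_tile 2 T P" and t: "matching_tiling \<P> \<T>"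
  shows "bar_tiling (cells \<T>)"
proof
  have til: "tiling \<P> \<T>" "edge_to_edge \<T>" "bars_continue \<T>" using t by (auto simp: matching_tiling_def)
  have til1: "(\<Union>U\<in>\<T>. fst U) = UNIV"
    and til2: "\<And>U V. U \<in> \<T> \<Longrightarrow> V \<in> \<T> \<Longrightarrow> U \<noteq> V \<Longrightarrow> interior (fst U) \<inter> interior (fst V) = {}"
    using til(1) unfolding tiling_def by simp_all
  have tile: "\<exists>g a b c I. isometry g \<and> two_color_lattice 2 a b c \<and> finite I \<and> I \<noteq> {} \<and>
      snd U = (\<lambda>ij. move_cell g (lattice_cell a b c ij)) ` I \<and> fst U = (\<Union>C\<in>snd U. fst C)" if U: "U \<in> \<T>" for U
  proof -
    obtain P g where Pg: "P \<in> \<P>" "isometry g" "U = move g P"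
    proof -
      have "\<forall>T\<in>\<T>. \<exists>P\<in>\<P>. \<exists>g. isometry g \<and> T = move g P"
        using til(1) unfolding tiling_def by (rule conjunct1)
      then show ?thesis using U that by blast
    qed
    obtain T where T: "patch_tile 2 T P" using P[OF Pg(1)] by blast
    obtain a b c I where "two_color_lattice 2 a b c" "finite I" "I \<noteq> {}"
      "snd (move g P) = (\<lambda>ij. move_cell g (lattice_cell a b c ij)) ` I" "fst (move g P) = (\<Union>C\<in>snd (move g P). fst C)"
      "compact (fst P)" "linf (\<lambda>_. 0) T = (\<Sum>ij\<in>I. real_of_int 0) / real (card I)"
      by (rule patch_tile_cells[OF T Pg(2)])
    then show ?thesis using Pg(2,3) by (intro exI[of _ g] exI[of _ a] exI[of _ b] exI[of _ c] exI[of _ I]) simp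
  qed
  show "\<exists>n m x e y e' k0 k1 k2. cell_rep n m x e y e' k0 k1 k2 C" if C: "C \<in> cells \<T>" for C
  proof -
    obtain U where "U \<in> \<T>" "C \<in> snd U" using C by (auto simp: cells_def)
    then obtain g a b c I where "isometry g" "two_color_lattice 2 a b c" "snd U = (\<lambda>ij. move_cell g (lattice_cell a b c ij)) ` I"
      using tile by metis
    moreover from this \<open>C \<in> snd U\<close> obtain i j where "C = move_cell g (lattice_cell a b c (i, j))" by force
    ultimately show ?thesis using moved_cell_rep[of a b c g i j] by metis
  qed
  show "(\<Union>C\<in>cells \<T>. fst C) = UNIV"
  proof -
    have "(\<Union>U\<in>\<T>. fst U) = (\<Union>U\<in>\<T>. \<Union>C\<in>snd U. fst C)" using tile by (intro SUP_cong refl) blast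
    also have "\<dots> = (\<Union>C\<in>cells \<T>. fst C)" by (auto simp: cells_def)
    finally show ?thesis using til1 by simp
  qed
  show "interior (fst C) \<inter> interior (fst D) = {}" if CD: "C \<in> cells \<T>" "D \<in> cells \<T>" "C \<noteq> D" for C D
  proof -
    obtain U V where UV: "U \<in> \<T>" "C \<in> snd U" "V \<in> \<T>" "D \<in> snd V" using CD by (auto simp: cells_def)
    show ?thesis
    proof (cases "U = V")
      case True
      obtain g a b c I where g12: "isometry g" "two_color_lattice 2 a b c" "snd U = (\<lambda>ij. move_cell g (lattice_cell a b c ij)) ` I"
        using tile[OF UV(1)] by metis
      then obtain ij ij' where g: "isometry g" "two_color_lattice 2 a b c" "C = move_cell g (lattice_cell a b c ij)"
        "D = move_cell g (lattice_cell a b c ij')"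
        using UV True by blast
      then have "ij \<noteq> ij'" using CD(3) by blast
      then show ?thesis using moved_cells_disjoint[OF g(2,1)] g(3,4) by simp
    next
      case False
      then have "interior (fst U) \<inter> interior (fst V) = {}" using til2 UV by simp
      moreover have "fst C \<subseteq> fst U" "fst D \<subseteq> fst V" using tile[OF UV(1)] tile[OF UV(3)] UV by blast+
      ultimately show ?thesis using interior_mono by blast
    qed
  qed
  show "(fst C \<inter> fst D) face_of fst C \<and> (fst C \<inter> fst D) face_of fst D" if "C \<in> cells \<T>" "D \<in> cells \<T>" for C D
    using til(2) that unfolding edge_to_edge_def by blast
  show "\<exists>\<L>. (\<forall>l\<in>\<L>. affine l \<and> aff_dim l = 1) \<and> (\<Union>C\<in>cells \<T>. snd C) = \<Union>\<L>"
    using til(3) unfolding bars_continue_def .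
qed

section \<open>The slope of a Sturmian lattice\<close>

lemma lattice_gap_cnt:
  fixes f :: "int \<Rightarrow> real"
  assumes "\<And>i. f (i + 1) - f i \<in> {2, 3::real}"
  shows "f (i + int n) - f i = 2 * real n + cnt (gap_word 2 f) i n"
proof (induction n)
  case (Suc n)
  have "f (i + int n + 1) - f (i + int n) = 2 + of_bool (gap_word 2 f (i + int n))"
    using assms[of "i + int n"] by (auto simp: gap_word_def)
  moreover have "i + int (Suc n) = i + int n + 1" by simp
  ultimately show ?case using Suc by (simp only: cnt_Suc) simp
qed simp

text \<open>Keep one index fixed and shift \<open>n\<close> steps from one of the other two families
  to the third: both sums of positions are 1 / 2 up to sign, so the two distances covered differ by
  at most 1. Hence any two windows of equal length from different families have nearly the same
  number of wide gaps.\<close>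

lemma lattice_slope:
  assumes lat: "two_color_lattice 2 a b c"
  obtains \<beta> where "\<beta> \<in> {0..1}" "\<And>f. f \<in> {a, b, c} \<Longrightarrow> near_slope \<beta> (gap_word 2 f)"
proof -
  have h: "\<bar>a i + b j + c k\<bar> = 1 / 2" if "i + j + k = 0" for i j k
    using lat that unfolding two_color_lattice_2_iff by blast
  have ga: "a (i + 1) - a i \<in> {2, 3}" and gb: "b (i + 1) - b i \<in> {2, 3}" and gc: "c (i + 1) - c i \<in> {2, 3}" for i
    using lat unfolding two_color_lattice_2_iff by auto
  have 1: "\<bar>cnt (gap_word 2 a) i n - cnt (gap_word 2 b) j n\<bar> \<le> 1" for i j n
  proof -
    have "\<bar>a (i + int n) + b j + c (- i - int n - j)\<bar> = 1 / 2" "\<bar>a i + b (j + int n) + c (- i - int n - j)\<bar> = 1 / 2"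
      by (rule h; simp)+
    then have "\<bar>(a (i + int n) - a i) - (b (j + int n) - b j)\<bar> \<le> 1" by linarith
    then have "\<bar>real_of_int (cnt (gap_word 2 a) i n - cnt (gap_word 2 b) j n)\<bar> \<le> 1"
      unfolding lattice_gap_cnt[of a, OF ga] lattice_gap_cnt[of b, OF gb] by simp
    then show ?thesis by linarith
  qed
  have 2: "\<bar>cnt (gap_word 2 a) i n - cnt (gap_word 2 c) j n\<bar> \<le> 1" for i j n
  proof -
    have "\<bar>a (i + int n) + b (- i - int n - j) + c j\<bar> = 1 / 2" "\<bar>a i + b (- i - int n - j) + c (j + int n)\<bar> = 1 / 2"
      by (rule h; simp)+
    then have "\<bar>(a (i + int n) - a i) - (c (j + int n) - c j)\<bar> \<le> 1" by linarith
    then have "\<bar>real_of_int (cnt (gap_word 2 a) i n - cnt (gap_word 2 c) j n)\<bar> \<le> 1"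
      unfolding lattice_gap_cnt[of a, OF ga] lattice_gap_cnt[of c, OF gc] by simp
    then show ?thesis by linarith
  qed
  obtain \<beta> where b: "\<beta> \<in> {0..1}" "near_slope \<beta> (gap_word 2 a)" "near_slope \<beta> (gap_word 2 b)"
    using slope_exists[OF 1] by blast
  moreover have "near_slope \<beta> (gap_word 2 c)" by (rule near_slope_transfer[OF b(2) 2])
  ultimately show ?thesis using that by blast
qed

lemma sum_int_interval: "(\<Sum>i\<in>{0..<int N}. f i) = (\<Sum>k<N. f (int k))"
proof -
  have "{0..<int N} = int ` {..<N}" by (auto simp: image_iff intro!: bexI[of _ "nat _"])
  then show ?thesis by (simp add: sum.reindex)
qed

lemma sum_window:
  fixes wt :: "nat \<Rightarrow> int"
  shows "(\<Sum>ij\<in>{0..<int N} \<times> {0..<int N}. real_of_int (wt (ctype u v ij))) =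
    real N * real N * wt 0 + real N * (real_of_int (wt 1) - wt 0) * (real_of_int (cnt u 0 N) + cnt v 0 N)
    + (real_of_int (wt 2) - 2 * real_of_int (wt 1) + wt 0) * real_of_int (cnt u 0 N) * real_of_int (cnt v 0 N)"
proof -
  let ?U = "\<lambda>i. of_bool (u i) :: real" and ?V = "\<lambda>j. of_bool (v j) :: real" and ?I = "{0..<int N}"
  have c: "(\<Sum>i\<in>?I. of_bool (w i) :: real) = real_of_int (cnt w 0 N)" for w
    by (simp add: sum_int_interval cnt_def)
  \<comment> \<open>The weight is a bilinear polynomial in the two indicators, with first and second
    differences of \<open>wt\<close> as coefficients, so the double sum factors.\<close>
  have pw: "real_of_int (wt (ctype u v (i, j))) = wt 0 + (real_of_int (wt 1) - wt 0) * ?U i + (real_of_int (wt 1) - wt 0) * ?V j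
    + (real_of_int (wt 2) - 2 * real_of_int (wt 1) + wt 0) * ?U i * ?V j" for i j
    by (cases "u i"; cases "v j"; simp add: ctype_def numeral_2_eq_2)
  have "(\<Sum>ij\<in>?I \<times> ?I. real_of_int (wt (ctype u v ij))) = (\<Sum>i\<in>?I. \<Sum>j\<in>?I. real_of_int (wt (ctype u v (i, j))))"
    by (simp add: sum.cartesian_product)
  also have "\<dots> = (\<Sum>i\<in>?I. real N * wt 0 + real N * (real_of_int (wt 1) - wt 0) * ?U i + (real_of_int (wt 1) - wt 0) * cnt v 0 N
      + (real_of_int (wt 2) - 2 * real_of_int (wt 1) + wt 0) * ?U i * cnt v 0 N)"
    unfolding pw sum.distrib by (simp only: sum_distrib_left[symmetric] c sum_constant card_atLeastLessThan_int) (simp add: algebra_simps)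
  also have "\<dots> = real N * (real N * wt 0) + real N * (real_of_int (wt 1) - wt 0) * cnt u 0 N
      + real N * ((real_of_int (wt 1) - wt 0) * cnt v 0 N) + (real_of_int (wt 2) - 2 * real_of_int (wt 1) + wt 0) * cnt u 0 N * cnt v 0 N"
    unfolding sum.distrib by (simp only: sum_distrib_left[symmetric] sum_distrib_right[symmetric] c sum_constant card_atLeastLessThan_int) simp
  finally show ?thesis by (simp add: algebra_simps)
qed

text \<open>A gap is at most 3, so the lower ends of the two strips are at most
  \<open>\<Delta> + 3\<close> apart; gaps of at least 2 turn this into a bound for the
  indices.\<close>

lemma lattice_index_distance:
  fixes a :: "int \<Rightarrow> real"
  assumes ga: "\<And>i. a (i + 1) - a i \<in> {2, 3}" and "a i \<le> s" "s \<le> a (i + 1)" "a i' \<le> t" "t \<le> a (i' + 1)" "\<bar>s - t\<bar> \<le> \<Delta>"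
  shows "\<bar>real_of_int (i - i')\<bar> \<le> \<Delta> + 3"
proof -
  have "\<bar>a i - a i'\<bar> \<le> \<Delta> + 3" using assms(2-) ga[of i] ga[of i'] by auto
  moreover have "2 * \<bar>real_of_int (i - i')\<bar> \<le> \<bar>a i - a i'\<bar>"
    using lattice_gaps[of a i i', OF ga] lattice_gaps[of a i' i, OF ga] by (cases "i \<le> i'") auto
  ultimately have "2 * \<bar>real_of_int (i - i')\<bar> \<le> \<Delta> + 3" by (rule order_trans[rotated])
  moreover have "\<bar>real_of_int (i - i')\<bar> \<le> 2 * \<bar>real_of_int (i - i')\<bar>" by simp
  ultimately show ?thesis by (rule order_trans[rotated])
qed

lemma matching_tile:
  assumes P: "\<forall>P\<in>\<P>. \<exists>T\<in>A. patch_tile 2 T P" and A: "\<forall>T\<in>A. linf wt T = 0"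
    and til: "tiling \<P> \<T>" and U: "U \<in> \<T>"
  shows "finite (snd U)" "(\<Sum>C\<in>snd U. cweight wt C) = 0" "fst U = (\<Union>C\<in>snd U. fst C)"
    "\<And>C. C \<in> snd U \<Longrightarrow> interior (fst C) \<noteq> {}" "\<exists>P\<in>\<P>. \<exists>g. isometry g \<and> U = move g P"
proof -
  have "\<forall>T\<in>\<T>. \<exists>P\<in>\<P>. \<exists>g. isometry g \<and> T = move g P" using til unfolding tiling_def by (rule conjunct1)
  then obtain P g where Pg: "P \<in> \<P>" "isometry g" "U = move g P" using U by blast
  then show "\<exists>P\<in>\<P>. \<exists>g. isometry g \<and> U = move g P" by blast
  obtain T where T: "T \<in> A" "patch_tile 2 T P" using P Pg(1) by blast
  obtain a b c I where h: "two_color_lattice 2 a b c" "finite I" "I \<noteq> {}"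
    "snd (move g P) = (\<lambda>ij. move_cell g (lattice_cell a b c ij)) ` I" "fst (move g P) = (\<Union>C\<in>snd (move g P). fst C)"
    "compact (fst P)" "linf wt T = (\<Sum>ij\<in>I. real_of_int (wt (ltype a b ij))) / real (card I)"
    by (rule patch_tile_cells[OF T(2) Pg(2)])
  show "finite (snd U)" unfolding Pg(3) h(4) using h(2) by simp
  show "fst U = (\<Union>C\<in>snd U. fst C)" unfolding Pg(3) by (rule h(5))
  show "interior (fst C) \<noteq> {}" if "C \<in> snd U" for C
    using that moved_cell_nonempty[OF h(1) Pg(2)] unfolding Pg(3) h(4) by blast
  have "inj_on (\<lambda>ij. move_cell g (lattice_cell a b c ij)) I"
    using inj_moved_cell[OF h(1) Pg(2)] by (rule inj_on_subset) simp
  then have "(\<Sum>C\<in>snd U. cweight wt C) = (\<Sum>ij\<in>I. cweight wt (move_cell g (lattice_cell a b c ij)))"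
    unfolding Pg(3) h(4) by (subst sum.reindex) (auto simp: o_def)
  also have "\<dots> = (\<Sum>ij\<in>I. real_of_int (wt (ltype a b ij)))"
    unfolding cweight_moved_cell[OF h(1) Pg(2)] ..
  also have "\<dots> = 0" using A T(1) h(2,3,7) by (auto simp: card_gt_0_iff)
  finally show "(\<Sum>C\<in>snd U. cweight wt C) = 0" .
qed

lemma finite_prototiles_diameter:
  assumes fin: "finite \<P>" and P: "\<And>P. P \<in> \<P> \<Longrightarrow> compact (fst P)"
  obtains \<Delta> where "0 \<le> \<Delta>" "\<And>P g p q. P \<in> \<P> \<Longrightarrow> isometry g \<Longrightarrow> p \<in> fst (move g P) \<Longrightarrow> q \<in> fst (move g P) \<Longrightarrow> dist p q \<le> \<Delta>"
proof -
  have "bounded (\<Union>P\<in>\<P>. fst P)" using fin P by (intro bounded_UN ballI compact_imp_bounded)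
  then obtain B where B: "\<And>p. p \<in> (\<Union>P\<in>\<P>. fst P) \<Longrightarrow> norm p \<le> B" unfolding bounded_iff by blast
  have "dist p q \<le> 2 * \<bar>B\<bar>" if "P \<in> \<P>" "isometry g" and pq: "p \<in> fst (move g P)" "q \<in> fst (move g P)" for P g p q
  proof -
    obtain p' q' where "p = g p'" "q = g q'" "p' \<in> fst P" "q' \<in> fst P" using pq by (auto simp: move_def)
    then have "dist p q = dist p' q'" using that(2) by (simp add: isometry_def)
    also have "\<dots> \<le> norm p' + norm q'" by (simp add: dist_norm norm_triangle_ineq4)
    also have "\<dots> \<le> 2 * \<bar>B\<bar>" using B[of p'] B[of q'] \<open>p' \<in> fst P\<close> \<open>q' \<in> fst P\<close> that(1) by (smt (verit) UN_I)
    finally show ?thesis .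
  qed
  then show ?thesis using that[of "2 * \<bar>B\<bar>"] by simp
qed

lemma moved_region:
  assumes lat: "two_color_lattice 2 a b c" and g: "isometry g"
  shows "\<exists>n m x0 y0. frame n m \<and> (\<forall>i j. fst (move_cell g (lattice_cell a b c (i, j))) =
    reg n m (a i + x0) (a (i + 1) - a i) (b j + y0) (b (j + 1) - b j))"
proof -
  obtain f where f: "linear f" "\<And>x y. f x \<bullet> f y = x \<bullet> y" "surj f" "\<And>p. g p = f p + g 0"
    using isometry_decompose[OF g] by metis
  show ?thesis
  proof (intro exI conjI allI)
    show "frame (f (nrm 0)) (f (nrm 1))" using frame_nrm(1) by (simp only: frame_def f(2))
    fix i j
    have "fst (move_cell g (lattice_cell a b c (i, j))) = g ` reg (nrm 0) (nrm 1) (a i) (a (i + 1) - a i) (b j) (b (j + 1) - b j)"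
      using cell_rep_sizes(6)[OF lattice_cell_rep[OF lat, of i j]] by (simp add: lattice_cell_def)
    also have "\<dots> = reg (f (nrm 0)) (f (nrm 1)) (a i + f (nrm 0) \<bullet> g 0) (a (i + 1) - a i) (b j + f (nrm 1) \<bullet> g 0) (b (j + 1) - b j)"
      unfolding reg_def isometry_image_Collect[OF f, of "\<lambda>X Y. a i \<le> X \<and> X \<le> a i + (a (i + 1) - a i) \<and> b j \<le> Y \<and> Y \<le> b j + (b (j + 1) - b j)"]
      by (auto simp: algebra_simps)
    finally show "fst (move_cell g (lattice_cell a b c (i, j))) =
      reg (f (nrm 0)) (f (nrm 1)) (a i + f (nrm 0) \<bullet> g 0) (a (i + 1) - a i) (b j + f (nrm 1) \<bullet> g 0) (b (j + 1) - b j)" .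
  qed
qed

text \<open>Every tile has total weight zero, so the weight of a large square window is that of the tiles
  crossing its boundary.\<close>

lemma tiling_slope_equation:
  assumes fin: "finite \<P>" and P: "\<forall>P\<in>\<P>. \<exists>T\<in>A. patch_tile 2 T P" and A: "\<forall>T\<in>A. linf wt T = 0"
    and til: "tiling \<P> \<T>" and g: "isometry g" and lat: "two_color_lattice 2 a b c"
    and cells: "cells \<T> = move_cell g ` range (lattice_cell a b c)"
    and \<beta>: "\<beta> \<in> {0..1}" "near_slope \<beta> (gap_word 2 a)" "near_slope \<beta> (gap_word 2 b)"
  shows "real_of_int (wt 0) * (1 - \<beta>)\<^sup>2 + 2 * real_of_int (wt 1) * \<beta> * (1 - \<beta>) + real_of_int (wt 2) * \<beta>\<^sup>2 = 0"
proof -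
  note tile = matching_tile[OF P A til]
  let ?F = "\<lambda>ij. move_cell g (lattice_cell a b c ij)"
  have injF: "inj ?F" by (rule inj_moved_cell[OF lat g])
  have ga: "a (i + 1) - a i \<in> {2, 3}" and gb: "b (i + 1) - b i \<in> {2, 3}" for i
    using lat unfolding two_color_lattice_2_iff by auto
  have disj: "\<And>U V. U \<in> \<T> \<Longrightarrow> V \<in> \<T> \<Longrightarrow> U \<noteq> V \<Longrightarrow> interior (fst U) \<inter> interior (fst V) = {}"
    using til unfolding tiling_def by simp
  have disj': "U = V" if "U \<in> \<T>" "V \<in> \<T>" "C \<in> snd U" "C \<in> snd V" for U V C
  proof (rule ccontr)
    assume "U \<noteq> V"
    then have "interior (fst U) \<inter> interior (fst V) = {}" using disj that by blast
    moreover have "fst C \<subseteq> fst U" "fst C \<subseteq> fst V" using tile(3) that by blast+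
    ultimately have "interior (fst C) = {}" using interior_mono by blast
    then show False using tile(4) that by blast
  qed
  have sub: "snd U \<subseteq> range ?F" if "U \<in> \<T>" for U
    using that cells by (auto simp: cells_def)
  have comp: "compact (fst P)" if PP: "P \<in> \<P>" for P
  proof -
    obtain T where T: "patch_tile 2 T P" using P PP by blast
    show ?thesis by (rule patch_tile_cells[OF T isometry_id])
  qed
  obtain \<Delta> where \<Delta>: "0 \<le> \<Delta>" "\<And>P g p q. P \<in> \<P> \<Longrightarrow> isometry g \<Longrightarrow> p \<in> fst (move g P) \<Longrightarrow> q \<in> fst (move g P) \<Longrightarrow> dist p q \<le> \<Delta>"
    using finite_prototiles_diameter[OF fin comp] by blast
  \<comment> \<open>Bound for the index distance of two cells of the same tile.\<close>
  define D where "D = \<lceil>\<Delta> + 3\<rceil>"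
  have D: "\<Delta> + 3 \<le> real_of_int D" "0 \<le> D" using \<Delta>(1) by (auto simp: D_def)
  obtain n m x0 y0 where reg: "frame n m"
    "\<And>i j. fst (?F (i, j)) = reg n m (a i + x0) (a (i + 1) - a i) (b j + y0) (b (j + 1) - b j)"
    using moved_region[OF lat g] by blast
  have near: "\<bar>i - i'\<bar> \<le> D \<and> \<bar>j - j'\<bar> \<le> D" if U: "U \<in> \<T>" "?F (i, j) \<in> snd U" "?F (i', j') \<in> snd U" for U i j i' j'
  proof -
    obtain p where p: "p \<in> interior (fst (?F (i, j)))" using tile(4)[OF U(1,2)] by blast
    obtain q where q: "q \<in> interior (fst (?F (i', j')))" using tile(4)[OF U(1,3)] by blast
    have p': "p \<in> fst (?F (i, j))" and q': "q \<in> fst (?F (i', j'))" using p q interior_subset by blast+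
    have pq: "p \<in> fst U" "q \<in> fst U" using p' q' U tile(3)[OF U(1)] by blast+
    obtain P h where "P \<in> \<P>" "isometry h" "U = move h P" using tile(5)[OF U(1)] by blast
    then have d: "norm (p - q) \<le> \<Delta>" using \<Delta>(2) pq by (simp add: dist_norm)
    have "norm n = 1" "norm m = 1" using reg(1) by (simp_all add: frame_def norm_eq_sqrt_inner)
    then have nd: "\<bar>(n \<bullet> p - x0) - (n \<bullet> q - x0)\<bar> \<le> \<Delta>" "\<bar>(m \<bullet> p - y0) - (m \<bullet> q - y0)\<bar> \<le> \<Delta>"
      using Cauchy_Schwarz_ineq2[of n "p - q"] Cauchy_Schwarz_ineq2[of m "p - q"] d by (simp_all add: inner_diff_right)
    have "\<bar>real_of_int (i - i')\<bar> \<le> \<Delta> + 3"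
      by (rule lattice_index_distance[of a, OF ga _ _ _ _ nd(1)]) (use p' q' in \<open>auto simp: reg(2) reg_def\<close>)
    moreover have "\<bar>real_of_int (j - j')\<bar> \<le> \<Delta> + 3"
      by (rule lattice_index_distance[of b, OF gb _ _ _ _ nd(2)]) (use p' q' in \<open>auto simp: reg(2) reg_def\<close>)
    ultimately show ?thesis using D(1) by linarith
  qed
  have "\<exists>U. U \<in> \<T> \<and> ?F ij \<in> snd U" for ij
  proof -
    have "?F ij \<in> cells \<T>" using cells by blast
    then show ?thesis unfolding cells_def by blast
  qed
  then obtain own where own: "\<And>ij. own ij \<in> \<T>" "\<And>ij. ?F ij \<in> snd (own ij)" by metis
  define B where "B = real_of_int (\<bar>wt 0\<bar> + \<bar>wt 1\<bar> + \<bar>wt 2\<bar>)"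
  have B0: "0 \<le> B" by (simp add: B_def)
  have wtB: "\<bar>real_of_int (wt (ltype a b ij))\<bar> \<le> B" for ij
    using ctype_le[of "gap_word 2 a" "gap_word 2 b" ij] by (auto simp: B_def)
  let ?\<omega> = "\<lambda>ij. real_of_int (wt (ltype a b ij))"
  have window: "\<bar>\<Sum>ij\<in>{0..<int N} \<times> {0..<int N}. ?\<omega> ij\<bar> \<le> B * (4 * D * real N + 4 * (real_of_int D * D))" for N
  proof -
    let ?W = "{0..<int N} \<times> {0..<int N}" and ?Z = "{- D..<int N + D} \<times> {- D..<int N + D}"
    define \<U> where "\<U> = own ` ?W"
    define idx where "idx U = {ij. ?F ij \<in> snd U}" for U :: tile
    have fin\<U>: "finite \<U>" by (simp add: \<U>_def)
    have \<U>\<T>: "\<U> \<subseteq> \<T>" using own by (auto simp: \<U>_def)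
    have fidx: "finite (idx U)" if "U \<in> \<T>" for U
      unfolding idx_def using finite_vimageI[OF tile(1)[OF that] injF] by (simp add: vimage_def)
    have "(\<Sum>ij\<in>idx U. ?\<omega> ij) = 0" if U: "U \<in> \<T>" for U
    proof -
      have "?F ` idx U = snd U" using sub[OF U] by (auto simp: idx_def)
      then have "(\<Sum>C\<in>snd U. cweight wt C) = (\<Sum>ij\<in>idx U. cweight wt (?F ij))"
        using inj_on_subset[OF injF, of "idx U"] by (metis (mono_tags, lifting) sum.reindex_cong subset_UNIV)
      then show ?thesis using tile(2)[OF U] by (simp only: cweight_moved_cell[OF lat g])
    qed
    then have "(\<Sum>U\<in>\<U>. \<Sum>ij\<in>idx U. ?\<omega> ij) = 0" using \<U>\<T> by (intro sum.neutral) blast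
    moreover have "(\<Sum>ij\<in>(\<Union>U\<in>\<U>. idx U). ?\<omega> ij) = (\<Sum>U\<in>\<U>. \<Sum>ij\<in>idx U. ?\<omega> ij)"
    proof (rule sum.UNION_disjoint[OF fin\<U>])
      show "\<forall>U\<in>\<U>. finite (idx U)" using fidx \<U>\<T> by blast
      show "\<forall>U\<in>\<U>. \<forall>V\<in>\<U>. U \<noteq> V \<longrightarrow> idx U \<inter> idx V = {}" using disj' \<U>\<T> unfolding idx_def by blast
    qed
    ultimately have zero: "(\<Sum>ij\<in>(\<Union>U\<in>\<U>. idx U). ?\<omega> ij) = 0" by simp
    \<comment> \<open>The index set of all tiles owning a cell of the window: it has weight zero and
      exceeds the window by a boundary layer of width at most \<open>D\<close>.\<close>
    define X where "X = (\<Union>U\<in>\<U>. idx U)"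
    have finX: "finite X" unfolding X_def using fin\<U> fidx \<U>\<T> by blast
    have WX: "?W \<subseteq> X" using own by (auto simp: X_def \<U>_def idx_def)
    have XZ: "X \<subseteq> ?Z"
    proof
      fix ij assume "ij \<in> X"
      then obtain ij0 where ij0: "ij0 \<in> ?W" "?F ij \<in> snd (own ij0)" by (auto simp: X_def \<U>_def idx_def)
      obtain i j i0 j0 where e: "ij = (i, j)" "ij0 = (i0, j0)" by (metis surj_pair)
      have "\<bar>i - i0\<bar> \<le> D \<and> \<bar>j - j0\<bar> \<le> D" using near[OF own(1)[of ij0], of i j i0 j0] ij0 own(2)[of ij0] e by simp
      then show "ij \<in> ?Z" using ij0 e by auto
    qed
    have side: "int N + D - (- D) = int (N + 2 * nat D)" using D(2) by simp
    have cZ: "card ?Z = (N + 2 * nat D) * (N + 2 * nat D)"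
      unfolding card_cartesian_product card_atLeastLessThan_int side nat_int ..
    have cW: "card ?W = N * N" by (simp add: card_cartesian_product)
    have "card (X - ?W) \<le> card (?Z - ?W)" using XZ by (intro card_mono) auto
    also have "\<dots> = card ?Z - card ?W" using D(2) by (intro card_Diff_subset) auto
    also have "\<dots> = 4 * nat D * N + 4 * (nat D * nat D)" unfolding cZ cW by (simp add: algebra_simps)
    finally have "real (card (X - ?W)) \<le> real (4 * nat D * N + 4 * (nat D * nat D))" by (simp only: of_nat_le_iff)
    also have "\<dots> = 4 * D * real N + 4 * (real_of_int D * D)" using D(2) by simp
    finally have cb: "real (card (X - ?W)) \<le> 4 * D * real N + 4 * (real_of_int D * D)" .
    have "(\<Sum>ij\<in>X. ?\<omega> ij) = (\<Sum>ij\<in>X - ?W. ?\<omega> ij) + (\<Sum>ij\<in>?W. ?\<omega> ij)"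
      by (rule sum.subset_diff[OF WX finX])
    then have "\<bar>\<Sum>ij\<in>?W. ?\<omega> ij\<bar> = \<bar>\<Sum>ij\<in>X - ?W. ?\<omega> ij\<bar>" using zero[folded X_def] by linarith
    also have "\<dots> \<le> (\<Sum>ij\<in>X - ?W. \<bar>?\<omega> ij\<bar>)" by (rule sum_abs)
    also have "\<dots> \<le> (\<Sum>ij\<in>X - ?W. B)" by (intro sum_mono wtB)
    also have "\<dots> = B * real (card (X - ?W))" by simp
    also have "\<dots> \<le> B * (4 * D * real N + 4 * (real_of_int D * D))" by (rule mult_left_mono[OF cb B0])
    finally show ?thesis .
  qed
  \<comment> \<open>The mean weight at slope \<beta>, expanded in powers of \<beta>; the window of
    side \<open>N\<close> has weight about \<open>N * N\<close> times this.\<close>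
  define \<Phi> where "\<Phi> = real_of_int (wt 0) + 2 * (real_of_int (wt 1) - wt 0) * \<beta> + (real_of_int (wt 2) - 2 * real_of_int (wt 1) + wt 0) * \<beta>\<^sup>2"
  define K where "K = B * (4 * real_of_int D + 4 * (real_of_int D * D) + 16)"
  \<comment> \<open>Replacing each count by \<open>N * \<beta>\<close> costs an error linear in
    \<open>N\<close>, and the weight of the window is itself linear in \<open>N\<close>. So
    \<open>N * N * \<Phi>\<close> is linear in \<open>N\<close>, which forces \<Phi> to
    vanish.\<close>
  have est: "real N * \<bar>\<Phi>\<bar> \<le> K" if N: "N > 0" for N :: nat
  proof -
    define e1 where "e1 = real_of_int (cnt (gap_word 2 a) 0 N) - real N * \<beta>"
    define e2 where "e2 = real_of_int (cnt (gap_word 2 b) 0 N) - real N * \<beta>"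
    have e: "\<bar>e1\<bar> \<le> 1" "\<bar>e2\<bar> \<le> 1"
      unfolding e1_def e2_def using \<beta>(2,3)[unfolded near_slope_def, rule_format, of 0 N] by auto
    define c1 where "c1 = real_of_int (wt 1) - wt 0"
    define c2 where "c2 = real_of_int (wt 2) - 2 * real_of_int (wt 1) + wt 0"
    have c: "\<bar>c1\<bar> \<le> 2 * B" "\<bar>c2\<bar> \<le> 2 * B" by (auto simp: c1_def c2_def B_def)
    have "real N * real N * \<Phi> = (\<Sum>ij\<in>{0..<int N} \<times> {0..<int N}. ?\<omega> ij) - real N * (c1 * (e1 + e2)) - c2 * (real N * (\<beta> * (e1 + e2)) + e1 * e2)"
    proof -
      have p: "real_of_int (cnt (gap_word 2 a) 0 N) = real N * \<beta> + e1" "real_of_int (cnt (gap_word 2 b) 0 N) = real N * \<beta> + e2"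
        by (simp_all add: e1_def e2_def)
      show ?thesis unfolding sum_window p \<Phi>_def c1_def[symmetric] c2_def[symmetric] by (simp add: power2_eq_square algebra_simps)
    qed
    moreover have "\<bar>real N * (c1 * (e1 + e2))\<bar> \<le> real N * (2 * B * 2)"
      unfolding abs_mult using c e B0 by (intro mult_mono) auto
    moreover have "\<bar>c2 * (real N * (\<beta> * (e1 + e2)) + e1 * e2)\<bar> \<le> 2 * B * (real N * (1 * 2) + 1 * 1)"
    proof -
      have "\<bar>real N * (\<beta> * (e1 + e2)) + e1 * e2\<bar> \<le> real N * (\<bar>\<beta>\<bar> * \<bar>e1 + e2\<bar>) + \<bar>e1\<bar> * \<bar>e2\<bar>"
        by (rule order_trans[OF abs_triangle_ineq]) (simp add: abs_mult)
      also have "\<dots> \<le> real N * (1 * 2) + 1 * 1" using \<beta>(1) e by (intro add_mono mult_mono) auto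
      finally show ?thesis unfolding abs_mult[of c2] using c B0 by (intro mult_mono) auto
    qed
    moreover note window[of N]
    ultimately have "\<bar>real N * real N * \<Phi>\<bar> \<le> B * (4 * D * real N + 4 * (real_of_int D * D)) + real N * (2 * B * 2) + 2 * B * (real N * (1 * 2) + 1 * 1)"
      by linarith
    also have "\<dots> = B * (4 * D * real N + 4 * (real_of_int D * D) * 1 + 8 * real N + 2 * 1)" by (simp add: algebra_simps)
    also have "\<dots> \<le> B * (4 * D * real N + 4 * (real_of_int D * D) * real N + 8 * real N + 2 * real N)"
      using B0 N D(2) by (intro mult_left_mono add_mono) auto
    also have "\<dots> \<le> B * (4 * D * real N + 4 * (real_of_int D * D) * real N + 16 * real N)"
      using B0 by (intro mult_left_mono) auto
    also have "\<dots> = real N * K" by (simp add: K_def algebra_simps)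
    finally have "real N * (real N * \<bar>\<Phi>\<bar>) \<le> real N * K" by (simp add: abs_mult mult.assoc)
    then show ?thesis using N by simp
  qed
  have "\<Phi> = 0"
  proof (rule ccontr)
    assume "\<Phi> \<noteq> 0"
    then have "0 < \<bar>\<Phi>\<bar>" by simp
    then obtain N where N: "max K 0 < real N * \<bar>\<Phi>\<bar>" by (rule archimedean_mult)
    then have "N > 0" by (cases "N = 0") auto
    then show False using est[of N] N by simp
  qed
  then show ?thesis unfolding \<Phi>_def by (simp add: power2_eq_square algebra_simps)
qed

section \<open>Translations preserving a lattice\<close>

lemma int_shift_of_strict_mono_surj:
  fixes f :: "int \<Rightarrow> int"
  assumes "strict_mono f" "surj f"
  shows "f k = k + f 0"
proof -
  have s: "f (k + 1) = f k + 1" for k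
  proof -
    obtain l where l: "f l = f k + 1" using assms(2) by (metis surjD)
    then have "k < l" using strict_mono_less[OF assms(1)] by (metis zless_add1_eq)
    then have "f (k + 1) \<le> f l" using strict_mono_less_eq[OF assms(1)] by simp
    moreover have "f k < f (k + 1)" using assms(1) by (simp add: strict_mono_def)
    ultimately show ?thesis using l by linarith
  qed
  show ?thesis
  proof (induction k rule: int_induct[of _ 0])
    case (step2 k)
    then show ?case using s[of "k - 1"] by simp
  qed (use s in auto)
qed

text \<open>The two enumerations differ by an order automorphism of the integers, which is a
  translation.\<close>

lemma same_range_shift:
  fixes a b :: "int \<Rightarrow> real"
  assumes "strict_mono a" "strict_mono b" "range a = range b"
  obtains P where "\<And>k. b k = a (k + P)"
proof -
  have "\<exists>l. a l = b k" for k using assms(3) by (metis rangeE rangeI)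
  then obtain f where f: "\<And>k. a (f k) = b k" by metis
  have "strict_mono f"
    using assms(1,2) f unfolding strict_mono_def by (metis assms(1) strict_mono_less)
  moreover have "surj f"
  proof -
    have "\<exists>k. f k = l" for l
    proof -
      obtain k where "b k = a l" using assms(3) by (metis rangeE rangeI)
      then show ?thesis using f assms(1) by (metis strict_mono_eq)
    qed
    then show ?thesis by (metis surjI)
  qed
  ultimately show ?thesis using int_shift_of_strict_mono_surj f that[of "f 0"] by metis
qed

lemma lattice_strict_mono:
  fixes f :: "int \<Rightarrow> real"
  assumes "\<And>i. f (i + 1) - f i \<in> {2, 3}"
  shows "strict_mono f"
proof (rule strict_monoI)
  fix i j :: int assume "i < j"
  then show "f i < f j" using lattice_mono(2)[of f i j, OF assms] by simp
qed

text \<open>An invariant sequence is shifted by some number \<open>P\<close> of indices, which is a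
  period of its gap word; irrationality of the slope leaves only \<open>P = 0\<close>.\<close>

lemma lattice_no_shift:
  fixes f :: "int \<Rightarrow> real"
  assumes gap: "\<And>i. f (i + 1) - f i \<in> {2, 3}" and slope: "near_slope \<beta> (gap_word 2 f)" "\<beta> \<notin> \<rat>"
    and "range (\<lambda>i. f i + \<delta>) = range f"
  shows "\<delta> = 0"
proof -
  have sm: "strict_mono f" by (rule lattice_strict_mono[of f, OF gap])
  then have "strict_mono (\<lambda>i. f i + \<delta>)" by (simp add: strict_mono_def)
  then obtain P where P: "\<And>k. f k + \<delta> = f (k + P)" using same_range_shift[OF sm _ assms(4)[symmetric]] by metis
  have per: "gap_word 2 f (i + P) = gap_word 2 f i" for i
  proof -
    have "f (i + P + 1) = f (i + 1) + \<delta>" using P[of "i + 1"] by (simp add: algebra_simps)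
    then show ?thesis unfolding gap_word_def P[symmetric] by simp
  qed
  have "P = 0"
  proof (rule ccontr)
    assume "P \<noteq> 0"
    define p where "p = nat \<bar>P\<bar>"
    have "p > 0" using \<open>P \<noteq> 0\<close> by (simp add: p_def)
    moreover have "gap_word 2 f (i + int p) = gap_word 2 f i" for i
      using per[of i] per[of "i - P"] by (cases "P > 0") (auto simp: p_def)
    ultimately show False using not_periodic_if_irrational[OF slope] by blast
  qed
  then show ?thesis using P[of 0] by simp
qed

text \<open>The heights of the lower corners can be read off from a cell. A translation permuting
  the cells therefore shifts the sequences \<open>a\<close> and \<open>b\<close> onto themselves, by
  \<open>n \<bullet> v\<close> and \<open>m \<bullet> v\<close>.\<close>

lemma translation_of_lattice:
  assumes lat: "two_color_lattice 2 a b c" and g: "isometry g"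
    and slope: "near_slope \<beta> (gap_word 2 a)" "near_slope \<beta> (gap_word 2 b)" "\<beta> \<notin> \<rat>"
    and inv: "move_cell (\<lambda>x. x + v) ` (move_cell g ` range (lattice_cell a b c)) = move_cell g ` range (lattice_cell a b c)"
  shows "v = 0"
proof -
  let ?F = "\<lambda>ij. move_cell g (lattice_cell a b c ij)"
  have ga: "a (i + 1) - a i \<in> {2, 3}" and gb: "b (i + 1) - b i \<in> {2, 3}" for i
    using lat unfolding two_color_lattice_2_iff by auto
  have sz: "0 \<le> a (i + 1) - a i" "0 \<le> b (i + 1) - b i" for i using ga[of i] gb[of i] by auto
  obtain n m x0 y0 where reg: "frame n m"
    "\<And>i j. fst (?F (i, j)) = reg n m (a i + x0) (a (i + 1) - a i) (b j + y0) (b (j + 1) - b j)"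
    using moved_region[OF lat g] by blast
  have shift: "(\<lambda>x. x + v) ` reg n m x e y e' = reg n m (x + n \<bullet> v) e (y + m \<bullet> v) e'" for x e y e'
  proof -
    have "p \<in> (\<lambda>x. x + v) ` S \<longleftrightarrow> p - v \<in> S" for p S by (auto simp: image_iff intro: bexI[of _ "p - v"])
    then show ?thesis by (auto simp: reg_def inner_diff_right algebra_simps)
  qed
  have eq: "a i + n \<bullet> v = a i' \<and> b j + m \<bullet> v = b j'" if "move_cell (\<lambda>x. x + v) (?F (i, j)) = ?F (i', j')" for i j i' j'
  proof -
    have "(\<lambda>x. x + v) ` fst (?F (i, j)) = fst (?F (i', j'))" using arg_cong[OF that, of fst] by (simp add: case_prod_beta)
    then have "reg n m (a i + x0 + n \<bullet> v) (a (i + 1) - a i) (b j + y0 + m \<bullet> v) (b (j + 1) - b j) =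
       reg n m (a i' + x0) (a (i' + 1) - a i') (b j' + y0) (b (j' + 1) - b j')"
      unfolding reg(2) shift .
    from reg_eq_iff[OF reg(1) this] sz show ?thesis by simp
  qed
  have fw: "\<exists>i' j'. a i + n \<bullet> v = a i' \<and> b j + m \<bullet> v = b j'" for i j
  proof -
    have "move_cell (\<lambda>x. x + v) (?F (i, j)) \<in> move_cell g ` range (lattice_cell a b c)" using inv by blast
    then obtain ij' where "move_cell (\<lambda>x. x + v) (?F (i, j)) = ?F ij'" by blast
    then show ?thesis using eq by (cases ij') blast
  qed
  have bw: "\<exists>i j. a i + n \<bullet> v = a i' \<and> b j + m \<bullet> v = b j'" for i' j'
  proof -
    have "?F (i', j') \<in> move_cell (\<lambda>x. x + v) ` (move_cell g ` range (lattice_cell a b c))" using inv by blast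
    then obtain ij where "?F (i', j') = move_cell (\<lambda>x. x + v) (?F ij)" by blast
    then show ?thesis using eq by (cases ij) metis
  qed
  have "range (\<lambda>i. a i + n \<bullet> v) = range a" "range (\<lambda>i. b i + m \<bullet> v) = range b"
    using fw bw by (auto simp: image_iff) (metis)+
  then have "n \<bullet> v = 0" "m \<bullet> v = 0"
    using lattice_no_shift[of a, OF ga slope(1,3)] lattice_no_shift[of b, OF gb slope(2,3)] by blast+
  then show ?thesis using frame_eqI[OF reg(1), of v 0] by simp
qed

section \<open>Edges and bars of a lattice as unions of lines\<close>

lemma lattice_regions_cover:
  assumes lat: "two_color_lattice 2 a b c"
  obtains i j where "p \<in> lattice_region a b (i, j)" "height 0 p < a (i + 1)" "height 1 p < b (j + 1)"
proof -
  have g: "a (i + 1) - a i \<in> {2, 3}" "b (i + 1) - b i \<in> {2, 3}" for i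
    using lat unfolding two_color_lattice_2_iff by auto
  have "a i + 2 \<le> a (i + 1)" "b i + 2 \<le> b (i + 1)" for i
    using g[of i] by auto
  then obtain i j where "a i \<le> height 0 p" "height 0 p < a (i + 1)" "b j \<le> height 1 p" "height 1 p < b (j + 1)"
    using bracket_real_seq[of a "height 0 p"] bracket_real_seq[of b "height 1 p"] by metis
  then show ?thesis by (intro that[of i j]) (auto simp: lattice_region_def)
qed

lemma lattice_region_reg:
  assumes lat: "two_color_lattice 2 a b c"
  shows "lattice_region a b (i, j) = reg (nrm 0) (nrm 1) (a i) (a (i + 1) - a i) (b j) (b (j + 1) - b j)"
  using cell_rep_sizes(6)[OF lattice_cell_rep[OF lat, of i j]] by (simp add: lattice_cell_def)

lemma lattice_frontiers:
  assumes lat: "two_color_lattice 2 a b c"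
  shows "(\<Union>ij. frontier (lattice_region a b ij)) = (\<Union>i. bar 0 (a i)) \<union> (\<Union>j. bar 1 (b j))"
proof (intro set_eqI iffI)
  fix p assume "p \<in> (\<Union>ij. frontier (lattice_region a b ij))"
  then obtain i j where "p \<in> frontier (lattice_region a b (i, j))" by auto
  then have "nrm 0 \<bullet> p \<in> {a i, a (i + 1)} \<or> nrm 1 \<bullet> p \<in> {b j, b (j + 1)}"
    unfolding lattice_region_reg[OF lat] frontier_reg[OF frame_nrm(1)] by auto
  then show "p \<in> (\<Union>i. bar 0 (a i)) \<union> (\<Union>j. bar 1 (b j))" unfolding bar_nrm by blast
next
  have g: "a (i + 1) - a i \<in> {2, 3}" "b (i + 1) - b i \<in> {2, 3}" for i
    using lat unfolding two_color_lattice_2_iff by auto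
  have sz: "a i + 2 \<le> a (i + 1)" "b i + 2 \<le> b (i + 1)" for i
    using g[of i] by auto
  fix p assume "p \<in> (\<Union>i. bar 0 (a i)) \<union> (\<Union>j. bar 1 (b j))"
  then consider k where "nrm 0 \<bullet> p = a k" | k where "nrm 1 \<bullet> p = b k" unfolding bar_nrm by blast
  then show "p \<in> (\<Union>ij. frontier (lattice_region a b ij))"
  proof cases
    case 1
    obtain i j where "p \<in> lattice_region a b (i, j)" by (rule lattice_regions_cover[OF lat])
    then have "p \<in> frontier (lattice_region a b (k, j))"
      using 1 sz[of k] unfolding lattice_region_reg[OF lat] frontier_reg[OF frame_nrm(1)] by (auto simp: reg_def)
    then show ?thesis by blast
  next
    case 2
    obtain i j where "p \<in> lattice_region a b (i, j)" by (rule lattice_regions_cover[OF lat])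
    then have "p \<in> frontier (lattice_region a b (i, k))"
      using 2 sz[of k] unfolding lattice_region_reg[OF lat] frontier_reg[OF frame_nrm(1)] by (auto simp: reg_def)
    then show ?thesis by blast
  qed
qed

lemma compact_lattice_region:
  assumes lat: "two_color_lattice 2 a b c"
  shows "compact (lattice_region a b ij)"
  using compact_reg[OF frame_nrm(1)] by (cases ij) (simp add: lattice_region_reg[OF lat])

lemma isometry_frontier_image:
  assumes "isometry g" "compact S"
  shows "frontier (g ` S) = g ` frontier S"
proof -
  have "continuous_on S g" using assms(1) unfolding continuous_on_iff isometry_def by auto
  then have "closed (g ` S)" using assms(2) by (intro compact_imp_closed compact_continuous_image)
  moreover have "closed S" using assms(2) by (rule compact_imp_closed)
  ultimately show ?thesis
    using isometry_bij[OF assms(1)]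
    by (simp add: frontier_def closure_closed isometry_interior_image[OF assms(1)] image_set_diff bij_is_inj)
qed

lemma lattice_image_bars_form:
  assumes lat: "two_color_lattice 2 a b c" and g: "isometry g"
    and cells: "cells \<T> = move_cell g ` range (lattice_cell a b c)"
  shows "bars_form_lattice 2 \<T> a b c"
proof -
  have "(\<Union>C\<in>cells \<T>. frontier (fst C)) = (\<Union>ij. frontier (g ` lattice_region a b ij))"
    unfolding cells by (simp add: lattice_cell_def)
  also have "\<dots> = (\<Union>ij. g ` frontier (lattice_region a b ij))"
    by (simp only: isometry_frontier_image[OF g compact_lattice_region[OF lat]])
  also have "\<dots> = g ` ((\<Union>i. bar 0 (a i)) \<union> (\<Union>j. bar 1 (b j)))"
    unfolding lattice_frontiers[OF lat, symmetric] by blast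
  finally have 1: "(\<Union>C\<in>cells \<T>. frontier (fst C)) = g ` ((\<Union>i. bar 0 (a i)) \<union> (\<Union>j. bar 1 (b j)))" .
  have "(\<Union>C\<in>cells \<T>. snd C) = (\<Union>ij. g ` (lattice_region a b ij \<inter> (\<Union>k. bar 2 (c k))))"
    unfolding cells by (simp add: lattice_cell_def)
  also have "\<dots> = g ` ((\<Union>ij. lattice_region a b ij) \<inter> (\<Union>k. bar 2 (c k)))" by blast
  also have "(\<Union>ij. lattice_region a b ij) = UNIV"
    using lattice_regions_cover[OF lat] by (metis UNIV_eq_I UN_I UNIV_I)
  finally have 2: "(\<Union>C\<in>cells \<T>. snd C) = g ` (\<Union>k. bar 2 (c k))" by simp
  show ?thesis unfolding bars_form_lattice_def using lat g 1 2 by blast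
qed

theorem forced_lattice:
  assumes fin: "finite \<P>" and P: "\<forall>P\<in>\<P>. \<exists>T\<in>A. patch_tile 2 T P" and A: "\<forall>T\<in>A. linf wt T = 0"
    and t: "matching_tiling \<P> \<T>"
  obtains g a b c \<beta> where "isometry g" "two_color_lattice 2 a b c" "cells \<T> = move_cell g ` range (lattice_cell a b c)"
    "\<beta> \<in> {0..1}" "\<And>f. f \<in> {a, b, c} \<Longrightarrow> near_slope \<beta> (gap_word 2 f)"
    "real_of_int (wt 0) * (1 - \<beta>)\<^sup>2 + 2 * real_of_int (wt 1) * \<beta> * (1 - \<beta>) + real_of_int (wt 2) * \<beta>\<^sup>2 = 0"
proof -
  have "bar_tiling (cells \<T>)" using matching_bar_tiling[OF _ t] P by blast
  then obtain g a b c where l: "isometry g" "two_color_lattice 2 a b c" "cells \<T> = move_cell g ` range (lattice_cell a b c)"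
    using bar_tiling.lattice_structure by metis
  obtain \<beta> where \<beta>: "\<beta> \<in> {0..1}" "\<And>f. f \<in> {a, b, c} \<Longrightarrow> near_slope \<beta> (gap_word 2 f)"
    using lattice_slope[OF l(2)] by metis
  have "tiling \<P> \<T>" using t by (simp add: matching_tiling_def)
  from tiling_slope_equation[OF fin P A this l \<beta>(1)] \<beta>(2) that[OF l \<beta>] show ?thesis by simp
qed

section \<open>Independence of the slope from the presentation\<close>

lemma near_slope_shift: "near_slope \<beta> w \<Longrightarrow> near_slope \<beta> (\<lambda>i. w (i + P))"
proof -
  have "cnt (\<lambda>i. w (i + P)) i n = cnt w (i + P) n" for i n
    by (simp add: cnt_def algebra_simps)
  then show "near_slope \<beta> w \<Longrightarrow> near_slope \<beta> (\<lambda>i. w (i + P))" by (simp add: near_slope_def)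
qed

lemma near_slope_reverse: "near_slope \<beta> w \<Longrightarrow> near_slope \<beta> (\<lambda>i. w (- i))"
proof -
  have "cnt (\<lambda>i. w (- i)) i n = cnt w (- i - int n + 1) n" for i n
  proof (induction n)
    case (Suc n)
    have "cnt w (- i - int (Suc n) + 1) (1 + n) = cnt w (- i - int (Suc n) + 1) 1 + cnt w (- i - int (Suc n) + 1 + int 1) n"
      by (rule cnt_add)
    moreover have "cnt w (- i - int (Suc n) + 1) 1 = of_bool (w (- (i + int n)))" by (simp add: cnt_def algebra_simps)
    moreover have "- i - int (Suc n) + 1 + int 1 = - i - int n + 1" by simp
    ultimately show ?case using Suc by (simp add: cnt_Suc)
  qed simp
  then show "near_slope \<beta> w \<Longrightarrow> near_slope \<beta> (\<lambda>i. w (- i))" by (simp add: near_slope_def)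
qed

text \<open>Any two presentations of the bars of a tiling as lattices share the family of lines carrying
  the bar segments, hence have the same slope.\<close>

lemma same_lines_same_slope:
  assumes gc: "\<And>i. c (i + 1) - c i \<in> {2, 3}" and gd: "\<And>i. d (i + 1) - d i \<in> {2, 3}"
    and g: "isometry g" and h: "isometry h"
    and eq: "g ` (\<Union>k. bar 2 (c k)) = h ` (\<Union>k. bar 2 (d k))"
    and slope: "near_slope \<beta> (gap_word 2 c)"
  shows "near_slope \<beta> (gap_word 2 d)"
proof -
  let ?k = "nrm 2"
  have fr: "frame (nrm 1) ?k" using frame_rotate[OF frame_nrm(1)] frame_nrm(2) by simp
  have uk: "?k \<bullet> ?k = 1" using fr by (simp only: frame_def)
  have lines: "\<exists>n \<tau>. n \<bullet> n = 1 \<and> s ` (\<Union>k. bar 2 (f k)) = {q. n \<bullet> q + \<tau> \<in> range f}" if s: "isometry s"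
    for s and f :: "int \<Rightarrow> real"
  proof -
    obtain l where l: "linear l" "\<And>x y. l x \<bullet> l y = x \<bullet> y" "surj l" "\<And>p. s p = l p + s 0"
      using isometry_decompose[OF s] by metis
    have "s ` (\<Union>k. bar 2 (f k)) = s ` {p. ?k \<bullet> p \<in> range f}" unfolding bar_nrm by (rule arg_cong[of _ _ "(`) s"]) blast
    also have "\<dots> = {q. l ?k \<bullet> q - l ?k \<bullet> s 0 \<in> range f}"
      by (rule isometry_image_Collect[OF l, of "\<lambda>X Y. X \<in> range f" ?k ?k])
    finally show ?thesis using l(2)[of ?k ?k] uk
      by (intro exI[of _ "l ?k"] exI[of _ "- (l ?k \<bullet> s 0)"]) simp
  qed
  obtain n \<sigma> where n: "n \<bullet> n = 1" "g ` (\<Union>k. bar 2 (c k)) = {q. n \<bullet> q + \<sigma> \<in> range c}" using lines[OF g, of c] by (elim exE conjE)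
  obtain m \<tau> where m: "m \<bullet> m = 1" "h ` (\<Union>k. bar 2 (d k)) = {q. m \<bullet> q + \<tau> \<in> range d}" using lines[OF h, of d] by (elim exE conjE)
  have same: "n \<bullet> q + \<sigma> \<in> range c \<longleftrightarrow> m \<bullet> q + \<tau> \<in> range d" for q
  proof -
    have "{q. n \<bullet> q + \<sigma> \<in> range c} = {q. m \<bullet> q + \<tau> \<in> range d}" by (rule trans[OF trans[OF n(2)[symmetric] eq] m(2)])
    then have "q \<in> {q. n \<bullet> q + \<sigma> \<in> range c} \<longleftrightarrow> q \<in> {q. m \<bullet> q + \<tau> \<in> range d}" by (rule arg_cong)
    then show ?thesis by (simp only: mem_Collect_eq)
  qed
  have smc: "strict_mono c" by (rule lattice_strict_mono[of c, OF gc])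
  have smd: "strict_mono d" by (rule lattice_strict_mono[of d, OF gd])
  \<comment> \<open>If the normals differed, some line of the first family would contain a point at
    level \<open>d 0 + 1\<close> of the second. It would lie on a line of the second family,
    although its gaps are at least 2.\<close>
  have "m = n \<or> m = - n"
  proof (rule ccontr)
    assume no: "\<not> ?thesis"
    obtain q where q: "n \<bullet> q = c 0 - \<sigma>" "m \<bullet> q = d 0 + 1 - \<tau>"
      using two_lines_meet[OF n(1) m(1)] no by metis
    have "n \<bullet> q + \<sigma> \<in> range c" using q by simp
    then have "d 0 + 1 \<in> range d" using same[of q] q by simp
    then obtain k where k: "d k = d 0 + 1" by (metis rangeE)
    then have "d 0 < d k" by simp
    then have "0 < k" using smd by (simp add: strict_mono_less)
    from lattice_mono(2)[of d 0 k, OF gd this] k show False by simp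
  qed
  then show ?thesis
  proof
    assume mn: "m = n"
    have r: "range (\<lambda>k. c k + (\<tau> - \<sigma>)) = range d"
    proof (intro set_eqI)
      fix x
      have "n \<bullet> ((x - \<tau>) *\<^sub>R n) = x - \<tau>" using n(1) by simp
      then have "x - \<tau> + \<sigma> \<in> range c \<longleftrightarrow> x \<in> range d" using same[of "(x - \<tau>) *\<^sub>R n"] mn n(1) by simp
      moreover have "x - \<tau> + \<sigma> = c k \<longleftrightarrow> x = c k + (\<tau> - \<sigma>)" for k by linarith
      then have "x - \<tau> + \<sigma> \<in> range c \<longleftrightarrow> x \<in> range (\<lambda>k. c k + (\<tau> - \<sigma>))"
        by (simp only: image_iff)
      ultimately show "x \<in> range (\<lambda>k. c k + (\<tau> - \<sigma>)) \<longleftrightarrow> x \<in> range d" by blast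
    qed
    have sm: "strict_mono (\<lambda>k. c k + (\<tau> - \<sigma>))" using smc by (simp add: strict_mono_def)
    obtain P where P: "\<And>k. d k = c (k + P) + (\<tau> - \<sigma>)" by (rule same_range_shift[OF sm smd r]) (rule that)
    have "gap_word 2 d = (\<lambda>i. gap_word 2 c (i + P))"
      by (rule ext) (simp add: gap_word_def P algebra_simps)
    then show ?thesis using near_slope_shift[OF slope] by simp
  next
    assume mn: "m = - n"
    \<comment> \<open>Opposite normals: the second sequence runs through the first one
      backwards.\<close>
    have r: "range (\<lambda>k. - c (- k) + (\<tau> + \<sigma>)) = range d"
    proof (intro set_eqI)
      fix x
      have "n \<bullet> ((\<tau> - x) *\<^sub>R n) = \<tau> - x" using n(1) by simp
      then have "\<tau> - x + \<sigma> \<in> range c \<longleftrightarrow> x \<in> range d" using same[of "(\<tau> - x) *\<^sub>R n"] mn n(1) by simp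
      moreover have "\<tau> - x + \<sigma> \<in> range c \<longleftrightarrow> x \<in> range (\<lambda>k. - c (- k) + (\<tau> + \<sigma>))"
      proof
        assume "\<tau> - x + \<sigma> \<in> range c"
        then obtain k where "\<tau> - x + \<sigma> = c k" by blast
        then have "x = - c (- (- k)) + (\<tau> + \<sigma>)" by simp
        then show "x \<in> range (\<lambda>k. - c (- k) + (\<tau> + \<sigma>))" by blast
      next
        assume "x \<in> range (\<lambda>k. - c (- k) + (\<tau> + \<sigma>))"
        then obtain k where "x = - c (- k) + (\<tau> + \<sigma>)" by blast
        then have "\<tau> - x + \<sigma> = c (- k)" by simp
        then show "\<tau> - x + \<sigma> \<in> range c" by blast
      qed
      ultimately show "x \<in> range (\<lambda>k. - c (- k) + (\<tau> + \<sigma>)) \<longleftrightarrow> x \<in> range d" by blast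
    qed
    have sm: "strict_mono (\<lambda>k. - c (- k) + (\<tau> + \<sigma>))" using smc by (simp add: strict_mono_def)
    obtain P where P: "\<And>k. d k = - c (- (k + P)) + (\<tau> + \<sigma>)" by (rule same_range_shift[OF sm smd r]) (rule that)
    \<comment> \<open>Reversal exchanges the two ends of a gap, which accounts for the additional 1
      in the index.\<close>
    have "gap_word 2 d i = gap_word 2 c (- (i + (P + 1)))" for i
    proof -
      have "- (i + (P + 1)) + 1 = - (i + P)" "i + 1 + P = i + (P + 1)" by simp_all
      then show ?thesis by (simp only: gap_word_def P) (simp add: algebra_simps)
    qed
    then have "gap_word 2 d = (\<lambda>i. (\<lambda>i. gap_word 2 c (- i)) (i + (P + 1)))" by (intro ext)
    then show ?thesis using near_slope_shift[OF near_slope_reverse[OF slope], of "P + 1"] by simp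
  qed
qed

text \<open>The first two families are only visible merged, as edges, so the third one is compared;
  within each lattice all three families have the same slope.\<close>

lemma bars_form_slope:
  assumes "bars_form_lattice 2 \<T> a b c" "bars_form_lattice 2 \<T> a' b' c'" "near_slope \<beta> (gap_word 2 c)"
    and "f \<in> {a', b', c'}"
  shows "near_slope \<beta> (gap_word 2 f)"
proof -
  obtain g where g: "isometry g" "(\<Union>C\<in>cells \<T>. snd C) = g ` (\<Union>k. bar 2 (c k))" "two_color_lattice 2 a b c"
    using assms(1) unfolding bars_form_lattice_def by (elim conjE exE) (rule that)
  obtain h where h: "isometry h" "(\<Union>C\<in>cells \<T>. snd C) = h ` (\<Union>k. bar 2 (c' k))" "two_color_lattice 2 a' b' c'"
    using assms(2) unfolding bars_form_lattice_def by (elim conjE exE) (rule that)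
  have gc: "c (i + 1) - c i \<in> {2, 3}" and gd: "c' (i + 1) - c' i \<in> {2, 3}" for i
    using g(3) h(3) unfolding two_color_lattice_2_iff by auto
  have "near_slope \<beta> (gap_word 2 c')"
    using same_lines_same_slope[of c c', OF gc gd g(1) h(1)] g(2) h(2) assms(3) by simp
  moreover obtain \<beta>' where b: "\<And>f. f \<in> {a', b', c'} \<Longrightarrow> near_slope \<beta>' (gap_word 2 f)"
    by (rule lattice_slope[OF h(3)]) (rule that)
  then have "near_slope \<beta>' (gap_word 2 c')" by simp
  ultimately have "\<beta> = \<beta>'" by (rule near_slope_unique)
  then show ?thesis using b assms(4) by simp
qed

lemma near_slope_has_slope:
  assumes "\<And>f. f \<in> {a, b, c} \<Longrightarrow> near_slope \<beta> (gap_word 2 f)"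
  shows "has_slope 2 a b c \<beta>"
  unfolding has_slope_def using near_slope_density[OF assms] by blast

text \<open>The second conclusion speaks of every presentation of the bars as a lattice, not just of
  the one constructed, and gives uniform discrepancy instead of density. The expansion constant
  needs both.\<close>

theorem aperiodic_patch_tiles_if_tiling:
  assumes fin: "finite \<P>" and P: "\<forall>P\<in>\<P>. is_tile P \<and> (\<exists>T\<in>A. patch_tile 2 T P)" and A: "\<forall>T\<in>A. linf wt T = 0"
    and ex: "\<exists>\<T>. matching_tiling \<P> \<T>"
    and roots: "\<And>\<beta>. real_of_int (wt 0) * (1 - \<beta>)\<^sup>2 + 2 * real_of_int (wt 1) * \<beta> * (1 - \<beta>) + real_of_int (wt 2) * \<beta>\<^sup>2 = 0 \<Longrightarrow>
      \<beta> \<in> \<Sigma> \<and> \<beta> \<notin> \<rat>"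
  shows "aperiodic_patch_tiles 2 A \<Sigma> \<P>"
    and "\<And>\<T> a b c. matching_tiling \<P> \<T> \<Longrightarrow> bars_form_lattice 2 \<T> a b c \<Longrightarrow>
      \<exists>\<beta>\<in>\<Sigma> \<inter> {0..1}. \<forall>f\<in>{a, b, c}. near_slope \<beta> (gap_word 2 f)"
proof -
  have P': "\<forall>P\<in>\<P>. \<exists>T\<in>A. patch_tile 2 T P" using P by blast
  have nonper: "non_periodic \<T>" if t: "matching_tiling \<P> \<T>" for \<T>
    unfolding non_periodic_def
  proof (intro allI impI notI)
    fix v :: complex assume v: "v \<noteq> 0" "move (\<lambda>x. x + v) ` \<T> = \<T>"
    obtain g a b c \<beta> where l: "isometry g" "two_color_lattice 2 a b c" "cells \<T> = move_cell g ` range (lattice_cell a b c)"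
      "\<beta> \<in> {0..1}" "\<And>f. f \<in> {a, b, c} \<Longrightarrow> near_slope \<beta> (gap_word 2 f)"
      "real_of_int (wt 0) * (1 - \<beta>)\<^sup>2 + 2 * real_of_int (wt 1) * \<beta> * (1 - \<beta>) + real_of_int (wt 2) * \<beta>\<^sup>2 = 0"
      using forced_lattice[OF fin P' A t] by blast
    have "cells (move (\<lambda>x. x + v) ` \<T>) = move_cell (\<lambda>x. x + v) ` cells \<T>"
      unfolding cells_def move_def by auto
    then have "move_cell (\<lambda>x. x + v) ` cells \<T> = cells \<T>" using v(2) by simp
    then have "v = 0" using translation_of_lattice[OF l(2,1) _ _ _ , of \<beta> v] l(3,5,6) roots by simp
    then show False using v(1) by simp
  qed
  show "aperiodic_patch_tiles 2 A \<Sigma> \<P>"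
    unfolding aperiodic_patch_tiles_def aperiodic_def
  proof (intro conjI allI impI fin P ex nonper)
    fix \<T> assume t: "matching_tiling \<P> \<T>"
    obtain g a b c \<beta> where l: "isometry g" "two_color_lattice 2 a b c" "cells \<T> = move_cell g ` range (lattice_cell a b c)"
      "\<beta> \<in> {0..1}" "\<And>f. f \<in> {a, b, c} \<Longrightarrow> near_slope \<beta> (gap_word 2 f)"
      "real_of_int (wt 0) * (1 - \<beta>)\<^sup>2 + 2 * real_of_int (wt 1) * \<beta> * (1 - \<beta>) + real_of_int (wt 2) * \<beta>\<^sup>2 = 0"
      using forced_lattice[OF fin P' A t] by blast
    show "\<exists>\<beta>\<in>\<Sigma>. \<exists>a b c. bars_form_lattice 2 \<T> a b c \<and> has_slope 2 a b c \<beta>"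
      using lattice_image_bars_form[OF l(2,1,3)] near_slope_has_slope[OF l(5)] roots[OF l(6)] by blast
  qed
  fix \<T> a' b' c' assume t: "matching_tiling \<P> \<T>" and bf: "bars_form_lattice 2 \<T> a' b' c'"
  obtain g a b c \<beta> where l: "isometry g" "two_color_lattice 2 a b c" "cells \<T> = move_cell g ` range (lattice_cell a b c)"
    "\<beta> \<in> {0..1}" "\<And>f. f \<in> {a, b, c} \<Longrightarrow> near_slope \<beta> (gap_word 2 f)"
    "real_of_int (wt 0) * (1 - \<beta>)\<^sup>2 + 2 * real_of_int (wt 1) * \<beta> * (1 - \<beta>) + real_of_int (wt 2) * \<beta>\<^sup>2 = 0"
    using forced_lattice[OF fin P' A t] by blast
  have "near_slope \<beta> (gap_word 2 f)" if "f \<in> {a', b', c'}" for f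
    using bars_form_slope[OF lattice_image_bars_form[OF l(2,1,3)] bf l(5) that] by simp
  then show "\<exists>\<beta>\<in>\<Sigma> \<inter> {0..1}. \<forall>f\<in>{a', b', c'}. near_slope \<beta> (gap_word 2 f)"
    using roots[OF l(6)] l(4) by blast
qed

section \<open>Existence of tilings\<close>

definition sturm_pos :: "real \<Rightarrow> int \<Rightarrow> real" where
  "sturm_pos \<alpha> i = 2 * real_of_int i + real_of_int \<lfloor>real_of_int i * \<alpha>\<rfloor>"

lemma sturm_pos_gap:
  assumes "0 < \<alpha>" "\<alpha> < 1"
  shows "sturm_pos \<alpha> (i + 1) - sturm_pos \<alpha> i = 2 + of_bool (rotw \<alpha> i)"
  using rotw_floor[OF assms, of i] by (simp add: sturm_pos_def)

text \<open>The floor of a sum exceeds the sum of the floors by 0 or 1; the offset 1 / 2 of the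
  third family centres this defect.\<close>

lemma sturm_lattice:
  assumes "0 < \<alpha>" "\<alpha> < 1"
  shows "two_color_lattice 2 (sturm_pos \<alpha>) (sturm_pos \<alpha>) (\<lambda>k. 1 / 2 - sturm_pos \<alpha> (- k))"
  unfolding two_color_lattice_2_iff
proof (intro conjI allI impI ballI)
  fix i j k :: int assume "i + j + k = 0"
  then have k: "- k = i + j" by simp
  let ?x = "real_of_int i * \<alpha>" and ?y = "real_of_int j * \<alpha>"
  have "real_of_int (i + j) * \<alpha> = ?x + ?y" by (simp add: algebra_simps)
  moreover have "\<lfloor>?x + ?y\<rfloor> = \<lfloor>?x\<rfloor> + \<lfloor>?y\<rfloor> \<or> \<lfloor>?x + ?y\<rfloor> = \<lfloor>?x\<rfloor> + \<lfloor>?y\<rfloor> + 1" by linarith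
  ultimately have "\<lfloor>real_of_int (i + j) * \<alpha>\<rfloor> = \<lfloor>?x\<rfloor> + \<lfloor>?y\<rfloor> \<or> \<lfloor>real_of_int (i + j) * \<alpha>\<rfloor> = \<lfloor>?x\<rfloor> + \<lfloor>?y\<rfloor> + 1"
    by simp
  then show "\<bar>sturm_pos \<alpha> i + sturm_pos \<alpha> j + (1 / 2 - sturm_pos \<alpha> (- k))\<bar> = 1 / 2"
    unfolding k sturm_pos_def by auto
next
  have gap: "sturm_pos \<alpha> (i + 1) - sturm_pos \<alpha> i \<in> {2, 3}" for i by (simp add: sturm_pos_gap[OF assms])
  fix f i assume "f \<in> {sturm_pos \<alpha>, sturm_pos \<alpha>, \<lambda>k. 1 / 2 - sturm_pos \<alpha> (- k)}"
  then consider "f = sturm_pos \<alpha>" | "f = (\<lambda>k. 1 / 2 - sturm_pos \<alpha> (- k))" by blast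
  then show "f (i + 1) - f i \<in> {2, 3}"
  proof cases
    case 1 then show ?thesis using gap by simp
  next
    case 2
    have "f (i + 1) - f i = sturm_pos \<alpha> (- i - 1 + 1) - sturm_pos \<alpha> (- i - 1)" by (simp add: 2)
    then show ?thesis using gap[of "- i - 1"] by simp
  qed
qed

lemma gap_word_sturm_pos:
  assumes "0 < \<alpha>" "\<alpha> < 1"
  shows "gap_word 2 (sturm_pos \<alpha>) = rotw \<alpha>"
  by (rule ext) (simp add: gap_word_def sturm_pos_gap[OF assms])

text \<open>Relative positions are integers, hence finitely many in a bounded range of indices: at
  most \<open>2 * N\<close> from the narrow widths and \<open>N + 1\<close> from the floors.\<close>

lemma sturm_pos_diff:
  assumes "0 < \<alpha>" "\<alpha> < 1" "\<bar>i\<bar> \<le> N"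
  shows "sturm_pos \<alpha> (i + I) - sturm_pos \<alpha> I \<in> real_of_int ` {- (3 * N + 1)..3 * N + 1}"
proof -
  let ?k = "2 * i + (\<lfloor>real_of_int (i + I) * \<alpha>\<rfloor> - \<lfloor>real_of_int I * \<alpha>\<rfloor>)"
  have "real_of_int (i + I) * \<alpha> = real_of_int i * \<alpha> + real_of_int I * \<alpha>" by (simp add: algebra_simps)
  moreover have "\<bar>real_of_int i * \<alpha>\<bar> \<le> real_of_int N * 1"
    unfolding abs_mult using assms by (intro mult_mono) auto
  ultimately have "\<bar>\<lfloor>real_of_int (i + I) * \<alpha>\<rfloor> - \<lfloor>real_of_int I * \<alpha>\<rfloor>\<bar> \<le> N + 1" by linarith
  then have "?k \<in> {- (3 * N + 1)..3 * N + 1}" using assms(3) by auto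
  moreover have "sturm_pos \<alpha> (i + I) - sturm_pos \<alpha> I = real_of_int ?k" by (simp add: sturm_pos_def)
  ultimately show ?thesis by blast
qed

section \<open>Finitely many cells up to translation\<close>

lemma two_color_lattice_shift:
  assumes "two_color_lattice 2 a b c"
  shows "two_color_lattice 2 (\<lambda>i. a (i + I) - a I) (\<lambda>j. b (j + J) - b J) (\<lambda>k. c (k - I - J) + a I + b J)"
  unfolding two_color_lattice_2_iff
proof (intro conjI allI impI ballI)
  have h: "\<bar>a i + b j + c k\<bar> = 1 / 2" if "i + j + k = 0" for i j k
    using assms that unfolding two_color_lattice_2_iff by blast
  fix i j k :: int assume "i + j + k = 0"
  then show "\<bar>a (i + I) - a I + (b (j + J) - b J) + (c (k - I - J) + a I + b J)\<bar> = 1 / 2"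
    using h[of "i + I" "j + J" "k - I - J"] by (simp add: add_ac)
next
  have g: "a (i + 1) - a i \<in> {2, 3}" "b (i + 1) - b i \<in> {2, 3}" "c (i + 1) - c i \<in> {2, 3}" for i
    using assms unfolding two_color_lattice_2_iff by auto
  have e: "i + 1 + P = i + P + 1" "i + 1 - P - Q = i - P - Q + 1" for i P Q :: int by simp_all
  fix f i assume "f \<in> {\<lambda>i. a (i + I) - a I, \<lambda>j. b (j + J) - b J, \<lambda>k. c (k - I - J) + a I + b J}"
  then consider "f = (\<lambda>i. a (i + I) - a I)" | "f = (\<lambda>j. b (j + J) - b J)" | "f = (\<lambda>k. c (k - I - J) + a I + b J)"
    by blast
  then show "f (i + 1) - f i \<in> {2, 3}"
  proof cases
    case 1 then show ?thesis using g(1)[of "i + I"] by (simp add: e)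
  next
    case 2 then show ?thesis using g(2)[of "i + J"] by (simp add: e)
  next
    case 3 then show ?thesis using g(3)[of "i - I - J"] by (simp add: e)
  qed
qed

lemma translate_Collect: "(\<lambda>p. p - v) ` {p. Q p} = {p. Q (p + v)}" for v :: complex
  by (auto simp: image_iff) (metis add_diff_cancel_right')

lemma lattice_cell_shift:
  fixes I J :: int and a b c :: "int \<Rightarrow> real"
  defines "v \<equiv> pt (nrm 0) (nrm 1) (a I) (b J)"
  shows "move_cell (\<lambda>p. p - v) (lattice_cell a b c (i + I, j + J)) =
    lattice_cell (\<lambda>i. a (i + I) - a I) (\<lambda>j. b (j + J) - b J) (\<lambda>k. c (k - I - J) + a I + b J) (i, j)"
proof -
  have v: "nrm 0 \<bullet> v = a I" "nrm 1 \<bullet> v = b J" unfolding v_def by (rule inner_pt[OF frame_nrm(1)])+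
  have h: "height 0 (p + v) = height 0 p + a I" "height 1 (p + v) = height 1 p + b J"
    "height 2 (p + v) = height 2 p - a I - b J" for p
    using v by (simp_all del: One_nat_def add: height_nrm frame_nrm(2) inner_add_right inner_diff_left)
  have R: "(\<lambda>p. p - v) ` lattice_region a b (i + I, j + J) = lattice_region (\<lambda>i. a (i + I) - a I) (\<lambda>j. b (j + J) - b J) (i, j)"
    unfolding lattice_region_def prod.case translate_Collect h by (intro Collect_cong) (auto simp: add_ac)
  have "(\<Union>k. bar 2 (c k)) = {p. \<exists>k. height 2 p = c k}" by (auto simp: bar_def)
  then have "(\<lambda>p. p - v) ` (\<Union>k. bar 2 (c k)) = {p. \<exists>k. height 2 p - a I - b J = c k}" by (simp only: translate_Collect h)
  also have "\<dots> = (\<Union>k. bar 2 (c (k - I - J) + a I + b J))"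
  proof -
    have "(\<exists>k. height 2 p - a I - b J = c k) \<longleftrightarrow> (\<exists>k. height 2 p = c (k - I - J) + a I + b J)" for p
    proof
      assume "\<exists>k. height 2 p - a I - b J = c k"
      then obtain k where "height 2 p - a I - b J = c k" ..
      then have "height 2 p = c (k + I + J - I - J) + a I + b J" by simp
      then show "\<exists>k. height 2 p = c (k - I - J) + a I + b J" ..
    next
      assume "\<exists>k. height 2 p = c (k - I - J) + a I + b J"
      then obtain k where "height 2 p = c (k - I - J) + a I + b J" ..
      then have "height 2 p - a I - b J = c (k - I - J)" by simp
      then show "\<exists>k. height 2 p - a I - b J = c k" ..
    qed
    then show ?thesis by (auto simp: bar_def)
  qed
  finally have B: "(\<lambda>p. p - v) ` (\<Union>k. bar 2 (c k)) = (\<Union>k. bar 2 (c (k - I - J) + a I + b J))" .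
  have "inj (\<lambda>p. p - v)" by (rule injI) simp
  then show ?thesis unfolding lattice_cell_def prod.case image_Int[OF \<open>inj _\<close>] R B by simp
qed

text \<open>A cell is determined by its corner, its two widths and the signs of the three offsets of
  its bars.\<close>

lemma finite_normalized_cells:
  assumes "finite X"
  obtains F where "finite F" "\<And>a b c i j. two_color_lattice 2 a b c \<Longrightarrow> a i \<in> X \<Longrightarrow> b j \<in> X \<Longrightarrow> lattice_cell a b c (i, j) \<in> F"
proof
  let ?mk = "\<lambda>(x, e, y, e', s0, s1, s2). (reg (nrm 0) (nrm 1) x e y e',
    {p \<in> reg (nrm 0) (nrm 1) x e y e'. (nrm 0 + nrm 1) \<bullet> p \<in> {x + y + s0, x + e + y + s1, x + e + y + e' + s2}})"
  let ?S = "{1 / 2, - 1 / 2 :: real}"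
  let ?D = "X \<times> {2, 3} \<times> X \<times> {2, 3} \<times> ?S \<times> ?S \<times> ?S"
  show "finite (?mk ` ?D)" using assms by simp
  fix a b c i j assume lat: "two_color_lattice 2 a b c" and x: "a i \<in> X" "b j \<in> X"
  have S: "k - z \<in> ?S" if "\<bar>k - z\<bar> = 1 / 2" for k z :: real
  proof -
    have "k - z = 1 / 2 \<or> k - z = - 1 / 2" using that by linarith
    then show ?thesis by simp
  qed
  have ga: "a (i + 1) - a i \<in> {2, 3}" and gb: "b (j + 1) - b j \<in> {2, 3}"
    using lat unfolding two_color_lattice_2_iff by auto
  define k0 k1 k2 where k: "k0 = - c (- i - j)" "k1 = - c (- i - j - 1)" "k2 = - c (- i - j - 2)"
  have rep: "cell_rep (nrm 0) (nrm 1) (a i) (a (i + 1) - a i) (b j) (b (j + 1) - b j) k0 k1 k2 (lattice_cell a b c (i, j))"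
    unfolding k by (rule lattice_cell_rep[OF lat])
  let ?t = "(a i, a (i + 1) - a i, b j, b (j + 1) - b j, k0 - (a i + b j), k1 - (a i + (a (i + 1) - a i) + b j),
    k2 - (a i + (a (i + 1) - a i) + b j + (b (j + 1) - b j)))"
  have t: "?t \<in> ?D" using x ga gb rep S unfolding cell_rep_def mem_Times_iff fst_conv snd_conv by blast
  have "lattice_cell a b c (i, j) = ?mk ?t" using rep unfolding cell_rep_def by simp
  then show "lattice_cell a b c (i, j) \<in> ?mk ` ?D" using t by (rule image_eqI)
qed

section \<open>Tiles and tilings made of lattice cells\<close>

lemma patch_tile_is_tile:
  assumes "patch_tile 2 T P"
  shows "is_tile P"
proof -
  obtain a b c I where h: "two_color_lattice 2 a b c" "finite I" "I \<noteq> {}"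
    "P = (\<Union>ij\<in>I. lattice_region a b ij, lattice_cell a b c ` I)"
    using assms unfolding patch_tile_def by blast
  let ?R = "\<Union>ij\<in>I. lattice_region a b ij"
  have ga: "a (i + 1) - a i \<in> {2, 3}" and gb: "b (j + 1) - b j \<in> {2, 3}" for i j
    using h(1) unfolding two_color_lattice_2_iff by auto
  have ci: "closure (interior (lattice_region a b ij)) = lattice_region a b ij" for ij
  proof (cases ij)
    case (Pair i j)
    have "0 < a (i + 1) - a i" "0 < b (j + 1) - b j" using ga[of i] gb[of j] by auto
    then show ?thesis unfolding Pair lattice_region_reg[OF h(1)] by (rule closure_interior_reg[OF frame_nrm(1)])
  qed
  have cp: "compact ?R" by (rule compact_UN[OF h(2)]) (rule compact_lattice_region[OF h(1)])
  have "lattice_region a b ij \<subseteq> closure (interior ?R)" if "ij \<in> I" for ij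
    using closure_mono[OF interior_mono[OF UN_upper[OF that]], of "lattice_region a b"] unfolding ci .
  moreover have "closure (interior ?R) \<subseteq> ?R"
    by (rule closure_minimal[OF interior_subset compact_imp_closed[OF cp]])
  ultimately have "closure (interior ?R) = ?R" by blast
  moreover have "?R \<noteq> {}"
  proof -
    obtain ij where ij: "ij \<in> I" using h(3) by blast
    have "a i \<le> a (i + 1)" "b j \<le> b (j + 1)" for i j using ga[of i] gb[of j] by auto
    then have "pt (nrm 0) (nrm 1) (a (fst ij)) (b (snd ij)) \<in> lattice_region a b ij"
      by (cases ij) (simp del: One_nat_def add: lattice_region_def height_nrm inner_pt[OF frame_nrm(1)])
    then show ?thesis using ij by blast
  qed
  ultimately show ?thesis using cp by (simp add: is_tile_def h(4))
qed

definition mk_point :: "(nat \<Rightarrow> real) \<Rightarrow> ppoint" where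
  "mk_point f = (f 0, f 1, f 2)"

lemma patch_tile_block:
  assumes lat: "two_color_lattice 2 a b c" and N: "finite N" "N \<noteq> {}"
    and m: "\<And>t. t \<in> {0, 1, 2} \<Longrightarrow> real (card {ij\<in>N. ltype a b ij = t}) = m * f t" and f: "f 0 + f 1 + f 2 = 1"
  shows "patch_tile 2 (mk_point f) (\<Union>ij\<in>N. lattice_region a b ij, lattice_cell a b c ` N)"
proof -
  have "real (card N) = m * f 0 + m * f 1 + m * f 2"
    using card_types[OF N(1), of "gap_word 2 a" "gap_word 2 b"] m[of 0] m[of 1] m[of 2] by simp
  also have "\<dots> = m * (f 0 + f 1 + f 2)" by (simp only: distrib_left)
  finally have cN: "real (card N) = m" using f by simp
  have "real (card N) \<noteq> 0" using N by simp
  with cN have m0: "m \<noteq> 0" by simp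
  have "ppt (2 * (m * f 0)) (m * f 1) (2 * (m * f 2)) = mk_point f"
  proof -
    have "2 * (m * f 0) + 2 * (m * f 1) + 2 * (m * f 2) = 2 * m * (f 0 + f 1 + f 2)" by (simp add: algebra_simps)
    then have "2 * (m * f 0) + 2 * (m * f 1) + 2 * (m * f 2) = 2 * m" using f by simp
    then show ?thesis using m0 by (simp add: ppt_def mk_point_def)
  qed
  then have "mk_point f = ppt (2 * real (card (N \<inter> S_cells 2 a b))) (real (card (N \<inter> M_cells 2 a b)))
    (2 * real (card (N \<inter> L_cells 2 a b)))"
    unfolding type_cells using m[of 0] m[of 1] m[of 2] by simp
  then show ?thesis unfolding patch_tile_def using lat N by blast
qed

text \<open>Strips of the same family coincide, touch along a supporting line, or are disjoint; each
  case cuts out a face. A cell is an intersection of two strips.\<close>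

lemma strip_face:
  fixes n :: complex and a :: "int \<Rightarrow> real"
  assumes gap: "\<And>i. a (i + 1) - a i \<in> {2, 3}" and S: "convex S"
    "\<And>p. p \<in> S \<Longrightarrow> a i \<le> n \<bullet> p \<and> n \<bullet> p \<le> a (i + 1)"
  shows "(S \<inter> {p. a i' \<le> n \<bullet> p \<and> n \<bullet> p \<le> a (i' + 1)}) face_of S"
proof -
  have sz: "a i + 2 \<le> a (i + 1)" for i using gap[of i] by auto
  consider "i' = i" | "i' = i + 1" | "i = i' + 1" | "i + 1 < i'" | "i' + 1 < i" by linarith
  then show ?thesis
  proof cases
    case 1
    then have "S \<inter> {p. a i' \<le> n \<bullet> p \<and> n \<bullet> p \<le> a (i' + 1)} = S" using S(2) by blast
    then show ?thesis using face_of_refl[OF S(1)] by simp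
  next
    case 2
    have "S \<inter> {p. a i' \<le> n \<bullet> p \<and> n \<bullet> p \<le> a (i' + 1)} = S \<inter> {p. n \<bullet> p = a (i + 1)}"
      using S(2) sz[of "i + 1"] 2 by force
    then show ?thesis using face_of_Int_supporting_hyperplane_le[OF S(1), of n "a (i + 1)"] S(2) by simp
  next
    case 3
    have "S \<inter> {p. a i' \<le> n \<bullet> p \<and> n \<bullet> p \<le> a (i' + 1)} = S \<inter> {p. n \<bullet> p = a i}"
      using S(2) sz[of i'] 3 by force
    then show ?thesis using face_of_Int_supporting_hyperplane_ge[OF S(1), of "a i" n] S(2) by simp
  next
    case 4
    have "a (i + 1) + 2 \<le> a i'" by (rule lattice_mono(2)[of a, OF gap 4])
    then have "S \<inter> {p. a i' \<le> n \<bullet> p \<and> n \<bullet> p \<le> a (i' + 1)} = {}" using S(2) by fastforce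
    then show ?thesis by simp
  next
    case 5
    have "a (i' + 1) + 2 \<le> a i" by (rule lattice_mono(2)[of a, OF gap 5])
    then have "S \<inter> {p. a i' \<le> n \<bullet> p \<and> n \<bullet> p \<le> a (i' + 1)} = {}" using S(2) by fastforce
    then show ?thesis by simp
  qed
qed

lemma lattice_region_face:
  assumes lat: "two_color_lattice 2 a b c"
  shows "(lattice_region a b ij \<inter> lattice_region a b ij') face_of lattice_region a b ij"
proof -
  obtain i j i' j' where ij: "ij = (i, j)" "ij' = (i', j')" by (metis surj_pair)
  have ga: "a (i + 1) - a i \<in> {2, 3}" and gb: "b (i + 1) - b i \<in> {2, 3}" for i
    using lat unfolding two_color_lattice_2_iff by auto
  have cv: "convex (lattice_region a b (i, j))" unfolding lattice_region_reg[OF lat] by (rule convex_reg)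
  have "(lattice_region a b (i, j) \<inter> {p. a i' \<le> nrm 0 \<bullet> p \<and> nrm 0 \<bullet> p \<le> a (i' + 1)}) face_of lattice_region a b (i, j)"
    by (rule strip_face[of a _ i, OF ga cv]) (simp add: lattice_region_def height_nrm)
  moreover have "(lattice_region a b (i, j) \<inter> {p. b j' \<le> nrm 1 \<bullet> p \<and> nrm 1 \<bullet> p \<le> b (j' + 1)}) face_of lattice_region a b (i, j)"
    by (rule strip_face[of b _ j, OF gb cv]) (simp del: One_nat_def add: lattice_region_def height_nrm)
  ultimately have "(lattice_region a b (i, j) \<inter> {p. a i' \<le> nrm 0 \<bullet> p \<and> nrm 0 \<bullet> p \<le> a (i' + 1)}) \<inter>
    (lattice_region a b (i, j) \<inter> {p. b j' \<le> nrm 1 \<bullet> p \<and> nrm 1 \<bullet> p \<le> b (j' + 1)}) face_of lattice_region a b (i, j)"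
    by (rule face_of_Int)
  also have "(lattice_region a b (i, j) \<inter> {p. a i' \<le> nrm 0 \<bullet> p \<and> nrm 0 \<bullet> p \<le> a (i' + 1)}) \<inter>
    (lattice_region a b (i, j) \<inter> {p. b j' \<le> nrm 1 \<bullet> p \<and> nrm 1 \<bullet> p \<le> b (j' + 1)}) =
    lattice_region a b (i, j) \<inter> lattice_region a b (i', j')"
    unfolding lattice_region_def height_nrm prod.case by blast
  finally show ?thesis unfolding ij .
qed

lemma block_tiling:
  fixes owner :: "int \<times> int \<Rightarrow> 'k" and a b c :: "int \<Rightarrow> real"
  assumes lat: "two_color_lattice 2 a b c"
  defines "block \<equiv> \<lambda>\<kappa>. (\<Union>ij\<in>{ij. owner ij = \<kappa>}. lattice_region a b ij, lattice_cell a b c ` {ij. owner ij = \<kappa>})"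
  assumes fin: "\<And>\<kappa>. finite {ij. owner ij = \<kappa>}"
    and proto: "\<And>\<kappa>. \<kappa> \<in> range owner \<Longrightarrow> \<exists>P\<in>\<P>. \<exists>g. isometry g \<and> block \<kappa> = move g P"
  shows "matching_tiling \<P> (block ` range owner)"
proof -
  let ?R = "lattice_region a b"
  have cells: "cells (block ` range owner) = range (lattice_cell a b c)"
    unfolding cells_def block_def by auto
  have cover: "(\<Union>T\<in>block ` range owner. fst T) = UNIV"
  proof (rule UNIV_eq_I[symmetric])
    fix p
    obtain i j where "p \<in> ?R (i, j)" by (rule lattice_regions_cover[OF lat])
    then show "p \<in> (\<Union>T\<in>block ` range owner. fst T)" unfolding block_def by auto
  qed
  have ga: "a (i + 1) - a i \<in> {2, 3}" and gb: "b (j + 1) - b j \<in> {2, 3}" for i j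
    using lat unfolding two_color_lattice_2_iff by auto
  have ci: "?R ij = closure (interior (?R ij))" for ij
  proof (cases ij)
    case (Pair i j)
    have "0 < a (i + 1) - a i" "0 < b (j + 1) - b j" using ga[of i] gb[of j] by auto
    then show ?thesis unfolding Pair lattice_region_reg[OF lat] by (rule closure_interior_reg[OF frame_nrm(1), symmetric])
  qed
  \<comment> \<open>The interior of a block may be larger than the union of the interiors of its
    cells, but every nonempty open set in the block meets one of these. Applied twice, this reduces
    disjointness of blocks to disjointness of cells.\<close>
  have meet: "\<exists>ij. owner ij = \<kappa> \<and> V \<inter> interior (?R ij) \<noteq> {}"
    if V: "open V" "V \<noteq> {}" "V \<subseteq> fst (block \<kappa>)" for V \<kappa>
  proof -
    obtain p where pV: "p \<in> V" using V(2) by blast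
    then have "p \<in> (\<Union>ij\<in>{ij. owner ij = \<kappa>}. ?R ij)" using V(3) unfolding block_def by (simp only: fst_conv) blast
    then obtain ij where p: "p \<in> V" "owner ij = \<kappa>" "p \<in> ?R ij" using pV by blast
    then have "p \<in> closure (interior (?R ij))" using ci by blast
    then have "V \<inter> interior (?R ij) \<noteq> {}" using p(1) V(1) open_Int_closure_eq_empty[OF V(1)] by blast
    then show ?thesis using p(2) by blast
  qed
  have disj: "interior (fst (block \<kappa>)) \<inter> interior (fst (block \<kappa>')) = {}" if "\<kappa> \<noteq> \<kappa>'" for \<kappa> \<kappa>'
  proof (rule ccontr)
    let ?V = "interior (fst (block \<kappa>)) \<inter> interior (fst (block \<kappa>'))"
    assume "?V \<noteq> {}"
    moreover have "?V \<subseteq> fst (block \<kappa>)" using interior_subset by blast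
    ultimately obtain ij where ij: "owner ij = \<kappa>" "?V \<inter> interior (?R ij) \<noteq> {}"
      using meet[of ?V \<kappa>] by (auto intro: open_Int)
    have "open (?V \<inter> interior (?R ij))" by (intro open_Int open_interior)
    moreover have "?V \<inter> interior (?R ij) \<subseteq> fst (block \<kappa>')" using interior_subset by blast
    ultimately obtain ij' where ij': "owner ij' = \<kappa>'" "?V \<inter> interior (?R ij) \<inter> interior (?R ij') \<noteq> {}"
      using meet[of "?V \<inter> interior (?R ij)" \<kappa>'] ij(2) by blast
    then have "interior (?R ij) \<inter> interior (?R ij') \<noteq> {}" by blast
    then have "ij = ij'" using lattice_regions_disjoint[OF lat] by blast
    then show False using ij(1) ij'(1) that by simp
  qed
  have tiling: "tiling \<P> (block ` range owner)"
    unfolding tiling_def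
  proof (intro conjI ballI impI)
    fix T assume "T \<in> block ` range owner"
    then show "\<exists>P\<in>\<P>. \<exists>g. isometry g \<and> T = move g P" using proto by blast
  next
    show "(\<Union>T\<in>block ` range owner. fst T) = UNIV" by (rule cover)
  next
    fix T U assume "T \<in> block ` range owner" "U \<in> block ` range owner" "T \<noteq> U"
    then obtain \<kappa> \<kappa>' where TU: "T = block \<kappa>" "U = block \<kappa>'" by (elim imageE) simp
    then have "\<kappa> \<noteq> \<kappa>'" using \<open>T \<noteq> U\<close> by metis
    then show "interior (fst T) \<inter> interior (fst U) = {}" unfolding TU by (rule disj)
  qed
  have edge: "edge_to_edge (block ` range owner)"
    unfolding edge_to_edge_def cells
  proof (intro ballI)
    fix C D assume "C \<in> range (lattice_cell a b c)" "D \<in> range (lattice_cell a b c)"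
    then obtain ij ij' where CD: "fst C = ?R ij" "fst D = ?R ij'" by (auto simp: lattice_cell_def)
    show "fst C \<inter> fst D face_of fst C \<and> fst C \<inter> fst D face_of fst D"
      unfolding CD using lattice_region_face[OF lat, of ij ij'] lattice_region_face[OF lat, of ij' ij] by (simp add: Int_commute)
  qed
  have "bars_continue (block ` range owner)"
    unfolding bars_continue_def
  proof (intro exI conjI ballI)
    have "(\<Union>C\<in>cells (block ` range owner). snd C) = (\<Union>ij. ?R ij) \<inter> (\<Union>k. bar 2 (c k))"
      unfolding cells by (simp add: lattice_cell_def)
    also have "(\<Union>ij. ?R ij) = UNIV" using cover unfolding block_def by auto
    finally show "(\<Union>C\<in>cells (block ` range owner). snd C) = \<Union>(range (\<lambda>k. bar 2 (c k)))" by simp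
    have n2: "nrm 2 \<noteq> 0" using frame_nonzero[OF frame_rotate[OF frame_nrm(1)]] frame_nrm(2) by simp
    fix l assume "l \<in> range (\<lambda>k. bar 2 (c k))"
    then obtain k where l: "l = {p. nrm 2 \<bullet> p = c k}" by (auto simp: bar_nrm)
    show "affine l" unfolding l by (rule affine_hyperplane)
    show "aff_dim l = 1" unfolding l using aff_dim_hyperplane[OF n2, of "c k"] by simp
  qed
  then show ?thesis using tiling edge by (simp add: matching_tiling_def)
qed

lemma block_shift:
  fixes a b c :: "int \<Rightarrow> real" and I J :: int
  defines "v \<equiv> pt (nrm 0) (nrm 1) (a I) (b J)"
    and "a' \<equiv> \<lambda>i. a (i + I) - a I" and "b' \<equiv> \<lambda>j. b (j + J) - b J" and "c' \<equiv> \<lambda>k. c (k - I - J) + a I + b J"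
  assumes N': "N = (\<lambda>(i, j). (i + I, j + J)) ` N'"
  shows "move (\<lambda>p. p - v) (\<Union>ij\<in>N. lattice_region a b ij, lattice_cell a b c ` N) =
    (\<Union>ij\<in>N'. lattice_region a' b' ij, lattice_cell a' b' c' ` N')"
proof -
  have sh: "move_cell (\<lambda>p. p - v) (lattice_cell a b c (i + I, j + J)) = lattice_cell a' b' c' (i, j)" for i j
    unfolding v_def a'_def b'_def c'_def by (rule lattice_cell_shift)
  then have sh': "(\<lambda>p. p - v) ` lattice_region a b (i + I, j + J) = lattice_region a' b' (i, j)" for i j
    by (simp add: lattice_cell_def)
  have "(\<lambda>p. p - v) ` (\<Union>ij\<in>N. lattice_region a b ij) = (\<Union>(i, j)\<in>N'. (\<lambda>p. p - v) ` lattice_region a b (i + I, j + J))"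
    unfolding N' by auto
  also have "\<dots> = (\<Union>ij\<in>N'. lattice_region a' b' ij)" unfolding sh' by auto
  finally have 1: "(\<lambda>p. p - v) ` (\<Union>ij\<in>N. lattice_region a b ij) = (\<Union>ij\<in>N'. lattice_region a' b' ij)" .
  have "move_cell (\<lambda>p. p - v) ` lattice_cell a b c ` N = (\<lambda>(i, j). move_cell (\<lambda>p. p - v) (lattice_cell a b c (i + I, j + J))) ` N'"
    unfolding N' image_image by (rule image_cong) auto
  also have "\<dots> = lattice_cell a' b' c' ` N'" unfolding sh by (rule image_cong) auto
  finally have 2: "move_cell (\<lambda>p. p - v) ` lattice_cell a b c ` N = lattice_cell a' b' c' ` N'" .
  show ?thesis unfolding move_def using 1 2 by simp
qed

text \<open>Frequencies of \<open>X\<close> and \<open>Y\<close> cells in the ratio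
  \<open>u : w\<close>, so that the weights \<open>- w\<close> of \<open>X\<close> and
  \<open>u\<close> of \<open>Y\<close> cancel.\<close>

definition pair_mix :: "nat \<Rightarrow> nat \<Rightarrow> int \<Rightarrow> int \<Rightarrow> nat \<Rightarrow> real" where
  "pair_mix X Y u w t = (if t = X then u / (w + u) else if t = Y then w / (w + u) else 0)"

section \<open>Prototiles from weightless blocks\<close>

lemma sum_types:
  fixes f :: "nat \<Rightarrow> real"
  assumes "{X, Y, Z} = {0, 1, 2}" "X \<noteq> Y" "Y \<noteq> Z" "X \<noteq> Z"
  shows "f 0 + f 1 + f 2 = f X + f Y + f Z"
proof -
  have "f 0 + f 1 + f 2 = sum f {0, 1, 2}" by simp
  also have "\<dots> = sum f {X, Y, Z}" by (simp only: assms(1))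
  also have "\<dots> = f X + f Y + f Z" using assms(2-4) by simp
  finally show ?thesis .
qed

lemma div_bound:
  fixes i h I :: int
  assumes "0 < h" "\<bar>i div h - I\<bar> \<le> 1"
  shows "\<bar>i - I * h\<bar> \<le> 2 * h"
proof -
  have e: "i = (i div h) * h + i mod h" by simp
  have m: "0 \<le> i mod h" "i mod h < h" using assms(1) by auto
  have "i div h = I - 1 \<or> i div h = I \<or> i div h = I + 1" using assms(2) by linarith
  then have "(i div h) * h = I * h - h \<or> (i div h) * h = I * h \<or> (i div h) * h = I * h + h" by (auto simp: algebra_simps)
  then show ?thesis using e m by linarith
qed

text \<open>Each block is translated so that the corner of its index square becomes the origin. Its
  cells then have integer corner heights in a range depending on \<open>h\<close> only, which leaves
  finitely many prototiles.\<close>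

theorem sturm_patch_tiles:
  fixes wt :: "nat \<Rightarrow> int" and w y z :: int and \<alpha> :: real
  assumes \<alpha>: "0 < \<alpha>" "\<alpha> < 1"
    and XYZ: "{X, Y, Z} = {0, 1, 2}" "X \<noteq> Y" "Y \<noteq> Z" "X \<noteq> Z"
    and wt: "wt X = - w" "wt Y = y" "wt Z = z" "0 < w" "0 \<le> y" "0 \<le> z"
    and mean: "real_of_int (wt 0) * (1 - \<alpha>)\<^sup>2 + 2 * real_of_int (wt 1) * \<alpha> * (1 - \<alpha>) + real_of_int (wt 2) * \<alpha>\<^sup>2 = 0"
  defines "A \<equiv> {mk_point (pair_mix X Y y w), mk_point (pair_mix X Z z w)}"
  obtains \<P> where "finite \<P>" "\<forall>P\<in>\<P>. is_tile P \<and> (\<exists>T\<in>A. patch_tile 2 T P)" "\<exists>\<T>. matching_tiling \<P> \<T>"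
proof -
  define a where "a = sturm_pos \<alpha>"
  define c where "c = (\<lambda>k. 1 / 2 - sturm_pos \<alpha> (- k))"
  have lat: "two_color_lattice 2 a a c" unfolding a_def c_def by (rule sturm_lattice[OF \<alpha>])
  have gw: "gap_word 2 a = rotw \<alpha>" unfolding a_def by (rule gap_word_sturm_pos[OF \<alpha>])
  obtain h :: int and owner :: "int \<times> int \<Rightarrow> (int \<times> int) \<times> bool" where h: "0 < h"
    and near: "\<And>i j I J b. owner (i, j) = ((I, J), b) \<Longrightarrow> \<bar>i div h - I\<bar> \<le> 1 \<and> \<bar>j div h - J\<bar> \<le> 1"
    and cT: "\<And>B. \<exists>m. int (card {c. owner c = (B, True) \<and> ctype (rotw \<alpha>) (rotw \<alpha>) c = X}) = y * m \<and>
      int (card {c. owner c = (B, True) \<and> ctype (rotw \<alpha>) (rotw \<alpha>) c = Y}) = w * m \<and>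
      {c. owner c = (B, True) \<and> ctype (rotw \<alpha>) (rotw \<alpha>) c = Z} = {}"
    and cF: "\<And>B. \<exists>m. int (card {c. owner c = (B, False) \<and> ctype (rotw \<alpha>) (rotw \<alpha>) c = X}) = z * m \<and>
      int (card {c. owner c = (B, False) \<and> ctype (rotw \<alpha>) (rotw \<alpha>) c = Z}) = w * m \<and>
      {c. owner c = (B, False) \<and> ctype (rotw \<alpha>) (rotw \<alpha>) c = Y} = {}"
    by (rule balanced_partition[OF \<alpha> XYZ wt mean]) (rule that)
  define N where "N \<kappa> = {ij. owner ij = \<kappa>}" for \<kappa>
  define block where "block \<kappa> = (\<Union>ij\<in>N \<kappa>. lattice_region a a ij, lattice_cell a a c ` N \<kappa>)" for \<kappa>
  define v where "v \<kappa> = pt (nrm 0) (nrm 1) (a (fst (fst \<kappa>) * h)) (a (snd (fst \<kappa>) * h))" for \<kappa> :: "(int \<times> int) \<times> bool"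
  define \<P> where "\<P> = (\<lambda>\<kappa>. move (\<lambda>p. p - v \<kappa>) (block \<kappa>)) ` range owner"
  define sh where "sh \<kappa> f i = f (i + fst (fst \<kappa>) * h) - f (fst (fst \<kappa>) * h)" for \<kappa> :: "(int \<times> int) \<times> bool" and f :: "int \<Rightarrow> real" and i
  define sh' where "sh' \<kappa> f i = f (i + snd (fst \<kappa>) * h) - f (snd (fst \<kappa>) * h)" for \<kappa> :: "(int \<times> int) \<times> bool" and f :: "int \<Rightarrow> real" and i
  define cs where "cs \<kappa> k = c (k - fst (fst \<kappa>) * h - snd (fst \<kappa>) * h) + a (fst (fst \<kappa>) * h) + a (snd (fst \<kappa>) * h)" for \<kappa> :: "(int \<times> int) \<times> bool" and k
  define N' where "N' \<kappa> = (\<lambda>(i, j). (i - fst (fst \<kappa>) * h, j - snd (fst \<kappa>) * h)) ` N \<kappa>" for \<kappa>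
  have lat': "two_color_lattice 2 (sh \<kappa> a) (sh' \<kappa> a) (cs \<kappa>)" for \<kappa>
    unfolding sh_def sh'_def cs_def by (rule two_color_lattice_shift[OF lat])
  have NN': "N \<kappa> = (\<lambda>(i, j). (i + fst (fst \<kappa>) * h, j + snd (fst \<kappa>) * h)) ` N' \<kappa>" for \<kappa>
    unfolding N'_def image_image by force
  have mv: "move (\<lambda>p. p - v \<kappa>) (block \<kappa>) =
    (\<Union>ij\<in>N' \<kappa>. lattice_region (sh \<kappa> a) (sh' \<kappa> a) ij, lattice_cell (sh \<kappa> a) (sh' \<kappa> a) (cs \<kappa>) ` N' \<kappa>)" for \<kappa>
    unfolding block_def v_def sh_def sh'_def cs_def by (rule block_shift[OF NN'])
  have bound: "\<bar>i\<bar> \<le> 2 * h \<and> \<bar>j\<bar> \<le> 2 * h" if ij: "(i, j) \<in> N' \<kappa>" for i j \<kappa>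
  proof -
    obtain I J b where k: "\<kappa> = ((I, J), b)" by (metis surj_pair)
    have "owner (i + I * h, j + J * h) = ((I, J), b)" using ij by (auto simp: N'_def N_def k)
    then show ?thesis using near div_bound[OF h, of "i + I * h" I] div_bound[OF h, of "j + J * h" J] by simp
  qed
  have finN': "finite (N' \<kappa>)" for \<kappa>
  proof (rule finite_subset)
    show "N' \<kappa> \<subseteq> {- 2 * h..2 * h} \<times> {- 2 * h..2 * h}"
    proof
      fix x assume "x \<in> N' \<kappa>"
      then show "x \<in> {- 2 * h..2 * h} \<times> {- 2 * h..2 * h}"
        using bound[of "fst x" "snd x" \<kappa>] by (cases x) (simp add: abs_le_iff minus_le_iff)
    qed
  qed simp
  have finN: "finite (N \<kappa>)" for \<kappa> unfolding NN' by (rule finite_imageI[OF finN'])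
  obtain F where F: "finite F" "\<And>a b c i j. two_color_lattice 2 a b c \<Longrightarrow> a i \<in> real_of_int ` {- (3 * (2 * h) + 1)..3 * (2 * h) + 1} \<Longrightarrow>
    b j \<in> real_of_int ` {- (3 * (2 * h) + 1)..3 * (2 * h) + 1} \<Longrightarrow> lattice_cell a b c (i, j) \<in> F"
    by (rule finite_normalized_cells[of "real_of_int ` {- (3 * (2 * h) + 1)..3 * (2 * h) + 1}"]) (simp, rule that)
  have cell_F: "lattice_cell (sh \<kappa> a) (sh' \<kappa> a) (cs \<kappa>) ` N' \<kappa> \<subseteq> F" for \<kappa>
  proof (rule image_subsetI)
    fix ij assume "ij \<in> N' \<kappa>"
    moreover obtain i j where ij: "ij = (i, j)" by (cases ij)
    ultimately have "\<bar>i\<bar> \<le> 2 * h" "\<bar>j\<bar> \<le> 2 * h" using bound by blast+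
    then show "lattice_cell (sh \<kappa> a) (sh' \<kappa> a) (cs \<kappa>) ij \<in> F"
      unfolding ij sh_def[of \<kappa> a i, symmetric]
      by (intro F(2) lat') (simp_all only: sh_def sh'_def a_def sturm_pos_diff[OF \<alpha>])
  qed
  \<comment> \<open>A prototile is determined by its set of cells, a subset of the finite set
    \<open>F\<close>.\<close>
  have "\<P> \<subseteq> (\<lambda>D. (\<Union>C\<in>D. fst C, D)) ` Pow F"
  proof
    fix P assume "P \<in> \<P>"
    then obtain \<kappa> where "P = move (\<lambda>p. p - v \<kappa>) (block \<kappa>)" by (auto simp: \<P>_def)
    then have "P = (\<lambda>D. (\<Union>C\<in>D. fst C, D)) (lattice_cell (sh \<kappa> a) (sh' \<kappa> a) (cs \<kappa>) ` N' \<kappa>)"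
      unfolding mv by (simp add: lattice_cell_def)
    then show "P \<in> (\<lambda>D. (\<Union>C\<in>D. fst C, D)) ` Pow F" using cell_F[of \<kappa>] by blast
  qed
  then have finP: "finite \<P>" by (rule finite_subset) (simp add: F(1))
  have type: "\<exists>T\<in>A. patch_tile 2 T P" if "P \<in> \<P>" for P
  proof -
    obtain \<kappa> where k: "\<kappa> \<in> range owner" "P = move (\<lambda>p. p - v \<kappa>) (block \<kappa>)" using \<open>P \<in> \<P>\<close> by (auto simp: \<P>_def)
    have ne: "N' \<kappa> \<noteq> {}" using k(1) by (auto simp: N'_def N_def)
    have card_eq: "card {ij\<in>N' \<kappa>. ltype (sh \<kappa> a) (sh' \<kappa> a) ij = t} = card {ij. owner ij = \<kappa> \<and> ctype (rotw \<alpha>) (rotw \<alpha>) ij = t}" for t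
    proof -
      let ?s = "\<lambda>(i, j). (i + fst (fst \<kappa>) * h, j + snd (fst \<kappa>) * h)"
      have g: "gap_word 2 (sh \<kappa> a) i = rotw \<alpha> (i + fst (fst \<kappa>) * h)" "gap_word 2 (sh' \<kappa> a) i = rotw \<alpha> (i + snd (fst \<kappa>) * h)" for i
        unfolding gw[symmetric] by (simp_all add: gap_word_def sh_def sh'_def algebra_simps)
      have ty: "ltype (sh \<kappa> a) (sh' \<kappa> a) ij = ctype (rotw \<alpha>) (rotw \<alpha>) (?s ij)" for ij
        by (cases ij) (simp add: ctype_def g)
      have inj: "inj_on ?s S" for S by (rule inj_onI) auto
      have "?s ` {ij\<in>N' \<kappa>. ltype (sh \<kappa> a) (sh' \<kappa> a) ij = t} = {ij\<in>N \<kappa>. ctype (rotw \<alpha>) (rotw \<alpha>) ij = t}"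
        unfolding NN' ty by blast
      then show ?thesis using card_image[OF inj, of "{ij\<in>N' \<kappa>. ltype (sh \<kappa> a) (sh' \<kappa> a) ij = t}"] by (simp add: N_def)
    qed
    have key: "patch_tile 2 (mk_point (pair_mix X V u w)) P"
      if V: "V \<noteq> X" "{X, V, U} = {0, 1, 2}" "U \<noteq> X" "U \<noteq> V" "0 \<le> u"
        and m: "int (card {ij. owner ij = \<kappa> \<and> ctype (rotw \<alpha>) (rotw \<alpha>) ij = X}) = u * m"
        "int (card {ij. owner ij = \<kappa> \<and> ctype (rotw \<alpha>) (rotw \<alpha>) ij = V}) = w * m"
        "{ij. owner ij = \<kappa> \<and> ctype (rotw \<alpha>) (rotw \<alpha>) ij = U} = {}"
      for V U u m
      unfolding k(2) mv
    proof (rule patch_tile_block[OF lat' finN' ne])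
      have wu: "real_of_int (w + u) > 0" using wt(4) V(5) by simp
      show "pair_mix X V u w 0 + pair_mix X V u w 1 + pair_mix X V u w 2 = 1"
        unfolding sum_types[OF V(2) V(1)[symmetric] V(4)[symmetric] V(3)[symmetric], of "pair_mix X V u w"] using V(1,3,4) wu by (simp add: pair_mix_def add_divide_distrib[symmetric])
      fix t :: nat assume "t \<in> {0, 1, 2}"
      then consider "t = X" | "t = V" | "t = U" using V(2) by blast
      then show "real (card {ij\<in>N' \<kappa>. ltype (sh \<kappa> a) (sh' \<kappa> a) ij = t}) = (real_of_int (w + u) * real_of_int m) * pair_mix X V u w t"
      proof cases
        case 1
        have "real_of_int (int (card {ij\<in>N' \<kappa>. ltype (sh \<kappa> a) (sh' \<kappa> a) ij = t})) = real_of_int (u * m)"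
          unfolding card_eq 1 m(1) ..
        then show ?thesis using 1 wu by (simp add: pair_mix_def)
      next
        case 2
        have "real_of_int (int (card {ij\<in>N' \<kappa>. ltype (sh \<kappa> a) (sh' \<kappa> a) ij = t})) = real_of_int (w * m)"
          unfolding card_eq 2 m(2) ..
        then show ?thesis using 2 V(1) wu by (simp add: pair_mix_def)
      next
        case 3
        then have "card {ij\<in>N' \<kappa>. ltype (sh \<kappa> a) (sh' \<kappa> a) ij = t} = 0" unfolding card_eq by (simp add: m(3))
        then show ?thesis using 3 V(3,4) by (simp add: pair_mix_def)
      qed
    qed
    obtain B b where \<kappa>: "\<kappa> = (B, b)" by (cases \<kappa>)
    show ?thesis
    proof (cases b)
      case True
      then have b: "b = True" by simp
      obtain m where m: "int (card {ij. owner ij = \<kappa> \<and> ctype (rotw \<alpha>) (rotw \<alpha>) ij = X}) = y * m"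
        "int (card {ij. owner ij = \<kappa> \<and> ctype (rotw \<alpha>) (rotw \<alpha>) ij = Y}) = w * m"
        "{ij. owner ij = \<kappa> \<and> ctype (rotw \<alpha>) (rotw \<alpha>) ij = Z} = {}"
        using cT[of B, folded \<kappa>[unfolded b]] by (elim exE conjE) (rule that)
      have "patch_tile 2 (mk_point (pair_mix X Y y w)) P"
        by (rule key[OF XYZ(2)[symmetric] XYZ(1) XYZ(4)[symmetric] XYZ(3)[symmetric] wt(5) m])
      then show ?thesis by (simp add: A_def)
    next
      case False
      then have b: "b = False" by simp
      obtain m where m: "int (card {ij. owner ij = \<kappa> \<and> ctype (rotw \<alpha>) (rotw \<alpha>) ij = X}) = z * m"
        "int (card {ij. owner ij = \<kappa> \<and> ctype (rotw \<alpha>) (rotw \<alpha>) ij = Z}) = w * m"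
        "{ij. owner ij = \<kappa> \<and> ctype (rotw \<alpha>) (rotw \<alpha>) ij = Y} = {}"
        using cF[of B, folded \<kappa>[unfolded b]] by (elim exE conjE) (rule that)
      have "{X, Z, Y} = {X, Y, Z}" by blast
      then have XZY: "{X, Z, Y} = {0, 1, 2}" using XYZ(1) by (rule trans)
      have "patch_tile 2 (mk_point (pair_mix X Z z w)) P"
        by (rule key[OF XYZ(4)[symmetric] XZY XYZ(2)[symmetric] XYZ(3) wt(6) m])
      then show ?thesis by (simp add: A_def)
    qed
  qed
  have "matching_tiling \<P> (block ` range owner)"
    unfolding block_def N_def
  proof (rule block_tiling[OF lat])
    show "finite {ij. owner ij = \<kappa>}" for \<kappa> using finN[of \<kappa>] by (simp add: N_def)
    fix \<kappa> assume "\<kappa> \<in> range owner"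
    then have P: "move (\<lambda>p. p - v \<kappa>) (block \<kappa>) \<in> \<P>" by (simp add: \<P>_def)
    have "isometry (\<lambda>p. p + v \<kappa>)" by (simp add: isometry_def)
    moreover have "block \<kappa> = move (\<lambda>p. p + v \<kappa>) (move (\<lambda>p. p - v \<kappa>) (block \<kappa>))"
    proof -
      have "(\<lambda>p. p + v \<kappa>) ` (\<lambda>p. p - v \<kappa>) ` S = S" for S by (simp add: image_image)
      then have "move_cell (\<lambda>p. p + v \<kappa>) (move_cell (\<lambda>p. p - v \<kappa>) C) = C" for C by (cases C) simp
      then show ?thesis
        unfolding move_def fst_conv snd_conv image_image by (simp add: image_image)
    qed
    ultimately have "\<exists>P\<in>\<P>. \<exists>g. isometry g \<and> block \<kappa> = move g P" using P by blast
    then show "\<exists>P\<in>\<P>. \<exists>g. isometry g \<and> (\<Union>ij\<in>{ij. owner ij = \<kappa>}. lattice_region a a ij, lattice_cell a a c ` {ij. owner ij = \<kappa>}) = move g P"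
      by (simp only: block_def N_def)
  qed
  then show ?thesis using finP type patch_tile_is_tile by (intro that[of \<P>]) blast+
qed

lemma pair_mix_Simplex:
  assumes XYZ: "{X, Y, Z} = {0, 1, 2}" "X \<noteq> Y" "Y \<noteq> Z" "X \<noteq> Z" and w: "0 < w" "0 \<le> u"
  shows "mk_point (pair_mix X Y u w) \<in> Simplex" "rational_point (mk_point (pair_mix X Y u w))"
    "linf wt (mk_point (pair_mix X Y u w)) = real_of_int (wt X * u + wt Y * w) / real_of_int (w + u)"
proof -
  let ?f = "pair_mix X Y u w"
  have wu: "real_of_int (w + u) > 0" using w by simp
  have nn: "0 \<le> ?f t" for t using w by (simp add: pair_mix_def)
  have "?f 0 + ?f 1 + ?f 2 = 1"
    unfolding sum_types[OF XYZ, of ?f] using XYZ(2-4) wu by (simp add: pair_mix_def add_divide_distrib[symmetric])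
  then show "mk_point ?f \<in> Simplex" using nn by (simp add: Simplex_def mk_point_def)
  have "?f t \<in> \<rat>" for t by (simp add: pair_mix_def)
  then show "rational_point (mk_point ?f)"
    unfolding rational_point_def mk_point_def prod.case by (intro exI[of _ 1]) simp
  have "linf wt (mk_point ?f) = real_of_int (wt X) * ?f X + real_of_int (wt Y) * ?f Y + real_of_int (wt Z) * ?f Z"
    unfolding linf_def mk_point_def prod.case
    by (rule sum_types[OF XYZ, of "\<lambda>t. real_of_int (wt t) * ?f t"])
  then show "linf wt (mk_point ?f) = real_of_int (wt X * u + wt Y * w) / real_of_int (w + u)"
    using XYZ by (simp add: pair_mix_def add_divide_distrib)
qed

section \<open>The pair of rational points\<close>

lemma linf_TC: "linf wt (TC \<beta>) = real_of_int (wt 0) * (1 - \<beta>)\<^sup>2 + 2 * real_of_int (wt 1) * \<beta> * (1 - \<beta>) + real_of_int (wt 2) * \<beta>\<^sup>2"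
  by (simp add: linf_def TC_eq algebra_simps)

text \<open>The zero line of the form enters the triangle on the side from \<open>X\<close> to
  \<open>Y\<close> and leaves it on the side from \<open>X\<close> to \<open>Z\<close>. Its points
  on the arc are given by the roots of the polynomial.\<close>

lemma enforcing_pair_mix:
  fixes wt :: "nat \<Rightarrow> int" and w y z :: int and \<alpha> :: real
  assumes \<alpha>: "0 < \<alpha>" "\<alpha> < 1"
    and XYZ: "{X, Y, Z} = {0, 1, 2}" "X \<noteq> Y" "Y \<noteq> Z" "X \<noteq> Z"
    and wt: "wt X = - w" "wt Y = y" "wt Z = z" "0 < w" "0 \<le> y" "0 \<le> z"
    and mean: "linf wt (TC \<alpha>) = 0"
    and roots: "\<And>\<beta>. linf wt (TC \<beta>) = 0 \<Longrightarrow> \<beta> = \<alpha> \<or> \<beta> = galois_conj \<alpha>"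
  defines "T1 \<equiv> mk_point (pair_mix X Y y w)" and "T2 \<equiv> mk_point (pair_mix X Z z w)"
  shows "enforcing_pair \<alpha> T1 T2" "linf wt T1 = 0" "linf wt T2 = 0"
proof -
  have "{X, Z, Y} = {X, Y, Z}" by blast
  then have XZY: "{X, Z, Y} = {0, 1, 2}" "X \<noteq> Z" "Z \<noteq> Y" "X \<noteq> Y" using XYZ by simp_all
  note s1 = pair_mix_Simplex[OF XYZ wt(4,5)] and s2 = pair_mix_Simplex[OF XZY wt(4,6)]
  show l1: "linf wt T1 = 0" unfolding T1_def s1(3) using wt by simp
  show l2: "linf wt T2 = 0" unfolding T2_def s2(3) using wt by simp
  have ne: "T1 \<noteq> T2"
  proof
    assume "T1 = T2"
    then have "\<forall>t\<in>{0, 1, 2}. pair_mix X Y y w t = pair_mix X Z z w t"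
      unfolding T1_def T2_def mk_point_def by simp
    then have "pair_mix X Y y w Y = pair_mix X Z z w Y" using XYZ(1) by blast
    moreover have "real_of_int (w + y) > 0" using wt by simp
    ultimately show False using XYZ wt(4,5) by (simp add: pair_mix_def split: if_splits)
  qed
  define f where "f t = (if t = 0 then (1 - \<alpha>)\<^sup>2 else if t = 1 then 2 * (\<alpha> * (1 - \<alpha>)) else \<alpha>\<^sup>2)" for t :: nat
  have Tf: "TC \<alpha> = mk_point f" by (simp add: TC_eq mk_point_def f_def)
  have fn: "0 \<le> f t" for t using \<alpha> by (simp add: f_def)
  have "f 0 + f 1 + f 2 = 1" by (simp add: f_def power2_eq_square algebra_simps)
  then have sum: "f X + f Y + f Z = 1" unfolding sum_types[OF XYZ, of f] .
  have "real_of_int (wt 0) * f 0 + real_of_int (wt 1) * f 1 + real_of_int (wt 2) * f 2 = 0"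
    using mean unfolding Tf by (simp add: linf_def mk_point_def)
  then have bal: "real_of_int w * f X = real_of_int y * f Y + real_of_int z * f Z"
    using sum_types[OF XYZ, of "\<lambda>t. real_of_int (wt t) * f t"] wt(1-3) by simp
  \<comment> \<open>Only \<open>T1\<close> has a \<open>Y\<close> coordinate and only
    \<open>T2\<close> a \<open>Z\<close> coordinate, which dictates the coefficients; the
    \<open>X\<close> coordinate then agrees by \<open>bal\<close>.\<close>
  define u where "u = f Y * real_of_int (w + y) / real_of_int w"
  define v where "v = f Z * real_of_int (w + z) / real_of_int w"
  have w0: "real_of_int w > 0" "real_of_int (w + y) > 0" "real_of_int (w + z) > 0" using wt by simp_all
  have w1: "real_of_int w + real_of_int y \<noteq> 0" "real_of_int w + real_of_int z \<noteq> 0" using w0 by simp_all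
  have uv: "0 \<le> u" "0 \<le> v" using fn w0 by (simp_all add: u_def v_def del: of_int_add)
  have "real_of_int w * (u + v) = real_of_int w * (f X + f Y + f Z)"
  proof -
    have "real_of_int w * u = f Y * real_of_int (w + y)" "real_of_int w * v = f Z * real_of_int (w + z)"
      using w0(1) by (simp_all add: u_def v_def)
    then show ?thesis using bal by (simp add: algebra_simps)
  qed
  then have uv1: "u + v = 1" using w0 sum by simp
  have comb: "f t = u * pair_mix X Y y w t + v * pair_mix X Z z w t" if "t \<in> {0, 1, 2}" for t
  proof -
    have "t \<in> {X, Y, Z}" unfolding XYZ(1) by fact
    then consider "t = X" | "t = Y" | "t = Z" by blast
    then show ?thesis
    proof cases
      case 1
      have "u * (y / real_of_int (w + y)) + v * (z / real_of_int (w + z)) = (f Y * y + f Z * z) / w"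
        using w0(2,3) by (simp add: u_def v_def add_divide_distrib del: of_int_add)
      also have "\<dots> = f X" using bal w0(1) by (simp add: field_simps)
      finally show ?thesis by (simp add: 1 pair_mix_def)
    next
      case 2
      then show ?thesis using XYZ(2-4) w0(1) w1 by (simp add: pair_mix_def u_def)
    next
      case 3
      then show ?thesis using XYZ(2-4) w0(1) w1 by (simp add: pair_mix_def v_def)
    qed
  qed
  have hull: "convex hull {T1, T2} = {s *\<^sub>R T1 + t *\<^sub>R T2 | s t. 0 \<le> s \<and> 0 \<le> t \<and> s + t = 1}" by (rule convex_hull_2)
  have "TC \<alpha> = u *\<^sub>R T1 + v *\<^sub>R T2"
    unfolding Tf T1_def T2_def using comb[of 0] comb[of 1] comb[of 2] by (simp add: mk_point_def)
  then have mem: "TC \<alpha> \<in> convex hull {T1, T2}" unfolding hull using uv uv1 by blast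
  have lin: "linf wt (s *\<^sub>R P + t *\<^sub>R Q) = s * linf wt P + t * linf wt Q" for s t P Q
    by (cases P; cases Q) (simp add: linf_def algebra_simps)
  have "convex hull {T1, T2} \<inter> arc_C \<subseteq> {TC \<alpha>, TC (galois_conj \<alpha>)}"
  proof
    fix P assume "P \<in> convex hull {T1, T2} \<inter> arc_C"
    then obtain s t \<beta> where "P = s *\<^sub>R T1 + t *\<^sub>R T2" "P = TC \<beta>" unfolding hull arc_C_def by blast
    then have "linf wt (TC \<beta>) = 0" using lin[of s T1 t T2] l1 l2 by simp
    then show "P \<in> {TC \<alpha>, TC (galois_conj \<alpha>)}" using roots \<open>P = TC \<beta>\<close> by blast
  qed
  then show "enforcing_pair \<alpha> T1 T2"
    unfolding enforcing_pair_def using s1(1,2) s2(1,2) ne mem by (simp add: T1_def T2_def)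
qed

theorem quadratic_slope_tiles:
  assumes q: "quadratic_irrational \<alpha>" and \<alpha>: "\<alpha> \<in> {0..1}"
  obtains T1 T2 \<P> where "enforcing_pair \<alpha> T1 T2" "aperiodic_patch_tiles 2 {T1, T2} {\<alpha>, galois_conj \<alpha>} \<P>"
    "\<And>\<T> a b c. matching_tiling \<P> \<T> \<Longrightarrow> bars_form_lattice 2 \<T> a b c \<Longrightarrow>
      \<exists>\<beta>\<in>{\<alpha>, galois_conj \<alpha>} \<inter> {0..1}. \<forall>f\<in>{a, b, c}. near_slope \<beta> (gap_word 2 f)"
proof -
  obtain p q r :: int where p: "\<alpha> \<notin> \<rat>" "p \<noteq> 0" and root: "of_int p * \<alpha>\<^sup>2 + of_int q * \<alpha> + of_int r = 0"
    using q unfolding quadratic_irrational_def by blast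
  have \<alpha>01: "0 < \<alpha>" "\<alpha> < 1" using \<alpha> p(1) by (auto simp: less_le)
  \<comment> \<open>Bernstein coefficients of the polynomial for the basis
    \<open>(1 - \<beta>)\<^sup>2\<close>, \<open>2 * \<beta> * (1 - \<beta>)\<close>,
    \<open>\<beta>\<^sup>2\<close>, doubled because the middle one is
    \<open>r + q / 2\<close>.\<close>
  define W where "W t = (if t = 0 then 2 * r else if t = 1 then 2 * r + q else 2 * (p + q + r))" for t :: nat
  have WT: "linf (\<lambda>t. s * W t) (TC \<beta>) = 2 * of_int s * (of_int p * \<beta>\<^sup>2 + of_int q * \<beta> + of_int r)" for s \<beta>
    by (simp add: linf_TC W_def power2_eq_square algebra_simps)
  have mean0: "real_of_int (W 0) * (1 - \<alpha>)\<^sup>2 + real_of_int (W 1) * (2 * \<alpha> * (1 - \<alpha>)) + real_of_int (W 2) * \<alpha>\<^sup>2 = 0"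
    using WT[of 1 \<alpha>] root by (simp add: linf_TC algebra_simps)
  have r0: "r \<noteq> 0"
  proof
    assume "r = 0"
    then have "\<alpha> * (of_int p * \<alpha> + of_int q) = 0" using root by (simp add: power2_eq_square algebra_simps)
    then have "of_int p * \<alpha> + of_int q = 0" using \<alpha>01 by simp
    then have "\<alpha> = - of_int q / of_int p" using p(2) by (simp add: field_simps)
    then show False using p(1) by simp
  qed
  have pos: "0 < (1 - \<alpha>)\<^sup>2" "0 < 2 * \<alpha> * (1 - \<alpha>)" "0 < \<alpha>\<^sup>2" using \<alpha>01 by simp_all
  \<comment> \<open>Weights of a single sign would make each term of the vanishing mean zero, but
    the first one is nonzero as \<open>r\<close> is.\<close>
  have mixed: False if s: "s = 1 \<or> s = - 1" "\<forall>t\<in>{0, 1, 2}. 0 \<le> s * W t" for s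
  proof -
    have "0 \<le> real_of_int (s * W t)" if "t \<in> {0, 1, 2}" for t using s(2) that by (simp only: of_int_0_le_iff)
    then have nn: "0 \<le> real_of_int (s * W 0)" "0 \<le> real_of_int (s * W 1)" "0 \<le> real_of_int (s * W 2)" by blast+
    note mult_nonneg_nonneg[OF nn(1) less_imp_le[OF pos(1)]] mult_nonneg_nonneg[OF nn(2) less_imp_le[OF pos(2)]]
      mult_nonneg_nonneg[OF nn(3) less_imp_le[OF pos(3)]]
    moreover have "real_of_int (s * W 0) * (1 - \<alpha>)\<^sup>2 + real_of_int (s * W 1) * (2 * \<alpha> * (1 - \<alpha>)) + real_of_int (s * W 2) * \<alpha>\<^sup>2 = 0"
      using mean0 s(1) by auto
    ultimately have "real_of_int (s * W 0) * (1 - \<alpha>)\<^sup>2 = 0" by linarith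
    then show False using pos(1) s(1) r0 by (auto simp: W_def)
  qed
  \<comment> \<open>With both signs present among three weights, one type stands alone against the
    other two; the sign \<open>s\<close> makes its weight the negative one.\<close>
  have "\<exists>s X Y Z. (s = 1 \<or> s = - 1) \<and> {X, Y, Z} = {0, 1, 2} \<and> X \<noteq> Y \<and> Y \<noteq> Z \<and> X \<noteq> Z \<and>
    0 < - (s * W X) \<and> 0 \<le> s * W Y \<and> 0 \<le> s * W Z"
  proof -
    have n: "\<not> (0 \<le> W 0 \<and> 0 \<le> W 1 \<and> 0 \<le> W 2)" "\<not> (W 0 \<le> 0 \<and> W 1 \<le> 0 \<and> W 2 \<le> 0)" using mixed[of 1] mixed[of "- 1"] by auto
    have S: "{1, 0, 2} = {0, 1, 2 :: nat}" "{2, 0, 1} = {0, 1, 2 :: nat}" by auto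
    consider "W 0 < 0 \<and> 0 \<le> W 1 \<and> 0 \<le> W 2 \<or> 0 < W 0 \<and> W 1 \<le> 0 \<and> W 2 \<le> 0"
      | "W 1 < 0 \<and> 0 \<le> W 0 \<and> 0 \<le> W 2 \<or> 0 < W 1 \<and> W 0 \<le> 0 \<and> W 2 \<le> 0"
      | "W 2 < 0 \<and> 0 \<le> W 0 \<and> 0 \<le> W 1 \<or> 0 < W 2 \<and> W 0 \<le> 0 \<and> W 1 \<le> 0"
      using n by linarith
    then show ?thesis
    proof cases
      case 1
      then show ?thesis
        by (elim disjE) (rule exI[of _ 1], rule exI[of _ 0], rule exI[of _ 1], rule exI[of _ 2], simp,
          rule exI[of _ "- 1"], rule exI[of _ 0], rule exI[of _ 1], rule exI[of _ 2], simp)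
    next
      case 2
      then show ?thesis
        by (elim disjE) (rule exI[of _ 1], rule exI[of _ 1], rule exI[of _ 0], rule exI[of _ 2], simp only: S, simp,
          rule exI[of _ "- 1"], rule exI[of _ 1], rule exI[of _ 0], rule exI[of _ 2], simp only: S, simp)
    next
      case 3
      then show ?thesis
        by (elim disjE) (rule exI[of _ 1], rule exI[of _ 2], rule exI[of _ 0], rule exI[of _ 1], simp only: S, simp,
          rule exI[of _ "- 1"], rule exI[of _ 2], rule exI[of _ 0], rule exI[of _ 1], simp only: S, simp)
    qed
  qed
  then obtain s X Y Z where s: "s = 1 \<or> s = - 1" and XYZ: "{X, Y, Z} = {0, 1, 2}" "X \<noteq> Y" "Y \<noteq> Z" "X \<noteq> Z"
    and sg: "0 < - (s * W X)" "0 \<le> s * W Y" "0 \<le> s * W Z" by (elim exE conjE)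
  let ?wt = "\<lambda>t. s * W t"
  let ?w = "- (s * W X)" and ?y = "s * W Y" and ?z = "s * W Z"
  have wt: "?wt X = - ?w" "?wt Y = ?y" "?wt Z = ?z" by simp_all
  have mean: "linf ?wt (TC \<alpha>) = 0" unfolding WT using root by simp
  have rts: "\<beta> = \<alpha> \<or> \<beta> = galois_conj \<alpha>" if "linf ?wt (TC \<beta>) = 0" for \<beta>
  proof -
    have "of_int p * \<beta>\<^sup>2 + of_int q * \<beta> + of_int r = 0" using that s unfolding WT by auto
    then show ?thesis by (rule quadratic_root_cases[OF p root])
  qed
  have conj: "galois_conj \<alpha> \<notin> \<rat>"
  proof
    assume "galois_conj \<alpha> \<in> \<rat>"
    then have "- of_int q / of_int p - galois_conj \<alpha> \<in> \<rat>" by simp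
    then show False using p(1) by (simp add: galois_conj_eq[OF p root])
  qed
  define T1 where "T1 = mk_point (pair_mix X Y ?y ?w)"
  define T2 where "T2 = mk_point (pair_mix X Z ?z ?w)"
  note e = enforcing_pair_mix[OF \<alpha>01 XYZ wt sg mean rts, folded T1_def T2_def]
  obtain \<P> where P: "finite \<P>" "\<forall>P\<in>\<P>. is_tile P \<and> (\<exists>T\<in>{T1, T2}. patch_tile 2 T P)" "\<exists>\<T>. matching_tiling \<P> \<T>"
    by (rule sturm_patch_tiles[OF \<alpha>01 XYZ wt sg mean[unfolded linf_TC], folded T1_def T2_def]) (rule that)
  have A: "\<forall>T\<in>{T1, T2}. linf ?wt T = 0" using e(2,3) by simp
  have roots: "\<beta> \<in> {\<alpha>, galois_conj \<alpha>} \<and> \<beta> \<notin> \<rat>"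
    if "real_of_int (?wt 0) * (1 - \<beta>)\<^sup>2 + 2 * real_of_int (?wt 1) * \<beta> * (1 - \<beta>) + real_of_int (?wt 2) * \<beta>\<^sup>2 = 0" for \<beta>
    using rts[of \<beta>, unfolded linf_TC, OF that] p(1) conj by blast
  note ap = aperiodic_patch_tiles_if_tiling[OF P(1,2) A P(3) roots]
  show ?thesis by (rule that[OF e(1) ap]) assumption+
qed

theorem real_quadratic_field_tiles:
  assumes "real_quadratic_field K"
  shows "\<exists>\<gamma> \<in> K \<inter> {0..1}. quadratic_irrational \<gamma> \<and>
    (\<exists>T1 T2 \<kappa> \<P> \<epsilon>. enforcing_pair \<gamma> T1 T2 \<and> aperiodic_patch_tiles \<kappa> {T1, T2} {\<gamma>, galois_conj \<gamma>} \<P> \<and>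
      quadratic_unit_of K \<epsilon> \<and> expansion_constant \<kappa> \<P> \<epsilon>)"
proof -
  obtain d :: nat where d: "1 < d" "squarefree d" and K: "K = {of_rat u + of_rat v * sqrt (real d) | u v. True}"
    using assms unfolding real_quadratic_field_def by blast
  obtain x y :: int where x: "2 \<le> x" and pell: "x\<^sup>2 - int d * y\<^sup>2 = 1" by (rule pell_solution[OF d])
  \<comment> \<open>The absolute value selects the larger of the two conjugate units for \<epsilon>,
    which leaves its inverse \<gamma> in the unit interval.\<close>
  define \<eta> where "\<eta> = real_of_int \<bar>y\<bar> * sqrt (real d)"
  define \<epsilon> where "\<epsilon> = real_of_int x + \<eta>"
  define \<gamma> where "\<gamma> = real_of_int x - \<eta>"
  have y0: "y \<noteq> 0"
  proof
    assume "y = 0"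
    then have "x * x = 1" using pell by (simp add: power2_eq_square)
    moreover have "2 * 2 \<le> x * x" using x by (intro mult_mono) auto
    ultimately show False by simp
  qed
  have sq: "\<eta>\<^sup>2 = real_of_int (int d * y\<^sup>2)" by (simp add: \<eta>_def power_mult_distrib)
  have "0 < \<eta>" using y0 d(1) by (simp add: \<eta>_def)
  then have \<epsilon>2: "2 < \<epsilon>" using x by (simp add: \<epsilon>_def)
  have prod: "\<gamma> * \<epsilon> = 1"
  proof -
    have "\<gamma> * \<epsilon> = real_of_int (x\<^sup>2) - \<eta>\<^sup>2" by (simp add: \<gamma>_def \<epsilon>_def algebra_simps power2_eq_square)
    also have "\<dots> = real_of_int (x\<^sup>2 - int d * y\<^sup>2)" unfolding sq by simp
    finally show ?thesis unfolding pell by simp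
  qed
  then have "\<gamma> = 1 / \<epsilon>" using \<epsilon>2 by (simp add: field_simps)
  then have \<gamma>01: "0 < \<gamma>" "\<gamma> < 1" using \<epsilon>2 by simp_all
  have sum: "\<gamma> + \<epsilon> = 2 * real_of_int x" by (simp add: \<gamma>_def \<epsilon>_def)
  have irr: "\<eta> \<notin> \<rat>"
  proof
    assume "\<eta> \<in> \<rat>"
    then have "\<eta> / real_of_int \<bar>y\<bar> \<in> \<rat>" by (intro Rats_divide) auto
    then show False using sqrt_irrational[OF d] y0 by (simp add: \<eta>_def)
  qed
  have \<gamma>irr: "\<gamma> \<notin> \<rat>"
  proof
    assume "\<gamma> \<in> \<rat>"
    then have "real_of_int x - \<gamma> \<in> \<rat>" by (intro Rats_diff) auto
    then show False using irr by (simp add: \<gamma>_def)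
  qed
  have \<epsilon>irr: "\<epsilon> \<notin> \<rat>"
  proof
    assume "\<epsilon> \<in> \<rat>"
    then have "\<epsilon> - real_of_int x \<in> \<rat>" by (intro Rats_diff) auto
    then show False using irr by (simp add: \<epsilon>_def)
  qed
  have g: "\<gamma>\<^sup>2 - 2 * real_of_int x * \<gamma> + 1 = 0" and e: "\<epsilon>\<^sup>2 - 2 * real_of_int x * \<epsilon> + 1 = 0"
    unfolding sum[symmetric] using prod by (simp_all add: power2_eq_square algebra_simps)
  have root: "real_of_int 1 * \<gamma>\<^sup>2 + real_of_int (- 2 * x) * \<gamma> + real_of_int 1 = 0" using g by simp
  have q: "quadratic_irrational \<gamma>"
    unfolding quadratic_irrational_def using \<gamma>irr root by (intro conjI exI[of _ 1] exI[of _ "- 2 * x"]) simp_all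
  have conj: "galois_conj \<gamma> = \<epsilon>" using galois_conj_eq[OF \<gamma>irr _ root] sum by simp
  have "real_of_int x + real_of_int c * sqrt (real d) \<in> K" for c
  proof -
    have "real_of_int x + real_of_int c * sqrt (real d) = of_rat (of_int x) + of_rat (of_int c) * sqrt (real d)" by simp
    then show ?thesis unfolding K by blast
  qed
  from this[of "\<bar>y\<bar>"] this[of "- \<bar>y\<bar>"] have KK: "\<epsilon> \<in> K" "\<gamma> \<in> K" by (simp_all add: \<epsilon>_def \<gamma>_def \<eta>_def)
  have unit: "quadratic_unit_of K \<epsilon>"
    unfolding quadratic_unit_of_def using KK(1) \<epsilon>irr e by (intro conjI exI[of _ "- 2 * x"] exI[of _ 1]) simp_all
  obtain T1 T2 \<P> where T: "enforcing_pair \<gamma> T1 T2" "aperiodic_patch_tiles 2 {T1, T2} {\<gamma>, galois_conj \<gamma>} \<P>"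
    and slope: "\<And>\<T> a b c. matching_tiling \<P> \<T> \<Longrightarrow> bars_form_lattice 2 \<T> a b c \<Longrightarrow>
      \<exists>\<beta>\<in>{\<gamma>, galois_conj \<gamma>} \<inter> {0..1}. \<forall>f\<in>{a, b, c}. near_slope \<beta> (gap_word 2 f)"
    by (rule quadratic_slope_tiles[OF q]) (use \<gamma>01 in simp, rule that)
  \<comment> \<open>Chosen so that \<open>n + 2\<close> is the trace \<open>2 * x\<close> of the
    unit; \<open>x\<close> being at least 2 gives the bound required of \<open>n\<close>.\<close>
  define n where "n = nat (2 * x - 2)"
  have nx: "2 \<le> n" "real n + 2 = 2 * real_of_int x" using x by (simp_all add: n_def)
  interpret noble_slope n \<gamma>
    by unfold_locales (use nx(1) \<gamma>01 g in \<open>simp_all add: nx(2)\<close>)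
  have "expansion_constant 2 \<P> \<epsilon>"
    unfolding expansion_constant_def
  proof (intro conjI exI[of _ "sturm_subst n"] allI impI ballI)
    show "1 < \<epsilon>" using \<epsilon>2 by simp
    show "primitive_subst (sturm_subst n)" by (rule primitive_sturm_subst)
    have "real n + 2 - \<gamma> = \<epsilon>" using nx(2) sum by simp
    then show "inflation_factor (sturm_subst n) \<epsilon>" using inflation_factor_sturm_subst by simp
    fix \<T> a b c f assume t: "matching_tiling \<P> \<T> \<and> bars_form_lattice 2 \<T> a b c" and f: "f \<in> {a, b, c}"
    obtain \<beta> where \<beta>: "\<beta> \<in> {\<gamma>, galois_conj \<gamma>}" "\<beta> \<in> {0..1}" "\<forall>f\<in>{a, b, c}. near_slope \<beta> (gap_word 2 f)"
      using slope[OF conjunct1[OF t] conjunct2[OF t]] by blast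
    \<comment> \<open>The conjugate is \<epsilon> itself, which exceeds 2 and cannot be a
      slope.\<close>
    have "\<beta> = \<gamma>" using \<beta>(1,2) \<epsilon>2 conj by auto
    then have "near_slope \<gamma> (gap_word 2 f)" using \<beta>(3) f by blast
    then have "bal (gap_word 2 f)" unfolding bal_def using near_slope_irrational \<gamma>irr by blast
    then show "gap_word 2 f \<in> subshift (sturm_subst n)" by (rule balanced_in_subshift)
  qed
  then have "\<exists>T1 T2 \<kappa> \<P> \<epsilon>. enforcing_pair \<gamma> T1 T2 \<and> aperiodic_patch_tiles \<kappa> {T1, T2} {\<gamma>, galois_conj \<gamma>} \<P> \<and>
      quadratic_unit_of K \<epsilon> \<and> expansion_constant \<kappa> \<P> \<epsilon>" using T unit by blast
  moreover have "\<gamma> \<in> K \<inter> {0..1}" using KK(2) \<gamma>01 by simp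
  ultimately show ?thesis using q by blast
qed

theorem theorem8p2:
  fixes \<alpha> :: real
  assumes "\<alpha> \<in> {0..1}"
  shows
    "(\<alpha> \<in> \<rat> \<longrightarrow>
        (\<exists>!T. T \<in> Simplex \<and> enforces {T} {\<alpha>}) \<and>
        (\<forall>T\<in>Simplex. enforces {T} {\<alpha>} \<longrightarrow> rational_point T)) \<and>
     (quadratic_irrational \<alpha> \<longrightarrow>
        (\<exists>T1 T2. enforcing_pair \<alpha> T1 T2 \<and>
           (\<exists>\<kappa> \<P>. aperiodic_patch_tiles \<kappa> {T1, T2} {\<alpha>, galois_conj \<alpha>} \<P>))) \<and>
     (\<forall>K. real_quadratic_field K \<longrightarrow>
        (\<exists>\<gamma> \<in> K \<inter> {0..1}. quadratic_irrational \<gamma> \<and>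
           (\<exists>T1 T2 \<kappa> \<P> \<epsilon>. enforcing_pair \<gamma> T1 T2 \<and>
              aperiodic_patch_tiles \<kappa> {T1, T2} {\<gamma>, galois_conj \<gamma>} \<P> \<and>
              quadratic_unit_of K \<epsilon> \<and> expansion_constant \<kappa> \<P> \<epsilon>))) \<and>
     (\<alpha> \<notin> \<rat> \<and> \<not> quadratic_irrational \<alpha> \<longrightarrow>
        (\<nexists>A. finite A \<and> A \<subseteq> Simplex \<and> (\<forall>T\<in>A. rational_point T) \<and> enforces A {\<alpha>}) \<and>
        (\<forall>A. finite A \<and> A \<subseteq> Simplex \<and> (\<forall>T\<in>A. rational_point T) \<and> TC \<alpha> \<in> convex hull A \<longrightarrow>
           (\<exists>q \<in> \<rat> \<inter> {0..1}. TC q \<in> convex hull A)))"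
proof (intro conjI impI)
  show "\<exists>!T. T \<in> Simplex \<and> enforces {T} {\<alpha>}" using enforces_singleton[OF assms] by simp
  show "\<forall>T\<in>Simplex. enforces {T} {\<alpha>} \<longrightarrow> rational_point T" if "\<alpha> \<in> \<rat>"
  proof (intro ballI impI)
    fix T assume "T \<in> Simplex" "enforces {T} {\<alpha>}"
    then have "T = TC \<alpha>" using enforces_singleton[OF assms, of T] by simp
    then show "rational_point T" using rational_point_TC[OF that] by simp
  qed
  show "\<exists>T1 T2. enforcing_pair \<alpha> T1 T2 \<and> (\<exists>\<kappa> \<P>. aperiodic_patch_tiles \<kappa> {T1, T2} {\<alpha>, galois_conj \<alpha>} \<P>)"
    if q: "quadratic_irrational \<alpha>"
    by (rule quadratic_slope_tiles[OF q assms]) blast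
  show "\<forall>K. real_quadratic_field K \<longrightarrow>
        (\<exists>\<gamma> \<in> K \<inter> {0..1}. quadratic_irrational \<gamma> \<and>
           (\<exists>T1 T2 \<kappa> \<P> \<epsilon>. enforcing_pair \<gamma> T1 T2 \<and>
              aperiodic_patch_tiles \<kappa> {T1, T2} {\<gamma>, galois_conj \<gamma>} \<P> \<and>
              quadratic_unit_of K \<epsilon> \<and> expansion_constant \<kappa> \<P> \<epsilon>))"
    using real_quadratic_field_tiles by simp
  assume "\<alpha> \<notin> \<rat> \<and> \<not> quadratic_irrational \<alpha>"
  then have \<alpha>: "\<alpha> \<notin> \<rat>" "\<not> quadratic_irrational \<alpha>" by simp_all
  show "\<nexists>A. finite A \<and> A \<subseteq> Simplex \<and> (\<forall>T\<in>A. rational_point T) \<and> enforces A {\<alpha>}"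
    using no_finite_enforcing_set[OF assms \<alpha>] by blast
  show "\<forall>A. finite A \<and> A \<subseteq> Simplex \<and> (\<forall>T\<in>A. rational_point T) \<and> TC \<alpha> \<in> convex hull A \<longrightarrow>
           (\<exists>q \<in> \<rat> \<inter> {0..1}. TC q \<in> convex hull A)"
    using hull_contains_rational_slope[OF assms \<alpha>] by blast
qed

end
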